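(* Let $\mathcal{A}$ be a locally noetherian Grothendieck cosmos equipped with an action of a group $G$. Suppose that: (a) the unit object $I$ is finitely presented; (b) $\mathcal{A}$ is generated by a small set of dualizable objects; (c) a localizing subcategory of $\mathcal{A}$ is a tensor ideal of $\mathcal{A}$ if and only if it is $G$-closed; (d) a torsion-free class of $\mathcal{A}_{\mathrm{noeth}}$ is a Hom ideal of $\mathcal{A}_{\mathrm{noeth}}$ if and only if it is $G$-closed; (e) for any $M\in\mathcal{A}$ and $x\in\operatorname{Supp}^G M$ there exists $y\in\operatorname{Ass}^G M$ such that $y\in\overline{\{x\}}$, the closure of $\{x\}$ in $\operatorname{Spec}^G\mathcal{A}$. Then there is an order-preserving bijection (both sides ordered by inclusion) between (i) the set of $G$-closed torsion-free classes of $\mathcal{A}_{\mathrm{noeth}}$, and (ii) the power set of $\operatorname{Spec}^G\mathcal{A}$. The bijection is given by $\Phi\mapsto(\operatorname{Ass}^G)^{-1}(\Phi):=\{M\in\mathcal{A}_{\mathrm{noeth}}\mid\operatorname{Ass}^G M\subseteq\Phi\}$ and $\mathcal{X}\mapsto\operatorname{Ass}^G\mathcal{X}:=\bigcup_{X\in\mathcal{X}}\operatorname{Ass}^G X$, where $\Phi$ is a subset of $\operatorname{Spec}^G\mathcal{A}$ and $\mathcal{X}$ is a $G$-closed torsion-free class.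
   Context: All subcategories are full and closed under isomorphisms. A Grothendieck cosmos is a symmetric monoidal closed category $(\mathcal{A},\otimes,I)$, with internal Hom $[-,-]$, whose underlying category is a Grothendieck category; it is locally noetherian if the underlying Grothendieck category is. $\mathcal{A}_{\mathrm{noeth}}$ is the full subcategory of noetherian objects; under (a) and (b) it is a symmetric monoidal closed abelian category with the restricted tensor product and internal Hom. An object $D$ is dualizable if there is $E$ such that $-\otimes E$ is right adjoint to $-\otimes D$. An action of $G$ on $\mathcal{A}$ is a group homomorphism from $G$ to the group of isomorphism classes of autoequivalences of the (underlying) category $\mathcal{A}$, written $X\mapsto g\cdot X$. A subcategory $\mathcal{X}$ is $G$-closed if $g\cdot X\in\mathcal{X}$ for all $g\in G$, $X\in\mathcal{X}$. In a symmetric monoidal closed category $\mathcal{B}$, a subcategory $\mathcal{X}$ is a tensor ideal (resp. Hom ideal) if $X\otimes M\in\mathcal{X}$ (resp. $[M,X]\in\mathcal{X}$) for all $X\in\mathcal{X}$, $M\in\mathcal{B}$. A Serre subcategory is an additive subcategory closed under subobjects, quotients and extensions; a localizing subcategory is a Serre subcategory closed under coproducts; a torsion-free class is an additive subcategory closed under subobjects and extensions. Atom spectrum: an object $H\neq0$ is monoform if for every nonzero subobject $L$ of $H$, the objects $H$ and $H/L$ have no common nonzero subobject (up to isomorphism). Two monoform objects are atom-equivalent if they have a common nonzero subobject. $\operatorname{Spec}\mathcal{A}$ is the set of atom-equivalence classes $\overline{H}$. $\operatorname{Supp}M:=\{\overline{H}\mid H\text{ a monoform subquotient of }M\}$, $\operatorname{Ass}M:=\{\overline{H}\mid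 H\text{ a monoform subobject of }M\}$; the sets $\operatorname{Supp}M$ ($M\in\mathcal{A}$) form an open basis of the topology of $\operatorname{Spec}\mathcal{A}$. $G$ acts on $\operatorname{Spec}\mathcal{A}$ by $g\cdot\overline{H}=\overline{g\cdot H}$; $\operatorname{Spec}^G\mathcal{A}:=\operatorname{Spec}\mathcal{A}/G$ with the quotient topology and quotient map $\pi_G$; $\operatorname{Supp}^G M:=\pi_G(\operatorname{Supp}M)$, $\operatorname{Ass}^G M:=\pi_G(\operatorname{Ass}M)$. *)

theory Defs
  imports "HOL-Analysis.Abstract_Topology" "HOL-Algebra.Group"
begin

section \<open>Universe\<close>

text \<open>
  Smallness is relative to a Grothendieck universe, given by an uncountable strongly inaccessible
  cardinal \<open>\<kappa>\<close>: a set of any type is small if its cardinality is below \<open>\<kappa>\<close>.  Up to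
  bijection, small index sets are the small sets over the carrier type of \<open>\<kappa>\<close>.
\<close>

context
  includes cardinal_syntax
begin

definition universe_cardinal :: "'k rel \<Rightarrow> bool" where
  "universe_cardinal \<kappa> \<longleftrightarrow>
     Card_order \<kappa> \<and> natLeq <o \<kappa> \<and> regularCard \<kappa> \<and>
     (\<forall>S::'k set. |S| <o \<kappa> \<longrightarrow> |Pow S| <o \<kappa>)"

definition small :: "'k rel \<Rightarrow> 's set \<Rightarrow> bool" where
  "small \<kappa> S \<longleftrightarrow> |S| <o \<kappa>"

end


section \<open>Categories\<close>

record ('o, 'a) cat =
  Obj :: "'o set"
  Arr :: "'a set"
  Dom :: "'a \<Rightarrow> 'o"
  Cod :: "'a \<Rightarrow> 'o"
  Idt :: "'o \<Rightarrow> 'a"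
  Comp :: "'a \<Rightarrow> 'a \<Rightarrow> 'a"  (infixr "\<cdot>\<index>" 65)

definition homs :: "('o, 'a, 'm) cat_scheme \<Rightarrow> 'o \<Rightarrow> 'o \<Rightarrow> 'a set" where
  "homs C X Y = {f \<in> Arr C. Dom C f = X \<and> Cod C f = Y}"

locale category =
  fixes C :: "('o, 'a, 'm) cat_scheme" (structure)
  assumes Dom_in: "f \<in> Arr C \<Longrightarrow> Dom C f \<in> Obj C"
    and Cod_in: "f \<in> Arr C \<Longrightarrow> Cod C f \<in> Obj C"
    and Idt_in: "X \<in> Obj C \<Longrightarrow> Idt C X \<in> homs C X X"
    and Comp_in: "\<lbrakk>f \<in> homs C X Y; g \<in> homs C Y Z\<rbrakk> \<Longrightarrow> g \<cdot> f \<in> homs C X Z"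
    and Comp_Idt: "f \<in> homs C X Y \<Longrightarrow> f \<cdot> Idt C X = f"
    and Idt_Comp: "f \<in> homs C X Y \<Longrightarrow> Idt C Y \<cdot> f = f"
    and Comp_assoc:
      "\<lbrakk>f \<in> homs C W X; g \<in> homs C X Y; h \<in> homs C Y Z\<rbrakk> \<Longrightarrow> (h \<cdot> g) \<cdot> f = h \<cdot> (g \<cdot> f)"

definition mono_arr :: "('o, 'a, 'm) cat_scheme \<Rightarrow> 'a \<Rightarrow> bool" where
  "mono_arr C f \<longleftrightarrow> f \<in> Arr C \<and>
     (\<forall>W. \<forall>u \<in> homs C W (Dom C f). \<forall>v \<in> homs C W (Dom C f). f \<cdot>\<^bsub>C\<^esub> u = f \<cdot>\<^bsub>C\<^esub> v \<longrightarrow> u = v)"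

definition epi_arr :: "('o, 'a, 'm) cat_scheme \<Rightarrow> 'a \<Rightarrow> bool" where
  "epi_arr C f \<longleftrightarrow> f \<in> Arr C \<and>
     (\<forall>W. \<forall>u \<in> homs C (Cod C f) W. \<forall>v \<in> homs C (Cod C f) W. u \<cdot>\<^bsub>C\<^esub> f = v \<cdot>\<^bsub>C\<^esub> f \<longrightarrow> u = v)"

definition iso_arr :: "('o, 'a, 'm) cat_scheme \<Rightarrow> 'a \<Rightarrow> bool" where
  "iso_arr C f \<longleftrightarrow> f \<in> Arr C \<and>
     (\<exists>g \<in> homs C (Cod C f) (Dom C f).
        g \<cdot>\<^bsub>C\<^esub> f = Idt C (Dom C f) \<and> f \<cdot>\<^bsub>C\<^esub> g = Idt C (Cod C f))"

definition isomorphic :: "('o, 'a, 'm) cat_scheme \<Rightarrow> 'o \<Rightarrow> 'o \<Rightarrow> bool" where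
  "isomorphic C X Y \<longleftrightarrow> (\<exists>f \<in> homs C X Y. iso_arr C f)"

definition is_zero :: "('o, 'a, 'm) cat_scheme \<Rightarrow> 'o \<Rightarrow> bool" where
  "is_zero C Z \<longleftrightarrow> Z \<in> Obj C \<and>
     (\<forall>X \<in> Obj C. (\<exists>!f. f \<in> homs C X Z) \<and> (\<exists>!f. f \<in> homs C Z X))"

definition zero_arr :: "('o, 'a, 'm) cat_scheme \<Rightarrow> 'a \<Rightarrow> bool" where
  "zero_arr C f \<longleftrightarrow> f \<in> Arr C \<and>
     (\<exists>Z. is_zero C Z \<and> (\<exists>a \<in> homs C (Dom C f) Z. \<exists>b \<in> homs C Z (Cod C f). f = b \<cdot>\<^bsub>C\<^esub> a))"

definition is_kernel :: "('o, 'a, 'm) cat_scheme \<Rightarrow> 'a \<Rightarrow> 'a \<Rightarrow> bool" where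
  "is_kernel C f k \<longleftrightarrow> f \<in> Arr C \<and> k \<in> Arr C \<and> Cod C k = Dom C f \<and> zero_arr C (f \<cdot>\<^bsub>C\<^esub> k) \<and>
     (\<forall>W. \<forall>u \<in> homs C W (Dom C f). zero_arr C (f \<cdot>\<^bsub>C\<^esub> u) \<longrightarrow>
        (\<exists>!v. v \<in> homs C W (Dom C k) \<and> k \<cdot>\<^bsub>C\<^esub> v = u))"

definition is_cokernel :: "('o, 'a, 'm) cat_scheme \<Rightarrow> 'a \<Rightarrow> 'a \<Rightarrow> bool" where
  "is_cokernel C f q \<longleftrightarrow> f \<in> Arr C \<and> q \<in> Arr C \<and> Dom C q = Cod C f \<and> zero_arr C (q \<cdot>\<^bsub>C\<^esub> f) \<and>
     (\<forall>W. \<forall>u \<in> homs C (Cod C f) W. zero_arr C (u \<cdot>\<^bsub>C\<^esub> f) \<longrightarrow>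
        (\<exists>!v. v \<in> homs C (Cod C q) W \<and> v \<cdot>\<^bsub>C\<^esub> q = u))"

text \<open>\<open>0 \<rightarrow> L \<rightarrow> M \<rightarrow> N \<rightarrow> 0\<close> with arrows \<open>f\<close>, \<open>g\<close> is exact:\<close>

definition short_exact :: "('o, 'a, 'm) cat_scheme \<Rightarrow> 'a \<Rightarrow> 'a \<Rightarrow> bool" where
  "short_exact C f g \<longleftrightarrow> is_kernel C g f \<and> is_cokernel C f g"

definition is_coproduct ::
    "('o, 'a, 'm) cat_scheme \<Rightarrow> 'i set \<Rightarrow> ('i \<Rightarrow> 'o) \<Rightarrow> 'o \<Rightarrow> ('i \<Rightarrow> 'a) \<Rightarrow> bool" where
  "is_coproduct C I X P \<iota> \<longleftrightarrow> P \<in> Obj C \<and> (\<forall>i\<in>I. \<iota> i \<in> homs C (X i) P) \<and>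
     (\<forall>Y \<in> Obj C. \<forall>f. (\<forall>i\<in>I. f i \<in> homs C (X i) Y) \<longrightarrow>
        (\<exists>!h. h \<in> homs C P Y \<and> (\<forall>i\<in>I. h \<cdot>\<^bsub>C\<^esub> \<iota> i = f i)))"

definition pair_family :: "'o \<Rightarrow> 'o \<Rightarrow> bool \<Rightarrow> 'o" where
  "pair_family X Y b = (if b then X else Y)"

definition is_direct_sum :: "('o, 'a, 'm) cat_scheme \<Rightarrow> 'o \<Rightarrow> 'o \<Rightarrow> 'o \<Rightarrow> bool" where
  "is_direct_sum C X Y P \<longleftrightarrow> (\<exists>\<iota>. is_coproduct C UNIV (pair_family X Y) P \<iota>)"

definition full_sub :: "('o, 'a, 'm) cat_scheme \<Rightarrow> 'o set \<Rightarrow> ('o, 'a, 'm) cat_scheme" where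
  "full_sub C S = C\<lparr>Obj := S, Arr := {f \<in> Arr C. Dom C f \<in> S \<and> Cod C f \<in> S}\<rparr>"


section \<open>Abelian and Grothendieck categories\<close>

definition preadditive :: "('o, 'a, 'm) cat_scheme \<Rightarrow> bool" where
  "preadditive C \<longleftrightarrow> (\<exists>add nul.
     (\<forall>X \<in> Obj C. \<forall>Y \<in> Obj C.
        comm_group \<lparr>carrier = homs C X Y, mult = add, one = nul X Y\<rparr>) \<and>
     (\<forall>X Y Z. \<forall>f \<in> homs C X Y. \<forall>f' \<in> homs C X Y. \<forall>g \<in> homs C Y Z. \<forall>g' \<in> homs C Y Z.
        g \<cdot>\<^bsub>C\<^esub> add f f' = add (g \<cdot>\<^bsub>C\<^esub> f) (g \<cdot>\<^bsub>C\<^esub> f') \<and>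
        add g g' \<cdot>\<^bsub>C\<^esub> f = add (g \<cdot>\<^bsub>C\<^esub> f) (g' \<cdot>\<^bsub>C\<^esub> f)))"

text \<open>In a preadditive category, binary coproducts are biproducts.\<close>

locale abelian_category = category +
  assumes preadd: "preadditive C"
    and ex_zero: "\<exists>Z. is_zero C Z"
    and ex_direct_sum: "\<lbrakk>X \<in> Obj C; Y \<in> Obj C\<rbrakk> \<Longrightarrow> \<exists>P. is_direct_sum C X Y P"
    and ex_kernel: "f \<in> Arr C \<Longrightarrow> \<exists>k. is_kernel C f k"
    and ex_cokernel: "f \<in> Arr C \<Longrightarrow> \<exists>q. is_cokernel C f q"
    and mono_normal: "mono_arr C f \<Longrightarrow> \<exists>g. is_kernel C g f"
    and epi_normal: "epi_arr C f \<Longrightarrow> \<exists>g. is_cokernel C g f"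

definition directed :: "'i set \<Rightarrow> ('i \<Rightarrow> 'i \<Rightarrow> bool) \<Rightarrow> bool" where
  "directed D leq \<longleftrightarrow> D \<noteq> {} \<and> (\<forall>i\<in>D. leq i i) \<and>
     (\<forall>i\<in>D. \<forall>j\<in>D. \<forall>k\<in>D. leq i j \<longrightarrow> leq j k \<longrightarrow> leq i k) \<and>
     (\<forall>i\<in>D. \<forall>j\<in>D. \<exists>k\<in>D. leq i k \<and> leq j k)"

definition direct_system ::
    "('o, 'a, 'm) cat_scheme \<Rightarrow> 'i set \<Rightarrow> ('i \<Rightarrow> 'i \<Rightarrow> bool) \<Rightarrow> ('i \<Rightarrow> 'o) \<Rightarrow> ('i \<Rightarrow> 'i \<Rightarrow> 'a) \<Rightarrow> bool" where
  "direct_system C D leq X t \<longleftrightarrow> directed D leq \<and> (\<forall>i\<in>D. X i \<in> Obj C) \<and>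
     (\<forall>i\<in>D. \<forall>j\<in>D. leq i j \<longrightarrow> t i j \<in> homs C (X i) (X j)) \<and>
     (\<forall>i\<in>D. t i i = Idt C (X i)) \<and>
     (\<forall>i\<in>D. \<forall>j\<in>D. \<forall>k\<in>D. leq i j \<longrightarrow> leq j k \<longrightarrow> t j k \<cdot>\<^bsub>C\<^esub> t i j = t i k)"

definition direct_cocone ::
    "('o, 'a, 'm) cat_scheme \<Rightarrow> 'i set \<Rightarrow> ('i \<Rightarrow> 'i \<Rightarrow> bool) \<Rightarrow> ('i \<Rightarrow> 'o) \<Rightarrow> ('i \<Rightarrow> 'i \<Rightarrow> 'a) \<Rightarrow>
     'o \<Rightarrow> ('i \<Rightarrow> 'a) \<Rightarrow> bool" where
  "direct_cocone C D leq X t L c \<longleftrightarrow> L \<in> Obj C \<and> (\<forall>i\<in>D. c i \<in> homs C (X i) L) \<and>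
     (\<forall>i\<in>D. \<forall>j\<in>D. leq i j \<longrightarrow> c j \<cdot>\<^bsub>C\<^esub> t i j = c i)"

definition is_direct_limit ::
    "('o, 'a, 'm) cat_scheme \<Rightarrow> 'i set \<Rightarrow> ('i \<Rightarrow> 'i \<Rightarrow> bool) \<Rightarrow> ('i \<Rightarrow> 'o) \<Rightarrow> ('i \<Rightarrow> 'i \<Rightarrow> 'a) \<Rightarrow>
     'o \<Rightarrow> ('i \<Rightarrow> 'a) \<Rightarrow> bool" where
  "is_direct_limit C D leq X t L c \<longleftrightarrow> direct_cocone C D leq X t L c \<and>
     (\<forall>M d. direct_cocone C D leq X t M d \<longrightarrow>
        (\<exists>!h. h \<in> homs C L M \<and> (\<forall>i\<in>D. h \<cdot>\<^bsub>C\<^esub> c i = d i)))"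

definition direct_limits_exact :: "'k rel \<Rightarrow> ('o, 'a, 'm) cat_scheme \<Rightarrow> bool" where
  "direct_limits_exact \<kappa> C \<longleftrightarrow>
     (\<forall>(D :: 'k set) leq X t Y u Z v f g L c M d N e f' g'.
        small \<kappa> D \<longrightarrow>
        direct_system C D leq X t \<longrightarrow> direct_system C D leq Y u \<longrightarrow> direct_system C D leq Z v \<longrightarrow>
        (\<forall>i\<in>D. f i \<in> homs C (X i) (Y i) \<and> g i \<in> homs C (Y i) (Z i) \<and> short_exact C (f i) (g i)) \<longrightarrow>
        (\<forall>i\<in>D. \<forall>j\<in>D. leq i j \<longrightarrow>
           f j \<cdot>\<^bsub>C\<^esub> t i j = u i j \<cdot>\<^bsub>C\<^esub> f i \<and> g j \<cdot>\<^bsub>C\<^esub> u i j = v i j \<cdot>\<^bsub>C\<^esub> g i) \<longrightarrow>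
        is_direct_limit C D leq X t L c \<longrightarrow>
        is_direct_limit C D leq Y u M d \<longrightarrow>
        is_direct_limit C D leq Z v N e \<longrightarrow>
        f' \<in> homs C L M \<longrightarrow> (\<forall>i\<in>D. f' \<cdot>\<^bsub>C\<^esub> c i = d i \<cdot>\<^bsub>C\<^esub> f i) \<longrightarrow>
        g' \<in> homs C M N \<longrightarrow> (\<forall>i\<in>D. g' \<cdot>\<^bsub>C\<^esub> d i = e i \<cdot>\<^bsub>C\<^esub> g i) \<longrightarrow>
        short_exact C f' g')"

definition generating :: "('o, 'a, 'm) cat_scheme \<Rightarrow> 'o set \<Rightarrow> bool" where
  "generating C S \<longleftrightarrow> S \<subseteq> Obj C \<and>
     (\<forall>X Y. \<forall>f \<in> homs C X Y. \<forall>g \<in> homs C X Y. f \<noteq> g \<longrightarrow>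
        (\<exists>P\<in>S. \<exists>s \<in> homs C P X. f \<cdot>\<^bsub>C\<^esub> s \<noteq> g \<cdot>\<^bsub>C\<^esub> s))"

locale grothendieck_category = abelian_category C
  for C :: "('o, 'a, 'm) cat_scheme" (structure) +
  fixes \<kappa> :: "'k rel"
  assumes locally_small: "\<lbrakk>X \<in> Obj C; Y \<in> Obj C\<rbrakk> \<Longrightarrow> small \<kappa> (homs C X Y)"
    and ex_coproduct:
      "\<lbrakk>small \<kappa> (I :: 'k set); \<And>i. i \<in> I \<Longrightarrow> Xs i \<in> Obj C\<rbrakk> \<Longrightarrow> \<exists>P \<iota>. is_coproduct C I Xs P \<iota>"
    and direct_limits_exact: "direct_limits_exact \<kappa> C"
    and ex_generator: "\<exists>P. generating C {P}"

definition subobject :: "('o, 'a, 'm) cat_scheme \<Rightarrow> 'o \<Rightarrow> 'o \<Rightarrow> bool" where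
  "subobject C L M \<longleftrightarrow> (\<exists>m \<in> homs C L M. mono_arr C m)"

definition quotient_object :: "('o, 'a, 'm) cat_scheme \<Rightarrow> 'o \<Rightarrow> 'o \<Rightarrow> bool" where
  "quotient_object C Q M \<longleftrightarrow> (\<exists>q \<in> homs C M Q. epi_arr C q)"

definition subquotient :: "('o, 'a, 'm) cat_scheme \<Rightarrow> 'o \<Rightarrow> 'o \<Rightarrow> bool" where
  "subquotient C Q M \<longleftrightarrow> (\<exists>L. subobject C L M \<and> quotient_object C Q L)"

definition sub_le :: "('o, 'a, 'm) cat_scheme \<Rightarrow> 'a \<Rightarrow> 'a \<Rightarrow> bool" where
  "sub_le C m n \<longleftrightarrow> (\<exists>h \<in> homs C (Dom C m) (Dom C n). m = n \<cdot>\<^bsub>C\<^esub> h)"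

text \<open>Ascending chain condition on subobjects, represented by monomorphisms into \<open>M\<close>:\<close>

definition noetherian :: "('o, 'a, 'm) cat_scheme \<Rightarrow> 'o \<Rightarrow> bool" where
  "noetherian C M \<longleftrightarrow> M \<in> Obj C \<and>
     (\<forall>m :: nat \<Rightarrow> 'a. (\<forall>n. mono_arr C (m n) \<and> Cod C (m n) = M \<and> sub_le C (m n) (m (Suc n))) \<longrightarrow>
        (\<exists>N. \<forall>n\<ge>N. sub_le C (m n) (m N)))"

definition noeth_cat :: "('o, 'a, 'm) cat_scheme \<Rightarrow> ('o, 'a, 'm) cat_scheme" where
  "noeth_cat C = full_sub C {M \<in> Obj C. noetherian C M}"

definition locally_noetherian :: "'k rel \<Rightarrow> ('o, 'a, 'm) cat_scheme \<Rightarrow> bool" where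
  "locally_noetherian \<kappa> C \<longleftrightarrow> (\<exists>S. small \<kappa> S \<and> (\<forall>P\<in>S. noetherian C P) \<and> generating C S)"

text \<open>
  Finite presentation: \<open>Hom(P, -)\<close> preserves direct limits.  The direct limit of the sets
  \<open>Hom(P, X i)\<close> is their disjoint union modulo the relation below.
\<close>

definition hom_limit_rel ::
    "('o, 'a, 'm) cat_scheme \<Rightarrow> 'o \<Rightarrow> 'i set \<Rightarrow> ('i \<Rightarrow> 'i \<Rightarrow> bool) \<Rightarrow> ('i \<Rightarrow> 'o) \<Rightarrow> ('i \<Rightarrow> 'i \<Rightarrow> 'a) \<Rightarrow>
     ('i \<times> 'a) rel" where
  "hom_limit_rel C P D leq X t =
     {((i, f), (j, g)). i \<in> D \<and> f \<in> homs C P (X i) \<and> j \<in> D \<and> g \<in> homs C P (X j) \<and>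
        (\<exists>k\<in>D. leq i k \<and> leq j k \<and> t i k \<cdot>\<^bsub>C\<^esub> f = t j k \<cdot>\<^bsub>C\<^esub> g)}"

definition finitely_presented :: "'k rel \<Rightarrow> ('o, 'a, 'm) cat_scheme \<Rightarrow> 'o \<Rightarrow> bool" where
  "finitely_presented \<kappa> C P \<longleftrightarrow> P \<in> Obj C \<and>
     (\<forall>(D :: 'k set) leq X t L c.
        small \<kappa> D \<longrightarrow> direct_system C D leq X t \<longrightarrow> is_direct_limit C D leq X t L c \<longrightarrow>
        bij_betw (\<lambda>x. the_elem ((\<lambda>(i, f). c i \<cdot>\<^bsub>C\<^esub> f) ` x))
          ((SIGMA i:D. homs C P (X i)) // hom_limit_rel C P D leq X t)
          (homs C P L))"


section \<open>Endofunctors and group actions\<close>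

record ('o, 'a) endofunctor =
  OMap :: "'o \<Rightarrow> 'o"
  AMap :: "'a \<Rightarrow> 'a"

definition is_endofunctor :: "('o, 'a, 'm) cat_scheme \<Rightarrow> ('o, 'a) endofunctor \<Rightarrow> bool" where
  "is_endofunctor C F \<longleftrightarrow>
     (\<forall>X \<in> Obj C. OMap F X \<in> Obj C) \<and>
     (\<forall>X Y. \<forall>f \<in> homs C X Y. AMap F f \<in> homs C (OMap F X) (OMap F Y)) \<and>
     (\<forall>X \<in> Obj C. AMap F (Idt C X) = Idt C (OMap F X)) \<and>
     (\<forall>X Y Z. \<forall>f \<in> homs C X Y. \<forall>g \<in> homs C Y Z. AMap F (g \<cdot>\<^bsub>C\<^esub> f) = AMap F g \<cdot>\<^bsub>C\<^esub> AMap F f)"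

definition functor_id :: "('o, 'a) endofunctor" where
  "functor_id = \<lparr>OMap = (\<lambda>X. X), AMap = (\<lambda>f. f)\<rparr>"

definition functor_comp :: "('o, 'a) endofunctor \<Rightarrow> ('o, 'a) endofunctor \<Rightarrow> ('o, 'a) endofunctor" where
  "functor_comp F K = \<lparr>OMap = OMap F \<circ> OMap K, AMap = AMap F \<circ> AMap K\<rparr>"

definition nat_isomorphic ::
    "('o, 'a, 'm) cat_scheme \<Rightarrow> ('o, 'a) endofunctor \<Rightarrow> ('o, 'a) endofunctor \<Rightarrow> bool" where
  "nat_isomorphic C F K \<longleftrightarrow>
     (\<exists>\<eta>. (\<forall>X \<in> Obj C. \<eta> X \<in> homs C (OMap F X) (OMap K X) \<and> iso_arr C (\<eta> X)) \<and>
          (\<forall>X Y. \<forall>f \<in> homs C X Y. \<eta> Y \<cdot>\<^bsub>C\<^esub> AMap F f = AMap K f \<cdot>\<^bsub>C\<^esub> \<eta> X))"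

definition right_adjoint ::
    "('o, 'a, 'm) cat_scheme \<Rightarrow> ('o, 'a) endofunctor \<Rightarrow> ('o, 'a) endofunctor \<Rightarrow> bool" where
  \<comment> \<open>\<open>K\<close> is right adjoint to \<open>F\<close>\<close>
  "right_adjoint C K F \<longleftrightarrow> is_endofunctor C F \<and> is_endofunctor C K \<and>
     (\<exists>\<phi>. (\<forall>X \<in> Obj C. \<forall>Y \<in> Obj C.
              bij_betw (\<phi> X Y) (homs C (OMap F X) Y) (homs C X (OMap K Y))) \<and>
          (\<forall>X X' Y Y'. X \<in> Obj C \<longrightarrow> Y \<in> Obj C \<longrightarrow>
             (\<forall>u \<in> homs C X' X. \<forall>v \<in> homs C Y Y'. \<forall>f \<in> homs C (OMap F X) Y.
                \<phi> X' Y' (v \<cdot>\<^bsub>C\<^esub> f \<cdot>\<^bsub>C\<^esub> AMap F u) = AMap K v \<cdot>\<^bsub>C\<^esub> \<phi> X Y f \<cdot>\<^bsub>C\<^esub> u)))"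

definition autoequivalences :: "('o, 'a, 'm) cat_scheme \<Rightarrow> ('o, 'a) endofunctor set" where
  "autoequivalences C = {F. is_endofunctor C F \<and>
     (\<exists>K. is_endofunctor C K \<and> nat_isomorphic C (functor_comp F K) functor_id \<and> nat_isomorphic C (functor_comp K F) functor_id)}"

definition nat_iso_rel :: "('o, 'a, 'm) cat_scheme \<Rightarrow> ('o, 'a) endofunctor rel" where
  "nat_iso_rel C = {(F, K). F \<in> autoequivalences C \<and> K \<in> autoequivalences C \<and> nat_isomorphic C F K}"

definition autoequivalence_group ::
    "('o, 'a, 'm) cat_scheme \<Rightarrow> ('o, 'a) endofunctor set monoid" where
  "autoequivalence_group C =
     \<lparr>carrier = autoequivalences C // nat_iso_rel C,
      mult = (\<lambda>x y. \<Union>F\<in>x. \<Union>K\<in>y. nat_iso_rel C `` {functor_comp F K}),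
      one = nat_iso_rel C `` {functor_id}\<rparr>"

definition is_action ::
    "('g, 'n) monoid_scheme \<Rightarrow> ('o, 'a, 'm) cat_scheme \<Rightarrow> ('g \<Rightarrow> ('o, 'a) endofunctor set) \<Rightarrow> bool" where
  "is_action G C \<rho> \<longleftrightarrow> group G \<and> \<rho> \<in> hom G (autoequivalence_group C)"

text \<open>The object \<open>g \<cdot> X\<close>, defined up to isomorphism: apply some representative of the class \<open>\<rho> g\<close>.\<close>

definition act :: "('g \<Rightarrow> ('o, 'a) endofunctor set) \<Rightarrow> 'g \<Rightarrow> 'o \<Rightarrow> 'o" where
  "act \<rho> g X = OMap (SOME F. F \<in> \<rho> g) X"

definition G_closed ::
    "('g, 'n) monoid_scheme \<Rightarrow> ('g \<Rightarrow> ('o, 'a) endofunctor set) \<Rightarrow> 'o set \<Rightarrow> bool" where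
  "G_closed G \<rho> \<X> \<longleftrightarrow> (\<forall>g \<in> carrier G. \<forall>X \<in> \<X>. act \<rho> g X \<in> \<X>)"


section \<open>Symmetric monoidal closed categories and Grothendieck cosmoi\<close>

record ('o, 'a) mon_cat = "('o, 'a) cat" +
  Tens :: "'o \<Rightarrow> 'o \<Rightarrow> 'o"  (infixl "\<odot>\<index>" 70)
  TensA :: "'a \<Rightarrow> 'a \<Rightarrow> 'a"  (infixl "\<star>\<index>" 70)
  Unt :: "'o"
  Assoc :: "'o \<Rightarrow> 'o \<Rightarrow> 'o \<Rightarrow> 'a"
  LUnit :: "'o \<Rightarrow> 'a"
  RUnit :: "'o \<Rightarrow> 'a"
  Braid :: "'o \<Rightarrow> 'o \<Rightarrow> 'a"
  IHom :: "'o \<Rightarrow> 'o \<Rightarrow> 'o"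

definition tensor_right ::
    "('o, 'a, 'm) mon_cat_scheme \<Rightarrow> 'o \<Rightarrow> ('o, 'a) endofunctor" where
  "tensor_right C M = \<lparr>OMap = (\<lambda>X. X \<odot>\<^bsub>C\<^esub> M), AMap = (\<lambda>f. f \<star>\<^bsub>C\<^esub> Idt C M)\<rparr>"

locale symmetric_monoidal_category = category C
  for C :: "('o, 'a, 'm) mon_cat_scheme" (structure) +
  assumes Tens_in: "\<lbrakk>X \<in> Obj C; Y \<in> Obj C\<rbrakk> \<Longrightarrow> X \<odot> Y \<in> Obj C"
    and TensA_in: "\<lbrakk>f \<in> homs C X X'; g \<in> homs C Y Y'\<rbrakk> \<Longrightarrow> f \<star> g \<in> homs C (X \<odot> Y) (X' \<odot> Y')"
    and TensA_Idt: "\<lbrakk>X \<in> Obj C; Y \<in> Obj C\<rbrakk> \<Longrightarrow> Idt C X \<star> Idt C Y = Idt C (X \<odot> Y)"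
    and TensA_Comp:
      "\<lbrakk>f \<in> homs C X X'; f' \<in> homs C X' X''; g \<in> homs C Y Y'; g' \<in> homs C Y' Y''\<rbrakk> \<Longrightarrow>
         (f' \<cdot> f) \<star> (g' \<cdot> g) = (f' \<star> g') \<cdot> (f \<star> g)"
    and Unt_in: "Unt C \<in> Obj C"
    and Assoc_iso:
      "\<lbrakk>X \<in> Obj C; Y \<in> Obj C; Z \<in> Obj C\<rbrakk> \<Longrightarrow>
         Assoc C X Y Z \<in> homs C ((X \<odot> Y) \<odot> Z) (X \<odot> (Y \<odot> Z)) \<and> iso_arr C (Assoc C X Y Z)"
    and Assoc_nat:
      "\<lbrakk>f \<in> homs C X X'; g \<in> homs C Y Y'; h \<in> homs C Z Z'\<rbrakk> \<Longrightarrow>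
         Assoc C X' Y' Z' \<cdot> ((f \<star> g) \<star> h) = (f \<star> (g \<star> h)) \<cdot> Assoc C X Y Z"
    and LUnit_iso: "X \<in> Obj C \<Longrightarrow> LUnit C X \<in> homs C (Unt C \<odot> X) X \<and> iso_arr C (LUnit C X)"
    and LUnit_nat: "f \<in> homs C X Y \<Longrightarrow> LUnit C Y \<cdot> (Idt C (Unt C) \<star> f) = f \<cdot> LUnit C X"
    and RUnit_iso: "X \<in> Obj C \<Longrightarrow> RUnit C X \<in> homs C (X \<odot> Unt C) X \<and> iso_arr C (RUnit C X)"
    and RUnit_nat: "f \<in> homs C X Y \<Longrightarrow> RUnit C Y \<cdot> (f \<star> Idt C (Unt C)) = f \<cdot> RUnit C X"
    and Braid_iso:
      "\<lbrakk>X \<in> Obj C; Y \<in> Obj C\<rbrakk> \<Longrightarrow> Braid C X Y \<in> homs C (X \<odot> Y) (Y \<odot> X) \<and> iso_arr C (Braid C X Y)"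
    and Braid_nat:
      "\<lbrakk>f \<in> homs C X X'; g \<in> homs C Y Y'\<rbrakk> \<Longrightarrow> Braid C X' Y' \<cdot> (f \<star> g) = (g \<star> f) \<cdot> Braid C X Y"
    and pentagon:
      "\<lbrakk>W \<in> Obj C; X \<in> Obj C; Y \<in> Obj C; Z \<in> Obj C\<rbrakk> \<Longrightarrow>
         Assoc C W X (Y \<odot> Z) \<cdot> Assoc C (W \<odot> X) Y Z =
         (Idt C W \<star> Assoc C X Y Z) \<cdot> Assoc C W (X \<odot> Y) Z \<cdot> (Assoc C W X Y \<star> Idt C Z)"
    and triangle:
      "\<lbrakk>X \<in> Obj C; Y \<in> Obj C\<rbrakk> \<Longrightarrow>
         (Idt C X \<star> LUnit C Y) \<cdot> Assoc C X (Unt C) Y = RUnit C X \<star> Idt C Y"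
    and hexagon:
      "\<lbrakk>X \<in> Obj C; Y \<in> Obj C; Z \<in> Obj C\<rbrakk> \<Longrightarrow>
         Assoc C Y Z X \<cdot> Braid C X (Y \<odot> Z) \<cdot> Assoc C X Y Z =
         (Idt C Y \<star> Braid C X Z) \<cdot> Assoc C Y X Z \<cdot> (Braid C X Y \<star> Idt C Z)"
    and symmetry:
      "\<lbrakk>X \<in> Obj C; Y \<in> Obj C\<rbrakk> \<Longrightarrow> Braid C Y X \<cdot> Braid C X Y = Idt C (X \<odot> Y)"

text \<open>
  Only the object part \<open>[M, Y] = IHom C M Y\<close> of the internal Hom is recorded; its action on
  arrows is determined by the adjunction.
\<close>

locale symmetric_monoidal_closed_category = symmetric_monoidal_category C
  for C :: "('o, 'a, 'm) mon_cat_scheme" (structure) +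
  assumes closed:
    "M \<in> Obj C \<Longrightarrow>
       \<exists>h. right_adjoint C \<lparr>OMap = (\<lambda>Y. IHom C M Y), AMap = h\<rparr> (tensor_right C M)"

locale grothendieck_cosmos =
  symmetric_monoidal_closed_category C + grothendieck_category C \<kappa>
  for C :: "('o, 'a, 'm) mon_cat_scheme" (structure) and \<kappa> :: "'k rel"

definition dualizable :: "('o, 'a, 'm) mon_cat_scheme \<Rightarrow> 'o \<Rightarrow> bool" where
  "dualizable C D \<longleftrightarrow> D \<in> Obj C \<and>
     (\<exists>E \<in> Obj C. right_adjoint C (tensor_right C E) (tensor_right C D))"


section \<open>Subcategories\<close>

text \<open>Full subcategories closed under isomorphisms are identified with their classes of objects.\<close>

definition subcategory :: "('o, 'a, 'm) cat_scheme \<Rightarrow> 'o set \<Rightarrow> bool" where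
  "subcategory C \<X> \<longleftrightarrow> \<X> \<subseteq> Obj C \<and> (\<forall>X\<in>\<X>. \<forall>Y. isomorphic C X Y \<longrightarrow> Y \<in> \<X>)"

definition additive_subcategory :: "('o, 'a, 'm) cat_scheme \<Rightarrow> 'o set \<Rightarrow> bool" where
  "additive_subcategory C \<X> \<longleftrightarrow> subcategory C \<X> \<and>
     (\<forall>Z. is_zero C Z \<longrightarrow> Z \<in> \<X>) \<and>
     (\<forall>X\<in>\<X>. \<forall>Y\<in>\<X>. \<forall>P. is_direct_sum C X Y P \<longrightarrow> P \<in> \<X>)"

definition closed_subobjects :: "('o, 'a, 'm) cat_scheme \<Rightarrow> 'o set \<Rightarrow> bool" where
  "closed_subobjects C \<X> \<longleftrightarrow> (\<forall>X\<in>\<X>. \<forall>L. subobject C L X \<longrightarrow> L \<in> \<X>)"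

definition closed_quotients :: "('o, 'a, 'm) cat_scheme \<Rightarrow> 'o set \<Rightarrow> bool" where
  "closed_quotients C \<X> \<longleftrightarrow> (\<forall>X\<in>\<X>. \<forall>Q. quotient_object C Q X \<longrightarrow> Q \<in> \<X>)"

definition closed_extensions :: "('o, 'a, 'm) cat_scheme \<Rightarrow> 'o set \<Rightarrow> bool" where
  "closed_extensions C \<X> \<longleftrightarrow>
     (\<forall>f g. short_exact C f g \<and> Dom C f \<in> \<X> \<and> Cod C g \<in> \<X> \<longrightarrow> Cod C f \<in> \<X>)"

definition closed_coproducts :: "'k rel \<Rightarrow> ('o, 'a, 'm) cat_scheme \<Rightarrow> 'o set \<Rightarrow> bool" where
  "closed_coproducts \<kappa> C \<X> \<longleftrightarrow>
     (\<forall>(I :: 'k set) X P \<iota>. small \<kappa> I \<longrightarrow> (\<forall>i\<in>I. X i \<in> \<X>) \<longrightarrow> is_coproduct C I X P \<iota> \<longrightarrow> P \<in> \<X>)"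

definition serre_subcategory :: "('o, 'a, 'm) cat_scheme \<Rightarrow> 'o set \<Rightarrow> bool" where
  "serre_subcategory C \<X> \<longleftrightarrow> additive_subcategory C \<X> \<and>
     closed_subobjects C \<X> \<and> closed_quotients C \<X> \<and> closed_extensions C \<X>"

definition localizing_subcategory :: "'k rel \<Rightarrow> ('o, 'a, 'm) cat_scheme \<Rightarrow> 'o set \<Rightarrow> bool" where
  "localizing_subcategory \<kappa> C \<X> \<longleftrightarrow> serre_subcategory C \<X> \<and> closed_coproducts \<kappa> C \<X>"

definition torsion_free_class :: "('o, 'a, 'm) cat_scheme \<Rightarrow> 'o set \<Rightarrow> bool" where
  "torsion_free_class C \<X> \<longleftrightarrow>
     additive_subcategory C \<X> \<and> closed_subobjects C \<X> \<and> closed_extensions C \<X>"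

definition tensor_ideal :: "('o, 'a, 'm) mon_cat_scheme \<Rightarrow> 'o set \<Rightarrow> bool" where
  "tensor_ideal C \<X> \<longleftrightarrow> (\<forall>X\<in>\<X>. \<forall>M \<in> Obj C. X \<odot>\<^bsub>C\<^esub> M \<in> \<X>)"

definition hom_ideal :: "('o, 'a, 'm) mon_cat_scheme \<Rightarrow> 'o set \<Rightarrow> bool" where
  "hom_ideal C \<X> \<longleftrightarrow> (\<forall>X\<in>\<X>. \<forall>M \<in> Obj C. IHom C M X \<in> \<X>)"


section \<open>Atom spectrum\<close>

definition common_nonzero_subobject :: "('o, 'a, 'm) cat_scheme \<Rightarrow> 'o \<Rightarrow> 'o \<Rightarrow> bool" where
  "common_nonzero_subobject C X Y \<longleftrightarrow>
     (\<exists>N \<in> Obj C. \<not> is_zero C N \<and> subobject C N X \<and> subobject C N Y)"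

definition monoform :: "('o, 'a, 'm) cat_scheme \<Rightarrow> 'o \<Rightarrow> bool" where
  "monoform C H \<longleftrightarrow> H \<in> Obj C \<and> \<not> is_zero C H \<and>
     (\<forall>l q. mono_arr C l \<and> Cod C l = H \<and> \<not> is_zero C (Dom C l) \<and> is_cokernel C l q \<longrightarrow>
        \<not> common_nonzero_subobject C H (Cod C q))"

definition atom_equiv :: "('o, 'a, 'm) cat_scheme \<Rightarrow> 'o \<Rightarrow> 'o \<Rightarrow> bool" where
  "atom_equiv C H K \<longleftrightarrow> monoform C H \<and> monoform C K \<and> common_nonzero_subobject C H K"

definition atom :: "('o, 'a, 'm) cat_scheme \<Rightarrow> 'o \<Rightarrow> 'o set" where
  "atom C H = {K. atom_equiv C H K}"

definition Spec :: "('o, 'a, 'm) cat_scheme \<Rightarrow> 'o set set" where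
  "Spec C = {atom C H | H. monoform C H}"

definition Supp :: "('o, 'a, 'm) cat_scheme \<Rightarrow> 'o \<Rightarrow> 'o set set" where
  "Supp C M = {atom C H | H. monoform C H \<and> subquotient C H M}"

definition Ass :: "('o, 'a, 'm) cat_scheme \<Rightarrow> 'o \<Rightarrow> 'o set set" where
  "Ass C M = {atom C H | H. monoform C H \<and> subobject C H M}"

definition Spec_top :: "('o, 'a, 'm) cat_scheme \<Rightarrow> 'o set topology" where
  "Spec_top C = topology_generated_by {Supp C M | M. M \<in> Obj C}"

definition quotient_topology :: "'x topology \<Rightarrow> ('x \<Rightarrow> 'y) \<Rightarrow> 'y topology" where
  "quotient_topology T p =
     topology (\<lambda>U. U \<subseteq> p ` topspace T \<and> openin T {x \<in> topspace T. p x \<in> U})"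

lemma openin_quotient_topology:
  "openin (quotient_topology T p) U \<longleftrightarrow>
     U \<subseteq> p ` topspace T \<and> openin T {x \<in> topspace T. p x \<in> U}"
proof -
  have Int: "{x \<in> topspace T. p x \<in> S \<inter> S'} = {x \<in> topspace T. p x \<in> S} \<inter> {x \<in> topspace T. p x \<in> S'}"
    for S S' by auto
  have Un: "{x \<in> topspace T. p x \<in> \<Union>\<K>} = (\<Union>K\<in>\<K>. {x \<in> topspace T. p x \<in> K})" for \<K>
    by auto
  have "istopology (\<lambda>U. U \<subseteq> p ` topspace T \<and> openin T {x \<in> topspace T. p x \<in> U})"
    unfolding istopology_def Int Un by blast
  then show ?thesis
    by (simp add: quotient_topology_def topology_inverse')
qed

lemma topspace_quotient_topology: "topspace (quotient_topology T p) = p ` topspace T"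
proof
  have "{x \<in> topspace T. p x \<in> p ` topspace T} = topspace T" by auto
  then have "openin (quotient_topology T p) (p ` topspace T)"
    by (simp add: openin_quotient_topology)
  then show "p ` topspace T \<subseteq> topspace (quotient_topology T p)"
    by (rule openin_subset)
  show "topspace (quotient_topology T p) \<subseteq> p ` topspace T"
    using openin_topspace[of "quotient_topology T p"] unfolding openin_quotient_topology by blast
qed

lemma quotient_map_quotient_topology: "quotient_map T (quotient_topology T p) p"
  by (simp add: quotient_map_def topspace_quotient_topology openin_quotient_topology)

text \<open>
  \<open>g \<cdot> x\<close> for an atom \<open>x\<close>: the members of the union all coincide, being \<open>atom C (g \<cdot> H)\<close> for
  representatives \<open>H\<close> of \<open>x\<close>.
\<close>

definition act_atom ::
    "('o, 'a, 'm) cat_scheme \<Rightarrow> ('g \<Rightarrow> ('o, 'a) endofunctor set) \<Rightarrow> 'g \<Rightarrow> 'o set \<Rightarrow> 'o set" where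
  "act_atom C \<rho> g x = (\<Union>H\<in>x. atom C (act \<rho> g H))"

definition orbit_map ::
    "('g, 'n) monoid_scheme \<Rightarrow> ('o, 'a, 'm) cat_scheme \<Rightarrow> ('g \<Rightarrow> ('o, 'a) endofunctor set) \<Rightarrow>
     'o set \<Rightarrow> 'o set set" where
  "orbit_map G C \<rho> x = {act_atom C \<rho> g x | g. g \<in> carrier G}"

definition SpecG ::
    "('g, 'n) monoid_scheme \<Rightarrow> ('o, 'a, 'm) cat_scheme \<Rightarrow> ('g \<Rightarrow> ('o, 'a) endofunctor set) \<Rightarrow>
     'o set set set" where
  "SpecG G C \<rho> = orbit_map G C \<rho> ` Spec C"

definition SpecG_top ::
    "('g, 'n) monoid_scheme \<Rightarrow> ('o, 'a, 'm) cat_scheme \<Rightarrow> ('g \<Rightarrow> ('o, 'a) endofunctor set) \<Rightarrow>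
     'o set set topology" where
  "SpecG_top G C \<rho> = quotient_topology (Spec_top C) (orbit_map G C \<rho>)"

definition SuppG ::
    "('g, 'n) monoid_scheme \<Rightarrow> ('o, 'a, 'm) cat_scheme \<Rightarrow> ('g \<Rightarrow> ('o, 'a) endofunctor set) \<Rightarrow>
     'o \<Rightarrow> 'o set set set" where
  "SuppG G C \<rho> M = orbit_map G C \<rho> ` Supp C M"

definition AssG ::
    "('g, 'n) monoid_scheme \<Rightarrow> ('o, 'a, 'm) cat_scheme \<Rightarrow> ('g \<Rightarrow> ('o, 'a) endofunctor set) \<Rightarrow>
     'o \<Rightarrow> 'o set set set" where
  "AssG G C \<rho> M = orbit_map G C \<rho> ` Ass C M"

text \<open>Atoms of noetherian objects are taken in the ambient category \<open>C\<close>, not in \<open>noeth_cat C\<close>.\<close>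

definition AssG_inv ::
    "('g, 'n) monoid_scheme \<Rightarrow> ('o, 'a, 'm) cat_scheme \<Rightarrow> ('g \<Rightarrow> ('o, 'a) endofunctor set) \<Rightarrow>
     'o set set set \<Rightarrow> 'o set" where
  "AssG_inv G C \<rho> \<Phi> = {M \<in> Obj (noeth_cat C). AssG G C \<rho> M \<subseteq> \<Phi>}"

definition AssG_class ::
    "('g, 'n) monoid_scheme \<Rightarrow> ('o, 'a, 'm) cat_scheme \<Rightarrow> ('g \<Rightarrow> ('o, 'a) endofunctor set) \<Rightarrow>
     'o set \<Rightarrow> 'o set set set" where
  "AssG_class G C \<rho> \<X> = (\<Union>X\<in>\<X>. AssG G C \<rho> X)"

definition G_torsion_free_classes ::
    "('g, 'n) monoid_scheme \<Rightarrow> ('o, 'a, 'm) cat_scheme \<Rightarrow> ('g \<Rightarrow> ('o, 'a) endofunctor set) \<Rightarrow>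
     'o set set" where
  "G_torsion_free_classes G C \<rho> = {\<X>. torsion_free_class (noeth_cat C) \<X> \<and> G_closed G \<rho> \<X>}"

end

theory Submission
  imports Defs
begin

text \<open>
  An orbit \<open>x\<close> is recovered as the only associated orbit of a noetherian monoform object representing it.
  The main point is that a \<open>G\<close>-closed torsion-free class \<open>\<X>\<close> contains every noetherian \<open>M\<close> all of whose
  associated orbits occur in \<open>\<X>\<close>.  Splitting off associated orbits reduces this to the case of a single
  orbit \<open>x\<close>.  Let \<open>L \<subseteq> M\<close> be maximal among the subobjects in \<open>\<X>\<close>; then no associated orbit of \<open>Q = M / L\<close>
  occurs in \<open>\<X>\<close>.  The localizing subcategory of the objects supported in the support of \<open>Q\<close> is a tensor
  ideal, which yields a subobject \<open>S\<close> of the unit that kills \<open>Q\<close> and whose quotient \<open>I / S\<close> is supported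
  there.  Hence multiplication maps \<open>S \<otimes> M\<close> to \<open>L\<close>, and the transposed map \<open>M \<rightarrow> [S, L]\<close> ends in an object of
  \<open>\<X>\<close>, as \<open>\<X>\<close> is a Hom ideal.  If it is not mono, its kernel is killed by \<open>S\<close>, so \<open>x\<close> lies in the
  support of \<open>Q\<close>, and the hypothesis on closures makes \<open>x\<close> topologically indistinguishable from an
  associated orbit of \<open>Q\<close>.  Comparing annihilators inside the unit object shows that such orbits are
  equal, which contradicts the choice of \<open>L\<close>.
\<close>

section \<open>Categories\<close>

text \<open>Hypothesis (c) speaks of localizing subcategories, so supports have to be bounded on
  arbitrary small coproducts. This is the reason for the long passage on direct limits: exactness of
  direct limits is what keeps a new atom from appearing in a coproduct. Hypothesis (e) yields only
  an orbit in a closure. Used once for \<open>Q\<close> and once for \<open>M\<close> it puts two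
  orbits into the closures of each other, and \<open>Spec^G\<close> is not assumed to be T0.
  \<open>orbit_separation\<close> fills this gap, with (d) instead of topology. Dualizability is
  needed for membership in a tensor ideal: an arrow \<open>D -> Q\<close> transposes to
  \<open>I -> Q \<odot> E\<close>, whose target is supported in the support of \<open>Q\<close>; for
  \<open>[D, Q]\<close> no such bound is at hand. Hypothesis (d) concerns noetherian objects, while
  the unit need not be noetherian. Ideals of the unit are therefore compared inside
  \<open>I / ann N\<close>, which embeds in \<open>[N, N]\<close> and is noetherian. Diagram chases
  use no elements: they are written as vanishing of composites and as factorizations
  \<open>sub_le\<close> between arrows with a common codomain.\<close>

context category
begin

section \<open>Composition, monomorphisms and the order of subobjects\<close>

lemma comp_arr [simp]:
  assumes "f \<in> Arr C" "g \<in> Arr C" "Cod C f = Dom C g"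
  shows "g \<cdot> f \<in> Arr C" "Dom C (g \<cdot> f) = Dom C f" "Cod C (g \<cdot> f) = Cod C g"
  using Comp_in[of f "Dom C f" "Dom C g" g "Cod C g"] assms by (simp_all add: homs_def)

lemma dom_obj [simp]: "f \<in> Arr C \<Longrightarrow> Dom C f \<in> Obj C"
  and cod_obj [simp]: "f \<in> Arr C \<Longrightarrow> Cod C f \<in> Obj C"
  by (rule Dom_in, assumption) (rule Cod_in)

lemma idt_arr [simp]:
  assumes "X \<in> Obj C"
  shows "Idt C X \<in> Arr C" "Dom C (Idt C X) = X" "Cod C (Idt C X) = X"
  using Idt_in[OF assms] by (simp_all add: homs_def)

lemma comp_idt [simp]: "\<lbrakk>f \<in> Arr C; Dom C f = X\<rbrakk> \<Longrightarrow> f \<cdot> Idt C X = f"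
  and idt_comp [simp]: "\<lbrakk>f \<in> Arr C; Cod C f = X\<rbrakk> \<Longrightarrow> Idt C X \<cdot> f = f"
  using Comp_Idt[of f X "Cod C f"] Idt_Comp[of f "Dom C f" X] by (simp_all add: homs_def)

lemma comp_assoc [simp]:
  "\<lbrakk>f \<in> Arr C; g \<in> Arr C; h \<in> Arr C; Cod C f = Dom C g; Cod C g = Dom C h\<rbrakk>
    \<Longrightarrow> (h \<cdot> g) \<cdot> f = h \<cdot> (g \<cdot> f)"
  using Comp_assoc[of f "Dom C f" "Dom C g" g "Dom C h" h "Cod C h"] by (simp add: homs_def)

text \<open>Simplification nests composites to the right, which hides the left side
  \<open>a \<cdot> b\<close> of a known equation inside \<open>a \<cdot> b \<cdot> u\<close>. The
  extended forms here and below make such equations applicable again.\<close>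

lemma comp_eq_extend:
  assumes "a \<cdot> b = c" "a \<in> Arr C" "b \<in> Arr C" "u \<in> Arr C" "Cod C b = Dom C a" "Cod C u = Dom C b"
  shows "a \<cdot> b \<cdot> u = c \<cdot> u"
  using assms by (metis comp_assoc)

lemma comp_eq_extend2:
  assumes "a \<cdot> b = c \<cdot> d" "a \<in> Arr C" "b \<in> Arr C" "u \<in> Arr C" "c \<in> Arr C" "d \<in> Arr C"
    "Cod C b = Dom C a" "Cod C u = Dom C b" "Cod C d = Dom C c" "Dom C d = Dom C b"
  shows "a \<cdot> b \<cdot> u = c \<cdot> d \<cdot> u"
  using assms by (metis comp_assoc)

lemma mono_arrD [simp]: "mono_arr C m \<Longrightarrow> m \<in> Arr C"
  by (simp add: mono_arr_def)

lemma epi_arrD [simp]: "epi_arr C m \<Longrightarrow> m \<in> Arr C"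
  by (simp add: epi_arr_def)

lemma mono_cancel:
  assumes "mono_arr C m" "u \<in> Arr C" "v \<in> Arr C" "Cod C u = Dom C m" "Cod C v = Dom C m"
    "m \<cdot> u = m \<cdot> v"
  shows "u = v"
proof -
  have "Dom C u = Dom C v" using assms comp_arr(2) mono_arrD by metis
  then show ?thesis using assms unfolding mono_arr_def homs_def by fastforce
qed

lemma epi_cancel:
  assumes "epi_arr C m" "u \<in> Arr C" "v \<in> Arr C" "Dom C u = Cod C m" "Dom C v = Cod C m"
    "u \<cdot> m = v \<cdot> m"
  shows "u = v"
proof -
  have "Cod C u = Cod C v" using assms comp_arr(3) epi_arrD by metis
  then show ?thesis using assms unfolding epi_arr_def homs_def by fastforce
qed

lemma mono_arrI:
  assumes "m \<in> Arr C"
    "\<And>u v. \<lbrakk>u \<in> Arr C; v \<in> Arr C; Dom C u = Dom C v; Cod C u = Dom C m; Cod C v = Dom C m; m \<cdot> u = m \<cdot> v\<rbrakk>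
       \<Longrightarrow> u = v"
  shows "mono_arr C m"
  using assms unfolding mono_arr_def homs_def by auto

lemma epi_arrI:
  assumes "m \<in> Arr C"
    "\<And>u v. \<lbrakk>u \<in> Arr C; v \<in> Arr C; Cod C u = Cod C v; Dom C u = Cod C m; Dom C v = Cod C m; u \<cdot> m = v \<cdot> m\<rbrakk>
       \<Longrightarrow> u = v"
  shows "epi_arr C m"
  using assms unfolding epi_arr_def homs_def by auto

lemma mono_comp:
  assumes "mono_arr C m" "mono_arr C n" "Cod C n = Dom C m"
  shows "mono_arr C (m \<cdot> n)"
proof (rule mono_arrI)
  fix u v assume uv: "u \<in> Arr C" "v \<in> Arr C" "Cod C u = Dom C (m \<cdot> n)" "Cod C v = Dom C (m \<cdot> n)"
    "(m \<cdot> n) \<cdot> u = (m \<cdot> n) \<cdot> v"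
  then have "m \<cdot> (n \<cdot> u) = m \<cdot> (n \<cdot> v)" using assms by simp
  then have "n \<cdot> u = n \<cdot> v" using assms uv by - (rule mono_cancel[OF assms(1)], simp_all)
  then show "u = v" using assms uv by - (rule mono_cancel[OF assms(2)], simp_all)
qed (use assms in simp)

lemma epi_comp:
  assumes "epi_arr C m" "epi_arr C n" "Cod C n = Dom C m"
  shows "epi_arr C (m \<cdot> n)"
proof (rule epi_arrI)
  fix u v assume uv: "u \<in> Arr C" "v \<in> Arr C" "Dom C u = Cod C (m \<cdot> n)" "Dom C v = Cod C (m \<cdot> n)"
    "u \<cdot> m \<cdot> n = v \<cdot> m \<cdot> n"
  then have "(u \<cdot> m) \<cdot> n = (v \<cdot> m) \<cdot> n" using assms by simp
  then have "u \<cdot> m = v \<cdot> m" using assms uv by - (rule epi_cancel[OF assms(2)], simp_all)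
  then show "u = v" using assms uv by - (rule epi_cancel[OF assms(1)], simp_all)
qed (use assms in simp)

lemma mono_of_comp:
  assumes "mono_arr C (m \<cdot> n)" "m \<in> Arr C" "n \<in> Arr C" "Cod C n = Dom C m"
  shows "mono_arr C n"
proof (rule mono_arrI)
  fix u v assume uv: "u \<in> Arr C" "v \<in> Arr C" "Cod C u = Dom C n" "Cod C v = Dom C n" "n \<cdot> u = n \<cdot> v"
  then have "(m \<cdot> n) \<cdot> u = (m \<cdot> n) \<cdot> v" using assms by simp
  then show "u = v" using assms uv by - (rule mono_cancel[OF assms(1)], simp_all)
qed (use assms in simp)

lemma epi_of_comp:
  assumes "epi_arr C (m \<cdot> n)" "m \<in> Arr C" "n \<in> Arr C" "Cod C n = Dom C m"
  shows "epi_arr C m"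
proof (rule epi_arrI)
  fix u v assume uv: "u \<in> Arr C" "v \<in> Arr C" "Dom C u = Cod C m" "Dom C v = Cod C m" "u \<cdot> m = v \<cdot> m"
  have "(u \<cdot> m) \<cdot> n = (v \<cdot> m) \<cdot> n" by (simp only: uv)
  then have "u \<cdot> (m \<cdot> n) = v \<cdot> (m \<cdot> n)" using assms uv(1-4) by simp
  then show "u = v" using assms(2-) uv(1-4) by - (rule epi_cancel[OF assms(1)], simp_all)
qed (use assms in simp)

lemma iso_arrD [simp]: "iso_arr C m \<Longrightarrow> m \<in> Arr C"
  by (simp add: iso_arr_def)

lemma iso_arrE:
  assumes "iso_arr C f"
  obtains g where "g \<in> Arr C" "Dom C g = Cod C f" "Cod C g = Dom C f"
    "g \<cdot> f = Idt C (Dom C f)" "f \<cdot> g = Idt C (Cod C f)" "iso_arr C g"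
proof -
  obtain g where "g \<in> Arr C" "Dom C g = Cod C f" "Cod C g = Dom C f"
    "g \<cdot> f = Idt C (Dom C f)" "f \<cdot> g = Idt C (Cod C f)"
    using assms unfolding iso_arr_def homs_def by auto
  moreover from this have "iso_arr C g" using assms unfolding iso_arr_def homs_def by auto
  ultimately show thesis using that by blast
qed

lemma idt_mono [simp]: "X \<in> Obj C \<Longrightarrow> mono_arr C (Idt C X)"
  by (rule mono_arrI) auto

lemma idt_epi [simp]: "X \<in> Obj C \<Longrightarrow> epi_arr C (Idt C X)"
  by (rule epi_arrI) auto

lemma iso_mono: assumes "iso_arr C f" shows "mono_arr C f"
proof -
  obtain g where g: "g \<in> Arr C" "Dom C g = Cod C f" "Cod C g = Dom C f" "g \<cdot> f = Idt C (Dom C f)"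
    by (rule iso_arrE[OF assms])
  then have "mono_arr C (g \<cdot> f)" using assms by simp
  then show ?thesis using mono_of_comp g assms by (metis iso_arrD)
qed

lemma iso_epi: assumes "iso_arr C f" shows "epi_arr C f"
proof -
  obtain g where g: "g \<in> Arr C" "Dom C g = Cod C f" "Cod C g = Dom C f" "f \<cdot> g = Idt C (Cod C f)"
    by (rule iso_arrE[OF assms])
  then have "epi_arr C (f \<cdot> g)" using assms by simp
  then show ?thesis using epi_of_comp g assms by (metis iso_arrD)
qed

lemma isomorphic_sym: assumes "isomorphic C X Y" shows "isomorphic C Y X"
proof -
  obtain f where f: "f \<in> homs C X Y" "iso_arr C f" using assms unfolding isomorphic_def by blast
  obtain g where "g \<in> Arr C" "Dom C g = Cod C f" "Cod C g = Dom C f" "iso_arr C g"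
    by (rule iso_arrE[OF f(2)])
  then show ?thesis using f unfolding isomorphic_def homs_def by blast
qed

lemma isomorphic_sub: "isomorphic C X Y \<Longrightarrow> subobject C X Y"
  unfolding isomorphic_def subobject_def using iso_mono by blast

lemma subobjectI: "\<lbrakk>mono_arr C m; Dom C m = L; Cod C m = M\<rbrakk> \<Longrightarrow> subobject C L M"
  unfolding subobject_def homs_def by (auto intro: mono_arrD)

lemma subobjectE:
  assumes "subobject C L M"
  obtains m where "mono_arr C m" "Dom C m = L" "Cod C m = M"
  using assms unfolding subobject_def homs_def by auto

lemma quotient_objectI: "\<lbrakk>epi_arr C m; Dom C m = M; Cod C m = Q\<rbrakk> \<Longrightarrow> quotient_object C Q M"
  unfolding quotient_object_def homs_def by (auto intro: epi_arrD)

lemma quotient_objectE: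
  assumes "quotient_object C Q M"
  obtains m where "epi_arr C m" "Dom C m = M" "Cod C m = Q"
  using assms unfolding quotient_object_def homs_def by auto

lemma subobject_trans: "\<lbrakk>subobject C L M; subobject C M N\<rbrakk> \<Longrightarrow> subobject C L N"
  using mono_comp by (metis subobjectE subobjectI comp_arr(2,3) mono_arrD)

lemma quotient_object_trans: "\<lbrakk>quotient_object C L M; quotient_object C M N\<rbrakk> \<Longrightarrow> quotient_object C L N"
  using epi_comp by (metis quotient_objectE quotient_objectI comp_arr(2,3) epi_arrD)

lemma subobject_refl [simp]: "M \<in> Obj C \<Longrightarrow> subobject C M M"
  by (rule subobjectI[of "Idt C M"]) auto

lemma quotient_object_refl [simp]: "M \<in> Obj C \<Longrightarrow> quotient_object C M M"
  by (rule quotient_objectI[of "Idt C M"]) auto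

lemma subobject_obj: "subobject C L M \<Longrightarrow> L \<in> Obj C \<and> M \<in> Obj C"
  by (metis subobjectE mono_arrD dom_obj cod_obj)

lemma quotient_object_obj: "quotient_object C Q M \<Longrightarrow> Q \<in> Obj C \<and> M \<in> Obj C"
  by (metis quotient_objectE epi_arrD dom_obj cod_obj)

lemma sub_leI: "\<lbrakk>h \<in> Arr C; Dom C h = Dom C u; Cod C h = Dom C m; m \<cdot> h = u\<rbrakk> \<Longrightarrow> sub_le C u m"
  unfolding sub_le_def homs_def by auto

lemma sub_leE:
  assumes "sub_le C u m"
  obtains h where "h \<in> Arr C" "Dom C h = Dom C u" "Cod C h = Dom C m" "m \<cdot> h = u"
  using assms unfolding sub_le_def homs_def by auto

lemma sub_le_comp_left:
  assumes "sub_le C u m" "m \<in> Arr C" "g \<in> Arr C" "Dom C g = Cod C m"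
  shows "sub_le C (g \<cdot> u) (g \<cdot> m)"
proof -
  obtain h where h: "h \<in> Arr C" "Dom C h = Dom C u" "Cod C h = Dom C m" "m \<cdot> h = u"
    using assms(1) by (rule sub_leE)
  then have "u \<in> Arr C" "Cod C u = Cod C m" using assms by auto
  then show ?thesis using h assms by (intro sub_leI[of h]) simp_all
qed

lemma sub_le_comp_right:
  assumes "sub_le C u m" "m \<in> Arr C" "g \<in> Arr C" "Cod C g = Dom C u"
  shows "sub_le C (u \<cdot> g) m"
proof -
  obtain h where h: "h \<in> Arr C" "Dom C h = Dom C u" "Cod C h = Dom C m" "m \<cdot> h = u"
    using assms(1) by (rule sub_leE)
  then have "u \<in> Arr C" "m \<cdot> (h \<cdot> g) = u \<cdot> g"
    using assms comp_eq_extend[OF h(4), of g] by auto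
  then show ?thesis using h assms by (intro sub_leI[of "h \<cdot> g"]) simp_all
qed

lemma sub_le_refl: "m \<in> Arr C \<Longrightarrow> sub_le C m m"
  by (rule sub_leI[of "Idt C (Dom C m)"]) auto

lemma sub_le_comp: "\<lbrakk>m \<in> Arr C; h \<in> Arr C; Cod C h = Dom C m\<rbrakk> \<Longrightarrow> sub_le C (m \<cdot> h) m"
  by (rule sub_leI[of h]) auto

lemma sub_le_trans:
  assumes "sub_le C u m" "sub_le C m n" "n \<in> Arr C"
  shows "sub_le C u n"
proof -
  obtain h where h: "h \<in> Arr C" "Dom C h = Dom C u" "Cod C h = Dom C m" "m \<cdot> h = u"
    using assms(1) by (rule sub_leE)
  obtain k where k: "k \<in> Arr C" "Dom C k = Dom C m" "Cod C k = Dom C n" "n \<cdot> k = m"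
    using assms(2) by (rule sub_leE)
  have "n \<cdot> (k \<cdot> h) = u" using comp_eq_extend[OF k(4), of h] h k assms by simp
  then show ?thesis by (rule sub_leI[of "k \<cdot> h", rotated 3]) (use h k in simp_all)
qed

text \<open>The chain condition as a maximum principle: without a maximal element, iterating a
  choice of larger elements gives a chain that never becomes stationary. Maximality is meant up to
  mutual factorization, since different arrows may represent the same subobject.\<close>

lemma noetherian_maximal:
  assumes "noetherian C M" "m0 \<in> S" "\<And>m. m \<in> S \<Longrightarrow> mono_arr C m \<and> Cod C m = M"
  obtains m where "m \<in> S" "\<And>n. \<lbrakk>n \<in> S; sub_le C m n\<rbrakk> \<Longrightarrow> sub_le C n m"
proof (rule ccontr)
  assume "\<not> thesis"
  with that have *: "\<forall>m\<in>S. \<exists>n\<in>S. sub_le C m n \<and> \<not> sub_le C n m" by blast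
  then obtain nx where nx: "\<And>m. m \<in> S \<Longrightarrow> nx m \<in> S \<and> sub_le C m (nx m) \<and> \<not> sub_le C (nx m) m"
    by metis
  define s where "s n = (nx ^^ n) m0" for n
  have s: "s n \<in> S" for n by (induction n) (auto simp: s_def assms nx)
  have "mono_arr C (s n) \<and> Cod C (s n) = M \<and> sub_le C (s n) (s (Suc n))" for n
    using s[of n] assms(3) nx[of "s n"] by (simp add: s_def)
  then obtain N where "\<forall>n\<ge>N. sub_le C (s n) (s N)"
    using assms(1) unfolding noetherian_def by blast
  then have "sub_le C (s (Suc N)) (s N)" by simp
  then show False using nx[OF s[of N]] by (simp add: s_def)
qed

section \<open>Zero objects and zero arrows\<close>

lemma is_zero_obj: "is_zero C Z \<Longrightarrow> Z \<in> Obj C"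
  by (simp add: is_zero_def)

lemma zero_arrD [simp]: "zero_arr C f \<Longrightarrow> f \<in> Arr C"
  by (simp add: zero_arr_def)

lemma is_zero_into:
  assumes "is_zero C Z" "f \<in> Arr C" "g \<in> Arr C" "Cod C f = Z" "Cod C g = Z" "Dom C f = Dom C g"
  shows "f = g"
proof -
  have "\<exists>!h. h \<in> homs C (Dom C f) Z" using assms unfolding is_zero_def by simp
  then show ?thesis using assms unfolding homs_def by auto
qed

lemma is_zero_from:
  assumes "is_zero C Z" "f \<in> Arr C" "g \<in> Arr C" "Dom C f = Z" "Dom C g = Z" "Cod C f = Cod C g"
  shows "f = g"
proof -
  have "\<exists>!h. h \<in> homs C Z (Cod C f)" using assms unfolding is_zero_def by simp
  then show ?thesis using assms unfolding homs_def by auto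
qed

lemma is_zero_ex_into:
  assumes "is_zero C Z" "X \<in> Obj C"
  obtains f where "f \<in> Arr C" "Dom C f = X" "Cod C f = Z"
proof -
  have "\<exists>!h. h \<in> homs C X Z" using assms unfolding is_zero_def by simp
  then show ?thesis using that unfolding homs_def by auto
qed

lemma is_zero_ex_from:
  assumes "is_zero C Z" "X \<in> Obj C"
  obtains f where "f \<in> Arr C" "Dom C f = Z" "Cod C f = X"
proof -
  have "\<exists>!h. h \<in> homs C Z X" using assms unfolding is_zero_def by simp
  then show ?thesis using that unfolding homs_def by auto
qed

lemma zero_arrE:
  assumes "zero_arr C f"
  obtains Z a b where "is_zero C Z" "a \<in> Arr C" "b \<in> Arr C" "Dom C a = Dom C f" "Cod C a = Z"
    "Dom C b = Z" "Cod C b = Cod C f" "b \<cdot> a = f"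
  using assms unfolding zero_arr_def homs_def by auto

lemma zero_arrI:
  assumes "is_zero C Z" "a \<in> Arr C" "b \<in> Arr C" "Cod C a = Z" "Dom C b = Z"
  shows "zero_arr C (b \<cdot> a)"
  using assms unfolding zero_arr_def homs_def by auto

lemma zero_arr_left [simp]:
  assumes "zero_arr C f" "g \<in> Arr C" "Dom C g = Cod C f"
  shows "zero_arr C (g \<cdot> f)"
  using assms(1)
proof (rule zero_arrE)
  fix Z a b
  assume *: "is_zero C Z" "a \<in> Arr C" "b \<in> Arr C" "Dom C a = Dom C f" "Cod C a = Z"
    "Dom C b = Z" "Cod C b = Cod C f" "b \<cdot> a = f"
  then have "zero_arr C ((g \<cdot> b) \<cdot> a)" using assms by (intro zero_arrI[of Z]) simp_all
  then show ?thesis using * assms by simp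
qed

lemma zero_arr_right [simp]:
  assumes "zero_arr C f" "g \<in> Arr C" "Cod C g = Dom C f"
  shows "zero_arr C (f \<cdot> g)"
  using assms(1)
proof (rule zero_arrE)
  fix Z a b
  assume *: "is_zero C Z" "a \<in> Arr C" "b \<in> Arr C" "Dom C a = Dom C f" "Cod C a = Z"
    "Dom C b = Z" "Cod C b = Cod C f" "b \<cdot> a = f"
  then have "zero_arr C (b \<cdot> (a \<cdot> g))" using assms by (intro zero_arrI[of Z]) simp_all
  moreover have "b \<cdot> (a \<cdot> g) = f \<cdot> g" by (rule comp_eq_extend) (use * assms in simp_all)
  ultimately show ?thesis by simp
qed

lemma zero_arr_right2 [simp]:
  assumes "zero_arr C (h \<cdot> f)" "h \<in> Arr C" "f \<in> Arr C" "Cod C f = Dom C h" "g \<in> Arr C" "Cod C g = Dom C f"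
  shows "zero_arr C (h \<cdot> f \<cdot> g)"
  using zero_arr_right[of "h \<cdot> f" g] assms by simp

lemma zero_left_eq: "\<lbrakk>zero_arr C h; k \<cdot> h = w; k \<in> Arr C; Dom C k = Cod C h\<rbrakk> \<Longrightarrow> zero_arr C w"
  and zero_right_eq: "\<lbrakk>zero_arr C k; k \<cdot> h = w; h \<in> Arr C; Cod C h = Dom C k\<rbrakk> \<Longrightarrow> zero_arr C w"
  using zero_arr_left[of h k] zero_arr_right[of k h] by auto

text \<open>No zero object is fixed, so the two arrows may factor through different ones; the arrow
  \<open>Z -> Z'\<close> compares the factorizations.\<close>

lemma zero_arr_unique:
  assumes "zero_arr C f" "zero_arr C g" "Dom C f = Dom C g" "Cod C f = Cod C g"
  shows "f = g"
proof -
  obtain Z a b where f: "is_zero C Z" "a \<in> Arr C" "b \<in> Arr C" "Dom C a = Dom C f" "Cod C a = Z"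
    "Dom C b = Z" "Cod C b = Cod C f" "b \<cdot> a = f" using assms(1) by (rule zero_arrE)
  obtain Z' a' b' where g: "is_zero C Z'" "a' \<in> Arr C" "b' \<in> Arr C" "Dom C a' = Dom C g" "Cod C a' = Z'"
    "Dom C b' = Z'" "Cod C b' = Cod C g" "b' \<cdot> a' = g" using assms(2) by (rule zero_arrE)
  obtain t where t: "t \<in> Arr C" "Dom C t = Z" "Cod C t = Z'"
    using is_zero_ex_from[OF f(1) is_zero_obj[OF g(1)]] .
  have "t \<cdot> a = a'" by (rule is_zero_into[OF g(1)]) (use f g t assms in simp_all)
  moreover have "b' \<cdot> t = b" by (rule is_zero_from[OF f(1)]) (use f g t assms in simp_all)
  ultimately show ?thesis using f g t comp_assoc[of a t b'] by simp
qed

text \<open>Replaces two universal properties by a single vanishing, which can be moved along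
  monomorphisms and epimorphisms by cancellation.\<close>

lemma is_zero_iff: "is_zero C X \<longleftrightarrow> X \<in> Obj C \<and> zero_arr C (Idt C X)"
proof
  assume X: "is_zero C X"
  then have "zero_arr C (Idt C X \<cdot> Idt C X)" using is_zero_obj[OF X] by (intro zero_arrI[OF X]) auto
  then show "X \<in> Obj C \<and> zero_arr C (Idt C X)" using is_zero_obj[OF X] by simp
next
  assume *: "X \<in> Obj C \<and> zero_arr C (Idt C X)"
  then obtain Z a b where z: "is_zero C Z" "a \<in> Arr C" "b \<in> Arr C" "Dom C a = X" "Cod C a = Z"
    "Dom C b = Z" "Cod C b = X" using zero_arrE[of "Idt C X"] by (metis idt_arr(2,3))
  have zero: "zero_arr C f" if "f \<in> Arr C" "Dom C f = X \<or> Cod C f = X" for f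
    using that zero_arr_left[of "Idt C X" f] zero_arr_right[of "Idt C X" f] * by auto
  show "is_zero C X" unfolding is_zero_def
  proof (intro conjI ballI)
    show "X \<in> Obj C" using * by simp
    fix Y assume Y: "Y \<in> Obj C"
    obtain f where "f \<in> Arr C" "Dom C f = Y" "Cod C f = Z" using is_zero_ex_into[OF z(1) Y] .
    then have "b \<cdot> f \<in> homs C Y X" using z by (simp add: homs_def)
    moreover obtain g where "g \<in> Arr C" "Dom C g = Z" "Cod C g = Y" using is_zero_ex_from[OF z(1) Y] .
    then have "g \<cdot> a \<in> homs C X Y" using z by (simp add: homs_def)
    ultimately show "\<exists>!f. f \<in> homs C Y X" "\<exists>!f. f \<in> homs C X Y"
      using zero zero_arr_unique unfolding homs_def by (smt (verit) mem_Collect_eq)+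
  qed
qed

lemma is_zero_zero_arr:
  assumes "is_zero C X" "f \<in> Arr C" "Dom C f = X \<or> Cod C f = X"
  shows "zero_arr C f"
  using assms zero_arr_left[of "Idt C X" f] zero_arr_right[of "Idt C X" f] by (auto simp: is_zero_iff)

lemma mono_zero_cancel:
  assumes "mono_arr C m" "zero_arr C (m \<cdot> f)" "f \<in> Arr C" "Cod C f = Dom C m"
  shows "zero_arr C f"
proof -
  obtain Z a b where f: "is_zero C Z" "a \<in> Arr C" "b \<in> Arr C" "Dom C a = Dom C f" "Cod C a = Z"
    "Dom C b = Z" "Cod C b = Cod C m" "b \<cdot> a = m \<cdot> f" using zero_arrE[OF assms(2)] assms
    by (metis comp_arr(2,3) mono_arrD)
  obtain t where t: "t \<in> Arr C" "Dom C t = Z" "Cod C t = Dom C m"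
    using is_zero_ex_from[OF f(1)] assms by (metis dom_obj mono_arrD)
  have z: "zero_arr C (t \<cdot> a)" by (rule zero_arrI[OF f(1)]) (use f t in auto)
  have "m \<cdot> (t \<cdot> a) = m \<cdot> f" by (rule zero_arr_unique) (use z assms f t in simp_all)
  then have "t \<cdot> a = f" using assms f t by - (rule mono_cancel[OF assms(1)], simp_all)
  then show ?thesis using z by simp
qed

lemma epi_zero_cancel:
  assumes "epi_arr C e" "zero_arr C (f \<cdot> e)" "f \<in> Arr C" "Dom C f = Cod C e"
  shows "zero_arr C f"
proof -
  obtain Z a b where f: "is_zero C Z" "a \<in> Arr C" "b \<in> Arr C" "Dom C a = Dom C e" "Cod C a = Z"
    "Dom C b = Z" "Cod C b = Cod C f" "b \<cdot> a = f \<cdot> e" using zero_arrE[OF assms(2)] assms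
    by (metis comp_arr(2,3) epi_arrD)
  obtain t where t: "t \<in> Arr C" "Cod C t = Z" "Dom C t = Cod C e"
    using is_zero_ex_into[OF f(1)] assms by (metis cod_obj epi_arrD)
  have z: "zero_arr C (b \<cdot> t)" by (rule zero_arrI[OF f(1)]) (use f t in auto)
  have "(b \<cdot> t) \<cdot> e = f \<cdot> e" by (rule zero_arr_unique) (use z assms f t in simp_all)
  then have "b \<cdot> t = f" using assms f t by - (rule epi_cancel[OF assms(1)], simp_all)
  then show ?thesis using z by simp
qed

lemma mono_zero_iff:
  "\<lbrakk>mono_arr C m; f \<in> Arr C; Cod C f = Dom C m\<rbrakk> \<Longrightarrow> zero_arr C (m \<cdot> f) \<longleftrightarrow> zero_arr C f"
  by (rule iffI, rule mono_zero_cancel, assumption+) simp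

lemma epi_zero_iff:
  "\<lbrakk>epi_arr C e; f \<in> Arr C; Dom C f = Cod C e\<rbrakk> \<Longrightarrow> zero_arr C (f \<cdot> e) \<longleftrightarrow> zero_arr C f"
  by (rule iffI, rule epi_zero_cancel, assumption+) simp

lemma is_zero_sub: "\<lbrakk>subobject C L M; is_zero C M\<rbrakk> \<Longrightarrow> is_zero C L"
proof (erule subobjectE)
  fix m assume "is_zero C M" "mono_arr C m" "Dom C m = L" "Cod C m = M"
  then show "is_zero C L"
    using mono_zero_cancel[of m "Idt C L"] is_zero_zero_arr[of M m] by (auto simp: is_zero_iff)
qed

lemma is_zero_quotient: "\<lbrakk>quotient_object C Q M; is_zero C M\<rbrakk> \<Longrightarrow> is_zero C Q"
proof (erule quotient_objectE)
  fix m assume "is_zero C M" "epi_arr C m" "Dom C m = M" "Cod C m = Q"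
  then show "is_zero C Q"
    using epi_zero_cancel[of m "Idt C Q"] is_zero_zero_arr[of M m] by (auto simp: is_zero_iff)
qed

section \<open>Kernels and cokernels as factorization properties\<close>

lemma kernelD:
  assumes "is_kernel C f k"
  shows "f \<in> Arr C" "k \<in> Arr C" "Cod C k = Dom C f" "zero_arr C (f \<cdot> k)" "mono_arr C k"
proof -
  show *: "f \<in> Arr C" "k \<in> Arr C" "Cod C k = Dom C f" "zero_arr C (f \<cdot> k)"
    using assms unfolding is_kernel_def by blast+
  show "mono_arr C k"
  proof (rule mono_arrI)
    fix u v assume uv: "u \<in> Arr C" "v \<in> Arr C" "Dom C u = Dom C v" "Cod C u = Dom C k" "Cod C v = Dom C k"
      "k \<cdot> u = k \<cdot> v"
    then have "k \<cdot> u \<in> homs C (Dom C u) (Dom C f)" using * by (simp add: homs_def)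
    moreover have "zero_arr C (f \<cdot> (k \<cdot> u))" using * uv zero_arr_right[of "f \<cdot> k" u] by simp
    ultimately have "\<exists>!w. w \<in> homs C (Dom C u) (Dom C k) \<and> k \<cdot> w = k \<cdot> u"
      using assms unfolding is_kernel_def by blast
    then show "u = v" using uv unfolding homs_def by auto
  qed (use * in blast)
qed

lemma kernel_factor:
  assumes "is_kernel C f k" "u \<in> Arr C" "Cod C u = Dom C f" "zero_arr C (f \<cdot> u)"
  shows "sub_le C u k"
proof -
  have "u \<in> homs C (Dom C u) (Dom C f)" using assms by (simp add: homs_def)
  then obtain v where "v \<in> homs C (Dom C u) (Dom C k)" "k \<cdot> v = u"
    using assms unfolding is_kernel_def by blast
  then show ?thesis unfolding sub_le_def by auto
qed

text \<open>The exchange rule of nearly all chases below: lying in a subobject is the same as being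
  killed by the arrow of which it is the kernel.\<close>

lemma kernel_factor_iff:
  assumes "is_kernel C f k" "u \<in> Arr C" "Cod C u = Dom C f"
  shows "sub_le C u k \<longleftrightarrow> zero_arr C (f \<cdot> u)"
proof
  assume "sub_le C u k"
  then obtain h where h: "h \<in> Arr C" "Dom C h = Dom C u" "Cod C h = Dom C k" "k \<cdot> h = u"
    by (rule sub_leE)
  have "zero_arr C ((f \<cdot> k) \<cdot> h)" using kernelD[OF assms(1)] h by - (rule zero_arr_right, simp_all)
  then show "zero_arr C (f \<cdot> u)" using kernelD[OF assms(1)] h by simp
qed (use kernel_factor assms in blast)

lemma kernelI:
  assumes "f \<in> Arr C" "mono_arr C k" "Cod C k = Dom C f" "zero_arr C (f \<cdot> k)"
    "\<And>u. \<lbrakk>u \<in> Arr C; Cod C u = Dom C f; zero_arr C (f \<cdot> u)\<rbrakk> \<Longrightarrow> sub_le C u k"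
  shows "is_kernel C f k"
  unfolding is_kernel_def
proof (intro conjI allI ballI impI)
  fix W u assume u: "u \<in> homs C W (Dom C f)" "zero_arr C (f \<cdot> u)"
  then have "sub_le C u k" using assms(5) by (auto simp: homs_def)
  then obtain v where "v \<in> homs C W (Dom C k)" "k \<cdot> v = u"
    using u unfolding sub_le_def homs_def by auto
  moreover have "v' = v" if "v' \<in> homs C W (Dom C k)" "k \<cdot> v' = u" for v'
    using that calculation by - (rule mono_cancel[OF assms(2)], simp_all add: homs_def)
  ultimately show "\<exists>!v. v \<in> homs C W (Dom C k) \<and> k \<cdot> v = u" by blast
next
  show "k \<in> Arr C" using assms(2) by (rule mono_arrD)
qed (rule assms)+

lemma cokernelD:
  assumes "is_cokernel C f q"
  shows "f \<in> Arr C" "q \<in> Arr C" "Dom C q = Cod C f" "zero_arr C (q \<cdot> f)" "epi_arr C q"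
proof -
  show *: "f \<in> Arr C" "q \<in> Arr C" "Dom C q = Cod C f" "zero_arr C (q \<cdot> f)"
    using assms unfolding is_cokernel_def by blast+
  show "epi_arr C q"
  proof (rule epi_arrI)
    fix u v assume uv: "u \<in> Arr C" "v \<in> Arr C" "Cod C u = Cod C v" "Dom C u = Cod C q" "Dom C v = Cod C q"
      "u \<cdot> q = v \<cdot> q"
    then have "u \<cdot> q \<in> homs C (Cod C f) (Cod C u)" using * by (simp add: homs_def)
    moreover have "zero_arr C ((u \<cdot> q) \<cdot> f)" using * uv(1-5) zero_arr_left[of "q \<cdot> f" u] by simp
    ultimately have "\<exists>!w. w \<in> homs C (Cod C q) (Cod C u) \<and> w \<cdot> q = u \<cdot> q"
      using assms unfolding is_cokernel_def by metis
    then show "u = v" using uv unfolding homs_def by auto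
  qed (use * in blast)
qed

lemma cokernel_factor:
  assumes "is_cokernel C f q" "u \<in> Arr C" "Dom C u = Cod C f" "zero_arr C (u \<cdot> f)"
  obtains v where "v \<in> Arr C" "Dom C v = Cod C q" "Cod C v = Cod C u" "v \<cdot> q = u"
proof -
  have "u \<in> homs C (Cod C f) (Cod C u)" using assms(2,3) by (simp add: homs_def)
  then obtain v where "v \<in> homs C (Cod C q) (Cod C u)" "v \<cdot> q = u"
    using assms unfolding is_cokernel_def by blast
  then show ?thesis using that[of v] by (simp add: homs_def)
qed

lemma cokernelI:
  assumes "f \<in> Arr C" "epi_arr C q" "Dom C q = Cod C f" "zero_arr C (q \<cdot> f)"
    "\<And>u. \<lbrakk>u \<in> Arr C; Dom C u = Cod C f; zero_arr C (u \<cdot> f)\<rbrakk> \<Longrightarrow>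
       \<exists>v\<in>Arr C. Dom C v = Cod C q \<and> Cod C v = Cod C u \<and> v \<cdot> q = u"
  shows "is_cokernel C f q"
  unfolding is_cokernel_def
proof (intro conjI allI ballI impI)
  fix W u assume u: "u \<in> homs C (Cod C f) W" "zero_arr C (u \<cdot> f)"
  then have "u \<in> Arr C" "Dom C u = Cod C f" by (simp_all add: homs_def)
  then obtain v where v: "v \<in> Arr C" "Dom C v = Cod C q" "Cod C v = Cod C u" "v \<cdot> q = u"
    using assms(5) u(2) by blast
  then have "v \<in> homs C (Cod C q) W" using u by (simp add: homs_def)
  moreover have "v' = v" if "v' \<in> homs C (Cod C q) W" "v' \<cdot> q = u" for v'
  proof (rule epi_cancel[OF assms(2)])
    show "v' \<cdot> q = v \<cdot> q" using that(2) v(4) by simp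
    show "v' \<in> Arr C" "Dom C v' = Cod C q" using that(1) by (simp_all add: homs_def)
  qed (rule v)+
  ultimately show "\<exists>!v. v \<in> homs C (Cod C q) W \<and> v \<cdot> q = u" using v(4) by blast
next
  show "q \<in> Arr C" using assms(2) by (rule epi_arrD)
qed (rule assms)+

end

section \<open>Abelian categories\<close>

context abelian_category
begin

lemma ex_zero_arr:
  assumes "X \<in> Obj C" "Y \<in> Obj C"
  obtains f where "zero_arr C f" "Dom C f = X" "Cod C f = Y"
proof -
  obtain Z where Z: "is_zero C Z" using ex_zero ..
  obtain a where "a \<in> Arr C" "Dom C a = X" "Cod C a = Z" by (rule is_zero_ex_into[OF Z assms(1)])
  moreover obtain b where "b \<in> Arr C" "Dom C b = Z" "Cod C b = Y" by (rule is_zero_ex_from[OF Z assms(2)])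
  ultimately show thesis using that[of "b \<cdot> a"] zero_arrI[OF Z, of a b] by simp
qed

text \<open>
  The additive structure enters only through differences, and those only through the vanishing of
  their composites.
\<close>

lemma ex_difference:
  assumes u: "u \<in> Arr C" "Dom C u = X" "Cod C u = Y" and v: "v \<in> Arr C" "Dom C v = X" "Cod C v = Y"
  obtains w where "w \<in> Arr C" "Dom C w = X" "Cod C w = Y"
    "\<And>f. \<lbrakk>f \<in> Arr C; Cod C f = X\<rbrakk> \<Longrightarrow> zero_arr C (w \<cdot> f) \<longleftrightarrow> u \<cdot> f = v \<cdot> f"
    "\<And>g. \<lbrakk>g \<in> Arr C; Dom C g = Y\<rbrakk> \<Longrightarrow> zero_arr C (g \<cdot> w) \<longleftrightarrow> g \<cdot> u = g \<cdot> v"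
proof -
  obtain add nul where grp: "\<And>X Y. \<lbrakk>X \<in> Obj C; Y \<in> Obj C\<rbrakk> \<Longrightarrow>
        comm_group \<lparr>carrier = homs C X Y, mult = add, one = nul X Y\<rparr>"
    and bil: "\<And>X Y Z f f' g g'. \<lbrakk>f \<in> homs C X Y; f' \<in> homs C X Y; g \<in> homs C Y Z; g' \<in> homs C Y Z\<rbrakk> \<Longrightarrow>
        g \<cdot> add f f' = add (g \<cdot> f) (g \<cdot> f') \<and> add g g' \<cdot> f = add (g \<cdot> f) (g' \<cdot> f)"
    using preadd unfolding preadditive_def by blast
  have G: "group \<lparr>carrier = homs C X Y, mult = add, one = nul X Y\<rparr>" if "X \<in> Obj C" "Y \<in> Obj C" for X Y
    using grp[OF that] by (rule comm_group.axioms)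
  have closed: "add f g \<in> homs C X Y" if "f \<in> homs C X Y" "g \<in> homs C X Y" "X \<in> Obj C" "Y \<in> Obj C"
    for f g X Y using group.subgroup_self[OF G[OF that(3,4)]] monoid.m_closed[OF group.is_monoid[OF G[OF that(3,4)]], of f g] that by simp
  have nul_in: "nul X Y \<in> homs C X Y" if "X \<in> Obj C" "Y \<in> Obj C" for X Y
    using monoid.one_closed[OF group.is_monoid[OF G[OF that]]] by simp
  have idem: "f = nul X Y" if "f \<in> homs C X Y" "add f f = f" "X \<in> Obj C" "Y \<in> Obj C" for f X Y
    using group.l_cancel_one[OF G[OF that(3,4)], of f f] that by simp
  have nul_nul: "add (nul X Y) (nul X Y) = nul X Y" if "X \<in> Obj C" "Y \<in> Obj C" for X Y
    using monoid.l_one[OF group.is_monoid[OF G[OF that]]] nul_in[OF that] by simp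
  \<comment> \<open>The neutral element of a hom group is not assumed to be a zero arrow. There is
    only one arrow \<open>a\<close> from \<open>X\<close> to a zero object, so
    \<open>add a a = a\<close>. Hence the zero arrow \<open>z = b \<cdot> a\<close> satisfies
    \<open>add z z = z\<close> and is neutral.\<close>
  have zero_iff: "zero_arr C f \<longleftrightarrow> f = nul X Y" if f: "f \<in> homs C X Y" and XY: "X \<in> Obj C" "Y \<in> Obj C" for f X Y
  proof -
    obtain z where z: "zero_arr C z" "Dom C z = X" "Cod C z = Y" by (rule ex_zero_arr[OF XY])
    obtain Z a b where ab: "is_zero C Z" "a \<in> Arr C" "b \<in> Arr C" "Dom C a = Dom C z" "Cod C a = Z"
      "Dom C b = Z" "Cod C b = Cod C z" "b \<cdot> a = z" using z(1) by (rule zero_arrE)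
    have a: "a \<in> homs C X Z" and b: "b \<in> homs C Z Y" using ab z by (simp_all add: homs_def)
    have "add a a \<in> homs C X Z" using closed[OF a a XY(1) is_zero_obj[OF ab(1)]] .
    then have "add a a = a" using is_zero_into[OF ab(1), of "add a a" a] a by (simp add: homs_def)
    then have "add z z = z" using bil[OF a a b b] ab(8) by simp
    then have "z = nul X Y" using idem[of z X Y] XY z by (simp add: homs_def)
    then show ?thesis using zero_arr_unique[of f z] f z by (auto simp: homs_def)
  qed
  have X: "X \<in> Obj C" and Y: "Y \<in> Obj C" using u by auto
  have uh: "u \<in> homs C X Y" and vh: "v \<in> homs C X Y" using u v by (simp_all add: homs_def)
  define v' where "v' = inv\<^bsub>\<lparr>carrier = homs C X Y, mult = add, one = nul X Y\<rparr>\<^esub> v"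
  have v': "v' \<in> homs C X Y" "add v' v = nul X Y"
    using group.inv_closed[OF G[OF X Y], of v] group.l_inv[OF G[OF X Y], of v] vh
    by (simp_all add: v'_def)
  have key: "add p q = nul X Y \<longleftrightarrow> p = r"
    if "p \<in> homs C X Y" "q \<in> homs C X Y" "r \<in> homs C X Y" "add q r = nul X Y" "X \<in> Obj C" "Y \<in> Obj C" for p q r X Y
  proof -
    interpret H: comm_group "\<lparr>carrier = homs C X Y, mult = add, one = nul X Y\<rparr>" using grp[OF that(5,6)] .
    have "inv\<^bsub>\<lparr>carrier = homs C X Y, mult = add, one = nul X Y\<rparr>\<^esub> q = r"
      using H.inv_equality[of r q] H.m_comm[of q r] that by simp
    moreover have "inv\<^bsub>\<lparr>carrier = homs C X Y, mult = add, one = nul X Y\<rparr>\<^esub> q = p \<longleftrightarrow> add p q = nul X Y"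
      using H.inv_equality[of p q] H.l_inv[of q] that by auto
    ultimately show ?thesis by auto
  qed
  define w where "w = add u v'"
  have w: "w \<in> homs C X Y" using closed[OF uh v'(1) X Y] by (simp add: w_def)
  show thesis
  proof (rule that)
    show "w \<in> Arr C" "Dom C w = X" "Cod C w = Y" using w by (simp_all add: homs_def)
    fix f assume f: "f \<in> Arr C" "Cod C f = X"
    let ?W = "Dom C f"
    have fh: "f \<in> homs C ?W X" and W: "?W \<in> Obj C" using f by (simp_all add: homs_def)
    have c: "u \<cdot> f \<in> homs C ?W Y" "v \<cdot> f \<in> homs C ?W Y" "v' \<cdot> f \<in> homs C ?W Y" "w \<cdot> f \<in> homs C ?W Y" "nul X Y \<cdot> f \<in> homs C ?W Y"
      using Comp_in[OF fh] uh vh v' w nul_in[OF X Y] by auto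
    have "zero_arr C (nul X Y \<cdot> f)" using f nul_in[OF X Y] zero_iff[OF nul_in[OF X Y] X Y] by (simp add: homs_def)
    then have "add (v' \<cdot> f) (v \<cdot> f) = nul ?W Y"
      using bil[OF fh fh v'(1) vh] v'(2) zero_iff[OF c(5) W Y] by simp
    then have "add (u \<cdot> f) (v' \<cdot> f) = nul ?W Y \<longleftrightarrow> u \<cdot> f = v \<cdot> f" by (rule key[OF c(1,3,2) _ W Y])
    moreover have "w \<cdot> f = add (u \<cdot> f) (v' \<cdot> f)" using bil[OF fh fh uh v'(1)] by (simp add: w_def)
    ultimately show "zero_arr C (w \<cdot> f) \<longleftrightarrow> u \<cdot> f = v \<cdot> f" using zero_iff[OF c(4) W Y] by simp
  next
    fix f assume f: "f \<in> Arr C" "Dom C f = Y"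
    let ?W = "Cod C f"
    have fh: "f \<in> homs C Y ?W" and W: "?W \<in> Obj C" using f by (simp_all add: homs_def)
    have c: "f \<cdot> u \<in> homs C X ?W" "f \<cdot> v \<in> homs C X ?W" "f \<cdot> v' \<in> homs C X ?W" "f \<cdot> w \<in> homs C X ?W" "f \<cdot> nul X Y \<in> homs C X ?W"
      using Comp_in[OF _ fh] uh vh v' w nul_in[OF X Y] by auto
    have "zero_arr C (f \<cdot> nul X Y)" using f nul_in[OF X Y] zero_iff[OF nul_in[OF X Y] X Y] by (simp add: homs_def)
    then have "add (f \<cdot> v') (f \<cdot> v) = nul X ?W"
      using bil[OF v'(1) vh fh fh] v'(2) zero_iff[OF c(5) X W] by simp
    then have "add (f \<cdot> u) (f \<cdot> v') = nul X ?W \<longleftrightarrow> f \<cdot> u = f \<cdot> v" by (rule key[OF c(1,3,2) _ X W])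
    moreover have "f \<cdot> w = add (f \<cdot> u) (f \<cdot> v')" using bil[OF uh v'(1) fh fh] by (simp add: w_def)
    ultimately show "zero_arr C (f \<cdot> w) \<longleftrightarrow> f \<cdot> u = f \<cdot> v" using zero_iff[OF c(4) X W] by simp
  qed
qed

text \<open>The test is applied to the difference of two arrows with the same composite.\<close>

lemma mono_arr_zeroI:
  assumes "m \<in> Arr C" "\<And>w. \<lbrakk>w \<in> Arr C; Cod C w = Dom C m; zero_arr C (m \<cdot> w)\<rbrakk> \<Longrightarrow> zero_arr C w"
  shows "mono_arr C m"
proof (rule mono_arrI[OF assms(1)])
  fix u v assume uv: "u \<in> Arr C" "v \<in> Arr C" "Dom C u = Dom C v" "Cod C u = Dom C m" "Cod C v = Dom C m"
    "m \<cdot> u = m \<cdot> v"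
  obtain w where w: "w \<in> Arr C" "Dom C w = Dom C u" "Cod C w = Dom C m"
    "\<And>f. \<lbrakk>f \<in> Arr C; Cod C f = Dom C u\<rbrakk> \<Longrightarrow> zero_arr C (w \<cdot> f) \<longleftrightarrow> u \<cdot> f = v \<cdot> f"
    "\<And>g. \<lbrakk>g \<in> Arr C; Dom C g = Dom C m\<rbrakk> \<Longrightarrow> zero_arr C (g \<cdot> w) \<longleftrightarrow> g \<cdot> u = g \<cdot> v"
    using ex_difference[of u "Dom C u" "Dom C m" v] uv by metis
  have "zero_arr C w" using assms(2)[OF w(1,3)] w(5)[of m] assms(1) uv(6) by simp
  then show "u = v" using w(1,2) w(4)[of "Idt C (Dom C u)"] uv(1-3) by simp
qed

lemma epi_arr_zeroI:
  assumes "m \<in> Arr C" "\<And>w. \<lbrakk>w \<in> Arr C; Dom C w = Cod C m; zero_arr C (w \<cdot> m)\<rbrakk> \<Longrightarrow> zero_arr C w"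
  shows "epi_arr C m"
proof (rule epi_arrI[OF assms(1)])
  fix u v assume uv: "u \<in> Arr C" "v \<in> Arr C" "Cod C u = Cod C v" "Dom C u = Cod C m" "Dom C v = Cod C m"
    "u \<cdot> m = v \<cdot> m"
  obtain w where w: "w \<in> Arr C" "Dom C w = Cod C m" "Cod C w = Cod C u"
    "\<And>f. \<lbrakk>f \<in> Arr C; Cod C f = Cod C m\<rbrakk> \<Longrightarrow> zero_arr C (w \<cdot> f) \<longleftrightarrow> u \<cdot> f = v \<cdot> f"
    "\<And>g. \<lbrakk>g \<in> Arr C; Dom C g = Cod C u\<rbrakk> \<Longrightarrow> zero_arr C (g \<cdot> w) \<longleftrightarrow> g \<cdot> u = g \<cdot> v"
    using ex_difference[of u "Cod C m" "Cod C u" v] uv by metis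
  have "zero_arr C w" using assms(2)[OF w(1,2)] w(4)[of m] assms(1) uv(6) by simp
  then show "u = v" using w(1,3) w(5)[of "Idt C (Cod C u)"] uv(1-3) by simp
qed

text \<open>By normality \<open>m\<close> is the kernel of some \<open>g\<close>. Since
  \<open>g\<close> kills \<open>m\<close>, it factors through \<open>q\<close>, so everything killed
  by \<open>q\<close> is killed by \<open>g\<close>.\<close>

lemma mono_kernel_cokernel:
  assumes "mono_arr C m" "is_cokernel C m q"
  shows "is_kernel C q m"
proof -
  obtain g where g: "is_kernel C g m" using mono_normal[OF assms(1)] ..
  note gD = kernelD[OF g] and qD = cokernelD[OF assms(2)]
  obtain v where v: "v \<in> Arr C" "Dom C v = Cod C q" "Cod C v = Cod C g" "v \<cdot> q = g"
    by (rule cokernel_factor[OF assms(2), of g]) (use gD in simp_all)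
  show ?thesis
  proof (rule kernelI)
    fix u assume u: "u \<in> Arr C" "Cod C u = Dom C q" "zero_arr C (q \<cdot> u)"
    then have "zero_arr C (v \<cdot> q \<cdot> u)" using v qD by simp
    then have "zero_arr C (g \<cdot> u)" using comp_eq_extend[OF v(4), of u] v qD u by simp
    then show "sub_le C u m" using kernel_factor[OF g] u gD qD by simp
  qed (use assms qD in simp_all)
qed

lemma epi_cokernel_kernel:
  assumes "epi_arr C q" "is_kernel C q m"
  shows "is_cokernel C m q"
proof -
  obtain g where g: "is_cokernel C g q" using epi_normal[OF assms(1)] ..
  note gD = cokernelD[OF g] and mD = kernelD[OF assms(2)]
  obtain v where v: "v \<in> Arr C" "Dom C v = Dom C g" "Cod C v = Dom C m" "m \<cdot> v = g"
    using kernel_factor[OF assms(2), of g] gD by (auto elim: sub_leE)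
  show ?thesis
  proof (rule cokernelI)
    fix u assume u: "u \<in> Arr C" "Dom C u = Cod C m" "zero_arr C (u \<cdot> m)"
    then have "zero_arr C ((u \<cdot> m) \<cdot> v)" using v mD by - (rule zero_arr_right, simp_all)
    then have "zero_arr C (u \<cdot> g)" using v mD u by simp
    then show "\<exists>v\<in>Arr C. Dom C v = Cod C q \<and> Cod C v = Cod C u \<and> v \<cdot> q = u"
      using cokernel_factor[OF g, of u] u gD mD by (metis (no_types, lifting))
  qed (use assms mD in simp_all)
qed

section \<open>Images and inverse images of subobjects\<close>

lemma mono_epi_iso:
  assumes "mono_arr C f" "epi_arr C f"
  shows "iso_arr C f"
proof -
  obtain g where g: "is_kernel C g f" using mono_normal[OF assms(1)] ..
  note gD = kernelD[OF g]
  have z: "zero_arr C g" using epi_zero_cancel[OF assms(2) gD(4)] gD by simp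
  have "sub_le C (Idt C (Cod C f)) f" using kernel_factor[OF g] gD z by simp
  then obtain h where h: "h \<in> Arr C" "Dom C h = Cod C f" "Cod C h = Dom C f" "f \<cdot> h = Idt C (Cod C f)"
    using gD by (auto elim: sub_leE)
  have "f \<cdot> (h \<cdot> f) = f \<cdot> Idt C (Dom C f)" using comp_eq_extend[OF h(4), of f] h gD by simp
  then have "h \<cdot> f = Idt C (Dom C f)" using h gD by - (rule mono_cancel[OF assms(1)], simp_all)
  then show ?thesis using h gD unfolding iso_arr_def homs_def by auto
qed

text \<open>The image is the kernel \<open>m\<close> of the cokernel of \<open>h\<close>. If
  \<open>w\<close> kills \<open>e\<close>, then \<open>h\<close> factors through the smaller
  subobject \<open>m \<cdot> k\<close> with \<open>k\<close> the kernel of \<open>w\<close>. That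
  subobject is the kernel of some \<open>c\<close>; as \<open>c\<close> kills \<open>h\<close>, it
  factors through the cokernel and kills \<open>m\<close>. So \<open>m\<close> factors through
  \<open>m \<cdot> k\<close>, and \<open>w\<close> vanishes.\<close>

lemma ex_epi_mono_factor:
  assumes "h \<in> Arr C"
  obtains e m where "epi_arr C e" "mono_arr C m" "Dom C e = Dom C h" "Cod C e = Dom C m"
    "Cod C m = Cod C h" "m \<cdot> e = h"
proof -
  obtain q where q: "is_cokernel C h q" using ex_cokernel[OF assms] ..
  obtain m where m: "is_kernel C q m" using ex_kernel[of q] cokernelD[OF q] by auto
  note qD = cokernelD[OF q] and mD = kernelD[OF m]
  obtain e where e: "e \<in> Arr C" "Dom C e = Dom C h" "Cod C e = Dom C m" "m \<cdot> e = h"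
    using kernel_factor[OF m assms] qD by (auto elim: sub_leE)
  have "epi_arr C e"
  proof (rule epi_arr_zeroI[OF e(1)])
    fix w assume w: "w \<in> Arr C" "Dom C w = Cod C e" "zero_arr C (w \<cdot> e)"
    obtain k where k: "is_kernel C w k" using ex_kernel[OF w(1)] ..
    note kD = kernelD[OF k]
    obtain e' where e': "e' \<in> Arr C" "Dom C e' = Dom C e" "Cod C e' = Dom C k" "k \<cdot> e' = e"
      using kernel_factor[OF k e(1)] w by (auto elim: sub_leE)
    have mk: "mono_arr C (m \<cdot> k)" using mono_comp mD kD w e by simp
    obtain c where c: "is_kernel C c (m \<cdot> k)" using mono_normal[OF mk] ..
    note cD = kernelD[OF c]
    have dims: "Dom C c = Cod C m" "Cod C k = Dom C m" "Dom C w = Dom C m" using cD kD mD w e by simp_all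
    have "zero_arr C ((c \<cdot> m \<cdot> k) \<cdot> e')" using cD e' by - (rule zero_arr_right, insert mD kD dims, simp_all)
    moreover have "(c \<cdot> m \<cdot> k) \<cdot> e' = c \<cdot> h" using cD(1) mD(2) kD(2) dims e' e by simp
    ultimately have "zero_arr C (c \<cdot> h)" by simp
    then obtain c' where c': "c' \<in> Arr C" "Dom C c' = Cod C q" "Cod C c' = Cod C c" "c' \<cdot> q = c"
      using cokernel_factor[OF q, of c] cD mD qD dims by metis
    have "zero_arr C (c' \<cdot> q \<cdot> m)" using c' mD qD by simp
    then have "zero_arr C (c \<cdot> m)" using comp_eq_extend[OF c'(4), of m] c' mD qD by simp
    then obtain j where j: "j \<in> Arr C" "Dom C j = Dom C m" "Cod C j = Dom C (m \<cdot> k)" "(m \<cdot> k) \<cdot> j = m"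
      using kernel_factor[OF c, of m] mD dims by (auto elim: sub_leE)
    have "m \<cdot> (k \<cdot> j) = m \<cdot> Idt C (Dom C m)" using j mD kD dims by simp
    then have "k \<cdot> j = Idt C (Dom C m)" using j mD kD dims by - (rule mono_cancel[OF mD(5)], simp_all)
    moreover have "zero_arr C ((w \<cdot> k) \<cdot> j)" using kD j dims mD by - (rule zero_arr_right, simp_all)
    ultimately show "zero_arr C w" using w j kD dims mD by simp
  qed
  then show thesis using that[of e m] e mD qD by simp
qed

text \<open>The inverse image of \<open>m\<close> along \<open>h\<close> is the kernel of
  \<open>h\<close> followed by the cokernel of \<open>m\<close>. Its universal property is stated
  through \<open>sub_le\<close>; the last clause is the stability of epimorphisms under pullback,
  which replaces lifting of elements.\<close>

lemma ex_pullback_mono: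
  assumes m: "mono_arr C m" and h: "h \<in> Arr C" "Cod C h = Cod C m"
  obtains p r where "mono_arr C p" "Cod C p = Dom C h" "r \<in> Arr C" "Dom C r = Dom C p" "Cod C r = Dom C m"
    "m \<cdot> r = h \<cdot> p"
    "\<And>u. \<lbrakk>u \<in> Arr C; Cod C u = Dom C h\<rbrakk> \<Longrightarrow> sub_le C u p \<longleftrightarrow> sub_le C (h \<cdot> u) m"
    "mono_arr C h \<Longrightarrow> mono_arr C r" "epi_arr C h \<Longrightarrow> epi_arr C r"
proof -
  obtain q where q: "is_cokernel C m q" using ex_cokernel[OF mono_arrD[OF m]] ..
  note qD = cokernelD[OF q] and mq = mono_kernel_cokernel[OF m q]
  have qh: "q \<cdot> h \<in> Arr C" "Dom C (q \<cdot> h) = Dom C h" using qD h by simp_all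
  obtain p where p: "is_kernel C (q \<cdot> h) p" using ex_kernel[OF qh(1)] ..
  note pD = kernelD[OF p]
  have pc: "Cod C p = Dom C h" using pD qh by simp
  have "zero_arr C (q \<cdot> (h \<cdot> p))" using pD qD h pc by simp
  then have "sub_le C (h \<cdot> p) m" using kernel_factor[OF mq, of "h \<cdot> p"] pD qD h pc by simp
  then obtain r where r: "r \<in> Arr C" "Dom C r = Dom C p" "Cod C r = Dom C m" "m \<cdot> r = h \<cdot> p"
    using pD pc h by (auto elim: sub_leE)
  have iff: "sub_le C u p \<longleftrightarrow> sub_le C (h \<cdot> u) m" if "u \<in> Arr C" "Cod C u = Dom C h" for u
    using kernel_factor_iff[OF p, of u] kernel_factor_iff[OF mq, of "h \<cdot> u"] that qh qD h by simp
  have "mono_arr C r" if "mono_arr C h"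
  proof -
    have mr: "mono_arr C (m \<cdot> r)" using mono_comp[OF that pD(5) pc] r by simp
    show ?thesis using mono_of_comp[OF mr mono_arrD[OF m] r(1,3)] .
  qed
  \<comment> \<open>Let \<open>i\<close> be the image of \<open>r\<close> and \<open>c\<close> an
    arrow with kernel \<open>m \<cdot> i\<close>. Then \<open>c \<cdot> h\<close> kills
    \<open>p\<close>, so it factors through \<open>q \<cdot> h\<close>, which is the cokernel of
    \<open>p\<close>. Cancelling \<open>h\<close> shows that \<open>c\<close> factors through
    \<open>q\<close>; hence \<open>c\<close> kills \<open>m\<close>, and \<open>i\<close> is all of
    \<open>Dom C m\<close>.\<close>
  moreover have "epi_arr C r" if eh: "epi_arr C h"
  proof -
    obtain e i where ei: "epi_arr C e" "mono_arr C i" "Dom C e = Dom C r" "Cod C e = Dom C i"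
      "Cod C i = Cod C r" "i \<cdot> e = r" by (rule ex_epi_mono_factor[OF r(1)])
    have mi: "mono_arr C (m \<cdot> i)" using mono_comp m ei r by simp
    obtain c where c: "is_kernel C c (m \<cdot> i)" using mono_normal[OF mi] ..
    note cD = kernelD[OF c]
    have dims: "Dom C c = Cod C m" "Cod C i = Dom C m" using cD ei m r by simp_all
    have "zero_arr C ((c \<cdot> m \<cdot> i) \<cdot> e)" using cD ei by - (rule zero_arr_right, insert m dims, simp_all)
    moreover have "(c \<cdot> m \<cdot> i) \<cdot> e = (c \<cdot> h) \<cdot> p" using cD(1) dims ei m r h pD pc by simp
    ultimately have z: "zero_arr C ((c \<cdot> h) \<cdot> p)" by simp
    have qhe: "epi_arr C (q \<cdot> h)" using epi_comp[OF qD(5) eh] h qD by simp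
    have ck: "is_cokernel C p (q \<cdot> h)" using epi_cokernel_kernel[OF qhe p] .
    obtain w where w: "w \<in> Arr C" "Dom C w = Cod C (q \<cdot> h)" "Cod C w = Cod C (c \<cdot> h)" "w \<cdot> q \<cdot> h = c \<cdot> h"
      by (rule cokernel_factor[OF ck _ _ z]) (use cD(1) dims h pc in simp_all)
    have "w \<cdot> q = c" by (rule epi_cancel[OF eh]) (use w cD(1) qD(2,3) dims h in simp_all)
    then have "c \<cdot> m = w \<cdot> q \<cdot> m" using w qD m h comp_assoc[of m q w] by simp
    then have "zero_arr C (c \<cdot> m)" using w qD h by simp
    then obtain j where j: "j \<in> Arr C" "Dom C j = Dom C m" "Cod C j = Dom C (m \<cdot> i)" "(m \<cdot> i) \<cdot> j = m"
      using kernel_factor[OF c, of m] m dims by (auto elim: sub_leE)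
    have "m \<cdot> (i \<cdot> j) = m \<cdot> Idt C (Dom C m)" using j m ei dims by simp
    then have ij: "i \<cdot> j = Idt C (Dom C m)" using j m ei dims r(1) by - (rule mono_cancel[OF m], simp_all)
    have e_ij: "epi_arr C (i \<cdot> j)" using ij m by simp
    have "epi_arr C i" by (rule epi_of_comp[OF e_ij]) (use j ei dims m in simp_all)
    from epi_comp[OF this ei(1,4)] show "epi_arr C r" unfolding ei(6) .
  qed
  ultimately show thesis using that[OF pD(5) pc r iff] by blast
qed

section \<open>Short exact sequences\<close>

lemma short_exactD:
  assumes "short_exact C f g"
  shows "is_kernel C g f" "is_cokernel C f g" "mono_arr C f" "epi_arr C g" "Cod C f = Dom C g"
    "f \<in> Arr C" "g \<in> Arr C"
  using assms kernelD[of g f] cokernelD[of f g] by (auto simp: short_exact_def)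

lemma mono_short_exact:
  assumes "mono_arr C m"
  obtains q where "short_exact C m q"
proof -
  obtain q where "is_cokernel C m q" using ex_cokernel[OF mono_arrD[OF assms]] ..
  then show thesis using that mono_kernel_cokernel[OF assms] by (auto simp: short_exact_def)
qed

lemma epi_short_exact:
  assumes "epi_arr C q"
  obtains m where "short_exact C m q"
proof -
  obtain m where "is_kernel C q m" using ex_kernel[OF epi_arrD[OF assms]] ..
  then show thesis using that epi_cokernel_kernel[OF assms] by (auto simp: short_exact_def)
qed

lemma sub_le_epi_cancel:
  assumes "epi_arr C e" "mono_arr C m" "u \<in> Arr C" "Dom C u = Cod C e" "Cod C u = Cod C m"
    "sub_le C (u \<cdot> e) m"
  shows "sub_le C u m"
proof -
  obtain q where q: "short_exact C m q" by (rule mono_short_exact[OF assms(2)])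
  note qD = short_exactD[OF q]
  have "zero_arr C (q \<cdot> u \<cdot> e)" using kernel_factor_iff[OF qD(1), of "u \<cdot> e"] assms qD by simp
  then have "zero_arr C (q \<cdot> u)" using epi_zero_cancel[OF assms(1), of "q \<cdot> u"] assms qD by simp
  then show ?thesis using kernel_factor_iff[OF qD(1), of u] assms qD by simp
qed

lemma sub_le_mono_cancel:
  assumes "mono_arr C i" "u \<in> Arr C" "v \<in> Arr C" "Cod C u = Dom C i" "Cod C v = Dom C i"
    "sub_le C (i \<cdot> u) (i \<cdot> v)"
  shows "sub_le C u v"
proof -
  obtain h where h: "h \<in> Arr C" "Dom C h = Dom C u" "Cod C h = Dom C v" "(i \<cdot> v) \<cdot> h = i \<cdot> u"
    using assms(6) by (rule sub_leE) (use assms in simp)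
  have "i \<cdot> (v \<cdot> h) = i \<cdot> u" using h assms by simp
  then have "v \<cdot> h = u" using h assms by - (rule mono_cancel[OF assms(1)], simp_all)
  then show ?thesis using h by (intro sub_leI[of h]) simp_all
qed

lemma sub_le_mono_iff:
  "\<lbrakk>mono_arr C i; u \<in> Arr C; v \<in> Arr C; Cod C u = Dom C i; Cod C v = Dom C i\<rbrakk> \<Longrightarrow>
    sub_le C (i \<cdot> u) (i \<cdot> v) \<longleftrightarrow> sub_le C u v"
  by (rule iffI, rule sub_le_mono_cancel, assumption+) (simp add: sub_le_comp_left)

lemma zero_sub_le:
  assumes "zero_arr C u" "m \<in> Arr C" "Cod C u = Cod C m"
  shows "sub_le C u m"
proof -
  obtain z where z: "zero_arr C z" "Dom C z = Dom C u" "Cod C z = Dom C m"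
    using ex_zero_arr[of "Dom C u" "Dom C m"] assms by auto
  have "m \<cdot> z = u" by (rule zero_arr_unique) (use z assms in simp_all)
  then show ?thesis using z by (intro sub_leI[of z]) simp_all
qed

lemma mono_zero_dom: "\<lbrakk>mono_arr C m; zero_arr C m\<rbrakk> \<Longrightarrow> is_zero C (Dom C m)"
  using mono_zero_cancel[of m "Idt C (Dom C m)"] by (simp add: is_zero_iff)

lemma epi_zero_cod: "\<lbrakk>epi_arr C m; zero_arr C m\<rbrakk> \<Longrightarrow> is_zero C (Cod C m)"
  using epi_zero_cancel[of m "Idt C (Cod C m)"] by (simp add: is_zero_iff)

lemma kernel_zero_mono:
  assumes "is_kernel C f k" "is_zero C (Dom C k)"
  shows "mono_arr C f"
proof (rule mono_arr_zeroI)
  fix w assume w: "w \<in> Arr C" "Cod C w = Dom C f" "zero_arr C (f \<cdot> w)"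
  then obtain h where h: "h \<in> Arr C" "Dom C h = Dom C w" "Cod C h = Dom C k" "k \<cdot> h = w"
    using kernel_factor[OF assms(1)] by (auto elim: sub_leE)
  have "zero_arr C h" using is_zero_zero_arr[OF assms(2)] h by simp
  then show "zero_arr C w" by (rule zero_left_eq[OF _ h(4)]) (use h kernelD[OF assms(1)] in simp_all)
qed (use kernelD[OF assms(1)] in simp)

lemma ex_zero_sub:
  assumes "M \<in> Obj C"
  obtains m where "mono_arr C m" "Cod C m = M" "is_zero C (Dom C m)"
proof -
  obtain Z where Z: "is_zero C Z" using ex_zero ..
  obtain m where m: "m \<in> Arr C" "Dom C m = Z" "Cod C m = M" by (rule is_zero_ex_from[OF Z assms])
  have "mono_arr C m" by (rule mono_arrI[OF m(1)]) (use is_zero_into[OF Z] m in auto)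
  then show thesis using that m Z by simp
qed

lemma cokernel_of_zero_dom:
  assumes "is_cokernel C f q" "zero_arr C f"
  shows "iso_arr C q"
proof (rule mono_epi_iso)
  note qD = cokernelD[OF assms(1)]
  have "zero_arr C (Idt C (Cod C f) \<cdot> f)" using assms(2) by simp
  then obtain v where v: "v \<in> Arr C" "Dom C v = Cod C q" "Cod C v = Cod C f" "v \<cdot> q = Idt C (Cod C f)"
    using cokernel_factor[OF assms(1), of "Idt C (Cod C f)"] qD by auto
  have m: "mono_arr C (v \<cdot> q)" using v qD by simp
  show "mono_arr C q" by (rule mono_of_comp[OF m]) (use v qD in simp_all)
qed (use cokernelD[OF assms(1)] in simp)

text \<open>With \<open>e'\<close> the epimorphic part of \<open>g\<close>, equality of the kernels
  lets \<open>e\<close> and \<open>e'\<close> factor through each other. The comparison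
  \<open>t\<close> therefore has the left inverse \<open>s\<close>, and \<open>j\<close> is
  \<open>t\<close> followed by the image of \<open>g\<close>. The kernels are given by their test
  arrows, which suits annihilators.\<close>

lemma ex_mono_of_same_kernel:
  assumes e: "epi_arr C e" and g: "g \<in> Arr C" "Dom C g = Dom C e"
    and same: "\<And>u. \<lbrakk>u \<in> Arr C; Cod C u = Dom C e\<rbrakk> \<Longrightarrow> zero_arr C (e \<cdot> u) \<longleftrightarrow> zero_arr C (g \<cdot> u)"
  obtains j where "mono_arr C j" "Dom C j = Cod C e" "Cod C j = Cod C g" "j \<cdot> e = g"
proof -
  obtain k where k: "short_exact C k e" by (rule epi_short_exact[OF e])
  note kD = short_exactD[OF k]
  obtain e' m' where g': "epi_arr C e'" "mono_arr C m'" "Dom C e' = Dom C g" "Cod C e' = Dom C m'"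
    "Cod C m' = Cod C g" "m' \<cdot> e' = g" by (rule ex_epi_mono_factor[OF g(1)])
  have gk: "zero_arr C (g \<cdot> k)" using same[of k] kD kernelD(4)[OF kD(1)] by simp
  obtain j where j: "j \<in> Arr C" "Dom C j = Cod C e" "Cod C j = Cod C g" "j \<cdot> e = g"
    by (rule cokernel_factor[OF kD(2) g(1) _ gk]) (use kD g in simp_all)
  have same': "zero_arr C (e' \<cdot> u) \<longleftrightarrow> zero_arr C (e \<cdot> u)" if u: "u \<in> Arr C" "Cod C u = Dom C e" for u
  proof -
    have "m' \<cdot> e' \<cdot> u = g \<cdot> u" by (rule comp_eq_extend[OF g'(6)]) (use g' u g in simp_all)
    then show ?thesis
      using same[OF u] mono_zero_iff[OF g'(2), of "e' \<cdot> u"] g' u g by simp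
  qed
  have e'k: "zero_arr C (e' \<cdot> k)" using same'[of k] kD kernelD(4)[OF kD(1)] by simp
  obtain t where t: "t \<in> Arr C" "Dom C t = Cod C e" "Cod C t = Cod C e'" "t \<cdot> e = e'"
    by (rule cokernel_factor[OF kD(2) _ _ e'k]) (use kD g g' in simp_all)
  obtain k' where k': "short_exact C k' e'" by (rule epi_short_exact[OF g'(1)])
  note k'D = short_exactD[OF k']
  have ek': "zero_arr C (e \<cdot> k')" using same'[of k'] k'D kernelD(4)[OF k'D(1)] g g' by simp
  obtain s where s: "s \<in> Arr C" "Dom C s = Cod C e'" "Cod C s = Cod C e" "s \<cdot> e' = e"
    by (rule cokernel_factor[OF k'D(2) _ _ ek']) (use k'D g g' e in simp_all)
  have "(s \<cdot> t) \<cdot> e = Idt C (Cod C e) \<cdot> e" using s t e by simp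
  then have st: "s \<cdot> t = Idt C (Cod C e)" using s t e by - (rule epi_cancel[OF e], simp_all)
  have mst: "mono_arr C (s \<cdot> t)" using st e by simp
  have mt: "mono_arr C t" by (rule mono_of_comp[OF mst]) (use s t in simp_all)
  have "(m' \<cdot> t) \<cdot> e = j \<cdot> e" using t g' j e by simp
  then have "m' \<cdot> t = j" using t g' j e by - (rule epi_cancel[OF e], simp_all)
  then have "mono_arr C j" using mono_comp[OF g'(2) mt] t g' by simp
  then show thesis using that j by blast
qed

text \<open>The inverse image \<open>p\<close> of a subobject \<open>h\<close> of the quotient is an
  extension of \<open>h\<close> by \<open>n\<close>. This is how a maximal subobject
  \<open>n\<close> is enlarged by a subobject of its quotient to reach a contradiction.\<close>

lemma pullback_extension:
  assumes nq: "short_exact C n q" and h: "mono_arr C h" "Cod C h = Cod C q"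
  obtains p n' r where "mono_arr C p" "Cod C p = Cod C n" "short_exact C n' r" "Dom C n' = Dom C n"
    "Cod C n' = Dom C p" "Cod C r = Dom C h" "p \<cdot> n' = n" "h \<cdot> r = q \<cdot> p" "sub_le C n p"
proof -
  note D = short_exactD[OF nq]
  obtain p r where p: "mono_arr C p" "Cod C p = Dom C q" "r \<in> Arr C" "Dom C r = Dom C p" "Cod C r = Dom C h"
    "h \<cdot> r = q \<cdot> p" "\<And>u. \<lbrakk>u \<in> Arr C; Cod C u = Dom C q\<rbrakk> \<Longrightarrow> sub_le C u p \<longleftrightarrow> sub_le C (q \<cdot> u) h"
    "epi_arr C q \<Longrightarrow> epi_arr C r"
    using ex_pullback_mono[OF h(1) D(7) h(2)[symmetric]] by metis
  have r: "epi_arr C r" using p(8) D by simp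
  have np: "sub_le C n p" using p(7)[of n] zero_sub_le[of "q \<cdot> n" h] kernelD(4)[OF D(1)] D h by simp
  then obtain n' where n': "n' \<in> Arr C" "Dom C n' = Dom C n" "Cod C n' = Dom C p" "p \<cdot> n' = n"
    by (rule sub_leE)
  have mpn: "mono_arr C (p \<cdot> n')" using n' D by simp
  have mn': "mono_arr C n'" by (rule mono_of_comp[OF mpn]) (use n' p in simp_all)
  have hr: "h \<cdot> r \<cdot> u = q \<cdot> p \<cdot> u" if "u \<in> Arr C" "Cod C u = Dom C p" for u
    by (rule comp_eq_extend2[OF p(6)]) (use that p h D in simp_all)
  have "is_kernel C r n'"
  proof (rule kernelI)
    have "zero_arr C (h \<cdot> r \<cdot> n')" using hr[of n'] n' kernelD(4)[OF D(1)] by simp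
    then show "zero_arr C (r \<cdot> n')" by (rule mono_zero_cancel[OF h(1)]) (use p(1-5) n' in simp_all)
    fix u assume u: "u \<in> Arr C" "Cod C u = Dom C r" "zero_arr C (r \<cdot> u)"
    have "zero_arr C (q \<cdot> p \<cdot> u)" using hr[of u] u p h zero_arr_left[of "r \<cdot> u" h] by simp
    then have "sub_le C (p \<cdot> u) (p \<cdot> n')" using kernel_factor[OF D(1), of "p \<cdot> u"] u p n' by simp
    then show "sub_le C u n'" using sub_le_mono_cancel[OF p(1), of u n'] u p n' by simp
  qed (use p n' mn' in simp_all)
  then have "short_exact C n' r" using epi_cokernel_kernel[OF r] by (simp add: short_exact_def)
  then show thesis using that[of p n' r] p n' np D by simp
qed

section \<open>Noetherian objects\<close>

lemma noetherian_sub: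
  assumes "noetherian C M" "subobject C L M"
  shows "noetherian C L"
proof -
  obtain i where i: "mono_arr C i" "Dom C i = L" "Cod C i = M" using assms(2) by (rule subobjectE)
  show ?thesis unfolding noetherian_def
  proof (intro conjI allI impI)
    fix m :: "nat \<Rightarrow> 'b"
    assume m: "\<forall>n. mono_arr C (m n) \<and> Cod C (m n) = L \<and> sub_le C (m n) (m (Suc n))"
    then have "\<forall>n. mono_arr C (i \<cdot> m n) \<and> Cod C (i \<cdot> m n) = M \<and> sub_le C (i \<cdot> m n) (i \<cdot> m (Suc n))"
      using i by (auto intro: mono_comp sub_le_comp_left)
    then obtain N where "\<forall>n\<ge>N. sub_le C (i \<cdot> m n) (i \<cdot> m N)"
      using assms(1)[unfolded noetherian_def, THEN conjunct2, rule_format, of "\<lambda>n. i \<cdot> m n"] by auto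
    then have "\<forall>n\<ge>N. sub_le C (m n) (m N)" using sub_le_mono_cancel[OF i(1)] m i by simp
    then show "\<exists>N. \<forall>n\<ge>N. sub_le C (m n) (m N)" ..
  qed (use i in auto)
qed

lemma noetherian_quotient:
  assumes "noetherian C M" "quotient_object C Q M"
  shows "noetherian C Q"
proof -
  obtain q where q: "epi_arr C q" "Dom C q = M" "Cod C q = Q" using assms(2) by (rule quotient_objectE)
  show ?thesis unfolding noetherian_def
  proof (intro conjI allI impI)
    fix m :: "nat \<Rightarrow> 'b"
    assume m: "\<forall>n. mono_arr C (m n) \<and> Cod C (m n) = Q \<and> sub_le C (m n) (m (Suc n))"
    have "\<exists>p r. mono_arr C p \<and> Cod C p = M \<and> epi_arr C r \<and> Dom C r = Dom C p \<and> Cod C r = Dom C (m n) \<and>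
        m n \<cdot> r = q \<cdot> p \<and> (\<forall>u. u \<in> Arr C \<and> Cod C u = M \<longrightarrow> sub_le C u p = sub_le C (q \<cdot> u) (m n))" for n
      using ex_pullback_mono[of "m n" q] m q by (metis epi_arrD)
    then obtain p r where p: "\<And>n. mono_arr C (p n)" "\<And>n. Cod C (p n) = M" "\<And>n. epi_arr C (r n)"
      "\<And>n. Dom C (r n) = Dom C (p n)" "\<And>n. Cod C (r n) = Dom C (m n)" "\<And>n. m n \<cdot> r n = q \<cdot> p n"
      "\<And>n u. \<lbrakk>u \<in> Arr C; Cod C u = M\<rbrakk> \<Longrightarrow> sub_le C u (p n) = sub_le C (q \<cdot> u) (m n)"
      by metis
    have le: "sub_le C (m n \<cdot> r n) (m k)" if "sub_le C (m n) (m k)" for n k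
      using sub_le_comp_right[OF that, of "r n"] m p by simp
    have "sub_le C (p n) (p (Suc n))" for n
      using le[of n "Suc n"] m p(6,7) p(1,2) by simp
    then obtain N where N: "\<forall>n\<ge>N. sub_le C (p n) (p N)"
      using assms(1)[unfolded noetherian_def, THEN conjunct2, rule_format, of p] p by auto
    have "sub_le C (m n) (m N)" if "n \<ge> N" for n
    proof (rule sub_le_epi_cancel[OF p(3)[of n]])
      show "sub_le C (m n \<cdot> r n) (m N)" using N that p by simp
    qed (use m p in simp_all)
    then show "\<exists>N. \<forall>n\<ge>N. sub_le C (m n) (m N)" by blast
  qed (use q in auto)
qed

section \<open>Monoform objects and atoms\<close>

text \<open>The working form of the definition: a nonzero arrow to \<open>H\<close> from one of its
  subobjects is mono. If such an \<open>f\<close> has a nonzero kernel \<open>k\<close>, its image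
  embeds in \<open>H\<close> and in \<open>H / k\<close>. Conversely, a common subobject of
  \<open>H\<close> and \<open>H / l\<close> gives the arrow from its inverse image in
  \<open>H\<close> back to \<open>H\<close>, which is nonzero and kills \<open>l\<close>.\<close>

lemma monoform_iff:
  "monoform C H \<longleftrightarrow> H \<in> Obj C \<and> \<not> is_zero C H \<and>
     (\<forall>m f. mono_arr C m \<and> Cod C m = H \<and> f \<in> Arr C \<and> Dom C f = Dom C m \<and> Cod C f = H \<and> \<not> zero_arr C f \<longrightarrow>
        mono_arr C f)" (is "_ \<longleftrightarrow> ?R")
proof
  assume H: "monoform C H"
  have "mono_arr C f" if m: "mono_arr C m" "Cod C m = H" and f: "f \<in> Arr C" "Dom C f = Dom C m" "Cod C f = H"
    "\<not> zero_arr C f" for m f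
  proof (rule ccontr)
    assume nm: "\<not> mono_arr C f"
    obtain k where k: "is_kernel C f k" using ex_kernel[OF f(1)] ..
    note kD = kernelD[OF k]
    have k0: "\<not> is_zero C (Dom C k)" using kernel_zero_mono[OF k] nm by blast
    have mk: "mono_arr C (m \<cdot> k)" using mono_comp m kD f by simp
    obtain q where q: "short_exact C (m \<cdot> k) q" by (rule mono_short_exact[OF mk])
    note qD = short_exactD[OF q]
    have dims: "Dom C q = Cod C m" "Cod C k = Dom C m" using qD(5) kD m f by simp_all
    obtain e i where ei: "epi_arr C e" "mono_arr C i" "Dom C e = Dom C f" "Cod C e = Dom C i"
      "Cod C i = Cod C f" "i \<cdot> e = f" by (rule ex_epi_mono_factor[OF f(1)])
    \<comment> \<open>Both \<open>e\<close> and \<open>q \<cdot> m\<close> have kernel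
      \<open>k\<close>, so the image of \<open>f\<close> embeds in the quotient of \<open>H\<close>
      by \<open>m \<cdot> k\<close>.\<close>
    have same: "zero_arr C (e \<cdot> u) \<longleftrightarrow> zero_arr C ((q \<cdot> m) \<cdot> u)" if u: "u \<in> Arr C" "Cod C u = Dom C e" for u
    proof -
      have "i \<cdot> e \<cdot> u = f \<cdot> u" by (rule comp_eq_extend[OF ei(6)]) (use u ei in simp_all)
      then have "zero_arr C (e \<cdot> u) \<longleftrightarrow> zero_arr C (f \<cdot> u)"
        using mono_zero_iff[OF ei(2), of "e \<cdot> u"] u ei by simp
      also have "\<dots> \<longleftrightarrow> sub_le C u k" using kernel_factor_iff[OF k, of u] u ei f by simp
      also have "\<dots> \<longleftrightarrow> sub_le C (m \<cdot> u) (m \<cdot> k)"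
        by (rule sub_le_mono_iff[symmetric]) (use u ei f m kD in simp_all)
      also have "\<dots> \<longleftrightarrow> zero_arr C (q \<cdot> m \<cdot> u)" using kernel_factor_iff[OF qD(1), of "m \<cdot> u"] u ei f m dims by simp
      finally show ?thesis using u ei f m dims qD by simp
    qed
    obtain j where j: "mono_arr C j" "Dom C j = Cod C e" "Cod C j = Cod C (q \<cdot> m)" "j \<cdot> e = q \<cdot> m"
      by (rule ex_mono_of_same_kernel[OF ei(1) _ _ same]) (use qD m dims ei f in simp_all)
    have "subobject C (Dom C i) (Cod C q)" using subobjectI[OF j(1)] j ei m dims qD by simp
    moreover have "subobject C (Dom C i) H" using subobjectI[OF ei(2)] ei f by simp
    moreover have "\<not> is_zero C (Dom C i)"
    proof
      assume "is_zero C (Dom C i)"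
      then have "zero_arr C i" using is_zero_zero_arr ei by simp
      then have "zero_arr C f" by (rule zero_right_eq[OF _ ei(6)]) (use ei in simp_all)
      then show False using f by simp
    qed
    ultimately have "common_nonzero_subobject C H (Cod C q)"
      unfolding common_nonzero_subobject_def using ei by auto
    moreover have "Cod C (m \<cdot> k) = H" "Dom C (m \<cdot> k) = Dom C k" using m kD dims by simp_all
    ultimately show False using H mk k0 qD(2) unfolding monoform_def by metis
  qed
  then show ?R using H unfolding monoform_def by blast
next
  assume R: ?R
  have "\<not> common_nonzero_subobject C H (Cod C q)"
    if l: "mono_arr C l" "Cod C l = H" "\<not> is_zero C (Dom C l)" "is_cokernel C l q" for l q
  proof
    assume "common_nonzero_subobject C H (Cod C q)"
    then obtain n1 n2 where n: "mono_arr C n1" "Cod C n1 = H" "\<not> is_zero C (Dom C n1)" "mono_arr C n2"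
      "Dom C n2 = Dom C n1" "Cod C n2 = Cod C q"
      unfolding common_nonzero_subobject_def by (metis subobjectE)
    have lq: "short_exact C l q" using mono_kernel_cokernel l by (simp add: short_exact_def)
    obtain p l' r where p: "mono_arr C p" "Cod C p = Cod C l" "short_exact C l' r" "Dom C l' = Dom C l"
      "Cod C l' = Dom C p" "Cod C r = Dom C n2" "p \<cdot> l' = l" "n2 \<cdot> r = q \<cdot> p"
      using pullback_extension[OF lq n(4,6)] by metis
    note rD = short_exactD[OF p(3)]
    have "\<not> zero_arr C (n1 \<cdot> r)"
      using mono_zero_cancel[OF n(1), of r] epi_zero_cod[OF rD(4)] rD p n by auto
    moreover have "n1 \<cdot> r \<in> Arr C" "Dom C (n1 \<cdot> r) = Dom C p" "Cod C (n1 \<cdot> r) = H" using n p rD by simp_all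
    ultimately have mr: "mono_arr C (n1 \<cdot> r)" using R p l by metis
    have "mono_arr C r" by (rule mono_of_comp[OF mr]) (use n p rD in simp_all)
    then have "zero_arr C l'" using mono_zero_cancel[of r l'] kernelD(4)[OF rD(1)] rD by simp
    then have "is_zero C (Dom C l')" using mono_zero_dom rD by simp
    then show False using l p by simp
  qed
  then show "monoform C H" unfolding monoform_def using R by blast
qed

lemma monoformD:
  assumes "monoform C H"
  shows "H \<in> Obj C" "\<not> is_zero C H"
  using assms by (simp_all add: monoform_iff)

lemma monoform_mono:
  assumes "monoform C H" "mono_arr C m" "Cod C m = H" "f \<in> Arr C" "Dom C f = Dom C m" "Cod C f = H"
    "\<not> zero_arr C f"
  shows "mono_arr C f"
  using assms unfolding monoform_iff by blast

lemma monoformI: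
  assumes "H \<in> Obj C" "\<not> is_zero C H"
    "\<And>m f. \<lbrakk>mono_arr C m; Cod C m = H; f \<in> Arr C; Dom C f = Dom C m; Cod C f = H; \<not> zero_arr C f\<rbrakk> \<Longrightarrow>
      mono_arr C f"
  shows "monoform C H"
  using assms unfolding monoform_iff by blast

lemma monoform_sub:
  assumes "monoform C H" "subobject C L H" "\<not> is_zero C L"
  shows "monoform C L"
  unfolding monoform_iff
proof (intro conjI allI impI)
  obtain i where i: "mono_arr C i" "Dom C i = L" "Cod C i = H" using assms(2) by (rule subobjectE)
  fix m f assume *: "mono_arr C m \<and> Cod C m = L \<and> f \<in> Arr C \<and> Dom C f = Dom C m \<and> Cod C f = L \<and> \<not> zero_arr C f"
  have "mono_arr C (i \<cdot> f)"
  proof (rule monoform_mono[OF assms(1)])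
    show "mono_arr C (i \<cdot> m)" using mono_comp i * by simp
    show "\<not> zero_arr C (i \<cdot> f)" using mono_zero_cancel[OF i(1), of f] * i by auto
  qed (use i * in simp_all)
  then show "mono_arr C f" by (rule mono_of_comp) (use i * in simp_all)
qed (use assms subobject_obj in blast)+

lemma common_nonzero_subobject_sym:
  "common_nonzero_subobject C X Y \<Longrightarrow> common_nonzero_subobject C Y X"
  unfolding common_nonzero_subobject_def by blast

lemma common_nonzero_subobjectI:
  "\<lbrakk>\<not> is_zero C N; subobject C N X; subobject C N Y\<rbrakk> \<Longrightarrow> common_nonzero_subobject C X Y"
  unfolding common_nonzero_subobject_def using subobject_obj by blast

lemma common_nonzero_subobjectE:
  assumes "common_nonzero_subobject C X Y"
  obtains N where "\<not> is_zero C N" "subobject C N X" "subobject C N Y" "N \<in> Obj C"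
  using assms unfolding common_nonzero_subobject_def by blast

text \<open>If the intersection of \<open>K\<close> and \<open>L\<close> were zero, \<open>L\<close>
  would embed in \<open>H / K\<close>, and \<open>L\<close> would be a nonzero subobject common to
  \<open>H\<close> and \<open>H / K\<close>.\<close>

lemma monoform_uniform:
  assumes H: "monoform C H" and K: "subobject C K H" "\<not> is_zero C K" and L: "subobject C L H" "\<not> is_zero C L"
  shows "common_nonzero_subobject C K L"
proof -
  obtain a where a: "mono_arr C a" "Dom C a = K" "Cod C a = H" using K(1) by (rule subobjectE)
  obtain b where b: "mono_arr C b" "Dom C b = L" "Cod C b = H" using L(1) by (rule subobjectE)
  obtain p r where p: "mono_arr C p" "Cod C p = Dom C b" "r \<in> Arr C" "Dom C r = Dom C p" "Cod C r = Dom C a"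
    "\<And>u. \<lbrakk>u \<in> Arr C; Cod C u = Dom C b\<rbrakk> \<Longrightarrow> sub_le C u p \<longleftrightarrow> sub_le C (b \<cdot> u) a" "mono_arr C r"
    using ex_pullback_mono[OF a(1), of b] a b by (metis mono_arrD)
  have "\<not> is_zero C (Dom C p)"
  proof
    assume 0: "is_zero C (Dom C p)"
    obtain q where q: "short_exact C a q" by (rule mono_short_exact[OF a(1)])
    note qD = short_exactD[OF q]
    have "mono_arr C (q \<cdot> b)"
    proof (rule mono_arr_zeroI)
      fix w assume w: "w \<in> Arr C" "Cod C w = Dom C (q \<cdot> b)" "zero_arr C ((q \<cdot> b) \<cdot> w)"
      then have "sub_le C w p"
        using kernel_factor_iff[OF qD(1), of "b \<cdot> w"] p(6)[of w] a b qD by simp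
      then obtain h where h: "h \<in> Arr C" "Dom C h = Dom C w" "Cod C h = Dom C p" "p \<cdot> h = w" by (rule sub_leE)
      have "zero_arr C h" using is_zero_zero_arr[OF 0, of h] h by simp
      then show "zero_arr C w" by (rule zero_left_eq[OF _ h(4)]) (use h p in simp_all)
    qed (use a b qD in simp)
    then have "common_nonzero_subobject C H (Cod C q)"
      using common_nonzero_subobjectI[OF L(2,1)] subobjectI[of "q \<cdot> b" L "Cod C q"] a b qD by simp
    then show False using H a K(2) qD(2) unfolding monoform_def by metis
  qed
  then show ?thesis using subobjectI[OF p(1)] subobjectI[OF p(7)] p a b by (intro common_nonzero_subobjectI[of "Dom C p"]) simp_all
qed

text \<open>The two common subobjects are both nonzero subobjects of the monoform \<open>K\<close>,
  so they share a nonzero subobject. This is the transitivity of atom equivalence.\<close>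

lemma common_nonzero_subobject_trans:
  assumes "monoform C K" "common_nonzero_subobject C H K" "common_nonzero_subobject C K L"
  shows "common_nonzero_subobject C H L"
proof -
  obtain N1 where N1: "\<not> is_zero C N1" "subobject C N1 H" "subobject C N1 K"
    using assms(2) by (rule common_nonzero_subobjectE)
  obtain N2 where N2: "\<not> is_zero C N2" "subobject C N2 K" "subobject C N2 L"
    using assms(3) by (rule common_nonzero_subobjectE)
  obtain N where "\<not> is_zero C N" "subobject C N N1" "subobject C N N2"
    using monoform_uniform[OF assms(1) N1(3,1) N2(2,1)] by (rule common_nonzero_subobjectE)
  then show ?thesis using N1 N2 subobject_trans by (meson common_nonzero_subobjectI)
qed

lemma atom_eq_iff:
  assumes "monoform C H" "monoform C K"
  shows "atom C H = atom C K \<longleftrightarrow> common_nonzero_subobject C H K"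
proof
  assume eq: "atom C H = atom C K"
  have "K \<in> atom C K" using assms monoformD[OF assms(2)]
    by (auto simp: atom_def atom_equiv_def intro: common_nonzero_subobjectI)
  then show "common_nonzero_subobject C H K" using eq by (auto simp: atom_def atom_equiv_def)
next
  assume "common_nonzero_subobject C H K"
  then show "atom C H = atom C K"
    using assms common_nonzero_subobject_trans common_nonzero_subobject_sym
    unfolding atom_def atom_equiv_def by blast
qed

lemma atom_sub:
  assumes "monoform C H" "subobject C N H" "\<not> is_zero C N"
  shows "atom C N = atom C H"
  using atom_eq_iff[OF monoform_sub[OF assms] assms(1)] common_nonzero_subobjectI[OF assms(3) _ assms(2)]
    subobject_obj[OF assms(2)] by simp

section \<open>Associated atoms and supports\<close>

lemma AssI: "\<lbrakk>monoform C H; subobject C H M\<rbrakk> \<Longrightarrow> atom C H \<in> Ass C M"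
  unfolding Ass_def by blast

lemma AssE:
  assumes "x \<in> Ass C M"
  obtains H where "monoform C H" "subobject C H M" "x = atom C H"
  using assms unfolding Ass_def by blast

lemma SuppI: "\<lbrakk>monoform C H; subobject C L M; quotient_object C H L\<rbrakk> \<Longrightarrow> atom C H \<in> Supp C M"
  unfolding Supp_def subquotient_def by blast

lemma SuppE:
  assumes "x \<in> Supp C M"
  obtains H L where "monoform C H" "subobject C L M" "quotient_object C H L" "x = atom C H"
  using assms unfolding Supp_def subquotient_def by blast

lemma Ass_sub: "subobject C L M \<Longrightarrow> Ass C L \<subseteq> Ass C M"
  unfolding Ass_def using subobject_trans by blast

lemma Ass_zero: "is_zero C M \<Longrightarrow> Ass C M = {}"
  by (meson AssE equals0I is_zero_sub monoformD(2))

lemma Ass_monoform: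
  assumes "monoform C H" shows "Ass C H = {atom C H}"
proof
  show "Ass C H \<subseteq> {atom C H}" using atom_sub[OF assms] monoformD(2) by (metis AssE singletonI subsetI)
  show "{atom C H} \<subseteq> Ass C H" using AssI[OF assms] monoformD(1)[OF assms] by simp
qed

lemma Ass_subset_Supp: "Ass C M \<subseteq> Supp C M"
  using SuppI quotient_object_refl monoformD(1) by (metis AssE subsetI)

text \<open>A monoform subobject \<open>H\<close> of the middle term either meets
  \<open>Dom C f\<close> trivially and embeds in \<open>Cod C g\<close>, or meets it in a nonzero
  subobject, which represents the same atom.\<close>

lemma Ass_extension:
  assumes fg: "short_exact C f g"
  shows "Ass C (Cod C f) \<subseteq> Ass C (Dom C f) \<union> Ass C (Cod C g)"
proof
  note D = short_exactD[OF fg]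
  fix x assume "x \<in> Ass C (Cod C f)"
  then obtain H h where H: "monoform C H" "mono_arr C h" "Dom C h = H" "Cod C h = Cod C f" "x = atom C H"
    by (metis AssE subobjectE)
  obtain k where k: "is_kernel C (g \<cdot> h) k" using ex_kernel[of "g \<cdot> h"] H D by auto
  note kD = kernelD[OF k]
  show "x \<in> Ass C (Dom C f) \<union> Ass C (Cod C g)"
  proof (cases "is_zero C (Dom C k)")
    case True
    then have "mono_arr C (g \<cdot> h)" by (rule kernel_zero_mono[OF k])
    then have "subobject C H (Cod C g)" using H D by (intro subobjectI[of "g \<cdot> h"]) simp_all
    then show ?thesis using AssI H by blast
  next
    case False
    have ck: "Cod C k = Dom C h" using kD(3) H D by simp
    have sk: "subobject C (Dom C k) H" using H kD ck by (intro subobjectI[of k]) simp_all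
    have "zero_arr C (g \<cdot> h \<cdot> k)" using kD(4) H D ck kD by simp
    then obtain u where u: "u \<in> Arr C" "Dom C u = Dom C (h \<cdot> k)" "Cod C u = Dom C f" "f \<cdot> u = h \<cdot> k"
      using kernel_factor[OF D(1), of "h \<cdot> k"] H D ck kD by (auto elim: sub_leE)
    have mfu: "mono_arr C (f \<cdot> u)" using mono_comp[OF H(2) kD(5) ck] u by simp
    have "mono_arr C u" by (rule mono_of_comp[OF mfu]) (use u D in simp_all)
    then have "subobject C (Dom C k) (Dom C f)" using u H kD ck by (intro subobjectI[of u]) simp_all
    then show ?thesis using AssI[OF monoform_sub[OF H(1) sk False]] atom_sub[OF H(1) sk False] H by auto
  qed
qed

lemma Supp_sub: "subobject C L M \<Longrightarrow> Supp C L \<subseteq> Supp C M"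
  unfolding Supp_def subquotient_def using subobject_trans by blast

lemma Supp_zero: "is_zero C M \<Longrightarrow> Supp C M = {}"
  by (meson SuppE equals0I is_zero_sub is_zero_quotient monoformD(2))

lemma sub_of_quotient:
  assumes "quotient_object C Q M" "subobject C L Q"
  obtains K where "subobject C K M" "quotient_object C L K"
proof -
  obtain q where q: "epi_arr C q" "Dom C q = M" "Cod C q = Q" using assms(1) by (rule quotient_objectE)
  obtain h where h: "mono_arr C h" "Dom C h = L" "Cod C h = Q" using assms(2) by (rule subobjectE)
  obtain p r where "mono_arr C p" "Cod C p = Dom C q" "epi_arr C r" "Dom C r = Dom C p" "Cod C r = Dom C h"
    using ex_pullback_mono[OF h(1), of q] q h by (metis epi_arrD)
  then show thesis using that[of "Dom C p"] subobjectI quotient_objectI q h by metis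
qed

lemma Supp_quotient:
  assumes "quotient_object C Q M" shows "Supp C Q \<subseteq> Supp C M"
proof
  fix x assume "x \<in> Supp C Q"
  then obtain H L where H: "monoform C H" "subobject C L Q" "quotient_object C H L" "x = atom C H"
    by (rule SuppE)
  obtain K where "subobject C K M" "quotient_object C L K" by (rule sub_of_quotient[OF assms H(2)])
  then show "x \<in> Supp C M" using SuppI[OF H(1)] H quotient_object_trans by blast
qed

text \<open>A monoform subquotient and a subobject of its denominator: either their image is nonzero, or the
  subquotient survives in the quotient.\<close>

lemma Supp_extension:
  assumes fg: "short_exact C f g"
  shows "Supp C (Cod C f) \<subseteq> Supp C (Dom C f) \<union> Supp C (Cod C g)"
proof
  note D = short_exactD[OF fg]
  fix x assume "x \<in> Supp C (Cod C f)"
  then obtain H L where H: "monoform C H" "subobject C L (Cod C f)" "quotient_object C H L" "x = atom C H"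
    by (rule SuppE)
  obtain l where l: "mono_arr C l" "Dom C l = L" "Cod C l = Cod C f" using H(2) by (rule subobjectE)
  obtain h where h: "epi_arr C h" "Dom C h = L" "Cod C h = H" using H(3) by (rule quotient_objectE)
  obtain p r where p: "mono_arr C p" "Cod C p = Dom C l" "r \<in> Arr C" "Dom C r = Dom C p" "Cod C r = Dom C f"
    "\<And>u. \<lbrakk>u \<in> Arr C; Cod C u = Dom C l\<rbrakk> \<Longrightarrow> sub_le C u p \<longleftrightarrow> sub_le C (l \<cdot> u) f" "mono_arr C r"
    using ex_pullback_mono[OF D(3), of l] l by (metis mono_arrD)
  show "x \<in> Supp C (Dom C f) \<union> Supp C (Cod C g)"
  proof (cases "zero_arr C (h \<cdot> p)")
    case False
    have hp: "h \<cdot> p \<in> Arr C" using h p l by simp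
    obtain e i where ei: "epi_arr C e" "mono_arr C i" "Dom C e = Dom C (h \<cdot> p)" "Cod C e = Dom C i"
      "Cod C i = Cod C (h \<cdot> p)" "i \<cdot> e = h \<cdot> p" by (rule ex_epi_mono_factor[OF hp])
    have iH: "subobject C (Dom C i) H" using ei h p l by (intro subobjectI[of i]) simp_all
    have i0: "\<not> is_zero C (Dom C i)"
    proof
      assume "is_zero C (Dom C i)"
      then have "zero_arr C i" using is_zero_zero_arr ei by simp
      then have "zero_arr C (h \<cdot> p)" by (rule zero_right_eq[OF _ ei(6)]) (use ei in simp_all)
      then show False using False by simp
    qed
    have "quotient_object C (Dom C i) (Dom C p)" using ei h p l by (intro quotient_objectI[of e]) simp_all
    moreover have "subobject C (Dom C p) (Dom C f)" using p by (intro subobjectI[of r]) simp_all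
    ultimately have "atom C (Dom C i) \<in> Supp C (Dom C f)" using SuppI[OF monoform_sub[OF H(1) iH i0]] by blast
    then show ?thesis using atom_sub[OF H(1) iH i0] H by simp
  next
    case True
    have gl: "g \<cdot> l \<in> Arr C" using D l by simp
    obtain e i where ei: "epi_arr C e" "mono_arr C i" "Dom C e = Dom C (g \<cdot> l)" "Cod C e = Dom C i"
      "Cod C i = Cod C (g \<cdot> l)" "i \<cdot> e = g \<cdot> l" by (rule ex_epi_mono_factor[OF gl])
    obtain k where k: "short_exact C k e" by (rule epi_short_exact[OF ei(1)])
    note kD = short_exactD[OF k]
    have dk: "Cod C k = Dom C l" "Dom C e = Dom C l" using kD ei D l by simp_all
    have "zero_arr C (i \<cdot> e \<cdot> k)" using kernelD(4)[OF kD(1)] ei kD by simp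
    then have "zero_arr C (g \<cdot> l \<cdot> k)"
      using comp_eq_extend2[OF ei(6), of k] ei D l kD dk by simp
    then have "sub_le C k p" using kernel_factor[OF D(1), of "l \<cdot> k"] p(6)[of k] kD dk l D by simp
    then obtain j where j: "j \<in> Arr C" "Dom C j = Dom C k" "Cod C j = Dom C p" "p \<cdot> j = k" by (rule sub_leE)
    have "zero_arr C ((h \<cdot> p) \<cdot> j)" by (rule zero_arr_right[OF True]) (use j h p l in simp_all)
    then have hk: "zero_arr C (h \<cdot> k)" using j h p l by simp
    obtain v where v: "v \<in> Arr C" "Dom C v = Cod C e" "Cod C v = Cod C h" "v \<cdot> e = h"
      by (rule cokernel_factor[OF kD(2) _ _ hk]) (use h dk l in simp_all)
    have eve: "epi_arr C (v \<cdot> e)" using v h by simp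
    have "epi_arr C v" by (rule epi_of_comp[OF eve]) (use v ei in simp_all)
    then have "quotient_object C H (Dom C i)" using v ei h by (intro quotient_objectI[of v]) simp_all
    moreover have "subobject C (Dom C i) (Cod C g)" using ei D l by (intro subobjectI[of i]) simp_all
    ultimately show ?thesis using SuppI[OF H(1)] H by blast
  qed
qed

text \<open>The image of \<open>f\<close> is a nonzero subobject of \<open>H\<close>, hence
  represents the atom of \<open>H\<close>, and it is a subquotient of \<open>M\<close>.\<close>

lemma Supp_nonzero_map:
  assumes H: "monoform C H" and f: "f \<in> Arr C" "Cod C f = H" "\<not> zero_arr C f" and P: "subobject C (Dom C f) M"
  shows "atom C H \<in> Supp C M"
proof -
  obtain e i where ei: "epi_arr C e" "mono_arr C i" "Dom C e = Dom C f" "Cod C e = Dom C i"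
    "Cod C i = Cod C f" "i \<cdot> e = f" by (rule ex_epi_mono_factor[OF f(1)])
  have iH: "subobject C (Dom C i) H" using ei f by (intro subobjectI[of i]) simp_all
  have i0: "\<not> is_zero C (Dom C i)"
  proof
    assume "is_zero C (Dom C i)"
    then have "zero_arr C i" using is_zero_zero_arr ei by simp
    then have "zero_arr C f" by (rule zero_right_eq[OF _ ei(6)]) (use ei in simp_all)
    then show False using f by simp
  qed
  have "quotient_object C (Dom C i) (Dom C f)" using ei by (intro quotient_objectI[of e]) simp_all
  then have "atom C (Dom C i) \<in> Supp C M" using SuppI[OF monoform_sub[OF H iH i0] P] by blast
  then show ?thesis using atom_sub[OF H iH i0] by simp
qed

text \<open>Among the kernels of nonzero maps from subobjects of \<open>M\<close> to \<open>M\<close>, a maximal one has monoform image.\<close>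

lemma ex_monoform_sub:
  assumes M: "noetherian C M" "\<not> is_zero C M"
  obtains H where "monoform C H" "subobject C H M"
proof -
  have Mo: "M \<in> Obj C" using M by (simp add: noetherian_def)
  \<comment> \<open>The kernels live in different subobjects \<open>m\<close>; composing with
    \<open>m\<close> makes all of them subobjects of \<open>M\<close>, where the chain condition
    applies.\<close>
  define S where "S = {m \<cdot> k | m f k. mono_arr C m \<and> Cod C m = M \<and> f \<in> Arr C \<and> Dom C f = Dom C m \<and>
    Cod C f = M \<and> \<not> zero_arr C f \<and> is_kernel C f k}"
  have SI: "m \<cdot> k \<in> S" if "mono_arr C m" "Cod C m = M" "f \<in> Arr C" "Dom C f = Dom C m"
    "Cod C f = M" "\<not> zero_arr C f" "is_kernel C f k" for m f k
    unfolding S_def using that by blast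
  have Smono: "mono_arr C x \<and> Cod C x = M" if xS: "x \<in> S" for x
  proof -
    obtain m f k where "x = m \<cdot> k" "mono_arr C m" "Cod C m = M" "Dom C f = Dom C m" "is_kernel C f k"
      using xS unfolding S_def by blast
    then show ?thesis using kernelD[of f k] mono_comp[of m k] by simp
  qed
  obtain k0 where "is_kernel C (Idt C M) k0" using ex_kernel[of "Idt C M"] Mo by auto
  moreover have "\<not> zero_arr C (Idt C M)" using M Mo by (simp add: is_zero_iff)
  ultimately have "Idt C M \<cdot> k0 \<in> S" using Mo by - (rule SI[of _ "Idt C M"], simp_all)
  then obtain x where x: "x \<in> S" "\<And>n. \<lbrakk>n \<in> S; sub_le C x n\<rbrakk> \<Longrightarrow> sub_le C n x"
    using noetherian_maximal[OF M(1), of "Idt C M \<cdot> k0" S] Smono by blast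
  obtain m f k where m: "x = m \<cdot> k" "mono_arr C m" "Cod C m = M" and f: "f \<in> Arr C" "Dom C f = Dom C m"
    "Cod C f = M" "\<not> zero_arr C f" and k: "is_kernel C f k" using x(1) unfolding S_def by blast
  note kD = kernelD[OF k]
  obtain e i where ei: "epi_arr C e" "mono_arr C i" "Dom C e = Dom C f" "Cod C e = Dom C i"
    "Cod C i = Cod C f" "i \<cdot> e = f" by (rule ex_epi_mono_factor[OF f(1)])
  have ek: "zero_arr C (e \<cdot> u) \<longleftrightarrow> sub_le C u k" if "u \<in> Arr C" "Cod C u = Dom C m" for u
  proof -
    have "i \<cdot> e \<cdot> u = f \<cdot> u" by (rule comp_eq_extend[OF ei(6)]) (use that ei f in simp_all)
    then show ?thesis using kernel_factor_iff[OF k, of u] mono_zero_iff[OF ei(2), of "e \<cdot> u"] that ei f by simp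
  qed
  have i0: "\<not> is_zero C (Dom C i)"
  proof
    assume "is_zero C (Dom C i)"
    then have "zero_arr C i" using is_zero_zero_arr ei by simp
    then have "zero_arr C f" by (rule zero_right_eq[OF _ ei(6)]) (use ei in simp_all)
    then show False using f by simp
  qed
  have "mono_arr C f2" if m2: "mono_arr C m2" "Cod C m2 = Dom C i"
    and f2: "f2 \<in> Arr C" "Dom C f2 = Dom C m2" "Cod C f2 = Dom C i" "\<not> zero_arr C f2" for m2 f2
  proof -
    obtain p r where p: "mono_arr C p" "Cod C p = Dom C e" "r \<in> Arr C" "Dom C r = Dom C p" "Cod C r = Dom C m2"
      "m2 \<cdot> r = e \<cdot> p" "\<And>u. \<lbrakk>u \<in> Arr C; Cod C u = Dom C e\<rbrakk> \<Longrightarrow> sub_le C u p \<longleftrightarrow> sub_le C (e \<cdot> u) m2"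
      "epi_arr C r"
      using ex_pullback_mono[OF m2(1), of e] ei m2 by (metis epi_arrD)
    have pm: "Cod C p = Dom C m" using p ei f by simp
    \<comment> \<open>With \<open>p\<close> the inverse image of \<open>m2\<close>, this is a
      nonzero arrow from a subobject of \<open>M\<close> to \<open>M\<close> whose kernel contains
      \<open>k\<close>. Maximality forces the kernel back into \<open>k\<close>.\<close>
    define g where "g = i \<cdot> f2 \<cdot> r"
    have g: "g \<in> Arr C" "Dom C g = Dom C p" "Cod C g = M" using p ei f f2 by (simp_all add: g_def)
    have g0: "zero_arr C (g \<cdot> u) \<longleftrightarrow> zero_arr C (f2 \<cdot> r \<cdot> u)" if "u \<in> Arr C" "Cod C u = Dom C p" for u
      using mono_zero_iff[OF ei(2), of "f2 \<cdot> r \<cdot> u"] that p f2 ei by (simp add: g_def)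
    have gn: "\<not> zero_arr C g"
      using mono_zero_iff[OF ei(2), of "f2 \<cdot> r"] epi_zero_iff[OF p(8), of f2] p f2 ei by (simp add: g_def)
    obtain k' where k': "is_kernel C g k'" using ex_kernel[OF g(1)] ..
    have mp: "mono_arr C (m \<cdot> p)" "Dom C (m \<cdot> p) = Dom C p" "Cod C (m \<cdot> p) = M"
      using mono_comp m p pm by simp_all
    have inS: "(m \<cdot> p) \<cdot> k' \<in> S" by (rule SI[OF mp(1,3) g(1) _ g(3) gn k']) (use mp g in simp)
    note k'D = kernelD[OF k']
    have k'p: "Cod C k' = Dom C p" using k'D g by simp
    have m2r: "m2 \<cdot> r \<cdot> u = e \<cdot> p \<cdot> u" if "u \<in> Arr C" "Cod C u = Dom C p" for u
      by (rule comp_eq_extend2[OF p(6)]) (use that p ei m2 in simp_all)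
    have kcod: "Cod C k = Dom C m" using kD f by simp
    have "zero_arr C (e \<cdot> k)" using ek[OF kD(2) kcod] sub_le_refl[OF kD(2)] by simp
    then have "sub_le C k p" using p(7)[of k] zero_sub_le[of "e \<cdot> k" m2] kD kcod ei f m2 by simp
    then obtain h where h: "h \<in> Arr C" "Dom C h = Dom C k" "Cod C h = Dom C p" "p \<cdot> h = k" by (rule sub_leE)
    have "zero_arr C (m2 \<cdot> r \<cdot> h)" using m2r[of h] h \<open>zero_arr C (e \<cdot> k)\<close> by simp
    then have "zero_arr C (r \<cdot> h)" using mono_zero_iff[OF m2(1), of "r \<cdot> h"] h p by simp
    then have "zero_arr C (f2 \<cdot> r \<cdot> h)" using f2 h p by simp
    then have "sub_le C h k'" using kernel_factor[OF k' h(1)] g0[of h] h g by simp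
    then have "sub_le C (p \<cdot> h) (p \<cdot> k')" using sub_le_comp_left p k'D k'p by simp
    then have "sub_le C (m \<cdot> k) (m \<cdot> p \<cdot> k')" using sub_le_comp_left[of k "p \<cdot> k'" m] h m p pm k'D k'p by simp
    then have le: "sub_le C (m \<cdot> p \<cdot> k') (m \<cdot> k)" using x(2)[OF inS] m p pm k'D k'p by simp
    have pk': "sub_le C (p \<cdot> k') k"
      by (rule sub_le_mono_cancel[OF m(2) _ _ _ _ le]) (use p(1) pm k'D(2) k'p kD(2) kcod in simp_all)
    \<comment> \<open>The inverse image \<open>p2\<close> of the kernel of \<open>f2\<close> lies in
      the kernel of \<open>g\<close>, hence in \<open>k\<close>, and is killed by \<open>e\<close>.
      Since \<open>r2\<close> is epi, \<open>k2\<close> is zero.\<close>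
    obtain k2 where k2: "is_kernel C f2 k2" using ex_kernel[OF f2(1)] ..
    note k2D = kernelD[OF k2]
    obtain p2 r2 where p2: "mono_arr C p2" "Cod C p2 = Dom C r" "r2 \<in> Arr C" "Dom C r2 = Dom C p2" "Cod C r2 = Dom C k2"
      "k2 \<cdot> r2 = r \<cdot> p2" "epi_arr C r2"
      using ex_pullback_mono[OF k2D(5), of r] p k2D f2 by (metis epi_arrD)
    have "zero_arr C ((f2 \<cdot> k2) \<cdot> r2)" by (rule zero_arr_right[OF k2D(4)]) (use p2 k2D f2 in simp_all)
    then have "zero_arr C (f2 \<cdot> r \<cdot> p2)" using p2 k2D f2 by simp
    then have "sub_le C p2 k'" using kernel_factor[OF k', of p2] g0[of p2] p2 p g by simp
    then have "sub_le C (p \<cdot> p2) (p \<cdot> k')" using sub_le_comp_left[of p2 k' p] p k'D k'p by simp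
    then have "sub_le C (p \<cdot> p2) k" using sub_le_trans[OF _ pk'] kD by simp
    then have "zero_arr C (e \<cdot> p \<cdot> p2)" using ek[of "p \<cdot> p2"] p p2 pm by simp
    then have "zero_arr C (m2 \<cdot> k2 \<cdot> r2)" using m2r[of p2] p2 p by simp
    then have "zero_arr C (k2 \<cdot> r2)" using mono_zero_iff[OF m2(1), of "k2 \<cdot> r2"] p2 k2D f2 p(1-5) by simp
    then have "zero_arr C k2" using epi_zero_iff[OF p2(7), of k2] p2 k2D by simp
    then show ?thesis by (rule kernel_zero_mono[OF k2 mono_zero_dom[OF k2D(5)]])
  qed
  then have "monoform C (Dom C i)" by (rule monoformI[OF dom_obj[OF mono_arrD[OF ei(2)]] i0])
  moreover have "subobject C (Dom C i) M" using ei f by (intro subobjectI[of i]) simp_all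
  ultimately show thesis using that by blast
qed

lemma Ass_nonempty: "\<lbrakk>noetherian C M; \<not> is_zero C M\<rbrakk> \<Longrightarrow> Ass C M \<noteq> {}"
  by (metis ex_monoform_sub AssI empty_iff)

text \<open>Take \<open>n\<close> maximal among the subobjects all of whose associated atoms lie in \<open>\<Phi>\<close>.\<close>

lemma Ass_split:
  assumes M: "noetherian C M"
  obtains n q where "short_exact C n q" "Cod C n = M" "Ass C (Dom C n) \<subseteq> \<Phi>"
    "Ass C (Cod C q) \<subseteq> Ass C M - \<Phi>"
proof -
  have Mo: "M \<in> Obj C" using M by (simp add: noetherian_def)
  define S where "S = {n. mono_arr C n \<and> Cod C n = M \<and> Ass C (Dom C n) \<subseteq> \<Phi>}"
  obtain z where z: "mono_arr C z" "Cod C z = M" "is_zero C (Dom C z)" using ex_zero_sub[OF Mo] .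
  then have "z \<in> S" using Ass_zero unfolding S_def by simp
  then obtain n where n: "n \<in> S" "\<And>n'. \<lbrakk>n' \<in> S; sub_le C n n'\<rbrakk> \<Longrightarrow> sub_le C n' n"
    using noetherian_maximal[OF M, of z S] unfolding S_def by blast
  then have nS: "mono_arr C n" "Cod C n = M" "Ass C (Dom C n) \<subseteq> \<Phi>" unfolding S_def by auto
  obtain q where q: "short_exact C n q" by (rule mono_short_exact[OF nS(1)])
  note qD = short_exactD[OF q]
  have "x \<in> Ass C M - \<Phi>" if x: "x \<in> Ass C (Cod C q)" for x
  proof -
    obtain h where h: "monoform C (Dom C h)" "mono_arr C h" "Cod C h = Cod C q" "x = atom C (Dom C h)"
      using x by (metis AssE subobjectE)
    obtain p n' r where p: "mono_arr C p" "Cod C p = Cod C n" "short_exact C n' r" "Dom C n' = Dom C n"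
      "Cod C n' = Dom C p" "Cod C r = Dom C h" "p \<cdot> n' = n" "h \<cdot> r = q \<cdot> p" "sub_le C n p"
      by (rule pullback_extension[OF q h(2,3)])
    note rD = short_exactD[OF p(3)]
    have np: "\<not> sub_le C p n"
    proof
      assume "sub_le C p n"
      then have "zero_arr C (h \<cdot> r)" using kernel_factor_iff[OF qD(1), of p] p qD by simp
      then have "zero_arr C r" using mono_zero_iff[OF h(2), of r] rD p by simp
      then have "is_zero C (Dom C h)" using epi_zero_cod rD p by metis
      then show False using monoformD[OF h(1)] by simp
    qed
    \<comment> \<open>Passing from \<open>n\<close> to \<open>p\<close> can add only the atom
      \<open>x\<close>. Since \<open>p\<close> leaves \<open>S\<close>, the atom \<open>x\<close> is
      associated to \<open>p\<close> and lies outside \<open>\<Phi>\<close>.\<close>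
    then have "p \<notin> S" using n(2) p by blast
    then have notin: "\<not> Ass C (Dom C p) \<subseteq> \<Phi>" using p nS unfolding S_def by simp
    have "Ass C (Dom C p) \<subseteq> Ass C (Dom C n) \<union> {x}"
      using Ass_extension[OF p(3)] Ass_monoform[OF h(1)] p h by simp
    then have "x \<in> Ass C (Dom C p)" "x \<notin> \<Phi>" using notin nS by auto
    moreover have "subobject C (Dom C p) M" using p nS by (intro subobjectI[of p]) simp_all
    ultimately show ?thesis using Ass_sub by blast
  qed
  then show thesis using that[OF q nS(2,3)] by blast
qed

text \<open>A noetherian generator separates the identity of \<open>M\<close> from the zero arrow;
  the image of the separating arrow is the required subobject.\<close>

lemma ex_noetherian_sub:
  assumes ln: "locally_noetherian \<kappa> C" and M: "M \<in> Obj C" "\<not> is_zero C M"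
  obtains N where "noetherian C N" "\<not> is_zero C N" "subobject C N M"
proof -
  obtain S where S: "\<And>P. P \<in> S \<Longrightarrow> noetherian C P" "generating C S"
    using ln unfolding locally_noetherian_def by blast
  obtain z where z: "zero_arr C z" "Dom C z = M" "Cod C z = M" by (rule ex_zero_arr[OF M(1) M(1)])
  have "Idt C M \<in> homs C M M" "z \<in> homs C M M" "Idt C M \<noteq> z"
    using z M by (auto simp: homs_def is_zero_iff)
  then obtain P s where P: "P \<in> S" "s \<in> homs C P M" "Idt C M \<cdot> s \<noteq> z \<cdot> s"
    using S(2) unfolding generating_def by blast
  have s: "s \<in> Arr C" "Dom C s = P" "Cod C s = M" using P by (simp_all add: homs_def)
  have s0: "\<not> zero_arr C s"
  proof
    assume "zero_arr C s"
    then have "s = z \<cdot> s" by (rule zero_arr_unique) (use z s in simp_all)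
    then show False using P s by simp
  qed
  obtain e i where ei: "epi_arr C e" "mono_arr C i" "Dom C e = Dom C s" "Cod C e = Dom C i"
    "Cod C i = Cod C s" "i \<cdot> e = s" by (rule ex_epi_mono_factor[OF s(1)])
  have "\<not> is_zero C (Dom C i)"
  proof
    assume "is_zero C (Dom C i)"
    then have "zero_arr C i" using is_zero_zero_arr ei by simp
    then have "zero_arr C s" by (rule zero_right_eq[OF _ ei(6)]) (use ei in simp_all)
    then show False using s0 by simp
  qed
  moreover have "noetherian C (Dom C i)"
    by (rule noetherian_quotient[OF S(1)[OF P(1)] quotient_objectI[OF ei(1)]]) (use ei s in simp_all)
  moreover have "subobject C (Dom C i) M" by (rule subobjectI[OF ei(2)]) (use ei s in simp_all)
  ultimately show thesis using that by blast
qed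

end

section \<open>Coproducts and direct limits\<close>

context category
begin

lemma coproductD:
  assumes "is_coproduct C I X P \<iota>"
  shows "P \<in> Obj C" "\<And>i. i \<in> I \<Longrightarrow> \<iota> i \<in> Arr C" "\<And>i. i \<in> I \<Longrightarrow> Dom C (\<iota> i) = X i" "\<And>i. i \<in> I \<Longrightarrow> Cod C (\<iota> i) = P"
  using assms unfolding is_coproduct_def homs_def by blast+

lemma coproduct_factor:
  assumes "is_coproduct C I X P \<iota>" "Y \<in> Obj C"
    "\<And>i. i \<in> I \<Longrightarrow> f i \<in> Arr C" "\<And>i. i \<in> I \<Longrightarrow> Dom C (f i) = X i" "\<And>i. i \<in> I \<Longrightarrow> Cod C (f i) = Y"
  obtains h where "h \<in> Arr C" "Dom C h = P" "Cod C h = Y" "\<And>i. i \<in> I \<Longrightarrow> h \<cdot> \<iota> i = f i"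
proof -
  have "\<forall>i\<in>I. f i \<in> homs C (X i) Y" using assms(3-5) unfolding homs_def by blast
  then have "\<exists>!h. h \<in> homs C P Y \<and> (\<forall>i\<in>I. h \<cdot> \<iota> i = f i)"
    using assms(1,2) unfolding is_coproduct_def by blast
  then show thesis using that unfolding homs_def by blast
qed

lemma coproduct_ext:
  assumes "is_coproduct C I X P \<iota>" "g \<in> Arr C" "h \<in> Arr C" "Dom C g = P" "Dom C h = P" "Cod C g = Cod C h"
    "\<And>i. i \<in> I \<Longrightarrow> g \<cdot> \<iota> i = h \<cdot> \<iota> i"
  shows "g = h"
proof -
  note D = coproductD[OF assms(1)]
  have "\<forall>i\<in>I. g \<cdot> \<iota> i \<in> homs C (X i) (Cod C g)" using assms D by (simp add: homs_def)
  then have ex1: "\<exists>!h'. h' \<in> homs C P (Cod C g) \<and> (\<forall>i\<in>I. h' \<cdot> \<iota> i = g \<cdot> \<iota> i)"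
    using assms(1)[unfolded is_coproduct_def, THEN conjunct2, THEN conjunct2, THEN bspec,
      OF cod_obj[OF assms(2)], THEN spec, of "\<lambda>i. g \<cdot> \<iota> i", THEN mp] by simp
  have "g \<in> homs C P (Cod C g)" "h \<in> homs C P (Cod C g)" using assms(2-6) by (simp_all add: homs_def)
  moreover have "\<forall>i\<in>I. h \<cdot> \<iota> i = g \<cdot> \<iota> i" using assms(7) by simp
  ultimately show ?thesis using ex1 by blast
qed

lemma direct_systemD:
  assumes "direct_system C D leq X t"
  shows "directed D leq" "\<And>i. i \<in> D \<Longrightarrow> X i \<in> Obj C"
    "\<And>i j. \<lbrakk>i \<in> D; j \<in> D; leq i j\<rbrakk> \<Longrightarrow> t i j \<in> Arr C"
    "\<And>i j. \<lbrakk>i \<in> D; j \<in> D; leq i j\<rbrakk> \<Longrightarrow> Dom C (t i j) = X i"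
    "\<And>i j. \<lbrakk>i \<in> D; j \<in> D; leq i j\<rbrakk> \<Longrightarrow> Cod C (t i j) = X j"
    "\<And>i. i \<in> D \<Longrightarrow> t i i = Idt C (X i)"
    "\<And>i j k. \<lbrakk>i \<in> D; j \<in> D; k \<in> D; leq i j; leq j k\<rbrakk> \<Longrightarrow> t j k \<cdot> t i j = t i k"
    "\<And>i. i \<in> D \<Longrightarrow> leq i i"
    "\<And>i j k. \<lbrakk>i \<in> D; j \<in> D; k \<in> D; leq i j; leq j k\<rbrakk> \<Longrightarrow> leq i k"
    "\<And>i j. \<lbrakk>i \<in> D; j \<in> D\<rbrakk> \<Longrightarrow> \<exists>k\<in>D. leq i k \<and> leq j k"
    "D \<noteq> {}"
  using assms unfolding direct_system_def directed_def homs_def by blast+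

lemma direct_systemI:
  assumes "directed D leq"
    "\<And>i. i \<in> D \<Longrightarrow> X i \<in> Obj C"
    "\<And>i j. \<lbrakk>i \<in> D; j \<in> D; leq i j\<rbrakk> \<Longrightarrow> t i j \<in> Arr C \<and> Dom C (t i j) = X i \<and> Cod C (t i j) = X j"
    "\<And>i. i \<in> D \<Longrightarrow> t i i = Idt C (X i)"
    "\<And>i j k. \<lbrakk>i \<in> D; j \<in> D; k \<in> D; leq i j; leq j k\<rbrakk> \<Longrightarrow> t j k \<cdot> t i j = t i k"
  shows "direct_system C D leq X t"
  using assms unfolding direct_system_def homs_def by blast

lemma direct_coconeI:
  assumes "L \<in> Obj C" "\<And>i. i \<in> D \<Longrightarrow> c i \<in> Arr C \<and> Dom C (c i) = X i \<and> Cod C (c i) = L"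
    "\<And>i j. \<lbrakk>i \<in> D; j \<in> D; leq i j\<rbrakk> \<Longrightarrow> c j \<cdot> t i j = c i"
  shows "direct_cocone C D leq X t L c"
  using assms unfolding direct_cocone_def homs_def by blast

lemma direct_coconeD:
  assumes "direct_cocone C D leq X t L c"
  shows "L \<in> Obj C" "\<And>i. i \<in> D \<Longrightarrow> c i \<in> Arr C" "\<And>i. i \<in> D \<Longrightarrow> Dom C (c i) = X i" "\<And>i. i \<in> D \<Longrightarrow> Cod C (c i) = L"
    "\<And>i j. \<lbrakk>i \<in> D; j \<in> D; leq i j\<rbrakk> \<Longrightarrow> c j \<cdot> t i j = c i"
  using assms unfolding direct_cocone_def homs_def by blast+

lemma direct_limit_cocone: "is_direct_limit C D leq X t L c \<Longrightarrow> direct_cocone C D leq X t L c"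
  by (simp add: is_direct_limit_def)

lemma direct_limit_factor:
  assumes "is_direct_limit C D leq X t L c" "direct_cocone C D leq X t M d"
  obtains h where "h \<in> Arr C" "Dom C h = L" "Cod C h = M" "\<And>i. i \<in> D \<Longrightarrow> h \<cdot> c i = d i"
proof -
  have "\<exists>!h. h \<in> homs C L M \<and> (\<forall>i\<in>D. h \<cdot> c i = d i)" using assms unfolding is_direct_limit_def by blast
  then show thesis using that unfolding homs_def by blast
qed

lemma direct_limit_ext:
  assumes "is_direct_limit C D leq X t L c" "g \<in> Arr C" "h \<in> Arr C" "Dom C g = L" "Dom C h = L" "Cod C g = Cod C h"
    "\<And>i. i \<in> D \<Longrightarrow> g \<cdot> c i = h \<cdot> c i" "direct_system C D leq X t"
  shows "g = h"
proof -
  note cD = direct_coconeD[OF direct_limit_cocone[OF assms(1)]] and tD = direct_systemD[OF assms(8)]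
  have "direct_cocone C D leq X t (Cod C g) (\<lambda>i. g \<cdot> c i)"
  proof (rule direct_coconeI)
    fix i j assume ij: "i \<in> D" "j \<in> D" "leq i j"
    have "g \<cdot> (c j \<cdot> t i j) = g \<cdot> c i" using cD(5)[OF ij] by simp
    then show "(g \<cdot> c j) \<cdot> t i j = g \<cdot> c i" using assms(2,4) cD(2-4)[OF ij(2)] tD(3-5)[OF ij] by simp
  qed (use assms(2,4) cD in simp_all)
  then have ex1: "\<exists>!h'. h' \<in> homs C L (Cod C g) \<and> (\<forall>i\<in>D. h' \<cdot> c i = g \<cdot> c i)"
    using assms(1)[unfolded is_direct_limit_def, THEN conjunct2, THEN spec, THEN spec, THEN mp] by blast
  have "g \<in> homs C L (Cod C g)" "h \<in> homs C L (Cod C g)" using assms(2-6) by (simp_all add: homs_def)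
  moreover have "\<forall>i\<in>D. h \<cdot> c i = g \<cdot> c i" using assms(7) by simp
  ultimately show ?thesis using ex1 by blast
qed

lemma direct_limitI:
  assumes "direct_cocone C D leq X t L c"
    "\<And>M d. direct_cocone C D leq X t M d \<Longrightarrow>
       \<exists>h. h \<in> Arr C \<and> Dom C h = L \<and> Cod C h = M \<and> (\<forall>i\<in>D. h \<cdot> c i = d i)"
    "\<And>g h. \<lbrakk>g \<in> Arr C; h \<in> Arr C; Dom C g = L; Dom C h = L; Cod C g = Cod C h;
        \<And>i. i \<in> D \<Longrightarrow> g \<cdot> c i = h \<cdot> c i\<rbrakk> \<Longrightarrow> g = h"
  shows "is_direct_limit C D leq X t L c"
  unfolding is_direct_limit_def
proof (intro conjI allI impI)
  fix M d assume d: "direct_cocone C D leq X t M d"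
  obtain h where h: "h \<in> Arr C" "Dom C h = L" "Cod C h = M" "\<forall>i\<in>D. h \<cdot> c i = d i" using assms(2)[OF d] by blast
  show "\<exists>!h. h \<in> homs C L M \<and> (\<forall>i\<in>D. h \<cdot> c i = d i)"
  proof (rule ex1I)
    show "h \<in> homs C L M \<and> (\<forall>i\<in>D. h \<cdot> c i = d i)" using h by (simp add: homs_def)
    fix g assume g: "g \<in> homs C L M \<and> (\<forall>i\<in>D. g \<cdot> c i = d i)"
    show "g = h" by (rule assms(3)) (use g h in \<open>simp_all add: homs_def\<close>)
  qed
qed (rule assms(1))

text \<open>Directedness makes any two legs of a cocone agree. The constant system supplies the
  middle term when a family of subobjects of one fixed object passes to the limit.\<close>

lemma direct_limit_const:
  assumes "directed D leq" "T \<in> Obj C"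
  shows "direct_system C D leq (\<lambda>_. T) (\<lambda>_ _. Idt C T)"
    "is_direct_limit C D leq (\<lambda>_. T) (\<lambda>_ _. Idt C T) T (\<lambda>_. Idt C T)"
proof -
  show "direct_system C D leq (\<lambda>_. T) (\<lambda>_ _. Idt C T)" by (rule direct_systemI) (use assms in simp_all)
  note dD = direct_systemD[OF this]
  show "is_direct_limit C D leq (\<lambda>_. T) (\<lambda>_ _. Idt C T) T (\<lambda>_. Idt C T)"
  proof (rule direct_limitI)
    show "direct_cocone C D leq (\<lambda>_. T) (\<lambda>_ _. Idt C T) T (\<lambda>_. Idt C T)"
      by (rule direct_coconeI) (use assms in simp_all)
    fix M d assume d: "direct_cocone C D leq (\<lambda>_. T) (\<lambda>_ _. Idt C T) M d"
    note D = direct_coconeD[OF d]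
    have eq: "d i = d j" if ij: "i \<in> D" "j \<in> D" for i j
    proof -
      obtain k where k: "k \<in> D" "leq i k" "leq j k" using dD(10)[OF ij] by blast
      show ?thesis using D(5)[OF ij(1) k(1,2)] D(5)[OF ij(2) k(1,3)] by simp
    qed
    obtain i0 where i0: "i0 \<in> D" using dD(11) by blast
    have "d i0 \<cdot> Idt C T = d i" if "i \<in> D" for i
      using trans[OF comp_idt[OF D(2,3)[OF i0]] eq[OF i0 that]] .
    then show "\<exists>h. h \<in> Arr C \<and> Dom C h = T \<and> Cod C h = M \<and> (\<forall>i\<in>D. h \<cdot> Idt C T = d i)"
      using D(2-4)[OF i0] by blast
  next
    fix g h assume *: "g \<in> Arr C" "h \<in> Arr C" "Dom C g = T" "Dom C h = T" "\<And>i. i \<in> D \<Longrightarrow> g \<cdot> Idt C T = h \<cdot> Idt C T"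
    obtain i0 where "i0 \<in> D" using dD(11) by blast
    then show "g = h" using *(5)[of i0] *(1-4) by simp
  qed
qed

end

lemma small_subset: "\<lbrakk>small \<kappa> D; E \<subseteq> D\<rbrakk> \<Longrightarrow> small \<kappa> E"
  unfolding small_def using card_of_mono1 ordLeq_ordLess_trans by blast

context abelian_category
begin

lemma coproduct_zero:
  assumes "is_coproduct C I X P \<iota>" "f \<in> Arr C" "Dom C f = P" "\<And>i. i \<in> I \<Longrightarrow> zero_arr C (f \<cdot> \<iota> i)"
  shows "zero_arr C f"
proof -
  note D = coproductD[OF assms(1)]
  obtain z where z: "zero_arr C z" "Dom C z = P" "Cod C z = Cod C f"
    using ex_zero_arr[OF D(1) cod_obj[OF assms(2)]] .
  have "z = f"
  proof (rule coproduct_ext[OF assms(1)])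
    fix i assume i: "i \<in> I"
    show "z \<cdot> \<iota> i = f \<cdot> \<iota> i" by (rule zero_arr_unique) (use assms(2,3) assms(4)[OF i] z D(1) D(2-4)[OF i] in simp_all)
  qed (use z assms in simp_all)
  then show ?thesis using z by simp
qed

text \<open>Splits off a single summand \<open>X j\<close>: the inclusion \<open>a\<close> of the
  other summands has the retraction \<open>s\<close>, and \<open>b\<close> is the projection. It
  makes a coproduct with one more summand an extension, so that closure under extensions
  applies.\<close>

lemma coproduct_split:
  assumes P: "is_coproduct C I X P \<iota>" and j: "j \<in> I" "X j \<in> Obj C" and Q: "is_coproduct C (I - {j}) X Q \<kappa>'"
  obtains a b where "short_exact C a b" "Dom C a = Q" "Cod C a = P" "Cod C b = X j"
proof -
  note pD = coproductD[OF P] and qD = coproductD[OF Q]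
  obtain a where a: "a \<in> Arr C" "Dom C a = Q" "Cod C a = P" "\<And>i. i \<in> I - {j} \<Longrightarrow> a \<cdot> \<kappa>' i = \<iota> i"
    using coproduct_factor[OF Q pD(1), of \<iota>] pD(2-4) by blast
  obtain z where z: "\<And>i. i \<in> I \<Longrightarrow> zero_arr C (z i)" "\<And>i. i \<in> I \<Longrightarrow> Dom C (z i) = X i" "\<And>i. i \<in> I \<Longrightarrow> Cod C (z i) = X j"
  proof -
    have "\<exists>z. zero_arr C z \<and> Dom C z = X i \<and> Cod C z = X j" if "i \<in> I" for i
      using ex_zero_arr[of "X i" "X j"] dom_obj[OF pD(2)[OF that]] pD(3)[OF that] j by metis
    then show thesis using that by metis
  qed
  obtain b where b: "b \<in> Arr C" "Dom C b = P" "Cod C b = X j"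
    "\<And>i. i \<in> I \<Longrightarrow> b \<cdot> \<iota> i = (if i = j then Idt C (X j) else z i)"
    by (rule coproduct_factor[OF P j(2), of "\<lambda>i. if i = j then Idt C (X j) else z i"]) (use j z in auto)
  obtain z' where z': "zero_arr C z'" "Dom C z' = X j" "Cod C z' = Q" by (rule ex_zero_arr[OF j(2) qD(1)])
  obtain s where s: "s \<in> Arr C" "Dom C s = P" "Cod C s = Q"
    "\<And>i. i \<in> I \<Longrightarrow> s \<cdot> \<iota> i = (if i = j then z' else \<kappa>' i)"
    by (rule coproduct_factor[OF P qD(1), of "\<lambda>i. if i = j then z' else \<kappa>' i"]) (use z' qD in auto)
  have "s \<cdot> a = Idt C Q"
  proof (rule coproduct_ext[OF Q])
    fix i assume i: "i \<in> I - {j}"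
    then have "s \<cdot> a \<cdot> \<kappa>' i = \<kappa>' i" using a(4)[OF i] s(4)[of i] by simp
    then show "(s \<cdot> a) \<cdot> \<kappa>' i = Idt C Q \<cdot> \<kappa>' i" using s a qD(2-4)[OF i] by simp
  qed (use s a qD in simp_all)
  then have "mono_arr C (s \<cdot> a)" using qD by simp
  then have ma: "mono_arr C a" by (rule mono_of_comp) (use s a in simp_all)
  have bj: "b \<cdot> \<iota> j = Idt C (X j)" using b(4)[OF j(1)] by simp
  then have "epi_arr C (b \<cdot> \<iota> j)" using j by simp
  then have eb: "epi_arr C b" by (rule epi_of_comp) (use b pD j in simp_all)
  have "is_cokernel C a b"
  proof (rule cokernelI[OF a(1) eb])
    show "zero_arr C (b \<cdot> a)"
    proof (rule coproduct_zero[OF Q])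
      fix i assume i: "i \<in> I - {j}"
      have "zero_arr C (b \<cdot> a \<cdot> \<kappa>' i)" using a(4)[OF i] b(4)[of i] z(1)[of i] i by simp
      then show "zero_arr C ((b \<cdot> a) \<cdot> \<kappa>' i)" using a(1-3) b(1-3) qD(2-4)[OF i] by simp
    qed (use a b in simp_all)
    fix u assume u: "u \<in> Arr C" "Dom C u = Cod C a" "zero_arr C (u \<cdot> a)"
    \<comment> \<open>An arrow killing the other summands is determined by its restriction to the
      summand \<open>j\<close>.\<close>
    define v where "v = u \<cdot> \<iota> j"
    have v: "v \<in> Arr C" "Dom C v = X j" "Cod C v = Cod C u" using u a pD(2-4)[OF j(1)] by (simp_all add: v_def)
    have "v \<cdot> b = u"
    proof (rule coproduct_ext[OF P])
      fix i assume i: "i \<in> I"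
      show "(v \<cdot> b) \<cdot> \<iota> i = u \<cdot> \<iota> i"
      proof (cases "i = j")
        case True
        then show ?thesis using bj v b pD(2-4)[OF i] by (simp add: v_def[symmetric])
      next
        case False
        then have i': "i \<in> I - {j}" using i by simp
        have "zero_arr C ((u \<cdot> a) \<cdot> \<kappa>' i)" by (rule zero_arr_right[OF u(3)]) (use u a qD(2-4)[OF i'] in simp_all)
        then have "zero_arr C (u \<cdot> \<iota> i)" using a(1-3) a(4)[OF i'] u qD(2-4)[OF i'] by simp
        moreover have "zero_arr C (v \<cdot> b \<cdot> \<iota> i)" using b(4)[OF i] False z[OF i] v by simp
        then have "zero_arr C ((v \<cdot> b) \<cdot> \<iota> i)" using v b(1-3) pD(2-4)[OF i] by simp
        ultimately show ?thesis by (intro zero_arr_unique) (use v b(1-3) pD(2-4)[OF i] u a(1-3) in simp_all)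
      qed
    qed (use v b u a in simp_all)
    then show "\<exists>v\<in>Arr C. Dom C v = Cod C b \<and> Cod C v = Cod C u \<and> v \<cdot> b = u" using v b by metis
  qed (use a b in simp_all)
  then have "short_exact C a b" using mono_kernel_cokernel[OF ma] by (simp add: short_exact_def)
  then show thesis using that a b by blast
qed

end

context grothendieck_category
begin

text \<open>The direct limit is the cokernel of the differences \<open>\<iota> j \<cdot> t i j - \<iota> i\<close>.\<close>

lemma ex_direct_limit:
  assumes D: "small \<kappa> (D :: 'k set)" and sys: "direct_system C D leq X t"
  obtains L c where "is_direct_limit C D leq X t L c"
proof -
  note tD = direct_systemD[OF sys]
  obtain P \<iota> where P: "is_coproduct C D X P \<iota>" using ex_coproduct[OF D] tD(2) by blast
  note pD = coproductD[OF P]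
  \<comment> \<open>The relations are indexed by pairs \<open>i\<close>, \<open>j\<close> with
    \<open>leq i j\<close>, but index sets are sets over the carrier of the universe cardinal. The
    pairs are therefore summed in two rounds, for fixed \<open>i\<close> over \<open>E i\<close> and
    then over \<open>i\<close>.\<close>
  define E where "E i = {j \<in> D. leq i j}" for i
  have E: "small \<kappa> (E i)" for i by (rule small_subset[OF D]) (auto simp: E_def)
  have "\<exists>Z \<mu>. is_coproduct C (E i) (\<lambda>_. X i) Z \<mu>" if "i \<in> D" for i by (rule ex_coproduct[OF E]) (rule tD(2)[OF that])
  then obtain Z \<mu> where Z: "\<And>i. i \<in> D \<Longrightarrow> is_coproduct C (E i) (\<lambda>_. X i) (Z i) (\<mu> i)" by metis
  note zD = coproductD[OF Z]
  obtain R \<nu> where R: "is_coproduct C D Z R \<nu>" using ex_coproduct[OF D, of Z] zD(1) by blast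
  note rD = coproductD[OF R]
  \<comment> \<open>\<open>w\<close> is the difference of \<open>\<iota> j \<cdot> t i j\<close> and
    \<open>\<iota> i\<close>, recorded only through the arrows that kill it.\<close>
  define Q where "Q i j w \<longleftrightarrow> w \<in> Arr C \<and> Dom C w = X i \<and> Cod C w = P \<and>
     (\<forall>g. g \<in> Arr C \<and> Dom C g = P \<longrightarrow> (zero_arr C (g \<cdot> w) \<longleftrightarrow> g \<cdot> \<iota> j \<cdot> t i j = g \<cdot> \<iota> i))" for i j w
  have ex_w: "\<exists>w. Q i j w" if ij: "i \<in> D" "j \<in> D" "leq i j" for i j
  proof -
    have 1: "\<iota> j \<cdot> t i j \<in> Arr C" "Dom C (\<iota> j \<cdot> t i j) = X i" "Cod C (\<iota> j \<cdot> t i j) = P"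
      using tD(3-5)[OF ij] pD(2-4)[OF ij(2)] by simp_all
    show ?thesis unfolding Q_def by (rule ex_difference[OF 1 pD(2-4)[OF ij(1)]]) blast
  qed
  define w where "w i j = (SOME w. Q i j w)" for i j
  have wQ: "Q i j (w i j)" if "i \<in> D" "j \<in> D" "leq i j" for i j
    using someI_ex[OF ex_w[OF that]] by (simp add: w_def)
  have w: "\<And>i j. \<lbrakk>i \<in> D; j \<in> D; leq i j\<rbrakk> \<Longrightarrow> w i j \<in> Arr C"
    "\<And>i j. \<lbrakk>i \<in> D; j \<in> D; leq i j\<rbrakk> \<Longrightarrow> Dom C (w i j) = X i"
    "\<And>i j. \<lbrakk>i \<in> D; j \<in> D; leq i j\<rbrakk> \<Longrightarrow> Cod C (w i j) = P"
    "\<And>i j g. \<lbrakk>i \<in> D; j \<in> D; leq i j; g \<in> Arr C; Dom C g = P\<rbrakk> \<Longrightarrow>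
       zero_arr C (g \<cdot> w i j) \<longleftrightarrow> g \<cdot> \<iota> j \<cdot> t i j = g \<cdot> \<iota> i"
    using wQ unfolding Q_def by blast+
  have "\<exists>h. h \<in> Arr C \<and> Dom C h = Z i \<and> Cod C h = P \<and> (\<forall>j\<in>E i. h \<cdot> \<mu> i j = w i j)" if i: "i \<in> D" for i
  proof -
    have 1: "w i j \<in> Arr C" "Dom C (w i j) = X i" "Cod C (w i j) = P" if "j \<in> E i" for j
      using w(1-3)[OF i, of j] that by (simp_all add: E_def)
    show ?thesis by (rule coproduct_factor[OF Z[OF i] pD(1) 1]) blast+
  qed
  then obtain h where h: "\<And>i. i \<in> D \<Longrightarrow> h i \<in> Arr C" "\<And>i. i \<in> D \<Longrightarrow> Dom C (h i) = Z i" "\<And>i. i \<in> D \<Longrightarrow> Cod C (h i) = P"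
    "\<And>i j. \<lbrakk>i \<in> D; j \<in> E i\<rbrakk> \<Longrightarrow> h i \<cdot> \<mu> i j = w i j" by metis
  obtain H where H: "H \<in> Arr C" "Dom C H = R" "Cod C H = P" "\<And>i. i \<in> D \<Longrightarrow> H \<cdot> \<nu> i = h i"
    using coproduct_factor[OF R pD(1), of h] h(1-3) by blast
  \<comment> \<open>Killing \<open>H\<close> is exactly the cocone condition, so the cokernel of
    \<open>H\<close> is the universal cocone.\<close>
  have H0: "zero_arr C (g \<cdot> H) \<longleftrightarrow> (\<forall>i\<in>D. \<forall>j\<in>D. leq i j \<longrightarrow> g \<cdot> \<iota> j \<cdot> t i j = g \<cdot> \<iota> i)" (is "?l = ?r")
    if g: "g \<in> Arr C" "Dom C g = P" for g
  proof
    assume l: ?l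
    show ?r
    proof (intro ballI impI)
      fix i j assume ij: "i \<in> D" "j \<in> D" "leq i j"
      then have jE: "j \<in> E i" by (simp add: E_def)
      have "zero_arr C ((g \<cdot> H) \<cdot> \<nu> i)" by (rule zero_arr_right[OF l]) (use g H(1-3) rD(2-4)[OF ij(1)] in simp_all)
      then have "zero_arr C (g \<cdot> h i)" using g H(1-3) H(4)[OF ij(1)] rD(2-4)[OF ij(1)] by simp
      then have "zero_arr C ((g \<cdot> h i) \<cdot> \<mu> i j)"
        by (rule zero_arr_right) (use g h(1-3)[OF ij(1)] zD(2-4)[OF ij(1) jE] in simp_all)
      then have "zero_arr C (g \<cdot> w i j)" using g h(1-3)[OF ij(1)] zD(2-4)[OF ij(1) jE] h(4)[OF ij(1) jE] by simp
      then show "g \<cdot> \<iota> j \<cdot> t i j = g \<cdot> \<iota> i" using w(4)[OF ij g] by simp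
    qed
  next
    assume r: ?r
    show ?l
    proof (rule coproduct_zero[OF R])
      fix i assume i: "i \<in> D"
      have "zero_arr C (g \<cdot> h i)"
      proof (rule coproduct_zero[OF Z[OF i]])
        fix j assume jE: "j \<in> E i"
        then have ij: "j \<in> D" "leq i j" by (simp_all add: E_def)
        have "zero_arr C (g \<cdot> w i j)" using w(4)[OF i ij g] r i ij by simp
        then show "zero_arr C ((g \<cdot> h i) \<cdot> \<mu> i j)"
          using g h(1-3)[OF i] zD(2-4)[OF i jE] h(4)[OF i jE] by simp
      qed (use g h(1-3)[OF i] in simp_all)
      then show "zero_arr C ((g \<cdot> H) \<cdot> \<nu> i)" using g H(1-3) H(4)[OF i] rD(2-4)[OF i] by simp
    qed (use g H in simp_all)
  qed
  obtain q where q: "is_cokernel C H q" using ex_cokernel[OF H(1)] ..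
  note qD = cokernelD[OF q]
  have qP: "Dom C q = P" using qD H by simp
  have qt: "q \<cdot> \<iota> j \<cdot> t i j = q \<cdot> \<iota> i" if "i \<in> D" "j \<in> D" "leq i j" for i j
    using H0[OF qD(2) qP] qD(4) that by blast
  have "is_direct_limit C D leq X t (Cod C q) (\<lambda>i. q \<cdot> \<iota> i)"
  proof (rule direct_limitI)
    show "direct_cocone C D leq X t (Cod C q) (\<lambda>i. q \<cdot> \<iota> i)"
    proof (rule direct_coconeI)
      fix i j assume ij: "i \<in> D" "j \<in> D" "leq i j"
      show "(q \<cdot> \<iota> j) \<cdot> t i j = q \<cdot> \<iota> i" using qt[OF ij] qD(2) qP pD(2-4)[OF ij(2)] tD(3-5)[OF ij] by simp
    qed (use qD(2) qP pD(2-4) in simp_all)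
    fix M d assume d: "direct_cocone C D leq X t M d"
    note dD = direct_coconeD[OF d]
    obtain g where g: "g \<in> Arr C" "Dom C g = P" "Cod C g = M" "\<And>i. i \<in> D \<Longrightarrow> g \<cdot> \<iota> i = d i"
      using coproduct_factor[OF P dD(1), of d] dD(2-4) by blast
    have "g \<cdot> \<iota> j \<cdot> t i j = g \<cdot> \<iota> i" if ij: "i \<in> D" "j \<in> D" "leq i j" for i j
    proof -
      have "(g \<cdot> \<iota> j) \<cdot> t i j = d i" using g(4)[OF ij(2)] dD(5)[OF ij] by simp
      then show ?thesis using g(1-3) g(4)[OF ij(1)] pD(2-4)[OF ij(2)] tD(3-5)[OF ij] by simp
    qed
    then have "zero_arr C (g \<cdot> H)" using H0[OF g(1,2)] by blast
    then obtain v where v: "v \<in> Arr C" "Dom C v = Cod C q" "Cod C v = Cod C g" "v \<cdot> q = g"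
      using cokernel_factor[OF q g(1)] g H by metis
    have "v \<cdot> q \<cdot> \<iota> i = d i" if i: "i \<in> D" for i
      using comp_eq_extend[OF v(4), of "\<iota> i"] v(1-3) qD(2) qP pD(2-4)[OF i] g(4)[OF i] by simp
    then show "\<exists>h. h \<in> Arr C \<and> Dom C h = Cod C q \<and> Cod C h = M \<and> (\<forall>i\<in>D. h \<cdot> q \<cdot> \<iota> i = d i)"
      using v(1-3) g(3) by metis
  next
    fix g h assume gh: "g \<in> Arr C" "h \<in> Arr C" "Dom C g = Cod C q" "Dom C h = Cod C q" "Cod C g = Cod C h"
      "\<And>i. i \<in> D \<Longrightarrow> g \<cdot> q \<cdot> \<iota> i = h \<cdot> q \<cdot> \<iota> i"
    have "g \<cdot> q = h \<cdot> q"
    proof (rule coproduct_ext[OF P])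
      fix i assume i: "i \<in> D"
      show "(g \<cdot> q) \<cdot> \<iota> i = (h \<cdot> q) \<cdot> \<iota> i" using gh(1-5) gh(6)[OF i] qD(2) qP pD(2-4)[OF i] by simp
    qed (use gh(1-5) qD(2) qP in simp_all)
    then show "g = h" using gh(1-5) by - (rule epi_cancel[OF qD(5)], simp_all)
  qed
  then show thesis using that by blast
qed

end

section \<open>Kernels of arrows out of direct limits\<close>

context category
begin

text \<open>Identity and composition laws of the restricted transition arrows follow from those of
  the given system by cancelling the monomorphisms. The dual lemma below cancels
  epimorphisms.\<close>

lemma direct_system_sub:
  assumes sys: "direct_system C D leq X t"
    and y: "\<And>i. i \<in> D \<Longrightarrow> mono_arr C (y i)" "\<And>i. i \<in> D \<Longrightarrow> Cod C (y i) = X i"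
    and s: "\<And>i j. \<lbrakk>i \<in> D; j \<in> D; leq i j\<rbrakk> \<Longrightarrow> s i j \<in> Arr C"
      "\<And>i j. \<lbrakk>i \<in> D; j \<in> D; leq i j\<rbrakk> \<Longrightarrow> Dom C (s i j) = Dom C (y i)"
      "\<And>i j. \<lbrakk>i \<in> D; j \<in> D; leq i j\<rbrakk> \<Longrightarrow> Cod C (s i j) = Dom C (y j)"
      "\<And>i j. \<lbrakk>i \<in> D; j \<in> D; leq i j\<rbrakk> \<Longrightarrow> y j \<cdot> s i j = t i j \<cdot> y i"
  shows "direct_system C D leq (\<lambda>i. Dom C (y i)) s"
proof (rule direct_systemI)
  note tD = direct_systemD[OF sys]
  show "directed D leq" by (rule tD(1))
  fix i assume i: "i \<in> D"
  show "Dom C (y i) \<in> Obj C" using y(1)[OF i] by simp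
  show "s i i = Idt C (Dom C (y i))"
    by (rule mono_cancel[OF y(1)[OF i]])
      (use y[OF i] s[OF i i tD(8)[OF i]] tD(6)[OF i] in simp_all)
next
  note tD = direct_systemD[OF sys]
  fix i j k assume ij: "i \<in> D" "j \<in> D" "k \<in> D" "leq i j" "leq j k"
  note sij = s[OF ij(1,2,4)] and sjk = s[OF ij(2,3,5)] and ik = tD(9)[OF ij]
  note sik = s[OF ij(1,3) ik]
  have 1: "y k \<cdot> s j k \<cdot> s i j = t j k \<cdot> y j \<cdot> s i j"
    by (rule comp_eq_extend2[OF sjk(4)]) (use sij(1-3) sjk(1-3) y[OF ij(3)] y[OF ij(2)] tD(3-5)[OF ij(2,3,5)] in simp_all)
  have 2: "t j k \<cdot> t i j \<cdot> y i = t i k \<cdot> y i"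
    by (rule comp_eq_extend[OF tD(7)[OF ij]])
      (use y[OF ij(1)] tD(3-5)[OF ij(2,3,5)] tD(3-5)[OF ij(1,2,4)] in simp_all)
  show "s j k \<cdot> s i j = s i k"
    by (rule mono_cancel[OF y(1)[OF ij(3)]])
      (use 1 2 sij sjk(1-3) sik in simp_all)
qed (use s in blast)

lemma direct_system_quotient:
  assumes sys: "direct_system C D leq X t"
    and e: "\<And>i. i \<in> D \<Longrightarrow> epi_arr C (e i)" "\<And>i. i \<in> D \<Longrightarrow> Dom C (e i) = X i"
    and v: "\<And>i j. \<lbrakk>i \<in> D; j \<in> D; leq i j\<rbrakk> \<Longrightarrow> v i j \<in> Arr C"
      "\<And>i j. \<lbrakk>i \<in> D; j \<in> D; leq i j\<rbrakk> \<Longrightarrow> Dom C (v i j) = Cod C (e i)"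
      "\<And>i j. \<lbrakk>i \<in> D; j \<in> D; leq i j\<rbrakk> \<Longrightarrow> Cod C (v i j) = Cod C (e j)"
      "\<And>i j. \<lbrakk>i \<in> D; j \<in> D; leq i j\<rbrakk> \<Longrightarrow> v i j \<cdot> e i = e j \<cdot> t i j"
  shows "direct_system C D leq (\<lambda>i. Cod C (e i)) v"
proof (rule direct_systemI)
  note tD = direct_systemD[OF sys]
  show "directed D leq" by (rule tD(1))
  fix i assume i: "i \<in> D"
  show "Cod C (e i) \<in> Obj C" using e(1)[OF i] by simp
  show "v i i = Idt C (Cod C (e i))"
    by (rule epi_cancel[OF e(1)[OF i]])
      (use e[OF i] v[OF i i tD(8)[OF i]] tD(6)[OF i] in simp_all)
next
  note tD = direct_systemD[OF sys]
  fix i j k assume ij: "i \<in> D" "j \<in> D" "k \<in> D" "leq i j" "leq j k"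
  note vij = v[OF ij(1,2,4)] and vjk = v[OF ij(2,3,5)] and ik = tD(9)[OF ij]
  note vik = v[OF ij(1,3) ik]
  have "v j k \<cdot> e j \<cdot> t i j = e k \<cdot> t j k \<cdot> t i j"
    by (rule comp_eq_extend2[OF vjk(4)]) (use vjk(1-3) e[OF ij(3)] e[OF ij(2)] tD(3-5)[OF ij(2,3,5)] tD(3-5)[OF ij(1,2,4)] in simp_all)
  then have "(v j k \<cdot> v i j) \<cdot> e i = v i k \<cdot> e i"
    using vij vjk(1-3) vik e[OF ij(1)] tD(7)[OF ij] by simp
  then show "v j k \<cdot> v i j = v i k"
    by - (rule epi_cancel[OF e(1)[OF ij(1)]], insert vij vjk(1-3) vik, simp_all)
qed (use v in blast)

end

context grothendieck_category
begin

lemma direct_limit_short_exact: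
  assumes "small \<kappa> (D :: 'k set)"
    and "direct_system C D leq X t" "direct_system C D leq Y u" "direct_system C D leq Z v"
    and fg: "\<And>i. i \<in> D \<Longrightarrow> short_exact C (f i) (g i)" "\<And>i. i \<in> D \<Longrightarrow> Dom C (f i) = X i"
      "\<And>i. i \<in> D \<Longrightarrow> Cod C (f i) = Y i" "\<And>i. i \<in> D \<Longrightarrow> Cod C (g i) = Z i"
    and sq: "\<And>i j. \<lbrakk>i \<in> D; j \<in> D; leq i j\<rbrakk> \<Longrightarrow> f j \<cdot> t i j = u i j \<cdot> f i"
      "\<And>i j. \<lbrakk>i \<in> D; j \<in> D; leq i j\<rbrakk> \<Longrightarrow> g j \<cdot> u i j = v i j \<cdot> g i"
    and lim: "is_direct_limit C D leq X t L c" "is_direct_limit C D leq Y u M d" "is_direct_limit C D leq Z v N e"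
    and f': "f' \<in> Arr C" "Dom C f' = L" "Cod C f' = M" "\<And>i. i \<in> D \<Longrightarrow> f' \<cdot> c i = d i \<cdot> f i"
    and g': "g' \<in> Arr C" "Dom C g' = M" "Cod C g' = N" "\<And>i. i \<in> D \<Longrightarrow> g' \<cdot> d i = e i \<cdot> g i"
  shows "short_exact C f' g'"
proof -
  have "\<forall>i\<in>D. f i \<in> homs C (X i) (Y i) \<and> g i \<in> homs C (Y i) (Z i) \<and> short_exact C (f i) (g i)"
  proof
    fix i assume i: "i \<in> D"
    show "f i \<in> homs C (X i) (Y i) \<and> g i \<in> homs C (Y i) (Z i) \<and> short_exact C (f i) (g i)"
      using short_exactD(5-7)[OF fg(1)[OF i]] fg[OF i] by (simp add: homs_def)
  qed
  moreover have "\<forall>i\<in>D. \<forall>j\<in>D. leq i j \<longrightarrow> f j \<cdot> t i j = u i j \<cdot> f i \<and> g j \<cdot> u i j = v i j \<cdot> g i"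
    using sq by blast
  moreover have "f' \<in> homs C L M" "g' \<in> homs C M N" using f' g' by (simp_all add: homs_def)
  moreover have "\<forall>i\<in>D. f' \<cdot> c i = d i \<cdot> f i" "\<forall>i\<in>D. g' \<cdot> d i = e i \<cdot> g i" using f'(4) g'(4) by blast+
  ultimately show ?thesis
    using direct_limits_exact[unfolded direct_limits_exact_def, THEN spec[of _ D], THEN spec[of _ leq],
        THEN spec[of _ X], THEN spec[of _ t], THEN spec[of _ Y], THEN spec[of _ u], THEN spec[of _ Z],
        THEN spec[of _ v], THEN spec[of _ f], THEN spec[of _ g], THEN spec[of _ L], THEN spec[of _ c],
        THEN spec[of _ M], THEN spec[of _ d], THEN spec[of _ N], THEN spec[of _ e], THEN spec[of _ f'],
        THEN spec[of _ g']] assms(1-4) lim by simp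
qed

text \<open>
  Exactness of direct limits in the form: a subobject \<open>n\<close> of \<open>L = lim X i\<close> that contains the images of the
  kernels of all \<open>\<pi> \<cdot> c i\<close> contains the kernel of \<open>\<pi>\<close>.  Writing \<open>Z i\<close> for the image of \<open>\<pi> \<cdot> c i\<close>,
  the limit of \<open>Z i \<rightarrow> T\<close> is a monomorphism, so the kernel of \<open>\<pi>\<close> is the limit of the kernels of \<open>X i \<rightarrow> Z i\<close>.
\<close>

lemma direct_limit_kernel_le:
  assumes D: "small \<kappa> (D :: 'k set)" and sys: "direct_system C D leq X t" and lim: "is_direct_limit C D leq X t L c"
    and pi: "\<pi> \<in> Arr C" "Dom C \<pi> = L" and n: "mono_arr C n" "Cod C n = L"
    and le: "\<And>i u. \<lbrakk>i \<in> D; u \<in> Arr C; Cod C u = X i; zero_arr C (\<pi> \<cdot> c i \<cdot> u)\<rbrakk> \<Longrightarrow> sub_le C (c i \<cdot> u) n"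
    and u: "u \<in> Arr C" "Cod C u = L" "zero_arr C (\<pi> \<cdot> u)"
  shows "sub_le C u n"
proof -
  note tD = direct_systemD[OF sys] and cD = direct_coconeD[OF direct_limit_cocone[OF lim]]
  define T where "T = Cod C \<pi>"
  have T: "T \<in> Obj C" using pi by (simp add: T_def)
  have pc: "\<pi> \<cdot> c i \<in> Arr C" "Dom C (\<pi> \<cdot> c i) = X i" "Cod C (\<pi> \<cdot> c i) = T" if "i \<in> D" for i
    using pi cD(2-4)[OF that] by (simp_all add: T_def)
  have "\<forall>i\<in>D. \<exists>e m. epi_arr C e \<and> mono_arr C m \<and> Dom C e = X i \<and> Cod C e = Dom C m \<and> Cod C m = T \<and> m \<cdot> e = \<pi> \<cdot> c i"
  proof
    fix i assume i: "i \<in> D"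
    show "\<exists>e m. epi_arr C e \<and> mono_arr C m \<and> Dom C e = X i \<and> Cod C e = Dom C m \<and> Cod C m = T \<and> m \<cdot> e = \<pi> \<cdot> c i"
      by (rule ex_epi_mono_factor[OF pc(1)[OF i]]) (unfold pc[OF i], blast)
  qed
  from bchoice[OF this] obtain e where "\<forall>i\<in>D. \<exists>m. epi_arr C (e i) \<and> mono_arr C m \<and> Dom C (e i) = X i \<and>
    Cod C (e i) = Dom C m \<and> Cod C m = T \<and> m \<cdot> e i = \<pi> \<cdot> c i" ..
  from bchoice[OF this] obtain m where "\<forall>i\<in>D. epi_arr C (e i) \<and> mono_arr C (m i) \<and> Dom C (e i) = X i \<and>
    Cod C (e i) = Dom C (m i) \<and> Cod C (m i) = T \<and> m i \<cdot> e i = \<pi> \<cdot> c i" ..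
  then have em: "\<And>i. i \<in> D \<Longrightarrow> epi_arr C (e i)" "\<And>i. i \<in> D \<Longrightarrow> mono_arr C (m i)"
    "\<And>i. i \<in> D \<Longrightarrow> Dom C (e i) = X i" "\<And>i. i \<in> D \<Longrightarrow> Cod C (e i) = Dom C (m i)"
    "\<And>i. i \<in> D \<Longrightarrow> Cod C (m i) = T" "\<And>i. i \<in> D \<Longrightarrow> m i \<cdot> e i = \<pi> \<cdot> c i"
    by blast+
  have "\<exists>y. short_exact C y (e i)" if "i \<in> D" for i using epi_short_exact[OF em(1)[OF that]] by blast
  then obtain y where ye: "\<And>i. i \<in> D \<Longrightarrow> short_exact C (y i) (e i)" by metis
  have "\<exists>k. short_exact C (m i) k" if "i \<in> D" for i using mono_short_exact[OF em(2)[OF that]] by blast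
  then obtain k where mk: "\<And>i. i \<in> D \<Longrightarrow> short_exact C (m i) (k i)" by metis
  note yeD = short_exactD[OF ye] and mkD = short_exactD[OF mk]
  have yX: "Cod C (y i) = X i" if "i \<in> D" for i using yeD(5)[OF that] em(3)[OF that] by simp
  have kT: "Dom C (k i) = T" if "i \<in> D" for i using mkD(5)[OF that] em(5)[OF that] by simp
  have me: "m i \<cdot> e i \<cdot> w = \<pi> \<cdot> c i \<cdot> w" if i: "i \<in> D" and w: "w \<in> Arr C" "Cod C w = X i" for i w
    by (rule comp_eq_extend2[OF em(6)[OF i]]) (use w em(2-5)[OF i] yeD(7)[OF i] pi cD(2-4)[OF i] in simp_all)
  have ct: "\<pi> \<cdot> c j \<cdot> t i j \<cdot> w = \<pi> \<cdot> c i \<cdot> w" if ij: "i \<in> D" "j \<in> D" "leq i j" and w: "w \<in> Arr C" "Cod C w = X i" for i j w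
    using comp_eq_extend[OF cD(5)[OF ij], of w] w cD(2-4)[OF ij(2)] tD(3-5)[OF ij] by simp
  have kery: "zero_arr C (\<pi> \<cdot> c i \<cdot> y i)" if i: "i \<in> D" for i
  proof -
    have "zero_arr C (m i \<cdot> e i \<cdot> y i)"
      by (rule zero_arr_left) (use kernelD(4)[OF yeD(1)[OF i]] em(2,4)[OF i] yeD(5-7)[OF i] in simp_all)
    then show ?thesis using me[OF i yeD(6)[OF i] yX[OF i]] by simp
  qed
  have ezero: "zero_arr C (e j \<cdot> w)" if j: "j \<in> D" and w: "w \<in> Arr C" "Cod C w = X j" "zero_arr C (\<pi> \<cdot> c j \<cdot> w)" for j w
    using me[OF j w(1,2)] w(3) mono_zero_iff[OF em(2)[OF j], of "e j \<cdot> w"] w em(3,4)[OF j] yeD(7)[OF j] by simp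

  \<comment> \<open>The kernels \<open>y i\<close> of \<open>\<pi> \<cdot> c i\<close> form a direct
    system, since \<open>t i j\<close> carries one into the next.\<close>
  define s where "s i j = (SOME s. s \<in> Arr C \<and> Dom C s = Dom C (y i) \<and> Cod C s = Dom C (y j) \<and> y j \<cdot> s = t i j \<cdot> y i)" for i j
  have s': "s i j \<in> Arr C \<and> Dom C (s i j) = Dom C (y i) \<and> Cod C (s i j) = Dom C (y j) \<and> y j \<cdot> s i j = t i j \<cdot> y i"
    if ij: "i \<in> D" "j \<in> D" "leq i j" for i j
  proof -
    have ty: "t i j \<cdot> y i \<in> Arr C" "Cod C (t i j \<cdot> y i) = X j" "Dom C (t i j \<cdot> y i) = Dom C (y i)"
      using tD(3-5)[OF ij] yeD(6)[OF ij(1)] yX[OF ij(1)] by simp_all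
    have "zero_arr C (\<pi> \<cdot> c j \<cdot> t i j \<cdot> y i)" using ct[OF ij yeD(6)[OF ij(1)] yX[OF ij(1)]] kery[OF ij(1)] by simp
    then have "zero_arr C (e j \<cdot> t i j \<cdot> y i)" using ezero[OF ij(2) ty(1,2)] by simp
    then have "sub_le C (t i j \<cdot> y i) (y j)" using kernel_factor[OF yeD(1)[OF ij(2)] ty(1)] ty em(3)[OF ij(2)] by simp
    then have "\<exists>s. s \<in> Arr C \<and> Dom C s = Dom C (y i) \<and> Cod C s = Dom C (y j) \<and> y j \<cdot> s = t i j \<cdot> y i"
      by (rule sub_leE) (unfold ty(3), blast)
    then show ?thesis unfolding s_def by (rule someI_ex)
  qed
  then have s: "\<And>i j. \<lbrakk>i \<in> D; j \<in> D; leq i j\<rbrakk> \<Longrightarrow> s i j \<in> Arr C"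
      "\<And>i j. \<lbrakk>i \<in> D; j \<in> D; leq i j\<rbrakk> \<Longrightarrow> Dom C (s i j) = Dom C (y i)"
      "\<And>i j. \<lbrakk>i \<in> D; j \<in> D; leq i j\<rbrakk> \<Longrightarrow> Cod C (s i j) = Dom C (y j)"
      "\<And>i j. \<lbrakk>i \<in> D; j \<in> D; leq i j\<rbrakk> \<Longrightarrow> y j \<cdot> s i j = t i j \<cdot> y i"
    by blast+
  have sysY: "direct_system C D leq (\<lambda>i. Dom C (y i)) s"
    by (rule direct_system_sub[OF sys yeD(3) yX s])

  \<comment> \<open>The images of \<open>\<pi> \<cdot> c i\<close> form a direct system as quotients
    of the \<open>X i\<close>.\<close>
  define v where "v i j = (SOME v. v \<in> Arr C \<and> Dom C v = Cod C (e i) \<and> Cod C v = Cod C (e j) \<and> v \<cdot> e i = e j \<cdot> t i j)" for i j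
  have v': "v i j \<in> Arr C \<and> Dom C (v i j) = Cod C (e i) \<and> Cod C (v i j) = Cod C (e j) \<and> v i j \<cdot> e i = e j \<cdot> t i j"
    if ij: "i \<in> D" "j \<in> D" "leq i j" for i j
  proof -
    have et: "e j \<cdot> t i j \<in> Arr C" "Dom C (e j \<cdot> t i j) = X i" "Cod C (e j \<cdot> t i j) = Cod C (e j)"
      using tD(3-5)[OF ij] yeD(7)[OF ij(2)] em(3)[OF ij(2)] by simp_all
    have ty: "t i j \<cdot> y i \<in> Arr C" "Cod C (t i j \<cdot> y i) = X j"
      using tD(3-5)[OF ij] yeD(6)[OF ij(1)] yX[OF ij(1)] by simp_all
    have "zero_arr C (\<pi> \<cdot> c j \<cdot> t i j \<cdot> y i)" using ct[OF ij yeD(6)[OF ij(1)] yX[OF ij(1)]] kery[OF ij(1)] by simp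
    then have "zero_arr C (e j \<cdot> t i j \<cdot> y i)" using ezero[OF ij(2) ty(1,2)] by simp
    then have "zero_arr C ((e j \<cdot> t i j) \<cdot> y i)"
      using tD(3-5)[OF ij] yeD(7)[OF ij(2)] em(3)[OF ij(2)] yeD(6)[OF ij(1)] yX[OF ij(1)] by simp
    then have "\<exists>v. v \<in> Arr C \<and> Dom C v = Cod C (e i) \<and> Cod C v = Cod C (e j) \<and> v \<cdot> e i = e j \<cdot> t i j"
      by (rule cokernel_factor[OF yeD(2)[OF ij(1)] et(1) et(2)[folded yX[OF ij(1)]]]) (unfold et(3), blast)
    then show ?thesis unfolding v_def by (rule someI_ex)
  qed
  then have v: "\<And>i j. \<lbrakk>i \<in> D; j \<in> D; leq i j\<rbrakk> \<Longrightarrow> v i j \<in> Arr C"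
      "\<And>i j. \<lbrakk>i \<in> D; j \<in> D; leq i j\<rbrakk> \<Longrightarrow> Dom C (v i j) = Cod C (e i)"
      "\<And>i j. \<lbrakk>i \<in> D; j \<in> D; leq i j\<rbrakk> \<Longrightarrow> Cod C (v i j) = Cod C (e j)"
      "\<And>i j. \<lbrakk>i \<in> D; j \<in> D; leq i j\<rbrakk> \<Longrightarrow> v i j \<cdot> e i = e j \<cdot> t i j"
    by blast+
  have sysZ: "direct_system C D leq (\<lambda>i. Cod C (e i)) v"
    by (rule direct_system_quotient[OF sys em(1) em(3) v])
  have mv: "m j \<cdot> v i j = m i" if ij: "i \<in> D" "j \<in> D" "leq i j" for i j
  proof (rule epi_cancel[OF em(1)[OF ij(1)]])
    have "(m j \<cdot> v i j) \<cdot> e i = m j \<cdot> e j \<cdot> t i j"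
      using v[OF ij] em(2,4)[OF ij(2)] yeD(7)[OF ij(1)] by simp
    also have "\<dots> = \<pi> \<cdot> c i" using me[OF ij(2) tD(3)[OF ij] tD(5)[OF ij]] cD(5)[OF ij] by simp
    finally show "(m j \<cdot> v i j) \<cdot> e i = m i \<cdot> e i" using em(6)[OF ij(1)] by simp
  qed (use v(1-3)[OF ij] em[OF ij(2)] em(2-5)[OF ij(1)] in simp_all)

  note constD = direct_limit_const[OF tD(1) T]
  \<comment> \<open>Exactness is available only for short exact sequences, so the images in
    \<open>T\<close> are completed by their cokernels, which form a third system.\<close>
  define x where "x i j = (SOME x. x \<in> Arr C \<and> Dom C x = Cod C (k i) \<and> Cod C x = Cod C (k j) \<and> x \<cdot> k i = k j)" for i j
  have x': "x i j \<in> Arr C \<and> Dom C (x i j) = Cod C (k i) \<and> Cod C (x i j) = Cod C (k j) \<and> x i j \<cdot> k i = k j"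
    if ij: "i \<in> D" "j \<in> D" "leq i j" for i j
  proof -
    have "zero_arr C ((k j \<cdot> m j) \<cdot> v i j)"
      by (rule zero_arr_right[OF kernelD(4)[OF mkD(1)[OF ij(2)]]])
        (use v(1-3)[OF ij] em(4,5)[OF ij(2)] mkD(5-7)[OF ij(2)] in simp_all)
    then have "zero_arr C (k j \<cdot> m i)" using mv[OF ij] v(1-3)[OF ij] em(4,5)[OF ij(2)] mkD(5-7)[OF ij(2)] by simp
    then have "\<exists>x. x \<in> Arr C \<and> Dom C x = Cod C (k i) \<and> Cod C x = Cod C (k j) \<and> x \<cdot> k i = k j"
      by (rule cokernel_factor[OF mkD(2)[OF ij(1)] mkD(7)[OF ij(2)] kT[OF ij(2), folded em(5)[OF ij(1)]]]) blast
    then show ?thesis unfolding x_def by (rule someI_ex)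
  qed
  then have x: "\<And>i j. \<lbrakk>i \<in> D; j \<in> D; leq i j\<rbrakk> \<Longrightarrow> x i j \<in> Arr C"
      "\<And>i j. \<lbrakk>i \<in> D; j \<in> D; leq i j\<rbrakk> \<Longrightarrow> Dom C (x i j) = Cod C (k i)"
      "\<And>i j. \<lbrakk>i \<in> D; j \<in> D; leq i j\<rbrakk> \<Longrightarrow> Cod C (x i j) = Cod C (k j)"
      "\<And>i j. \<lbrakk>i \<in> D; j \<in> D; leq i j\<rbrakk> \<Longrightarrow> x i j \<cdot> k i = k j"
    by blast+
  have kI: "k i \<cdot> Idt C T = k i" if "i \<in> D" for i using kT[OF that] mkD(7)[OF that] by simp
  have sysW: "direct_system C D leq (\<lambda>i. Cod C (k i)) x"
    by (rule direct_system_quotient[OF constD(1) mkD(4) kT x(1-3)]) (use kI x(4) in simp_all)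

  obtain Y yc where Y: "is_direct_limit C D leq (\<lambda>i. Dom C (y i)) s Y yc" by (rule ex_direct_limit[OF D sysY])
  obtain Z zc where Z: "is_direct_limit C D leq (\<lambda>i. Cod C (e i)) v Z zc" by (rule ex_direct_limit[OF D sysZ])
  obtain W wc where W: "is_direct_limit C D leq (\<lambda>i. Cod C (k i)) x W wc" by (rule ex_direct_limit[OF D sysW])
  note ycD = direct_coconeD[OF direct_limit_cocone[OF Y]] and zcD = direct_coconeD[OF direct_limit_cocone[OF Z]]
    and wcD = direct_coconeD[OF direct_limit_cocone[OF W]]

  have "direct_cocone C D leq (\<lambda>i. Dom C (y i)) s L (\<lambda>i. c i \<cdot> y i)"
  proof (rule direct_coconeI)
    fix i j assume ij: "i \<in> D" "j \<in> D" "leq i j"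
    show "(c j \<cdot> y j) \<cdot> s i j = c i \<cdot> y i"
      using comp_eq_extend[OF cD(5)[OF ij], of "y i"] s[OF ij] cD(2-4)[OF ij(2)] tD(3-5)[OF ij]
        yeD(6)[OF ij(1)] yeD(6)[OF ij(2)] yX[OF ij(1)] yX[OF ij(2)] by simp
  qed (use cD(1) cD(2-4) yeD(6) yX in simp_all)
  then obtain f' where f': "f' \<in> Arr C" "Dom C f' = Y" "Cod C f' = L" "\<And>i. i \<in> D \<Longrightarrow> f' \<cdot> yc i = c i \<cdot> y i"
    by (rule direct_limit_factor[OF Y]) blast
  have "direct_cocone C D leq X t Z (\<lambda>i. zc i \<cdot> e i)"
  proof (rule direct_coconeI)
    fix i j assume ij: "i \<in> D" "j \<in> D" "leq i j"
    show "(zc j \<cdot> e j) \<cdot> t i j = zc i \<cdot> e i"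
      using comp_eq_extend[OF zcD(5)[OF ij], of "e i"] v[OF ij] zcD(2-4)[OF ij(2)] tD(3-5)[OF ij]
        yeD(7)[OF ij(1)] yeD(7)[OF ij(2)] em(3)[OF ij(2)] by simp
  qed (use zcD(1) zcD(2-4) yeD(7) em(3) in simp_all)
  then obtain g' where g': "g' \<in> Arr C" "Dom C g' = L" "Cod C g' = Z" "\<And>i. i \<in> D \<Longrightarrow> g' \<cdot> c i = zc i \<cdot> e i"
    by (rule direct_limit_factor[OF lim]) blast
  have "direct_cocone C D leq (\<lambda>i. Cod C (e i)) v T m"
    by (rule direct_coconeI) (use T mkD(6) em(4,5) mv in simp_all)
  then obtain h where h: "h \<in> Arr C" "Dom C h = Z" "Cod C h = T" "\<And>i. i \<in> D \<Longrightarrow> h \<cdot> zc i = m i"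
    by (rule direct_limit_factor[OF Z]) blast
  have "direct_cocone C D leq (\<lambda>_. T) (\<lambda>_ _. Idt C T) W (\<lambda>i. wc i \<cdot> k i)"
  proof (rule direct_coconeI)
    fix i j assume ij: "i \<in> D" "j \<in> D" "leq i j"
    show "(wc j \<cdot> k j) \<cdot> Idt C T = wc i \<cdot> k i"
      using comp_eq_extend[OF wcD(5)[OF ij], of "k i"] x[OF ij] wcD(2-4)[OF ij(2)]
        mkD(7)[OF ij(1)] mkD(7)[OF ij(2)] kT[OF ij(2)] wcD(2-4)[OF ij(1)] kT[OF ij(1)] by simp
  qed (use wcD(1) wcD(2-4) mkD(7) kT in simp_all)
  then obtain l where l: "l \<in> Arr C" "Dom C l = T" "Cod C l = W" "\<And>i. i \<in> D \<Longrightarrow> l \<cdot> Idt C T = wc i \<cdot> k i"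
    by (rule direct_limit_factor[OF constD(2)]) blast

  \<comment> \<open>First use of exactness: the limit of the kernels \<open>y i\<close> is the
    kernel of \<open>g'\<close>.\<close>
  have fg: "short_exact C f' g'"
    by (rule direct_limit_short_exact[OF D sysY sys sysZ ye _ yX _ _ _ Y lim Z f' g']) (use s(4) v(4) in simp_all)
  \<comment> \<open>Second use: the limit of the images embeds in \<open>T\<close>, so
    \<open>h\<close> is mono.\<close>
  have hl: "short_exact C h l"
    by (rule direct_limit_short_exact[OF D sysZ constD(1) sysW mk _ _ _ _ _ Z constD(2) W h(1-3) _ l])
      (use em(4,5) mv h(4) kI x(4) mkD(6) in simp_all)
  have hg: "h \<cdot> g' = \<pi>"
  proof (rule direct_limit_ext[OF lim _ _ _ _ _ _ sys])
    fix i assume i: "i \<in> D"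
    have "h \<cdot> zc i \<cdot> e i = m i \<cdot> e i"
      by (rule comp_eq_extend[OF h(4)[OF i]]) (use h(1,2) zcD(2-4)[OF i] yeD(7)[OF i] in simp_all)
    then show "(h \<cdot> g') \<cdot> c i = \<pi> \<cdot> c i" using g'(1-3) g'(4)[OF i] h(1-3) cD(2-4)[OF i] em(6)[OF i] by simp
  qed (use h(1-3) g'(1-3) pi T_def in simp_all)

  \<comment> \<open>Since \<open>\<pi>\<close> is \<open>g'\<close> followed by the monomorphism
    \<open>h\<close>, the two have the same kernel, namely \<open>f'\<close>.\<close>
  have "h \<cdot> g' \<cdot> u = \<pi> \<cdot> u" by (rule comp_eq_extend[OF hg]) (use h(1-3) g'(1-3) u in simp_all)
  then have "zero_arr C (g' \<cdot> u)"
    using mono_zero_iff[OF short_exactD(3)[OF hl], of "g' \<cdot> u"] h(1-3) g'(1-3) u by simp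
  then have uf: "sub_le C u f'" using kernel_factor[OF short_exactD(1)[OF fg] u(1)] u g'(2) by simp

  have "\<forall>i\<in>D. \<exists>d. d \<in> Arr C \<and> Dom C d = Dom C (y i) \<and> Cod C d = Dom C n \<and> n \<cdot> d = c i \<cdot> y i"
  proof
    fix i assume i: "i \<in> D"
    have cy: "Dom C (c i \<cdot> y i) = Dom C (y i)" using cD(2-4)[OF i] yeD(6)[OF i] yX[OF i] by simp
    show "\<exists>d. d \<in> Arr C \<and> Dom C d = Dom C (y i) \<and> Cod C d = Dom C n \<and> n \<cdot> d = c i \<cdot> y i"
      by (rule sub_leE[OF le[OF i yeD(6)[OF i] yX[OF i] kery[OF i]]]) (unfold cy, blast)
  qed
  from bchoice[OF this] obtain d where
    "\<forall>i\<in>D. d i \<in> Arr C \<and> Dom C (d i) = Dom C (y i) \<and> Cod C (d i) = Dom C n \<and> n \<cdot> d i = c i \<cdot> y i" ..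
  then have d: "\<And>i. i \<in> D \<Longrightarrow> d i \<in> Arr C" "\<And>i. i \<in> D \<Longrightarrow> Dom C (d i) = Dom C (y i)"
    "\<And>i. i \<in> D \<Longrightarrow> Cod C (d i) = Dom C n" "\<And>i. i \<in> D \<Longrightarrow> n \<cdot> d i = c i \<cdot> y i"
    by blast+
  \<comment> \<open>The factorizations of all \<open>c i \<cdot> y i\<close> through
    \<open>n\<close> are compatible because \<open>n\<close> is mono; in the limit they give a
    factorization of \<open>f'\<close> through \<open>n\<close>.\<close>
  have "direct_cocone C D leq (\<lambda>i. Dom C (y i)) s (Dom C n) d"
  proof (rule direct_coconeI)
    fix i j assume ij: "i \<in> D" "j \<in> D" "leq i j"
    have "n \<cdot> d j \<cdot> s i j = c j \<cdot> y j \<cdot> s i j"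
      by (rule comp_eq_extend2[OF d(4)[OF ij(2)]])
        (use n d(1-3)[OF ij(2)] s(1-3)[OF ij] cD(2-4)[OF ij(2)] yeD(6)[OF ij(2)] yX[OF ij(2)] in simp_all)
    also have "\<dots> = c i \<cdot> y i"
      using comp_eq_extend[OF cD(5)[OF ij], of "y i"] s[OF ij] cD(2-4)[OF ij(2)] tD(3-5)[OF ij]
        yeD(6)[OF ij(1)] yX[OF ij(1)] by simp
    finally have "n \<cdot> d j \<cdot> s i j = n \<cdot> d i" using d(4)[OF ij(1)] by simp
    then show "d j \<cdot> s i j = d i"
      by - (rule mono_cancel[OF n(1)], insert d(1-3)[OF ij(2)] d(1-3)[OF ij(1)] s(1-3)[OF ij], simp_all)
  qed (use n d(1-3) in simp_all)
  then obtain \<psi> where psi: "\<psi> \<in> Arr C" "Dom C \<psi> = Y" "Cod C \<psi> = Dom C n" "\<And>i. i \<in> D \<Longrightarrow> \<psi> \<cdot> yc i = d i"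
    by (rule direct_limit_factor[OF Y]) blast
  have "n \<cdot> \<psi> = f'"
  proof (rule direct_limit_ext[OF Y _ _ _ _ _ _ sysY])
    fix i assume i: "i \<in> D"
    show "(n \<cdot> \<psi>) \<cdot> yc i = f' \<cdot> yc i" using n psi(1-3) psi(4)[OF i] ycD(2-4)[OF i] d(4)[OF i] f'(4)[OF i] by simp
  qed (use n psi(1-3) f'(1-3) in simp_all)
  then have "sub_le C f' n" using psi(1-3) f'(2) by (intro sub_leI[of \<psi>]) simp_all
  then show ?thesis using sub_le_trans[OF uf] n by simp
qed

end

section \<open>Supports of direct limits and coproducts\<close>

context category
begin

text \<open>Every summand \<open>X k\<close> appears in the segment of \<open>k\<close> itself, and
  directedness makes the pieces compatible. Along a well-ordering this turns a coproduct into a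
  limit of coproducts over closed initial segments.\<close>

lemma coproduct_limit_of_segments:
  assumes dir: "directed D leq" and P: "is_coproduct C D X P \<iota>"
    and S: "\<And>j. j \<in> D \<Longrightarrow> is_coproduct C {k \<in> D. leq k j} X (S j) (\<kappa>' j)"
  obtains t c where "direct_system C D leq S t" "is_direct_limit C D leq S t P c"
proof -
  have refl: "leq i i" if "i \<in> D" for i using dir that unfolding directed_def by blast
  have trans: "leq i k" if "i \<in> D" "j \<in> D" "k \<in> D" "leq i j" "leq j k" for i j k
    using dir that unfolding directed_def by blast
  note pD = coproductD[OF P] and sD = coproductD[OF S]
  define t where "t i j = (SOME t. t \<in> Arr C \<and> Dom C t = S i \<and> Cod C t = S j \<and> (\<forall>k\<in>D. leq k i \<longrightarrow> t \<cdot> \<kappa>' i k = \<kappa>' j k))" for i j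
  have t: "t i j \<in> Arr C \<and> Dom C (t i j) = S i \<and> Cod C (t i j) = S j \<and> (\<forall>k\<in>D. leq k i \<longrightarrow> t i j \<cdot> \<kappa>' i k = \<kappa>' j k)"
    if ij: "i \<in> D" "j \<in> D" "leq i j" for i j
  proof -
    have mem: "k \<in> {k \<in> D. leq k j}" if "k \<in> {k \<in> D. leq k i}" for k using trans[of k i j] that ij by blast
    have "\<exists>t. t \<in> Arr C \<and> Dom C t = S i \<and> Cod C t = S j \<and> (\<forall>k\<in>D. leq k i \<longrightarrow> t \<cdot> \<kappa>' i k = \<kappa>' j k)"
      by (rule coproduct_factor[OF S[OF ij(1)] sD(1)[OF ij(2)] sD(2)[OF ij(2) mem] sD(3)[OF ij(2) mem] sD(4)[OF ij(2) mem]])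
        blast+
    then show ?thesis unfolding t_def by (rule someI_ex)
  qed
  define c where "c j = (SOME c. c \<in> Arr C \<and> Dom C c = S j \<and> Cod C c = P \<and> (\<forall>k\<in>D. leq k j \<longrightarrow> c \<cdot> \<kappa>' j k = \<iota> k))" for j
  have c: "c j \<in> Arr C \<and> Dom C (c j) = S j \<and> Cod C (c j) = P \<and> (\<forall>k\<in>D. leq k j \<longrightarrow> c j \<cdot> \<kappa>' j k = \<iota> k)"
    if j: "j \<in> D" for j
  proof -
    have mem: "k \<in> D" if "k \<in> {k \<in> D. leq k j}" for k using that by blast
    have "\<exists>c. c \<in> Arr C \<and> Dom C c = S j \<and> Cod C c = P \<and> (\<forall>k\<in>D. leq k j \<longrightarrow> c \<cdot> \<kappa>' j k = \<iota> k)"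
      by (rule coproduct_factor[OF S[OF j] pD(1) pD(2)[OF mem] pD(3)[OF mem] pD(4)[OF mem]]) blast+
    then show ?thesis unfolding c_def by (rule someI_ex)
  qed
  have ext: "f = g" if j: "j \<in> D" and fg: "f \<in> Arr C" "g \<in> Arr C" "Dom C f = S j" "Dom C g = S j" "Cod C f = Cod C g"
    "\<And>k. \<lbrakk>k \<in> D; leq k j\<rbrakk> \<Longrightarrow> f \<cdot> \<kappa>' j k = g \<cdot> \<kappa>' j k" for f g j
    by (rule coproduct_ext[OF S[OF j] fg(1-5)]) (use fg(6) in blast)
  have kD: "\<kappa>' j k \<in> Arr C" "Dom C (\<kappa>' j k) = X k" "Cod C (\<kappa>' j k) = S j" if "j \<in> D" "k \<in> D" "leq k j" for j k
    using sD(2-4)[OF that(1), of k] that by simp_all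
  have sys: "direct_system C D leq S t"
  proof (rule direct_systemI[OF dir])
    fix i assume i: "i \<in> D"
    show "S i \<in> Obj C" by (rule sD(1)[OF i])
    show "t i i = Idt C (S i)"
      by (rule ext[OF i]) (use t[OF i i refl[OF i]] sD(1)[OF i] kD[OF i] in auto)
  next
    fix i j k assume ij: "i \<in> D" "j \<in> D" "k \<in> D" "leq i j" "leq j k"
    note tij = t[OF ij(1,2,4)] and tjk = t[OF ij(2,3,5)] and tik = t[OF ij(1,3) trans[OF ij]]
    show "t j k \<cdot> t i j = t i k"
    proof (rule ext[OF ij(1)])
      fix l assume l: "l \<in> D" "leq l i"
      have lj: "leq l j" by (rule trans[OF l(1) ij(1,2) l(2) ij(4)])
      show "(t j k \<cdot> t i j) \<cdot> \<kappa>' i l = t i k \<cdot> \<kappa>' i l"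
        using tij tjk tik kD[OF ij(1) l] l lj by simp
    qed (use tij tjk tik in simp_all)
  qed (use t in blast)
  have "is_direct_limit C D leq S t P c"
  proof (rule direct_limitI)
    show "direct_cocone C D leq S t P c"
    proof (rule direct_coconeI[OF pD(1)])
      fix i j assume ij: "i \<in> D" "j \<in> D" "leq i j"
      show "c j \<cdot> t i j = c i"
      proof (rule ext[OF ij(1)])
        fix l assume l: "l \<in> D" "leq l i"
        have lj: "leq l j" by (rule trans[OF l(1) ij(1,2) l(2) ij(3)])
        show "(c j \<cdot> t i j) \<cdot> \<kappa>' i l = c i \<cdot> \<kappa>' i l"
          using t[OF ij] c[OF ij(1)] c[OF ij(2)] kD[OF ij(1) l] l lj by simp
      qed (use t[OF ij] c[OF ij(1)] c[OF ij(2)] in simp_all)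
    qed (use c in blast)
    fix M d assume d: "direct_cocone C D leq S t M d"
    note dD = direct_coconeD[OF d]
    \<comment> \<open>A cocone on the segments is restricted to the summand \<open>k\<close> through
      the leg at \<open>k\<close>; reflexivity puts \<open>k\<close> into its own segment.\<close>
    have dk: "d k \<cdot> \<kappa>' k k \<in> Arr C" "Dom C (d k \<cdot> \<kappa>' k k) = X k" "Cod C (d k \<cdot> \<kappa>' k k) = M" if "k \<in> D" for k
      using dD(2-4)[OF that] kD[OF that that refl[OF that]] by simp_all
    have "\<exists>h. h \<in> Arr C \<and> Dom C h = P \<and> Cod C h = M \<and> (\<forall>k\<in>D. h \<cdot> \<iota> k = d k \<cdot> \<kappa>' k k)"
      by (rule coproduct_factor[OF P dD(1) dk]) blast+
    then obtain h where "h \<in> Arr C \<and> Dom C h = P \<and> Cod C h = M \<and> (\<forall>k\<in>D. h \<cdot> \<iota> k = d k \<cdot> \<kappa>' k k)" ..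
    then have h: "h \<in> Arr C" "Dom C h = P" "Cod C h = M" "\<And>k. k \<in> D \<Longrightarrow> h \<cdot> \<iota> k = d k \<cdot> \<kappa>' k k"
      by blast+
    have "h \<cdot> c j = d j" if j: "j \<in> D" for j
    proof (rule ext[OF j])
      fix l assume l: "l \<in> D" "leq l j"
      note tl = t[OF l(1) j l(2)] and k1 = kD[OF l(1) l(1) refl[OF l(1)]]
      have "d j \<cdot> t l j \<cdot> \<kappa>' l l = d l \<cdot> \<kappa>' l l"
        by (rule comp_eq_extend[OF dD(5)[OF l(1) j l(2)]]) (use dD(2-4)[OF j] tl k1 in simp_all)
      then have "d j \<cdot> \<kappa>' j l = d l \<cdot> \<kappa>' l l" using tl l refl[OF l(1)] by simp
      then show "(h \<cdot> c j) \<cdot> \<kappa>' j l = d j \<cdot> \<kappa>' j l" using h(1-3) h(4)[OF l(1)] c[OF j] kD[OF j l] l by simp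
    qed (use h(1-3) c[OF j] dD(2-4)[OF j] in simp_all)
    then show "\<exists>h. h \<in> Arr C \<and> Dom C h = P \<and> Cod C h = M \<and> (\<forall>i\<in>D. h \<cdot> c i = d i)" using h(1-3) by blast
  next
    fix g h assume gh: "g \<in> Arr C" "h \<in> Arr C" "Dom C g = P" "Dom C h = P" "Cod C g = Cod C h"
      "\<And>i. i \<in> D \<Longrightarrow> g \<cdot> c i = h \<cdot> c i"
    show "g = h"
    proof (rule coproduct_ext[OF P gh(1-5)])
      fix k assume k: "k \<in> D"
      note ck = c[OF k] and k1 = kD[OF k k refl[OF k]]
      have "g \<cdot> c k \<cdot> \<kappa>' k k = h \<cdot> c k \<cdot> \<kappa>' k k"
        by (rule comp_eq_extend2[OF gh(6)[OF k]]) (use ck k1 gh(1-5) in simp_all)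
      then show "g \<cdot> \<iota> k = h \<cdot> \<iota> k" using ck k refl[OF k] by simp
    qed
  qed
  then show thesis using that sys by blast
qed

end

context grothendieck_category
begin

text \<open>Let \<open>H\<close> be the quotient of \<open>L1 \<subseteq> L\<close> by
  \<open>k\<close>. If its atom lies in no \<open>Supp C (X i)\<close>, then the inverse image of
  \<open>L1\<close> in each \<open>X i\<close> maps to zero in \<open>H\<close>, hence into
  \<open>k\<close>. By \<open>direct_limit_kernel_le\<close>, applied to the quotient of
  \<open>L\<close> by \<open>L1\<close>, all of \<open>L1\<close> lies in \<open>k\<close>, so
  \<open>H\<close> would be zero.\<close>

lemma Supp_direct_limit:
  assumes D: "small \<kappa> (D :: 'k set)" and sys: "direct_system C D leq X t" and lim: "is_direct_limit C D leq X t L c"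
  shows "Supp C L \<subseteq> (\<Union>i\<in>D. Supp C (X i))"
proof
  fix x assume "x \<in> Supp C L"
  then obtain H L1 where H: "monoform C H" "subobject C L1 L" "quotient_object C H L1" "x = atom C H" by (rule SuppE)
  obtain l where l: "mono_arr C l" "Dom C l = L1" "Cod C l = L" using H(2) by (rule subobjectE)
  obtain h where h: "epi_arr C h" "Dom C h = L1" "Cod C h = H" using H(3) by (rule quotient_objectE)
  obtain q where q: "short_exact C l q" by (rule mono_short_exact[OF l(1)])
  obtain k where k: "short_exact C k h" by (rule epi_short_exact[OF h(1)])
  note qD = short_exactD[OF q] and kD = short_exactD[OF k]
    and cD = direct_coconeD[OF direct_limit_cocone[OF lim]]
  show "x \<in> (\<Union>i\<in>D. Supp C (X i))"
  proof (rule ccontr)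
    assume x: "x \<notin> (\<Union>i\<in>D. Supp C (X i))"
    have kc: "Cod C k = L1" using kD(5) h by simp
    have "sub_le C l (l \<cdot> k)"
    proof (rule direct_limit_kernel_le[OF D sys lim])
      show "q \<in> Arr C" "Dom C q = L" using qD l by simp_all
      show "mono_arr C (l \<cdot> k)" "Cod C (l \<cdot> k) = L" using mono_comp[OF l(1) kD(3)] kc kD l by simp_all
      show "l \<in> Arr C" "Cod C l = L" "zero_arr C (q \<cdot> l)" using l kernelD(4)[OF qD(1)] by simp_all
      fix i u assume i: "i \<in> D" and u: "u \<in> Arr C" "Cod C u = X i" "zero_arr C (q \<cdot> c i \<cdot> u)"
      note ci = cD(2-4)[OF i]
      obtain p r where p: "mono_arr C p" "Cod C p = Dom C (c i)" "r \<in> Arr C" "Dom C r = Dom C p" "Cod C r = Dom C l"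
        "l \<cdot> r = c i \<cdot> p" "\<And>u. \<lbrakk>u \<in> Arr C; Cod C u = Dom C (c i)\<rbrakk> \<Longrightarrow> sub_le C u p \<longleftrightarrow> sub_le C (c i \<cdot> u) l"
        using ex_pullback_mono[OF l(1) ci(1)] ci l by metis
      have hr: "zero_arr C (h \<cdot> r)"
      proof (rule ccontr)
        assume "\<not> zero_arr C (h \<cdot> r)"
        moreover have "subobject C (Dom C (h \<cdot> r)) (X i)"
          by (rule subobjectI[OF p(1)]) (use p(2-5) ci h l in simp_all)
        ultimately have "x \<in> Supp C (X i)"
          using Supp_nonzero_map[OF H(1), of "h \<cdot> r" "X i"] p(3,5) h l H(4) by simp
        then show False using x i by blast
      qed
      have "sub_le C (c i \<cdot> u) l" using kernel_factor[OF qD(1), of "c i \<cdot> u"] u ci l qD by simp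
      then have "sub_le C u p" using p(7)[of u] u ci by simp
      then obtain v where v: "v \<in> Arr C" "Dom C v = Dom C u" "Cod C v = Dom C p" "p \<cdot> v = u" by (rule sub_leE)
      have "zero_arr C ((h \<cdot> r) \<cdot> v)" by (rule zero_arr_right[OF hr]) (use v p(3-5) h l in simp_all)
      then have "sub_le C (r \<cdot> v) k" using kernel_factor[OF kD(1), of "r \<cdot> v"] v p(3-5) h l by simp
      then have "sub_le C (l \<cdot> r \<cdot> v) (l \<cdot> k)" using sub_le_comp_left[of "r \<cdot> v" k l] kD kc l by simp
      moreover have "l \<cdot> r \<cdot> v = c i \<cdot> p \<cdot> v"
        by (rule comp_eq_extend2[OF p(6)]) (use v p(1-5) ci l in simp_all)
      ultimately show "sub_le C (c i \<cdot> u) (l \<cdot> k)" using v by simp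
    qed
    then have "sub_le C (l \<cdot> Idt C L1) (l \<cdot> k)" using l by simp
    then have "sub_le C (Idt C L1) k"
      by - (rule sub_le_mono_cancel[OF l(1)], insert l kD(6) kc dom_obj[OF mono_arrD[OF l(1)]], simp_all)
    then have "zero_arr C (h \<cdot> Idt C L1)"
      using kernel_factor_iff[OF kD(1), of "Idt C L1"] h dom_obj[OF mono_arrD[OF l(1)]] l by simp
    then have "is_zero C H" using epi_zero_cod[OF h(1)] h by simp
    then show False using monoformD[OF H(1)] by simp
  qed
qed

text \<open>A coproduct is built by transfinite recursion along a well-ordering of the index set.\<close>

lemma Supp_coproduct:
  assumes I: "small \<kappa> (I :: 'k set)" and P: "is_coproduct C I X P \<iota>"
  shows "Supp C P \<subseteq> (\<Union>i\<in>I. Supp C (X i))"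
proof -
  note pD = coproductD[OF P]
  have Xo: "X i \<in> Obj C" if "i \<in> I" for i using dom_obj[OF pD(2)[OF that]] pD(3)[OF that] by simp
  obtain r where r: "well_order_on I r" using well_order_on by blast
  then have ro: "refl_on I r" "trans r" "antisym r" "total_on I r" "wf (r - Id)"
    unfolding well_order_on_def linear_order_on_def partial_order_on_def preorder_on_def by auto
  define leq where "leq a b \<longleftrightarrow> (a, b) \<in> r" for a b
  have leq: "leq a a" if "a \<in> I" for a using ro(1) that by (simp add: leq_def refl_on_def)
  have tr: "leq a c" if "leq a b" "leq b c" for a b c using ro(2) that unfolding leq_def trans_def by blast
  have tot: "leq a b \<or> leq b a" if "a \<in> I" "b \<in> I" for a b
    using ro(4) leq that unfolding leq_def total_on_def by metis
  have dir: "directed E leq" if "E \<subseteq> I" "E \<noteq> {}" for E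
    unfolding directed_def
  proof (intro conjI ballI impI)
    fix i j assume "i \<in> E" "j \<in> E"
    then show "\<exists>k\<in>E. leq i k \<and> leq j k" using tot[of i j] leq that by (metis subsetD)
  qed (use that leq tr in blast)+
  have sm: "small \<kappa> E" if "E \<subseteq> I" for E using small_subset[OF I that] .
  have "\<exists>S \<kappa>'. is_coproduct C {k \<in> I. leq k j} X S \<kappa>'" for j
    by (rule ex_coproduct[OF sm]) (use Xo in auto)
  then have "\<exists>S. \<forall>j. \<exists>\<kappa>'. is_coproduct C {k \<in> I. leq k j} X (S j) \<kappa>'" by (intro choice) blast
  then obtain S where "\<forall>j. \<exists>\<kappa>'. is_coproduct C {k \<in> I. leq k j} X (S j) \<kappa>'" ..
  from choice[OF this] obtain \<kappa>' where "\<forall>j. is_coproduct C {k \<in> I. leq k j} X (S j) (\<kappa>' j)" ..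
  then have S: "is_coproduct C {k \<in> I. leq k j} X (S j) (\<kappa>' j)" for j by blast
  let ?U = "\<Union>i\<in>I. Supp C (X i)"
  \<comment> \<open>The limit stage, for a down-closed \<open>E\<close> whose closed segments are
    settled. It serves both the strict segment below an index and, at the end, all of
    \<open>I\<close>.\<close>
  have lim: "Supp C Q \<subseteq> ?U" if E: "E \<subseteq> I" "\<And>j k. \<lbrakk>j \<in> E; k \<in> I; leq k j\<rbrakk> \<Longrightarrow> k \<in> E"
    and Q: "is_coproduct C E X Q \<nu>" and IH: "\<And>j. j \<in> E \<Longrightarrow> Supp C (S j) \<subseteq> ?U" for E Q \<nu>
  proof (cases "E = {}")
    case True
    have "zero_arr C (Idt C Q)" by (rule coproduct_zero[OF Q]) (use coproductD(1)[OF Q] True in simp_all)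
    then have "is_zero C Q" using coproductD(1)[OF Q] by (simp add: is_zero_iff)
    then show ?thesis using Supp_zero by simp
  next
    case False
    have seg: "is_coproduct C {k \<in> E. leq k j} X (S j) (\<kappa>' j)" if j: "j \<in> E" for j
    proof -
      have "{k \<in> E. leq k j} = {k \<in> I. leq k j}" using E j by blast
      then show ?thesis using S by simp
    qed
    obtain t c where "direct_system C E leq S t" "is_direct_limit C E leq S t Q c"
      by (rule coproduct_limit_of_segments[OF dir[OF E(1) False] Q seg])
    then have "Supp C Q \<subseteq> (\<Union>i\<in>E. Supp C (S i))" by (rule Supp_direct_limit[OF sm[OF E(1)]])
    then show ?thesis using IH by blast
  qed
  have seg: "j \<in> I \<longrightarrow> Supp C (S j) \<subseteq> ?U" for j
  proof (induction j rule: wf_induct_rule[OF ro(5)])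
    case (1 j)
    show ?case
    proof
      assume j: "j \<in> I"
      \<comment> \<open>The strict segment below \<open>j\<close>. Removing \<open>j\<close> leaves
        only indices to which the induction hypothesis applies.\<close>
      define E where "E = {k \<in> I. leq k j} - {j}"
      have EI: "E \<subseteq> I" by (auto simp: E_def)
      have "\<exists>Q \<nu>. is_coproduct C E X Q \<nu>" by (rule ex_coproduct[OF sm[OF EI]]) (use Xo EI in blast)
      then obtain Q \<nu> where Q: "is_coproduct C E X Q \<nu>" by blast
      have "Supp C Q \<subseteq> ?U"
      proof (rule lim[OF EI _ Q])
        fix i k assume ik: "i \<in> E" "k \<in> I" "leq k i"
        have ij: "leq i j" "i \<noteq> j" using ik(1) by (simp_all add: E_def)
        have "leq k j" by (rule tr[OF ik(3) ij(1)])
        moreover have "k \<noteq> j" using ij ik(3) antisymD[OF ro(3), of i j] unfolding leq_def by blast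
        ultimately show "k \<in> E" using ik(2) by (simp add: E_def)
      next
        fix i assume "i \<in> E"
        then show "Supp C (S i) \<subseteq> ?U" using 1[of i] by (auto simp: E_def leq_def)
      qed
      \<comment> \<open>The closed segment differs from the strict one by the single summand
        \<open>X j\<close>, so its coproduct is an extension of \<open>X j\<close> by
        \<open>Q\<close>.\<close>
      moreover obtain a b where ab: "short_exact C a b" "Dom C a = Q" "Cod C a = S j" "Cod C b = X j"
        
        by (rule coproduct_split[OF S[of j] _ Xo[OF j] Q[unfolded E_def]]) (use j leq in simp)
      ultimately show "Supp C (S j) \<subseteq> ?U" using Supp_extension[OF ab(1)] ab j by auto
    qed
  qed
  show ?thesis by (rule lim[OF _ _ P]) (use seg in auto)
qed

end

section \<open>Autoequivalences\<close>

context category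
begin

lemma functorD:
  assumes "is_endofunctor C F"
  shows "X \<in> Obj C \<Longrightarrow> OMap F X \<in> Obj C"
    "f \<in> Arr C \<Longrightarrow> AMap F f \<in> Arr C" "f \<in> Arr C \<Longrightarrow> Dom C (AMap F f) = OMap F (Dom C f)"
    "f \<in> Arr C \<Longrightarrow> Cod C (AMap F f) = OMap F (Cod C f)"
    "X \<in> Obj C \<Longrightarrow> AMap F (Idt C X) = Idt C (OMap F X)"
    "\<lbrakk>f \<in> Arr C; g \<in> Arr C; Cod C f = Dom C g\<rbrakk> \<Longrightarrow> AMap F (g \<cdot> f) = AMap F g \<cdot> AMap F f"
proof -
  show "X \<in> Obj C \<Longrightarrow> OMap F X \<in> Obj C" "X \<in> Obj C \<Longrightarrow> AMap F (Idt C X) = Idt C (OMap F X)"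
    using assms unfolding is_endofunctor_def by blast+
  have "AMap F f \<in> homs C (OMap F (Dom C f)) (OMap F (Cod C f))" if "f \<in> Arr C" for f
  proof -
    have "f \<in> homs C (Dom C f) (Cod C f)" using that by (simp add: homs_def)
    then show ?thesis using assms unfolding is_endofunctor_def by blast
  qed
  then show "f \<in> Arr C \<Longrightarrow> AMap F f \<in> Arr C" "f \<in> Arr C \<Longrightarrow> Dom C (AMap F f) = OMap F (Dom C f)"
    "f \<in> Arr C \<Longrightarrow> Cod C (AMap F f) = OMap F (Cod C f)" by (simp_all add: homs_def)
  assume fg: "f \<in> Arr C" "g \<in> Arr C" "Cod C f = Dom C g"
  then have "f \<in> homs C (Dom C f) (Dom C g)" "g \<in> homs C (Dom C g) (Cod C g)" by (simp_all add: homs_def)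
  then show "AMap F (g \<cdot> f) = AMap F g \<cdot> AMap F f" using assms unfolding is_endofunctor_def by blast
qed

lemma isomorphicI: "\<lbrakk>iso_arr C f; Dom C f = X; Cod C f = Y\<rbrakk> \<Longrightarrow> isomorphic C X Y"
  unfolding isomorphic_def homs_def using iso_arrD by blast

lemma isomorphicE:
  assumes "isomorphic C X Y"
  obtains f g where "f \<in> Arr C" "g \<in> Arr C" "Dom C f = X" "Cod C f = Y" "Dom C g = Y" "Cod C g = X"
    "g \<cdot> f = Idt C X" "f \<cdot> g = Idt C Y"
  using assms unfolding isomorphic_def iso_arr_def homs_def by blast

lemma isomorphicI2:
  "\<lbrakk>f \<in> Arr C; g \<in> Arr C; Dom C f = X; Cod C f = Y; Dom C g = Y; Cod C g = X;
    g \<cdot> f = Idt C X; f \<cdot> g = Idt C Y\<rbrakk> \<Longrightarrow> isomorphic C X Y"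
  unfolding isomorphic_def iso_arr_def homs_def by blast

lemma isomorphic_trans:
  assumes "isomorphic C X Y" "isomorphic C Y Z"
  shows "isomorphic C X Z"
proof -
  obtain f g where f: "f \<in> Arr C" "g \<in> Arr C" "Dom C f = X" "Cod C f = Y" "Dom C g = Y" "Cod C g = X"
    "g \<cdot> f = Idt C X" "f \<cdot> g = Idt C Y" using assms(1) by (rule isomorphicE)
  obtain h k where h: "h \<in> Arr C" "k \<in> Arr C" "Dom C h = Y" "Cod C h = Z" "Dom C k = Z" "Cod C k = Y"
    "k \<cdot> h = Idt C Y" "h \<cdot> k = Idt C Z" using assms(2) by (rule isomorphicE)
  have "k \<cdot> h \<cdot> f = f" using comp_eq_extend[OF h(7), of f] f h by simp
  moreover have "f \<cdot> g \<cdot> k = k" using comp_eq_extend[OF f(8), of k] f h by simp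
  ultimately show ?thesis by (intro isomorphicI2[of "h \<cdot> f" "g \<cdot> k"]) (use f h in simp_all)
qed

lemma isomorphic_functor:
  assumes "is_endofunctor C F" "isomorphic C X Y"
  shows "isomorphic C (OMap F X) (OMap F Y)"
proof -
  obtain f g where f: "f \<in> Arr C" "g \<in> Arr C" "Dom C f = X" "Cod C f = Y" "Dom C g = Y" "Cod C g = X"
    "g \<cdot> f = Idt C X" "f \<cdot> g = Idt C Y" using assms(2) by (rule isomorphicE)
  have XY: "X \<in> Obj C" "Y \<in> Obj C" using dom_obj[OF f(1)] dom_obj[OF f(2)] f(3,5) by simp_all
  note FD = functorD[OF assms(1)]
  have c: "AMap F (g \<cdot> f) = AMap F g \<cdot> AMap F f" "AMap F (f \<cdot> g) = AMap F f \<cdot> AMap F g"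
    by (rule FD(6), insert f(1-6), simp_all)+
  have "AMap F g \<cdot> AMap F f = Idt C (OMap F X)" "AMap F f \<cdot> AMap F g = Idt C (OMap F Y)"
    using c[symmetric] unfolding f(7,8) FD(5)[OF XY(1)] FD(5)[OF XY(2)] .
  then show ?thesis
    by - (rule isomorphicI2[of "AMap F f" "AMap F g"], insert FD(2-4)[OF f(1)] FD(2-4)[OF f(2)] f(3-6), simp_all)
qed

lemma nat_isomorphic_obj: "\<lbrakk>nat_isomorphic C F K; X \<in> Obj C\<rbrakk> \<Longrightarrow> isomorphic C (OMap F X) (OMap K X)"
  unfolding nat_isomorphic_def isomorphic_def by blast

lemma nat_isomorphic_refl: "is_endofunctor C F \<Longrightarrow> nat_isomorphic C F F"
proof -
  assume F: "is_endofunctor C F"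
  have iso: "iso_arr C (Idt C (OMap F X))" if "X \<in> Obj C" for X
    unfolding iso_arr_def homs_def using functorD(1)[OF F that] by simp
  show ?thesis unfolding nat_isomorphic_def
  proof (intro exI[of _ "\<lambda>X. Idt C (OMap F X)"] conjI ballI allI)
    fix X assume X: "X \<in> Obj C"
    show "Idt C (OMap F X) \<in> homs C (OMap F X) (OMap F X)" using functorD(1)[OF F X] by (simp add: homs_def)
    show "iso_arr C (Idt C (OMap F X))" by (rule iso[OF X])
  next
    fix X Y f assume "f \<in> homs C X Y"
    then have f: "f \<in> Arr C" "Dom C f = X" "Cod C f = Y" by (simp_all add: homs_def)
    show "Idt C (OMap F Y) \<cdot> AMap F f = AMap F f \<cdot> Idt C (OMap F X)"
      using functorD(2-4)[OF F f(1)] f by simp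
  qed
qed

end

text \<open>The data are symmetric in \<open>F\<close> and \<open>K\<close>, and no triangle
  identities are demanded; \<open>swap\<close> carries each fact about one functor to the
  other.\<close>

locale equivalence_pair = abelian_category C for C :: "('o, 'a, 'm) cat_scheme" (structure) +
  fixes F K :: "('o, 'a) endofunctor"
  assumes F: "is_endofunctor C F" and K: "is_endofunctor C K"
    and FK: "nat_isomorphic C (functor_comp F K) functor_id"
    and KF: "nat_isomorphic C (functor_comp K F) functor_id"
begin

lemma swap: "equivalence_pair C K F"
  by unfold_locales (rule K F KF FK)+

lemma ex_counit:
  obtains \<epsilon> where "\<And>X. X \<in> Obj C \<Longrightarrow> \<epsilon> X \<in> Arr C" "\<And>X. X \<in> Obj C \<Longrightarrow> Dom C (\<epsilon> X) = OMap F (OMap K X)"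
    "\<And>X. X \<in> Obj C \<Longrightarrow> Cod C (\<epsilon> X) = X" "\<And>X. X \<in> Obj C \<Longrightarrow> iso_arr C (\<epsilon> X)"
    "\<And>f. f \<in> Arr C \<Longrightarrow> \<epsilon> (Cod C f) \<cdot> AMap F (AMap K f) = f \<cdot> \<epsilon> (Dom C f)"
proof -
  obtain \<epsilon> where e: "\<forall>X \<in> Obj C. \<epsilon> X \<in> homs C (OMap F (OMap K X)) X \<and> iso_arr C (\<epsilon> X)"
    "\<forall>X Y. \<forall>f \<in> homs C X Y. \<epsilon> Y \<cdot> AMap F (AMap K f) = f \<cdot> \<epsilon> X"
    using FK unfolding nat_isomorphic_def functor_comp_def functor_id_def by auto
  show thesis
  proof (rule that[of \<epsilon>])
    fix f assume "f \<in> Arr C"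
    then have "f \<in> homs C (Dom C f) (Cod C f)" by (simp add: homs_def)
    then show "\<epsilon> (Cod C f) \<cdot> AMap F (AMap K f) = f \<cdot> \<epsilon> (Dom C f)" using e(2) by blast
  qed (use e(1) in \<open>simp_all add: homs_def\<close>)
qed

text \<open>The counit is a natural isomorphism, so \<open>AMap F (AMap K f)\<close>, and hence
  \<open>AMap K f\<close>, determines \<open>f\<close>.\<close>

lemma K_faithful:
  assumes fg: "f \<in> Arr C" "g \<in> Arr C" "Dom C f = Dom C g" "Cod C f = Cod C g" "AMap K f = AMap K g"
  shows "f = g"
proof -
  obtain \<epsilon> where e: "\<And>X. X \<in> Obj C \<Longrightarrow> \<epsilon> X \<in> Arr C" "\<And>X. X \<in> Obj C \<Longrightarrow> Dom C (\<epsilon> X) = OMap F (OMap K X)"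
    "\<And>X. X \<in> Obj C \<Longrightarrow> Cod C (\<epsilon> X) = X" "\<And>X. X \<in> Obj C \<Longrightarrow> iso_arr C (\<epsilon> X)"
    "\<And>f. f \<in> Arr C \<Longrightarrow> \<epsilon> (Cod C f) \<cdot> AMap F (AMap K f) = f \<cdot> \<epsilon> (Dom C f)" by (rule ex_counit) blast
  have "f \<cdot> \<epsilon> (Dom C g) = g \<cdot> \<epsilon> (Dom C g)" using e(5)[OF fg(1)] e(5)[OF fg(2)] fg(3-5) by simp
  then show ?thesis
    by - (rule epi_cancel[OF iso_epi[OF e(4)[OF dom_obj[OF fg(2)]]]], insert fg(1-4) e(1-3)[OF dom_obj[OF fg(2)]], simp_all)
qed

lemma FK_isomorphic: "X \<in> Obj C \<Longrightarrow> isomorphic C (OMap F (OMap K X)) X"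
  using nat_isomorphic_obj[OF FK] by (simp add: functor_comp_def functor_id_def)

text \<open>By naturality, applying \<open>K\<close> to \<open>AMap F f\<close> gives back
  \<open>f\<close> up to isomorphisms, and \<open>f\<close> can be cancelled there; faithfulness of
  \<open>K\<close> finishes. The epimorphism case is analogous.\<close>

lemma F_mono:
  assumes f: "mono_arr C f" shows "mono_arr C (AMap F f)"
proof (rule mono_arrI)
  interpret sw: equivalence_pair C K F by (rule swap)
  obtain \<eta> where e: "\<And>X. X \<in> Obj C \<Longrightarrow> \<eta> X \<in> Arr C" "\<And>X. X \<in> Obj C \<Longrightarrow> Dom C (\<eta> X) = OMap K (OMap F X)"
    "\<And>X. X \<in> Obj C \<Longrightarrow> Cod C (\<eta> X) = X" "\<And>X. X \<in> Obj C \<Longrightarrow> iso_arr C (\<eta> X)"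
    "\<And>f. f \<in> Arr C \<Longrightarrow> \<eta> (Cod C f) \<cdot> AMap K (AMap F f) = f \<cdot> \<eta> (Dom C f)" by (rule sw.ex_counit) blast
  have fa: "f \<in> Arr C" using f by simp
  note Ff = functorD(2-4)[OF F fa]
  note ed = e(1-3)[OF dom_obj[OF fa]] and ec = e(1-3)[OF cod_obj[OF fa]] and nat = e(5)[OF fa]
  note KFf = functorD(2-4)[OF K Ff(1)]
  show "AMap F f \<in> Arr C" by (rule Ff)
  fix u v assume uv: "u \<in> Arr C" "v \<in> Arr C" "Dom C u = Dom C v" "Cod C u = Dom C (AMap F f)"
    "Cod C v = Dom C (AMap F f)" "AMap F f \<cdot> u = AMap F f \<cdot> v"
  note Ku = functorD(2-4)[OF K uv(1)] and Kv = functorD(2-4)[OF K uv(2)]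
  have "AMap K (AMap F f) \<cdot> AMap K u = AMap K (AMap F f) \<cdot> AMap K v"
    using functorD(6)[OF K uv(1) Ff(1) uv(4)] functorD(6)[OF K uv(2) Ff(1) uv(5)] uv(6) by simp
  then have "\<eta> (Cod C f) \<cdot> AMap K (AMap F f) \<cdot> AMap K u = \<eta> (Cod C f) \<cdot> AMap K (AMap F f) \<cdot> AMap K v" by simp
  moreover have "\<eta> (Cod C f) \<cdot> AMap K (AMap F f) \<cdot> AMap K w = f \<cdot> \<eta> (Dom C f) \<cdot> AMap K w"
    if "w \<in> Arr C" "Cod C w = Dom C (AMap F f)" for w
    by (rule comp_eq_extend2[OF nat]) (use KFf ed ec Ff fa functorD(2-4)[OF K that(1)] that(2) in simp_all)
  ultimately have "f \<cdot> \<eta> (Dom C f) \<cdot> AMap K u = f \<cdot> \<eta> (Dom C f) \<cdot> AMap K v" using uv by simp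
  then have "\<eta> (Dom C f) \<cdot> AMap K u = \<eta> (Dom C f) \<cdot> AMap K v"
    by - (rule mono_cancel[OF f], insert Ku Kv uv(4,5) Ff ed, simp_all)
  then have "AMap K u = AMap K v"
    by - (rule mono_cancel[OF iso_mono[OF e(4)[OF dom_obj[OF fa]]]], insert Ku Kv uv(4,5) Ff ed, simp_all)
  then show "u = v" by - (rule K_faithful, insert uv(1-5), simp_all)
qed

lemma F_epi:
  assumes f: "epi_arr C f" shows "epi_arr C (AMap F f)"
proof (rule epi_arrI)
  interpret sw: equivalence_pair C K F by (rule swap)
  obtain \<eta> where e: "\<And>X. X \<in> Obj C \<Longrightarrow> \<eta> X \<in> Arr C" "\<And>X. X \<in> Obj C \<Longrightarrow> Dom C (\<eta> X) = OMap K (OMap F X)"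
    "\<And>X. X \<in> Obj C \<Longrightarrow> Cod C (\<eta> X) = X" "\<And>X. X \<in> Obj C \<Longrightarrow> iso_arr C (\<eta> X)"
    "\<And>f. f \<in> Arr C \<Longrightarrow> \<eta> (Cod C f) \<cdot> AMap K (AMap F f) = f \<cdot> \<eta> (Dom C f)" by (rule sw.ex_counit) blast
  have fa: "f \<in> Arr C" using f by simp
  note Ff = functorD(2-4)[OF F fa]
  note ed = e(1-3)[OF dom_obj[OF fa]] and ec = e(1-3)[OF cod_obj[OF fa]] and nat = e(5)[OF fa]
  note KFf = functorD(2-4)[OF K Ff(1)]
  show "AMap F f \<in> Arr C" by (rule Ff)
  obtain \<theta> where th: "\<theta> \<in> Arr C" "Dom C \<theta> = Cod C f" "Cod C \<theta> = OMap K (OMap F (Cod C f))"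
    "\<theta> \<cdot> \<eta> (Cod C f) = Idt C (OMap K (OMap F (Cod C f)))" "iso_arr C \<theta>"
    using iso_arrE[OF e(4)[OF cod_obj[OF fa]]] ec by metis
  have "\<theta> \<cdot> \<eta> (Cod C f) \<cdot> AMap K (AMap F f) = AMap K (AMap F f)"
    using comp_eq_extend[OF th(4), of "AMap K (AMap F f)"] th(1-3) ec KFf Ff by simp
  then have KFf_eq: "AMap K (AMap F f) = \<theta> \<cdot> f \<cdot> \<eta> (Dom C f)" using nat by simp
  fix u v assume uv: "u \<in> Arr C" "v \<in> Arr C" "Cod C u = Cod C v" "Dom C u = Cod C (AMap F f)"
    "Dom C v = Cod C (AMap F f)" "u \<cdot> AMap F f = v \<cdot> AMap F f"
  note Ku = functorD(2-4)[OF K uv(1)] and Kv = functorD(2-4)[OF K uv(2)]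
  have "AMap K u \<cdot> AMap K (AMap F f) = AMap K v \<cdot> AMap K (AMap F f)"
    using functorD(6)[OF K Ff(1) uv(1)] functorD(6)[OF K Ff(1) uv(2)] uv(4-6) by simp
  then have "AMap K u \<cdot> \<theta> \<cdot> f \<cdot> \<eta> (Dom C f) = AMap K v \<cdot> \<theta> \<cdot> f \<cdot> \<eta> (Dom C f)" by (simp only: KFf_eq)
  then have "(AMap K u \<cdot> \<theta> \<cdot> f) \<cdot> \<eta> (Dom C f) = (AMap K v \<cdot> \<theta> \<cdot> f) \<cdot> \<eta> (Dom C f)"
    using Ku Kv uv(4,5) Ff th(1-3) ed fa by simp
  then have "AMap K u \<cdot> \<theta> \<cdot> f = AMap K v \<cdot> \<theta> \<cdot> f"
    by - (rule epi_cancel[OF iso_epi[OF e(4)[OF dom_obj[OF fa]]]], insert Ku Kv uv(4,5) Ff th(1-3) ed fa, simp_all)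
  then have "(AMap K u \<cdot> \<theta>) \<cdot> f = (AMap K v \<cdot> \<theta>) \<cdot> f"
    using Ku Kv uv(4,5) Ff th(1-3) fa by simp
  then have "AMap K u \<cdot> \<theta> = AMap K v \<cdot> \<theta>"
    by - (rule epi_cancel[OF f], insert Ku Kv uv(4,5) Ff th(1-3) fa, simp_all)
  then have "AMap K u = AMap K v"
    by - (rule epi_cancel[OF iso_epi[OF th(5)]], insert Ku Kv uv(4,5) Ff th(1-3) fa, simp_all)
  then show "u = v" by - (rule K_faithful, insert uv(1-5), simp_all)
qed

lemma F_subobject: "subobject C L M \<Longrightarrow> subobject C (OMap F L) (OMap F M)"
  using F_mono functorD(3,4)[OF F] by (metis subobjectE subobjectI mono_arrD)

lemma F_quotient: "quotient_object C L M \<Longrightarrow> quotient_object C (OMap F L) (OMap F M)"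
  using F_epi functorD(3,4)[OF F] by (metis quotient_objectE quotient_objectI epi_arrD)

text \<open>\<open>K\<close> sends the identity and the zero endomorphism of \<open>OMap F Z\<close>
  to arrows into an object isomorphic to \<open>Z\<close>. They agree there, so they agree by
  faithfulness.\<close>

lemma F_zero:
  assumes "is_zero C Z" shows "is_zero C (OMap F Z)"
proof -
  interpret sw: equivalence_pair C K F by (rule swap)
  have Z: "Z \<in> Obj C" using is_zero_obj[OF assms] .
  have FZ: "OMap F Z \<in> Obj C" using functorD(1)[OF F Z] .
  have 0: "is_zero C (OMap K (OMap F Z))"
    by (rule is_zero_sub[OF isomorphic_sub[OF sw.FK_isomorphic[OF Z]] assms])
  obtain z where z: "zero_arr C z" "Dom C z = OMap F Z" "Cod C z = OMap F Z" by (rule ex_zero_arr[OF FZ FZ])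
  have za: "z \<in> Arr C" using z by simp
  have "AMap K z = AMap K (Idt C (OMap F Z))"
    by (rule is_zero_into[OF 0]) (use functorD(2-4)[OF K za] functorD(2-4)[OF K, of "Idt C (OMap F Z)"] z FZ in simp_all)
  then have "z = Idt C (OMap F Z)" by - (rule K_faithful, insert z za FZ, simp_all)
  then show ?thesis using z FZ by (simp add: is_zero_iff)
qed

lemma F_zero_iff:
  assumes "X \<in> Obj C" shows "is_zero C (OMap F X) \<longleftrightarrow> is_zero C X"
proof
  interpret sw: equivalence_pair C K F by (rule swap)
  assume "is_zero C (OMap F X)"
  then have "is_zero C (OMap K (OMap F X))" by (rule sw.F_zero)
  then show "is_zero C X" using is_zero_sub isomorphic_sub isomorphic_sym[OF sw.FK_isomorphic[OF assms]] by blast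
qed (rule F_zero)

lemma F_zero_arr: "zero_arr C f \<Longrightarrow> zero_arr C (AMap F f)"
proof -
  assume f: "zero_arr C f"
  obtain Z a b where ab: "is_zero C Z" "a \<in> Arr C" "b \<in> Arr C" "Dom C a = Dom C f" "Cod C a = Z"
    "Dom C b = Z" "Cod C b = Cod C f" "b \<cdot> a = f" using f by (rule zero_arrE)
  have "zero_arr C (AMap F b \<cdot> AMap F a)"
    by (rule zero_arrI[OF F_zero[OF ab(1)]]) (use functorD(2-4)[OF F ab(2)] functorD(2-4)[OF F ab(3)] ab in simp_all)
  then show ?thesis using functorD(6)[OF F ab(2,3)] ab by simp
qed

text \<open>\<open>K\<close> maps a chain of subobjects of \<open>OMap F M\<close> to a chain in an
  object isomorphic to \<open>M\<close>. The latter becomes stationary; applying \<open>F\<close>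
  and the counit brings the factorizations back.\<close>

lemma F_noetherian:
  assumes M: "noetherian C M" shows "noetherian C (OMap F M)"
  unfolding noetherian_def
proof (intro conjI allI impI)
  interpret sw: equivalence_pair C K F by (rule swap)
  have Mo: "M \<in> Obj C" using M by (simp add: noetherian_def)
  show FM: "OMap F M \<in> Obj C" by (rule functorD(1)[OF F Mo])
  fix m :: "nat \<Rightarrow> 'a"
  assume m: "\<forall>n. mono_arr C (m n) \<and> Cod C (m n) = OMap F M \<and> sub_le C (m n) (m (Suc n))"
  obtain \<epsilon> where e: "\<And>X. X \<in> Obj C \<Longrightarrow> \<epsilon> X \<in> Arr C" "\<And>X. X \<in> Obj C \<Longrightarrow> Dom C (\<epsilon> X) = OMap F (OMap K X)"
    "\<And>X. X \<in> Obj C \<Longrightarrow> Cod C (\<epsilon> X) = X" "\<And>X. X \<in> Obj C \<Longrightarrow> iso_arr C (\<epsilon> X)"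
    "\<And>f. f \<in> Arr C \<Longrightarrow> \<epsilon> (Cod C f) \<cdot> AMap F (AMap K f) = f \<cdot> \<epsilon> (Dom C f)" by (rule ex_counit) blast
  have KFM: "noetherian C (OMap K (OMap F M))"
    by (rule noetherian_sub[OF M isomorphic_sub[OF sw.FK_isomorphic[OF Mo]]])
  have ma: "m n \<in> Arr C" "Cod C (m n) = OMap F M" for n using m by auto
  note Km = functorD(2-4)[OF K ma(1)]
  have le: "sub_le C (AMap E u) (AMap E v)" if "is_endofunctor C E" "sub_le C u v" "v \<in> Arr C" for E u v
    using that(2)
  proof (rule sub_leE)
    fix h assume h: "h \<in> Arr C" "Dom C h = Dom C u" "Cod C h = Dom C v" "v \<cdot> h = u"
    have u: "u \<in> Arr C" using h that(3) by auto
    show ?thesis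
      using functorD(2-4)[OF that(1) h(1)] functorD(2-4)[OF that(1) u] functorD(2-4)[OF that(1,3)]
        functorD(6)[OF that(1) h(1) that(3) h(3)] h(2-4)
      by (intro sub_leI[of "AMap E h"]) simp_all
  qed
  have "\<forall>n. mono_arr C (AMap K (m n)) \<and> Cod C (AMap K (m n)) = OMap K (OMap F M) \<and>
      sub_le C (AMap K (m n)) (AMap K (m (Suc n)))"
    using m sw.F_mono Km ma le[OF K] by simp
  then obtain N where N: "\<forall>n\<ge>N. sub_le C (AMap K (m n)) (AMap K (m N))"
    using KFM[unfolded noetherian_def, THEN conjunct2, THEN spec, of "\<lambda>n. AMap K (m n)"] by blast
  have "sub_le C (m n) (m N)" if n: "n \<ge> N" for n
  proof -
    have 1: "sub_le C (AMap F (AMap K (m n))) (AMap F (AMap K (m N)))" using le[OF F _ Km(1)] N n by blast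
    note eF = e(1-3)[OF FM] and FKm = functorD(2-4)[OF F Km(1)]
    have 2: "\<epsilon> (OMap F M) \<cdot> AMap F (AMap K (m l)) = m l \<cdot> \<epsilon> (Dom C (m l))" for l
      using e(5)[OF ma(1)[of l]] ma(2) by simp
    have "sub_le C (\<epsilon> (OMap F M) \<cdot> AMap F (AMap K (m n))) (\<epsilon> (OMap F M) \<cdot> AMap F (AMap K (m N)))"
      by (rule sub_le_comp_left[OF 1]) (use eF FKm Km ma in simp_all)
    then have 3: "sub_le C (m n \<cdot> \<epsilon> (Dom C (m n))) (m N \<cdot> \<epsilon> (Dom C (m N)))" unfolding 2 .
    have 4: "sub_le C (m N \<cdot> \<epsilon> (Dom C (m N))) (m N)"
      by (rule sub_le_comp) (use ma e(1-3)[OF dom_obj[OF ma(1)]] in simp_all)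
    show ?thesis
      by (rule sub_le_epi_cancel[OF iso_epi[OF e(4)[OF dom_obj[OF ma(1)]]] _ _ _ _ sub_le_trans[OF 3 4]])
        (use m ma e(1-3)[OF dom_obj[OF ma(1)]] in simp_all)
  qed
  then show "\<exists>N. \<forall>n\<ge>N. sub_le C (m n) (m N)" by blast
qed

text \<open>Uses the arrow criterion \<open>monoform_iff\<close>: \<open>K\<close> transports the
  subobject and the arrow into an object isomorphic to \<open>H\<close>, and the counit transports
  the conclusion back.\<close>

lemma F_monoform:
  assumes H: "monoform C H" shows "monoform C (OMap F H)"
proof (rule monoformI)
  interpret sw: equivalence_pair C K F by (rule swap)
  note Ho = monoformD[OF H]
  show "OMap F H \<in> Obj C" by (rule functorD(1)[OF F Ho(1)])
  show "\<not> is_zero C (OMap F H)" using F_zero_iff[OF Ho(1)] Ho(2) by simp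
  fix m f assume m: "mono_arr C m" "Cod C m = OMap F H"
    and f: "f \<in> Arr C" "Dom C f = Dom C m" "Cod C f = OMap F H" "\<not> zero_arr C f"
  obtain \<epsilon> where e: "\<And>X. X \<in> Obj C \<Longrightarrow> \<epsilon> X \<in> Arr C" "\<And>X. X \<in> Obj C \<Longrightarrow> Dom C (\<epsilon> X) = OMap F (OMap K X)"
    "\<And>X. X \<in> Obj C \<Longrightarrow> Cod C (\<epsilon> X) = X" "\<And>X. X \<in> Obj C \<Longrightarrow> iso_arr C (\<epsilon> X)"
    "\<And>f. f \<in> Arr C \<Longrightarrow> \<epsilon> (Cod C f) \<cdot> AMap F (AMap K f) = f \<cdot> \<epsilon> (Dom C f)" by (rule ex_counit) blast
  have ma: "m \<in> Arr C" using m by simp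
  note Km = functorD(2-4)[OF K ma] and Kf = functorD(2-4)[OF K f(1)]
  note FKf = functorD(2-4)[OF F Kf(1)]
  note ed = e(1-3)[OF dom_obj[OF f(1)]] and ec = e(1-3)[OF cod_obj[OF f(1)]]
  have KFH: "monoform C (OMap K (OMap F H))"
    by (rule monoform_sub[OF H isomorphic_sub[OF sw.FK_isomorphic[OF Ho(1)]]])
      (use sw.F_zero_iff[OF functorD(1)[OF F Ho(1)]] F_zero_iff[OF Ho(1)] Ho(2) in simp)
  have "\<not> zero_arr C (AMap K f)"
  proof
    assume "zero_arr C (AMap K f)"
    then have "zero_arr C (AMap F (AMap K f))" by (rule F_zero_arr)
    then have "zero_arr C (f \<cdot> \<epsilon> (Dom C f))"
      by (rule zero_left_eq[OF _ e(5)[OF f(1)]]) (use FKf Kf ec in simp_all)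
    then have "zero_arr C f" using epi_zero_iff[OF iso_epi[OF e(4)[OF dom_obj[OF f(1)]]] f(1)] ed by simp
    then show False using f by simp
  qed
  then have "mono_arr C (AMap K f)"
    by - (rule monoform_mono[OF KFH sw.F_mono[OF m(1)]], insert Km Kf m f, simp_all)
  then have "mono_arr C (AMap F (AMap K f))" by (rule F_mono)
  then have "mono_arr C (\<epsilon> (Cod C f) \<cdot> AMap F (AMap K f))"
    by - (rule mono_comp[OF iso_mono[OF e(4)[OF cod_obj[OF f(1)]]]], insert ec FKf Kf, simp_all)
  then have 1: "mono_arr C (f \<cdot> \<epsilon> (Dom C f))" using e(5)[OF f(1)] by simp
  obtain \<theta> where th: "\<theta> \<in> Arr C" "Dom C \<theta> = Dom C f" "Cod C \<theta> = OMap F (OMap K (Dom C f))"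
    "\<epsilon> (Dom C f) \<cdot> \<theta> = Idt C (Dom C f)" "iso_arr C \<theta>"
    using iso_arrE[OF e(4)[OF dom_obj[OF f(1)]]] ed by metis
  have "mono_arr C ((f \<cdot> \<epsilon> (Dom C f)) \<cdot> \<theta>)" by (rule mono_comp[OF 1 iso_mono[OF th(5)]]) (use th ed f in simp)
  then show "mono_arr C f" using th ed f by simp
qed

lemma F_atom_eq:
  assumes "monoform C H" "monoform C L" "atom C H = atom C L"
  shows "atom C (OMap F H) = atom C (OMap F L)"
proof -
  obtain N where N: "\<not> is_zero C N" "subobject C N H" "subobject C N L" "N \<in> Obj C"
    using assms(3) unfolding atom_eq_iff[OF assms(1,2)] by (rule common_nonzero_subobjectE)
  show ?thesis unfolding atom_eq_iff[OF F_monoform[OF assms(1)] F_monoform[OF assms(2)]]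
    by (rule common_nonzero_subobjectI[of "OMap F N"]) (use N F_zero_iff F_subobject in auto)
qed

end

lemma (in abelian_category) isomorphic_atom:
  assumes "monoform C H" "isomorphic C L H"
  shows "monoform C L" "atom C L = atom C H"
proof -
  have "\<not> is_zero C L" using is_zero_sub isomorphic_sub isomorphic_sym[OF assms(2)] monoformD(2)[OF assms(1)] by blast
  then show "monoform C L" "atom C L = atom C H"
    using monoform_sub[OF assms(1)] atom_sub[OF assms(1)] isomorphic_sub[OF assms(2)] by blast+
qed

section \<open>Group actions\<close>

locale acted_category = abelian_category C for C :: "('o, 'a, 'm) cat_scheme" (structure) +
  fixes G :: "('g, 'n) monoid_scheme" and \<rho> :: "'g \<Rightarrow> ('o, 'a) endofunctor set"
  assumes action: "is_action G C \<rho>"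
begin

sublocale group G using action by (simp add: is_action_def)

lemma rho_class:
  assumes "g \<in> carrier G"
  obtains E where "E \<in> autoequivalences C" "\<rho> g = nat_iso_rel C `` {E}"
proof -
  have "\<rho> g \<in> autoequivalences C // nat_iso_rel C"
    using action assms unfolding is_action_def hom_def autoequivalence_group_def by auto
  then show thesis using that by (auto elim: quotientE)
qed

lemma rho_nonempty: "g \<in> carrier G \<Longrightarrow> \<exists>F. F \<in> \<rho> g"
proof -
  assume "g \<in> carrier G"
  then obtain E where E: "E \<in> autoequivalences C" "\<rho> g = nat_iso_rel C `` {E}" by (rule rho_class)
  then have "E \<in> \<rho> g" using nat_isomorphic_refl[of E] by (auto simp: nat_iso_rel_def autoequivalences_def)
  then show ?thesis by blast
qed

lemma rho_isomorphic:
  assumes "g \<in> carrier G" "F \<in> \<rho> g" "K \<in> \<rho> g" "X \<in> Obj C"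
  shows "isomorphic C (OMap F X) (OMap K X)"
proof -
  obtain E where E: "E \<in> autoequivalences C" "\<rho> g = nat_iso_rel C `` {E}" by (rule rho_class[OF assms(1)])
  then have "nat_isomorphic C E F" "nat_isomorphic C E K" using assms by (auto simp: nat_iso_rel_def)
  then show ?thesis
    using isomorphic_trans[OF isomorphic_sym[OF nat_isomorphic_obj] nat_isomorphic_obj] assms(4) by blast
qed

lemma rho_autoequivalence: "\<lbrakk>g \<in> carrier G; F \<in> \<rho> g\<rbrakk> \<Longrightarrow> F \<in> autoequivalences C"
  by (auto elim!: rho_class simp: nat_iso_rel_def)

definition repr where "repr g = (SOME F. F \<in> \<rho> g)"

lemma repr_in: "g \<in> carrier G \<Longrightarrow> repr g \<in> \<rho> g"
  unfolding repr_def using rho_nonempty by (rule someI_ex)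

lemma act_repr: "act \<rho> g X = OMap (repr g) X"
  by (simp add: act_def repr_def)

lemma repr_equivalence:
  assumes "g \<in> carrier G"
  obtains K where "equivalence_pair C (repr g) K"
proof -
  have "repr g \<in> autoequivalences C" using rho_autoequivalence[OF assms repr_in[OF assms]] .
  then obtain K where "is_endofunctor C (repr g)" "is_endofunctor C K"
    "nat_isomorphic C (functor_comp (repr g) K) functor_id" "nat_isomorphic C (functor_comp K (repr g)) functor_id"
    unfolding autoequivalences_def by blast
  then have "equivalence_pair C (repr g) K" by unfold_locales
  then show thesis by (rule that)
qed

lemma repr_functor: "g \<in> carrier G \<Longrightarrow> is_endofunctor C (repr g)"
  using repr_equivalence equivalence_pair.F by blast

lemma act_obj: "\<lbrakk>g \<in> carrier G; X \<in> Obj C\<rbrakk> \<Longrightarrow> act \<rho> g X \<in> Obj C"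
  unfolding act_repr using functorD(1)[OF repr_functor] by blast

lemma act_sub: "\<lbrakk>g \<in> carrier G; subobject C X Y\<rbrakk> \<Longrightarrow> subobject C (act \<rho> g X) (act \<rho> g Y)"
  unfolding act_repr by (metis repr_equivalence equivalence_pair.F_subobject)

lemma act_quotient: "\<lbrakk>g \<in> carrier G; quotient_object C X Y\<rbrakk> \<Longrightarrow> quotient_object C (act \<rho> g X) (act \<rho> g Y)"
  unfolding act_repr by (metis repr_equivalence equivalence_pair.F_quotient)

lemma act_noetherian: "\<lbrakk>g \<in> carrier G; noetherian C X\<rbrakk> \<Longrightarrow> noetherian C (act \<rho> g X)"
  unfolding act_repr by (metis repr_equivalence equivalence_pair.F_noetherian)

lemma act_monoform: "\<lbrakk>g \<in> carrier G; monoform C X\<rbrakk> \<Longrightarrow> monoform C (act \<rho> g X)"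
  unfolding act_repr by (metis repr_equivalence equivalence_pair.F_monoform)

lemma act_atom_eq:
  "\<lbrakk>g \<in> carrier G; monoform C H; monoform C L; atom C H = atom C L\<rbrakk> \<Longrightarrow>
    atom C (act \<rho> g H) = atom C (act \<rho> g L)"
  unfolding act_repr by (metis repr_equivalence equivalence_pair.F_atom_eq)

lemma act_isomorphic: "\<lbrakk>g \<in> carrier G; isomorphic C X Y\<rbrakk> \<Longrightarrow> isomorphic C (act \<rho> g X) (act \<rho> g Y)"
  unfolding act_repr by (rule isomorphic_functor[OF repr_functor])

text \<open>\<open>\<rho>\<close> is multiplicative only on isomorphism classes. Some composite of
  members of \<open>\<rho> g\<close> and \<open>\<rho> h\<close> is naturally isomorphic to the
  chosen representative of the product, and members of one class agree on objects up to
  isomorphism.\<close>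

lemma act_mult:
  assumes "g \<in> carrier G" "h \<in> carrier G" "X \<in> Obj C"
  shows "isomorphic C (act \<rho> (g \<otimes>\<^bsub>G\<^esub> h) X) (act \<rho> g (act \<rho> h X))"
proof -
  have gh: "g \<otimes>\<^bsub>G\<^esub> h \<in> carrier G" using assms by simp
  have "\<rho> (g \<otimes>\<^bsub>G\<^esub> h) = (\<Union>F\<in>\<rho> g. \<Union>K\<in>\<rho> h. nat_iso_rel C `` {functor_comp F K})"
    using action assms unfolding is_action_def hom_def autoequivalence_group_def by auto
  then obtain F K where FK: "F \<in> \<rho> g" "K \<in> \<rho> h" "nat_isomorphic C (functor_comp F K) (repr (g \<otimes>\<^bsub>G\<^esub> h))"
    using repr_in[OF gh] by (auto simp: nat_iso_rel_def)
  have KX: "OMap K X \<in> Obj C"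
    using rho_autoequivalence[OF assms(2) FK(2)] functorD(1)[of K] assms by (auto simp: autoequivalences_def)
  have a: "isomorphic C (OMap F (OMap K X)) (act \<rho> (g \<otimes>\<^bsub>G\<^esub> h) X)"
    using nat_isomorphic_obj[OF FK(3) assms(3)] by (simp add: act_repr functor_comp_def)
  have b: "isomorphic C (OMap F (OMap K X)) (act \<rho> g (OMap K X))"
    unfolding act_repr by (rule rho_isomorphic[OF assms(1) FK(1) repr_in[OF assms(1)] KX])
  have "isomorphic C (OMap K X) (act \<rho> h X)"
    unfolding act_repr by (rule rho_isomorphic[OF assms(2) FK(2) repr_in[OF assms(2)] assms(3)])
  then have c: "isomorphic C (act \<rho> g (OMap K X)) (act \<rho> g (act \<rho> h X))" by (rule act_isomorphic[OF assms(1)])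
  show ?thesis by (rule isomorphic_trans[OF isomorphic_sym[OF a] isomorphic_trans[OF b c]])
qed

text \<open>Multiplicativity at the unit gives \<open>E (E X)\<close> isomorphic to
  \<open>E X\<close> for the representative \<open>E\<close>; a quasi-inverse cancels one
  \<open>E\<close>.\<close>

lemma act_one:
  assumes "X \<in> Obj C"
  shows "isomorphic C (act \<rho> \<one>\<^bsub>G\<^esub> X) X"
proof -
  have one: "\<one>\<^bsub>G\<^esub> \<in> carrier G" by simp
  obtain K where "equivalence_pair C (repr \<one>\<^bsub>G\<^esub>) K" by (rule repr_equivalence[OF one])
  then interpret E: equivalence_pair C "repr \<one>\<^bsub>G\<^esub>" K .
  interpret sw: equivalence_pair C K "repr \<one>\<^bsub>G\<^esub>" by (rule E.swap)
  let ?E = "OMap (repr \<one>\<^bsub>G\<^esub>)"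
  have "isomorphic C (?E X) (?E (?E X))" using act_mult[OF one one assms] by (simp add: act_repr)
  then have 1: "isomorphic C (OMap K (?E X)) (OMap K (?E (?E X)))" by (rule isomorphic_functor[OF E.K])
  have 2: "isomorphic C (OMap K (?E (?E X))) (?E X)" by (rule sw.FK_isomorphic[OF functorD(1)[OF E.F assms]])
  show ?thesis unfolding act_repr
    by (rule isomorphic_trans[OF isomorphic_sym[OF isomorphic_trans[OF 1 2]] sw.FK_isomorphic[OF assms]])
qed

lemma act_inv:
  assumes "g \<in> carrier G" "X \<in> Obj C"
  shows "isomorphic C (act \<rho> (inv\<^bsub>G\<^esub> g) (act \<rho> g X)) X"
proof -
  have "isomorphic C (act \<rho> (inv\<^bsub>G\<^esub> g \<otimes>\<^bsub>G\<^esub> g) X) (act \<rho> (inv\<^bsub>G\<^esub> g) (act \<rho> g X))"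
    by (rule act_mult) (use assms in simp_all)
  then have "isomorphic C (act \<rho> \<one>\<^bsub>G\<^esub> X) (act \<rho> (inv\<^bsub>G\<^esub> g) (act \<rho> g X))" using assms(1) by simp
  then show ?thesis using isomorphic_trans[OF isomorphic_sym act_one[OF assms(2)]] by blast
qed

section \<open>Orbits of atoms and the quotient topology\<close>

abbreviation orbit where "orbit H \<equiv> orbit_map G C \<rho> (atom C H)"

text \<open>The union in \<open>act_atom\<close> collapses, since equivalent monoform objects have
  equivalent translates.\<close>

lemma orbit_eq:
  assumes H: "monoform C H"
  shows "orbit H = {atom C (act \<rho> g H) | g. g \<in> carrier G}"
proof -
  have "act_atom C \<rho> g (atom C H) = atom C (act \<rho> g H)" if g: "g \<in> carrier G" for g
  proof -
    have "H \<in> atom C H" using H monoformD[OF H] by (auto simp: atom_def atom_equiv_def intro: common_nonzero_subobjectI)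
    moreover have "atom C (act \<rho> g L) = atom C (act \<rho> g H)" if "L \<in> atom C H" for L
    proof -
      have "monoform C L" "atom C H = atom C L"
        using that atom_eq_iff by (auto simp: atom_def atom_equiv_def)
      then show ?thesis using act_atom_eq[OF g H] by metis
    qed
    ultimately show ?thesis unfolding act_atom_def by blast
  qed
  then show ?thesis unfolding orbit_map_def by auto
qed

lemma atom_in_orbit: "monoform C H \<Longrightarrow> atom C H \<in> orbit H"
proof -
  assume H: "monoform C H"
  have "atom C (act \<rho> \<one>\<^bsub>G\<^esub> H) = atom C H" using isomorphic_atom(2)[OF H act_one[OF monoformD(1)[OF H]]] .
  then show ?thesis unfolding orbit_eq[OF H] using one_closed by blast
qed

lemma orbit_act:
  assumes H: "monoform C H" and g: "g \<in> carrier G"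
  shows "orbit (act \<rho> g H) = orbit H"
proof -
  note Ho = monoformD(1)[OF H] and gH = act_monoform[OF g H]
  have 1: "atom C (act \<rho> h (act \<rho> g H)) = atom C (act \<rho> (h \<otimes>\<^bsub>G\<^esub> g) H)" if h: "h \<in> carrier G" for h
    using isomorphic_atom(2)[OF act_monoform[OF h gH] act_mult[OF h g Ho]] by simp
  have 2: "atom C (act \<rho> h H) = atom C (act \<rho> (h \<otimes>\<^bsub>G\<^esub> inv\<^bsub>G\<^esub> g) (act \<rho> g H))" if h: "h \<in> carrier G" for h
  proof -
    have "(h \<otimes>\<^bsub>G\<^esub> inv\<^bsub>G\<^esub> g) \<otimes>\<^bsub>G\<^esub> g = h" using h g by (simp add: m_assoc)
    then show ?thesis using 1[of "h \<otimes>\<^bsub>G\<^esub> inv\<^bsub>G\<^esub> g"] h g by simp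
  qed
  show ?thesis unfolding orbit_eq[OF H] orbit_eq[OF gH]
  proof (intro equalityI subsetI)
    fix x assume "x \<in> {atom C (act \<rho> h (act \<rho> g H)) |h. h \<in> carrier G}"
    then obtain h where "h \<in> carrier G" "x = atom C (act \<rho> h (act \<rho> g H))" by blast
    then show "x \<in> {atom C (act \<rho> h H) |h. h \<in> carrier G}" using 1 g by blast
  next
    fix x assume "x \<in> {atom C (act \<rho> h H) |h. h \<in> carrier G}"
    then obtain h where "h \<in> carrier G" "x = atom C (act \<rho> h H)" by blast
    then show "x \<in> {atom C (act \<rho> h (act \<rho> g H)) |h. h \<in> carrier G}" using 2 g by blast
  qed
qed

lemma orbit_eqE:
  assumes "monoform C H" "monoform C L" "orbit H = orbit L"
  obtains g where "g \<in> carrier G" "atom C L = atom C (act \<rho> g H)"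
proof -
  have "atom C L \<in> {atom C (act \<rho> g H) | g. g \<in> carrier G}"
    using atom_in_orbit[OF assms(2)] unfolding assms(3)[symmetric] orbit_eq[OF assms(1)] .
  then show thesis using that by blast
qed

lemma AssGI: "\<lbrakk>monoform C H; subobject C H M\<rbrakk> \<Longrightarrow> orbit H \<in> AssG G C \<rho> M"
  unfolding AssG_def using AssI by blast

lemma AssGE:
  assumes "x \<in> AssG G C \<rho> M"
  obtains H where "monoform C H" "subobject C H M" "x = orbit H"
  using assms unfolding AssG_def by (auto elim: AssE)

lemma SuppGI: "\<lbrakk>monoform C H; subobject C L M; quotient_object C H L\<rbrakk> \<Longrightarrow> orbit H \<in> SuppG G C \<rho> M"
  unfolding SuppG_def using SuppI by blast

lemma SuppGE:
  assumes "x \<in> SuppG G C \<rho> M"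
  obtains H L where "monoform C H" "subobject C L M" "quotient_object C H L" "x = orbit H"
  using assms unfolding SuppG_def by (auto elim: SuppE)

lemma AssG_sub: "subobject C L M \<Longrightarrow> AssG G C \<rho> L \<subseteq> AssG G C \<rho> M"
  unfolding AssG_def by (intro image_mono Ass_sub)

lemma AssG_extension: "short_exact C f g \<Longrightarrow> AssG G C \<rho> (Cod C f) \<subseteq> AssG G C \<rho> (Dom C f) \<union> AssG G C \<rho> (Cod C g)"
  unfolding AssG_def using image_mono[OF Ass_extension] by (metis image_Un)

lemma AssG_zero: "is_zero C M \<Longrightarrow> AssG G C \<rho> M = {}"
  by (simp add: AssG_def Ass_zero)

lemma AssG_nonempty: "\<lbrakk>noetherian C M; \<not> is_zero C M\<rbrakk> \<Longrightarrow> AssG G C \<rho> M \<noteq> {}"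
  by (simp add: AssG_def Ass_nonempty)

lemma AssG_monoform: "monoform C H \<Longrightarrow> AssG G C \<rho> H = {orbit H}"
  by (simp add: AssG_def Ass_monoform)

lemma AssG_subset_SuppG: "AssG G C \<rho> M \<subseteq> SuppG G C \<rho> M"
  unfolding AssG_def SuppG_def by (intro image_mono Ass_subset_Supp)

lemma SuppG_sub: "subobject C L M \<Longrightarrow> SuppG G C \<rho> L \<subseteq> SuppG G C \<rho> M"
  unfolding SuppG_def by (intro image_mono Supp_sub)

lemma SuppG_quotient: "quotient_object C L M \<Longrightarrow> SuppG G C \<rho> L \<subseteq> SuppG G C \<rho> M"
  unfolding SuppG_def by (intro image_mono Supp_quotient)

lemma SuppG_extension: "short_exact C f g \<Longrightarrow> SuppG G C \<rho> (Cod C f) \<subseteq> SuppG G C \<rho> (Dom C f) \<union> SuppG G C \<rho> (Cod C g)"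
  unfolding SuppG_def using image_mono[OF Supp_extension] by (metis image_Un)

lemma AssG_isomorphic: "isomorphic C X Y \<Longrightarrow> AssG G C \<rho> X = AssG G C \<rho> Y"
  using AssG_sub isomorphic_sub isomorphic_sym by blast

lemma SuppG_isomorphic: "isomorphic C X Y \<Longrightarrow> SuppG G C \<rho> X = SuppG G C \<rho> Y"
  using SuppG_sub isomorphic_sub isomorphic_sym by blast

lemma AssG_act:
  assumes "g \<in> carrier G" "M \<in> Obj C"
  shows "AssG G C \<rho> (act \<rho> g M) = AssG G C \<rho> M"
proof
  have sub: "AssG G C \<rho> X \<subseteq> AssG G C \<rho> (act \<rho> h X)" if h: "h \<in> carrier G" for h X
  proof
    fix x assume "x \<in> AssG G C \<rho> X"
    then obtain H where H: "monoform C H" "subobject C H X" "x = orbit H" by (rule AssGE)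
    have "orbit (act \<rho> h H) \<in> AssG G C \<rho> (act \<rho> h X)" by (rule AssGI[OF act_monoform[OF h H(1)] act_sub[OF h H(2)]])
    then show "x \<in> AssG G C \<rho> (act \<rho> h X)" using orbit_act[OF H(1) h] H(3) by simp
  qed
  show "AssG G C \<rho> M \<subseteq> AssG G C \<rho> (act \<rho> g M)" by (rule sub[OF assms(1)])
  show "AssG G C \<rho> (act \<rho> g M) \<subseteq> AssG G C \<rho> M"
    using sub[of "inv\<^bsub>G\<^esub> g" "act \<rho> g M"] AssG_isomorphic[OF act_inv[OF assms]] assms(1) by simp
qed

lemma SuppG_act:
  assumes "g \<in> carrier G" "M \<in> Obj C"
  shows "SuppG G C \<rho> (act \<rho> g M) = SuppG G C \<rho> M"
proof
  have sub: "SuppG G C \<rho> X \<subseteq> SuppG G C \<rho> (act \<rho> h X)" if h: "h \<in> carrier G" for h X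
  proof
    fix x assume "x \<in> SuppG G C \<rho> X"
    then obtain H L where H: "monoform C H" "subobject C L X" "quotient_object C H L" "x = orbit H" by (rule SuppGE)
    have "orbit (act \<rho> h H) \<in> SuppG G C \<rho> (act \<rho> h X)"
      by (rule SuppGI[OF act_monoform[OF h H(1)] act_sub[OF h H(2)] act_quotient[OF h H(3)]])
    then show "x \<in> SuppG G C \<rho> (act \<rho> h X)" using orbit_act[OF H(1) h] H(4) by simp
  qed
  show "SuppG G C \<rho> M \<subseteq> SuppG G C \<rho> (act \<rho> g M)" by (rule sub[OF assms(1)])
  show "SuppG G C \<rho> (act \<rho> g M) \<subseteq> SuppG G C \<rho> M"
    using sub[of "inv\<^bsub>G\<^esub> g" "act \<rho> g M"] SuppG_isomorphic[OF act_inv[OF assms]] assms(1) by simp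
qed

text \<open>The preimage of \<open>SuppG G C \<rho> M\<close> in the atom spectrum is the union of
  the basic open sets \<open>Supp C (act \<rho> g M)\<close> over the group.\<close>

lemma openin_SuppG:
  assumes M: "M \<in> Obj C"
  shows "openin (SpecG_top G C \<rho>) (SuppG G C \<rho> M)"
proof -
  have base: "openin (Spec_top C) (Supp C X)" if "X \<in> Obj C" for X
    unfolding Spec_top_def by (rule topology_generated_by_Basis) (use that in blast)
  have top: "z \<in> topspace (Spec_top C) \<Longrightarrow> \<exists>H. monoform C H \<and> z = atom C H" for z
    unfolding Spec_top_def topology_generated_by_topspace by (auto elim: SuppE)
  have "{z \<in> topspace (Spec_top C). orbit_map G C \<rho> z \<in> SuppG G C \<rho> M} = (\<Union>g\<in>carrier G. Supp C (act \<rho> g M))"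
  proof (intro equalityI subsetI)
    fix z assume "z \<in> {z \<in> topspace (Spec_top C). orbit_map G C \<rho> z \<in> SuppG G C \<rho> M}"
    then have z: "z \<in> topspace (Spec_top C)" "orbit_map G C \<rho> z \<in> SuppG G C \<rho> M" by auto
    obtain L where L: "monoform C L" "z = atom C L" using top[OF z(1)] by blast
    obtain H N where H: "monoform C H" "subobject C N M" "quotient_object C H N" "orbit_map G C \<rho> z = orbit H"
      using z(2) by (rule SuppGE)
    obtain g where g: "g \<in> carrier G" "atom C L = atom C (act \<rho> g H)"
      by (rule orbit_eqE[OF H(1) L(1)]) (use H(4) L(2) in simp)
    have "atom C (act \<rho> g H) \<in> Supp C (act \<rho> g M)"
      by (rule SuppI[OF act_monoform[OF g(1) H(1)] act_sub[OF g(1) H(2)] act_quotient[OF g(1) H(3)]])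
    then show "z \<in> (\<Union>g\<in>carrier G. Supp C (act \<rho> g M))" unfolding L(2) g(2) using g(1) by blast
  next
    fix z assume "z \<in> (\<Union>g\<in>carrier G. Supp C (act \<rho> g M))"
    then obtain g where g: "g \<in> carrier G" "z \<in> Supp C (act \<rho> g M)" by blast
    have "orbit_map G C \<rho> z \<in> SuppG G C \<rho> (act \<rho> g M)" using g by (simp add: SuppG_def)
    moreover have "z \<in> topspace (Spec_top C)"
      using openin_subset[OF base[OF act_obj[OF g(1) M]]] g(2) by blast
    ultimately show "z \<in> {z \<in> topspace (Spec_top C). orbit_map G C \<rho> z \<in> SuppG G C \<rho> M}"
      using SuppG_act[OF g(1) M] by simp
  qed
  moreover have "openin (Spec_top C) (\<Union>g\<in>carrier G. Supp C (act \<rho> g M))"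
    by (rule openin_Union) (use base act_obj M in blast)
  ultimately show ?thesis unfolding SpecG_top_def openin_quotient_topology
    using openin_subset[OF base[OF M]] by (auto simp: SuppG_def)
qed

text \<open>An open set that meets the closure of a point contains the point. Two orbits in the
  closures of each other thus lie in the same supports.\<close>

lemma closure_SuppG:
  assumes "y \<in> SpecG_top G C \<rho> closure_of {x}" "M \<in> Obj C" "y \<in> SuppG G C \<rho> M"
  shows "x \<in> SuppG G C \<rho> M"
  using assms openin_SuppG[OF assms(2)] unfolding in_closure_of by blast

end

section \<open>The category of noetherian objects\<close>

context abelian_category
begin

abbreviation NC where "NC \<equiv> noeth_cat C"

lemma noeth_obj: "noetherian C M \<Longrightarrow> M \<in> Obj C"
  by (simp add: noetherian_def)

lemma NC_simps [simp]:
  "Obj NC = {M. noetherian C M}"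
  "Arr NC = {f \<in> Arr C. noetherian C (Dom C f) \<and> noetherian C (Cod C f)}"
  "Dom NC = Dom C" "Cod NC = Cod C" "Idt NC = Idt C" "Comp NC = Comp C"
  by (auto simp: noeth_cat_def full_sub_def noetherian_def)

lemma NC_homs [simp]: "homs NC X Y = {f \<in> homs C X Y. noetherian C X \<and> noetherian C Y}"
  by (auto simp: homs_def)

lemma NC_category: "category NC"
  by unfold_locales (auto simp: homs_def noeth_obj)

lemma zero_noetherian: "is_zero C Z \<Longrightarrow> noetherian C Z"
proof -
  assume Z: "is_zero C Z"
  have "sub_le C m n" if "mono_arr C m" "Cod C m = Z" "mono_arr C n" "Cod C n = Z" for m n
    by (rule zero_sub_le) (use that is_zero_zero_arr[OF Z, of m] in simp_all)
  then show ?thesis unfolding noetherian_def using is_zero_obj[OF Z] by blast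
qed

lemma NC_zero_iff: "is_zero NC Z \<longleftrightarrow> is_zero C Z"
proof
  assume Z: "is_zero C Z"
  note Zn = zero_noetherian[OF Z]
  show "is_zero NC Z" unfolding is_zero_def
  proof (intro conjI ballI)
    show "Z \<in> Obj NC" using Zn by simp
    fix X assume "X \<in> Obj NC"
    then have X: "noetherian C X" by simp
    have eq: "homs NC X Z = homs C X Z" "homs NC Z X = homs C Z X" using X Zn by simp_all
    show "\<exists>!f. f \<in> homs NC X Z" "\<exists>!f. f \<in> homs NC Z X"
      unfolding eq using Z noeth_obj[OF X] unfolding is_zero_def by blast+
  qed
next
  assume Z: "is_zero NC Z"
  then have Zn: "noetherian C Z" using category.is_zero_obj[OF NC_category Z] by simp
  note Zo = noeth_obj[OF Zn]
  obtain z where z: "zero_arr C z" "Dom C z = Z" "Cod C z = Z" by (rule ex_zero_arr[OF Zo Zo])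
  have "z = Idt C Z" by (rule category.is_zero_into[OF NC_category Z]) (use z Zo Zn in simp_all)
  then show "is_zero C Z" using z Zo by (simp add: is_zero_iff)
qed

lemma NC_zero_arr_iff: "f \<in> Arr NC \<Longrightarrow> zero_arr NC f \<longleftrightarrow> zero_arr C f"
proof
  assume f: "f \<in> Arr NC"
  show "zero_arr C f" if z: "zero_arr NC f"
    using z unfolding zero_arr_def NC_zero_iff NC_simps NC_homs by blast
  show "zero_arr NC f" if z: "zero_arr C f"
  proof -
    obtain Z a b where ab: "is_zero C Z" "a \<in> Arr C" "b \<in> Arr C" "Dom C a = Dom C f" "Cod C a = Z"
      "Dom C b = Z" "Cod C b = Cod C f" "b \<cdot> a = f" by (rule zero_arrE[OF z])
    have "zero_arr NC (Comp NC b a)"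
      by (rule category.zero_arrI[OF NC_category, of Z]) (use ab f zero_noetherian[OF ab(1)] in \<open>simp_all add: NC_zero_iff\<close>)
    then show ?thesis using ab by simp
  qed
qed

text \<open>The kernel of an arrow with noetherian domain is noetherian, so noetherian test objects
  already detect it.\<close>

lemma NC_mono_iff: "m \<in> Arr NC \<Longrightarrow> mono_arr NC m \<longleftrightarrow> mono_arr C m"
proof
  assume m: "m \<in> Arr NC"
  then have ma: "m \<in> Arr C" "noetherian C (Dom C m)" "noetherian C (Cod C m)" by simp_all
  show "mono_arr NC m" if "mono_arr C m"
    by (rule category.mono_arrI[OF NC_category m]) (use that in \<open>auto intro: mono_cancel\<close>)
  show "mono_arr C m" if mn: "mono_arr NC m"
  proof -
    obtain k where k: "is_kernel C m k" using ex_kernel[OF ma(1)] ..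
    note kD = kernelD[OF k]
    have kn: "noetherian C (Dom C k)"
      by (rule noetherian_sub[OF ma(2) subobjectI[OF kD(5) refl kD(3)]])
    obtain z where z: "zero_arr C z" "Dom C z = Dom C k" "Cod C z = Dom C m"
      using ex_zero_arr[OF dom_obj[OF kD(2)] dom_obj[OF ma(1)]] .
    have "m \<cdot> k = m \<cdot> z" by (rule zero_arr_unique) (use kD z in simp_all)
    then have "k = z" by - (rule category.mono_cancel[OF NC_category mn], insert kD z kn ma, simp_all)
    then have k0: "zero_arr C k" using z(1) by (rule ssubst)
    show ?thesis by (rule kernel_zero_mono[OF k mono_zero_dom[OF kD(5) k0]])
  qed
qed

text \<open>Only the middle term has to be assumed noetherian, since the property passes to
  subobjects and quotients. The universal properties are then restricted to fewer test
  objects.\<close>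

lemma NC_short_exactI:
  assumes fg: "short_exact C f g" and n: "noetherian C (Cod C f)"
  shows "short_exact NC f g"
proof -
  note D = short_exactD[OF fg]
  have nf: "noetherian C (Dom C f)" by (rule noetherian_sub[OF n subobjectI[OF D(3) refl refl]])
  have ng: "noetherian C (Cod C g)"
    by (rule noetherian_quotient[OF n quotient_objectI[OF D(4) D(5)[symmetric] refl]])
  have fa: "f \<in> Arr NC" and ga: "g \<in> Arr NC" using D n nf ng by simp_all
  have gf: "g \<cdot> f \<in> Arr NC" using D nf ng by simp
  have z: "zero_arr NC (Comp NC g f)" using NC_zero_arr_iff[OF gf] kernelD(4)[OF D(1)] by simp
  have "is_kernel NC g f"
  proof (rule category.kernelI[OF NC_category ga])
    show "mono_arr NC f" using NC_mono_iff[OF fa] D(3) by simp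
    fix u assume u: "u \<in> Arr NC" "Cod NC u = Dom NC g" "zero_arr NC (Comp NC g u)"
    have "g \<cdot> u \<in> Arr NC" using u(1,2) D ng by simp
    then have "zero_arr C (g \<cdot> u)" using NC_zero_arr_iff u(3) by simp
    then have "sub_le C u f" using kernel_factor[OF D(1)] u by simp
    then show "sub_le NC u f" unfolding sub_le_def using u nf by auto
  qed (use z D in simp_all)
  moreover have "is_cokernel NC f g"
  proof (rule category.cokernelI[OF NC_category fa])
    show "epi_arr NC g"
      by (rule category.epi_arrI[OF NC_category ga]) (use epi_cancel[OF D(4)] in auto)
    fix u assume u: "u \<in> Arr NC" "Dom NC u = Cod NC f" "zero_arr NC (Comp NC u f)"
    have "u \<cdot> f \<in> Arr NC" using u(1,2) D nf by simp
    then have uf: "zero_arr C (u \<cdot> f)" using NC_zero_arr_iff u(3) by simp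
    obtain v where v: "v \<in> Arr C" "Dom C v = Cod C g" "Cod C v = Cod C u" "v \<cdot> g = u"
      by (rule cokernel_factor[OF D(2) _ _ uf]) (use u in simp_all)
    then show "\<exists>v\<in>Arr NC. Dom NC v = Cod NC g \<and> Cod NC v = Cod NC u \<and> Comp NC v g = u"
      using u ng by (intro bexI[of _ v]) simp_all
  qed (use z D in simp_all)
  ultimately show ?thesis by (simp add: short_exact_def)
qed

lemma NC_short_exactD:
  assumes fg: "short_exact NC f g"
  shows "short_exact C f g"
proof -
  have k: "is_kernel NC g f" and c: "is_cokernel NC f g" using fg by (simp_all add: short_exact_def)
  note kD = category.kernelD[OF NC_category k] and cD = category.cokernelD[OF NC_category c]
  have ga: "g \<in> Arr C" "noetherian C (Dom C g)" "noetherian C (Cod C g)" using kD(1) by simp_all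
  have fa: "f \<in> Arr C" "noetherian C (Dom C f)" "noetherian C (Cod C f)" using kD(2) by simp_all
  have dim: "Cod C f = Dom C g" using kD(3) by simp
  have gf: "g \<cdot> f \<in> Arr NC" using ga fa dim by simp
  have z: "zero_arr C (g \<cdot> f)" using NC_zero_arr_iff[OF gf] kD(4) by simp
  have mf: "mono_arr C f" using NC_mono_iff[OF kD(2)] kD(5) by simp
  have kg: "is_kernel C g f"
  proof (rule kernelI[OF ga(1) mf dim z])
    obtain l where l: "is_kernel C g l" using ex_kernel[OF ga(1)] ..
    note lD = kernelD[OF l]
    have ln: "noetherian C (Dom C l)" by (rule noetherian_sub[OF ga(2) subobjectI[OF lD(5) refl lD(3)]])
    have gl: "g \<cdot> l \<in> Arr NC" using ga lD ln by simp
    have "sub_le NC l f"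
      by (rule category.kernel_factor[OF NC_category k]) (use lD ln ga NC_zero_arr_iff[OF gl] in simp_all)
    then have lf: "sub_le C l f" by (auto simp: sub_le_def)
    fix u assume "u \<in> Arr C" "Cod C u = Dom C g" "zero_arr C (g \<cdot> u)"
    then have "sub_le C u l" by (rule kernel_factor[OF l])
    then show "sub_le C u f" using sub_le_trans[OF _ lf] fa by blast
  qed
  \<comment> \<open>The cokernel formed in \<open>C\<close> is again noetherian, so \<open>q\<close>
    and \<open>g\<close> factor through each other and \<open>g\<close> is epi in \<open>C\<close>
    too.\<close>
  obtain q where q: "is_cokernel C f q" using ex_cokernel[OF fa(1)] ..
  note qD = cokernelD[OF q]
  have qn: "noetherian C (Cod C q)" by (rule noetherian_quotient[OF fa(3) quotient_objectI[OF qD(5) qD(3) refl]])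
  have qf: "q \<cdot> f \<in> Arr NC" using qD fa qn by simp
  obtain v where v: "v \<in> Arr NC" "Dom NC v = Cod NC g" "Cod NC v = Cod NC q" "Comp NC v g = q"
  proof (rule category.cokernel_factor[OF NC_category c])
    show "q \<in> Arr NC" "Dom NC q = Cod NC f" using qD fa qn by simp_all
    show "zero_arr NC (Comp NC q f)" using NC_zero_arr_iff[OF qf] qD by simp
  qed (rule that)
  obtain w where w: "w \<in> Arr C" "Dom C w = Cod C q" "Cod C w = Cod C g" "w \<cdot> q = g"
    by (rule cokernel_factor[OF q ga(1) dim[symmetric] z])
  have va: "v \<in> Arr C" "Dom C v = Cod C g" "Cod C v = Cod C q" "v \<cdot> g = q" using v by simp_all
  have "w \<cdot> v \<cdot> g = Idt C (Cod C g) \<cdot> g" using va w ga by simp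
  then have wv: "w \<cdot> v = Idt C (Cod C g)"
    by - (rule category.epi_cancel[OF NC_category cD(5)], insert va w ga fa qn, simp_all)
  have e_wv: "epi_arr C (w \<cdot> v)" using wv ga by simp
  have ew: "epi_arr C w" by (rule epi_of_comp[OF e_wv]) (use va w in simp_all)
  have "epi_arr C (w \<cdot> q)" by (rule epi_comp[OF ew qD(5)]) (use w in simp)
  then have eg: "epi_arr C g" using w by simp
  show ?thesis using kg epi_cokernel_kernel[OF eg kg] by (simp add: short_exact_def)
qed

text \<open>The sum is known only through noetherian test objects; writing it as an extension in
  \<open>C\<close> reduces closure under direct sums to closure under extensions.\<close>

lemma NC_direct_sum:
  assumes P: "is_direct_sum NC X Y P" and XY: "noetherian C X" "noetherian C Y"
  obtains a b where "short_exact C a b" "Dom C a = X" "Cod C a = P" "Cod C b = Y"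
proof -
  obtain \<iota> where i: "is_coproduct NC UNIV (pair_family X Y) P \<iota>" using P unfolding is_direct_sum_def ..
  note iD = category.coproductD[OF NC_category i]
  have Pn: "noetherian C P" using iD(1) by simp
  have i1: "\<iota> True \<in> Arr C" "Dom C (\<iota> True) = X" "Cod C (\<iota> True) = P"
    and i2: "\<iota> False \<in> Arr C" "Dom C (\<iota> False) = Y" "Cod C (\<iota> False) = P"
    using iD(2-4)[of True] iD(2-4)[of False] by (simp_all add: pair_family_def)
  note Xo = noeth_obj[OF XY(1)] and Yo = noeth_obj[OF XY(2)]
  have ex: "\<exists>h. h \<in> Arr C \<and> Dom C h = P \<and> Cod C h = W \<and> h \<cdot> \<iota> True = f \<and> h \<cdot> \<iota> False = g"
    if W: "noetherian C W" and f: "f \<in> Arr C" "Dom C f = X" "Cod C f = W" and g: "g \<in> Arr C" "Dom C g = Y" "Cod C g = W"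
    for W f g
  proof -
    have WN: "W \<in> Obj NC" using W by simp
    obtain h where h: "h \<in> Arr NC" "Dom NC h = P" "Cod NC h = W"
      "\<And>b. b \<in> UNIV \<Longrightarrow> Comp NC h (\<iota> b) = (if b then f else g)"
      by (rule category.coproduct_factor[OF NC_category i WN, of "\<lambda>b. if b then f else g"])
        (use f g W XY in \<open>auto simp: pair_family_def\<close>)
    then show ?thesis using h(4)[of True] h(4)[of False] by auto
  qed
  obtain z1 where z1: "zero_arr C z1" "Dom C z1 = X" "Cod C z1 = Y" by (rule ex_zero_arr[OF Xo Yo])
  obtain z2 where z2: "zero_arr C z2" "Dom C z2 = Y" "Cod C z2 = X" by (rule ex_zero_arr[OF Yo Xo])
  obtain b where b: "b \<in> Arr C" "Dom C b = P" "Cod C b = Y" "b \<cdot> \<iota> True = z1" "b \<cdot> \<iota> False = Idt C Y"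
    using ex[OF XY(2), of z1 "Idt C Y"] z1 Yo by auto
  obtain s where s: "s \<in> Arr C" "Dom C s = P" "Cod C s = X" "s \<cdot> \<iota> True = Idt C X" "s \<cdot> \<iota> False = z2"
    using ex[OF XY(1), of "Idt C X" z2] z2 Xo by auto
  have "mono_arr C (s \<cdot> \<iota> True)" using s Xo by simp
  then have m1: "mono_arr C (\<iota> True)" by (rule mono_of_comp) (use s i1 in simp_all)
  have "epi_arr C (b \<cdot> \<iota> False)" using b Yo by simp
  then have eb: "epi_arr C b" by (rule epi_of_comp) (use b i2 in simp_all)
  obtain q where q: "short_exact C (\<iota> True) q" by (rule mono_short_exact[OF m1])
  note qD = short_exactD[OF q]
  have dq: "Dom C q = P" using qD(5) i1 by simp
  have qn: "noetherian C (Cod C q)" by (rule noetherian_quotient[OF Pn quotient_objectI[OF qD(4) dq refl]])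
  have q0: "zero_arr C (q \<cdot> \<iota> True)" by (rule kernelD(4)[OF qD(1)])
  \<comment> \<open>The two arrows agree on both injections. Uniqueness applies because the target,
    a quotient of \<open>P\<close>, is noetherian.\<close>
  have vq: "(q \<cdot> \<iota> False) \<cdot> b = q"
  proof (rule category.coproduct_ext[OF NC_category i, unfolded NC_simps])
    fix t :: bool
    show "((q \<cdot> \<iota> False) \<cdot> b) \<cdot> \<iota> t = q \<cdot> \<iota> t"
    proof (cases t)
      case True
      have "zero_arr C ((q \<cdot> \<iota> False) \<cdot> b \<cdot> \<iota> True)"
        by (rule zero_arr_left) (use z1 b qD(7) dq i2 in simp_all)
      then have "zero_arr C (((q \<cdot> \<iota> False) \<cdot> b) \<cdot> \<iota> True)" using b(1-3) qD(7) dq i1 i2 by simp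
      then show ?thesis unfolding True using True
        by (intro zero_arr_unique) (use q0 b(1-3) qD(7) dq i1 i2 in simp_all)
    next
      case False
      then show ?thesis using b qD(7) dq i2 by simp
    qed
  qed (use b(1-3) qD(7) dq i2 XY Pn qn in simp_all)
  have "is_kernel C b (\<iota> True)"
  proof (rule kernelI[OF b(1) m1])
    fix u assume u: "u \<in> Arr C" "Cod C u = Dom C b" "zero_arr C (b \<cdot> u)"
    have "zero_arr C ((q \<cdot> \<iota> False) \<cdot> b \<cdot> u)" by (rule zero_arr_left[OF u(3)]) (use u b(1-3) qD(7) dq i2 in simp_all)
    moreover have "(q \<cdot> \<iota> False) \<cdot> b \<cdot> u = q \<cdot> u"
      by (rule comp_eq_extend[OF vq]) (use u b(1-3) qD(7) dq i2 in simp_all)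
    ultimately have "zero_arr C (q \<cdot> u)" by simp
    then show "sub_le C u (\<iota> True)" using kernel_factor[OF qD(1) u(1)] u b dq by simp
  qed (use b i1 z1 in simp_all)
  then have "short_exact C (\<iota> True) b" using epi_cokernel_kernel[OF eb] by (simp add: short_exact_def)
  then show thesis using that i1 b by blast
qed

lemma NC_subobject_iff: "subobject NC L M \<longleftrightarrow> subobject C L M \<and> noetherian C M"
proof
  assume "subobject NC L M"
  then obtain m where m: "mono_arr NC m" "m \<in> homs C L M" "noetherian C L" "noetherian C M"
    unfolding subobject_def by auto
  then have "m \<in> Arr NC" by (simp add: homs_def)
  then have "mono_arr C m" using NC_mono_iff m by blast
  then show "subobject C L M \<and> noetherian C M" using m unfolding subobject_def by blast
next
  assume *: "subobject C L M \<and> noetherian C M"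
  then have L: "noetherian C L" using noetherian_sub by blast
  obtain m where m: "mono_arr C m" "Dom C m = L" "Cod C m = M" using conjunct1[OF *] by (rule subobjectE)
  then have ma: "m \<in> Arr NC" using L * by simp
  then have "mono_arr NC m" using NC_mono_iff[OF ma] m by blast
  moreover have "m \<in> homs NC L M" using m L * by (simp add: homs_def)
  ultimately show "subobject NC L M" unfolding subobject_def by blast
qed

text \<open>Translates the closure properties from noetherian objects to the ambient category, in
  which all later chases take place.\<close>

lemma torsion_free_NC_D:
  assumes X: "torsion_free_class NC \<X>"
  shows "M \<in> \<X> \<Longrightarrow> noetherian C M"
    "is_zero C Z \<Longrightarrow> Z \<in> \<X>"
    "\<lbrakk>M \<in> \<X>; subobject C L M\<rbrakk> \<Longrightarrow> L \<in> \<X>"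
    "\<lbrakk>short_exact C f g; noetherian C (Cod C f); Dom C f \<in> \<X>; Cod C g \<in> \<X>\<rbrakk> \<Longrightarrow> Cod C f \<in> \<X>"
proof -
  have *: "\<X> \<subseteq> Obj NC" "\<forall>Z. is_zero NC Z \<longrightarrow> Z \<in> \<X>" "closed_subobjects NC \<X>" "closed_extensions NC \<X>"
    using X unfolding torsion_free_class_def additive_subcategory_def subcategory_def by blast+
  show 1: "M \<in> \<X> \<Longrightarrow> noetherian C M" for M using *(1) unfolding NC_simps by blast
  show "is_zero C Z \<Longrightarrow> Z \<in> \<X>" using *(2) unfolding NC_zero_iff by blast
  show "\<lbrakk>M \<in> \<X>; subobject C L M\<rbrakk> \<Longrightarrow> L \<in> \<X>"
    using *(3) 1 unfolding closed_subobjects_def NC_subobject_iff by blast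
  assume fg: "short_exact C f g" "noetherian C (Cod C f)" "Dom C f \<in> \<X>" "Cod C g \<in> \<X>"
  show "Cod C f \<in> \<X>"
    using *(4)[unfolded closed_extensions_def NC_simps, THEN spec, THEN spec, THEN mp]
      NC_short_exactI[OF fg(1,2)] fg(3,4) by blast
qed

text \<open>Closure under isomorphisms comes from closure under subobjects, and closure under direct
  sums from closure under extensions.\<close>

lemma torsion_free_NC_I:
  assumes n: "\<And>M. M \<in> \<X> \<Longrightarrow> noetherian C M"
    and z: "\<And>Z. is_zero C Z \<Longrightarrow> Z \<in> \<X>"
    and s: "\<And>M L. \<lbrakk>M \<in> \<X>; subobject C L M\<rbrakk> \<Longrightarrow> L \<in> \<X>"
    and e: "\<And>f g. \<lbrakk>short_exact C f g; noetherian C (Cod C f); Dom C f \<in> \<X>; Cod C g \<in> \<X>\<rbrakk> \<Longrightarrow> Cod C f \<in> \<X>"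
  shows "torsion_free_class NC \<X>"
  unfolding torsion_free_class_def additive_subcategory_def subcategory_def closed_subobjects_def
    closed_extensions_def NC_zero_iff NC_subobject_iff
proof (intro conjI ballI allI impI)
  show "\<X> \<subseteq> Obj NC" using n by auto
  fix X Y assume X: "X \<in> \<X>" and iso: "isomorphic NC X Y"
  have "subobject NC Y X"
    by (rule category.isomorphic_sub[OF NC_category category.isomorphic_sym[OF NC_category iso]])
  then show "Y \<in> \<X>" unfolding NC_subobject_iff using s[OF X] by blast
next
  fix X Y P assume XY: "X \<in> \<X>" "Y \<in> \<X>" and P: "is_direct_sum NC X Y P"
  have Pn: "noetherian C P" using P unfolding is_direct_sum_def is_coproduct_def NC_simps by blast
  obtain a b where ab: "short_exact C a b" "Dom C a = X" "Cod C a = P" "Cod C b = Y"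
    by (rule NC_direct_sum[OF P n[OF XY(1)] n[OF XY(2)]])
  show "P \<in> \<X>" using e[OF ab(1)] unfolding ab(2-4) using XY Pn by blast
next
  fix f g assume *: "short_exact NC f g \<and> Dom NC f \<in> \<X> \<and> Cod NC g \<in> \<X>"
  then have "f \<in> Arr NC" unfolding short_exact_def is_kernel_def by blast
  then have n: "noetherian C (Cod C f)" by simp
  show "Cod NC f \<in> \<X>" using e[OF NC_short_exactD n, of g] * unfolding NC_simps by blast
qed (use z s in blast)+

end

context acted_category
begin

lemma AssG_inv_iff: "M \<in> AssG_inv G C \<rho> \<Phi> \<longleftrightarrow> noetherian C M \<and> AssG G C \<rho> M \<subseteq> \<Phi>"
  unfolding AssG_inv_def by simp

lemma AssG_inv_torsion_free: "torsion_free_class NC (AssG_inv G C \<rho> \<Phi>)"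
proof (rule torsion_free_NC_I; unfold AssG_inv_iff)
  show "noetherian C M \<and> AssG G C \<rho> M \<subseteq> \<Phi> \<Longrightarrow> noetherian C M" for M by blast
  show "is_zero C Z \<Longrightarrow> noetherian C Z \<and> AssG G C \<rho> Z \<subseteq> \<Phi>" for Z
    using zero_noetherian AssG_zero by simp
  show "\<lbrakk>noetherian C M \<and> AssG G C \<rho> M \<subseteq> \<Phi>; subobject C L M\<rbrakk> \<Longrightarrow> noetherian C L \<and> AssG G C \<rho> L \<subseteq> \<Phi>" for M L
    using noetherian_sub AssG_sub by blast
  show "\<lbrakk>short_exact C f g; noetherian C (Cod C f); noetherian C (Dom C f) \<and> AssG G C \<rho> (Dom C f) \<subseteq> \<Phi>;
      noetherian C (Cod C g) \<and> AssG G C \<rho> (Cod C g) \<subseteq> \<Phi>\<rbrakk> \<Longrightarrow> noetherian C (Cod C f) \<and> AssG G C \<rho> (Cod C f) \<subseteq> \<Phi>" for f g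
    using AssG_extension[of f g] by blast
qed

lemma AssG_inv_closed: "G_closed G \<rho> (AssG_inv G C \<rho> \<Phi>)"
  unfolding G_closed_def AssG_inv_iff
proof (intro ballI)
  fix g X assume "g \<in> carrier G" "X \<in> AssG_inv G C \<rho> \<Phi>"
  then show "noetherian C (act \<rho> g X) \<and> AssG G C \<rho> (act \<rho> g X) \<subseteq> \<Phi>"
    unfolding AssG_inv_iff using act_noetherian[of g X] AssG_act[of g X] noeth_obj[of X] by simp
qed

section \<open>Subcategories cut out by supports\<close>

definition SuppG_inv where "SuppG_inv U = {M \<in> Obj C. SuppG G C \<rho> M \<subseteq> U}"

lemma SuppG_inv_closed: "G_closed G \<rho> (SuppG_inv U)"
  unfolding G_closed_def SuppG_inv_def using act_obj SuppG_act by simp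

lemma SuppG_inv_serre: "serre_subcategory C (SuppG_inv U)"
  unfolding serre_subcategory_def additive_subcategory_def subcategory_def closed_subobjects_def
    closed_quotients_def closed_extensions_def
proof (intro conjI ballI allI impI)
  show "SuppG_inv U \<subseteq> Obj C" by (auto simp: SuppG_inv_def)
  show "Y \<in> SuppG_inv U" if "X \<in> SuppG_inv U" "isomorphic C X Y" for X Y
    using that SuppG_isomorphic[OF that(2)] subobject_obj[OF isomorphic_sub[OF that(2)]] by (simp add: SuppG_inv_def)
  show "Z \<in> SuppG_inv U" if "is_zero C Z" for Z
    using that is_zero_obj[OF that] by (simp add: SuppG_inv_def SuppG_def Supp_zero)
  show "L \<in> SuppG_inv U" if "X \<in> SuppG_inv U" "subobject C L X" for X L
    using that SuppG_sub[OF that(2)] subobject_obj[OF that(2)] by (auto simp: SuppG_inv_def)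
  show "Q \<in> SuppG_inv U" if "X \<in> SuppG_inv U" "quotient_object C Q X" for X Q
    using that SuppG_quotient[OF that(2)] quotient_object_obj[OF that(2)] by (auto simp: SuppG_inv_def)
  show ext: "Cod C f \<in> SuppG_inv U" if "short_exact C f g \<and> Dom C f \<in> SuppG_inv U \<and> Cod C g \<in> SuppG_inv U" for f g
    using that SuppG_extension[of f g] short_exactD(6)[of f g] by (auto simp: SuppG_inv_def)
  fix X Y P assume XY: "X \<in> SuppG_inv U" "Y \<in> SuppG_inv U" and P: "is_direct_sum C X Y P"
  obtain \<iota> where i: "is_coproduct C UNIV (pair_family X Y) P \<iota>" using P unfolding is_direct_sum_def ..
  have Yo: "Y \<in> Obj C" "X \<in> Obj C" using XY by (simp_all add: SuppG_inv_def)
  \<comment> \<open>With the index \<open>False\<close> removed, the coproduct of the pair is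
    \<open>X\<close> itself, so \<open>coproduct_split\<close> presents \<open>P\<close> as an
    extension of \<open>Y\<close> by \<open>X\<close>.\<close>
  have Q: "is_coproduct C (UNIV - {False}) (pair_family X Y) X (\<lambda>_. Idt C X)"
  proof -
    have U: "UNIV - {False} = {True}" by auto
    have ex1: "\<exists>!h. h \<in> homs C X Z \<and> h \<cdot> Idt C X = f" if "f \<in> homs C X Z" for Z f
      using that by (auto simp: homs_def)
    show ?thesis unfolding is_coproduct_def U
    proof (intro conjI ballI allI impI)
      show "X \<in> Obj C" by (rule Yo(2))
      show "Idt C X \<in> homs C (pair_family X Y i) X" if "i \<in> {True}" for i
        using that Yo(2) by (simp add: pair_family_def homs_def)
      fix Z f assume "\<forall>i\<in>{True}. f i \<in> homs C (pair_family X Y i) Z"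
      then have "f True \<in> homs C X Z" by (simp add: pair_family_def)
      from ex1[OF this] show "\<exists>!h. h \<in> homs C X Z \<and> (\<forall>i\<in>{True}. h \<cdot> Idt C X = f i)" by simp
    qed
  qed
  obtain a b where ab: "short_exact C a b" "Dom C a = X" "Cod C a = P" "Cod C b = pair_family X Y False"
    by (rule coproduct_split[OF i, of False, OF _ _ Q]) (use Yo in \<open>simp_all add: pair_family_def\<close>)
  then show "P \<in> SuppG_inv U" using ext[of a b] XY by (simp add: pair_family_def)
qed

end

section \<open>Tensor products\<close>

context abelian_category
begin

text \<open>Extracts from an adjunction what the chases need: a bijective transposition, natural in
  the source, that preserves and detects zero arrows. It is stated for general functors since it
  serves both the internal Hom and tensoring with a dual.\<close>

lemma right_adjoint_hom:
  assumes "right_adjoint C K F"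
  obtains \<phi> where
    "\<And>V Y f. \<lbrakk>V \<in> Obj C; f \<in> Arr C; Dom C f = OMap F V; Cod C f = Y\<rbrakk> \<Longrightarrow>
       \<phi> V Y f \<in> Arr C \<and> Dom C (\<phi> V Y f) = V \<and> Cod C (\<phi> V Y f) = OMap K Y"
    "\<And>V Y f g. \<lbrakk>V \<in> Obj C; f \<in> Arr C; Dom C f = OMap F V; Cod C f = Y; g \<in> Arr C; Dom C g = OMap F V; Cod C g = Y;
       \<phi> V Y f = \<phi> V Y g\<rbrakk> \<Longrightarrow> f = g"
    "\<And>V Y g. \<lbrakk>Y \<in> Obj C; g \<in> Arr C; Dom C g = V; Cod C g = OMap K Y\<rbrakk> \<Longrightarrow>
       \<exists>f \<in> Arr C. Dom C f = OMap F V \<and> Cod C f = Y \<and> \<phi> V Y f = g"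
    "\<And>u Y f. \<lbrakk>u \<in> Arr C; f \<in> Arr C; Dom C f = OMap F (Cod C u); Cod C f = Y\<rbrakk> \<Longrightarrow>
       \<phi> (Dom C u) Y (f \<cdot> AMap F u) = \<phi> (Cod C u) Y f \<cdot> u"
    "\<And>V Y f. \<lbrakk>V \<in> Obj C; f \<in> Arr C; Dom C f = OMap F V; Cod C f = Y\<rbrakk> \<Longrightarrow>
       zero_arr C (\<phi> V Y f) \<longleftrightarrow> zero_arr C f"
    "\<And>u. zero_arr C u \<Longrightarrow> zero_arr C (AMap F u)"
proof -
  have F: "is_endofunctor C F" and K: "is_endofunctor C K" using assms unfolding right_adjoint_def by blast+
  note FD = functorD[OF F] and KD = functorD[OF K]
  obtain \<phi> where bij: "\<And>X Y. \<lbrakk>X \<in> Obj C; Y \<in> Obj C\<rbrakk> \<Longrightarrow> bij_betw (\<phi> X Y) (homs C (OMap F X) Y) (homs C X (OMap K Y))"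
    and nat0: "\<And>X X' Y Y' u v f. \<lbrakk>X \<in> Obj C; Y \<in> Obj C; u \<in> homs C X' X; v \<in> homs C Y Y'; f \<in> homs C (OMap F X) Y\<rbrakk> \<Longrightarrow>
        \<phi> X' Y' (v \<cdot> f \<cdot> AMap F u) = AMap K v \<cdot> \<phi> X Y f \<cdot> u"
    using assms unfolding right_adjoint_def by metis
  have h: "f \<in> homs C (Dom C f) (Cod C f)" if "f \<in> Arr C" for f using that by (simp add: homs_def)
  have 1: "\<phi> V Y f \<in> Arr C \<and> Dom C (\<phi> V Y f) = V \<and> Cod C (\<phi> V Y f) = OMap K Y"
    if "V \<in> Obj C" "f \<in> Arr C" "Dom C f = OMap F V" "Cod C f = Y" for V Y f
  proof -
    have "Y \<in> Obj C" using cod_obj[OF that(2)] that(4) by simp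
    then have "\<phi> V Y f \<in> homs C V (OMap K Y)"
      using bij_betw_apply[OF bij[OF that(1)]] h[OF that(2)] that(3,4) by simp
    then show ?thesis by (simp add: homs_def)
  qed
  have 2: "f = g" if "V \<in> Obj C" "f \<in> Arr C" "Dom C f = OMap F V" "Cod C f = Y" "g \<in> Arr C" "Dom C g = OMap F V"
    "Cod C g = Y" "\<phi> V Y f = \<phi> V Y g" for V Y f g
  proof -
    have "Y \<in> Obj C" using cod_obj[OF that(2)] that(4) by simp
    then have "inj_on (\<phi> V Y) (homs C (OMap F V) Y)" using bij[OF that(1)] by (simp add: bij_betw_def)
    moreover have "f \<in> homs C (OMap F V) Y" "g \<in> homs C (OMap F V) Y" using that(2-7) by (simp_all add: homs_def)
    ultimately show ?thesis using inj_onD[of "\<phi> V Y" "homs C (OMap F V) Y" f g] that(8) by blast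
  qed
  have 3: "\<exists>f \<in> Arr C. Dom C f = OMap F V \<and> Cod C f = Y \<and> \<phi> V Y f = g"
    if "Y \<in> Obj C" "g \<in> Arr C" "Dom C g = V" "Cod C g = OMap K Y" for V Y g
  proof -
    have "V \<in> Obj C" using dom_obj[OF that(2)] that(3) by simp
    then have "\<phi> V Y ` homs C (OMap F V) Y = homs C V (OMap K Y)" using bij[OF _ that(1)] by (simp add: bij_betw_def)
    moreover have "g \<in> homs C V (OMap K Y)" using that by (simp add: homs_def)
    ultimately obtain f where "f \<in> homs C (OMap F V) Y" "g = \<phi> V Y f" by blast
    then show ?thesis by (auto simp: homs_def)
  qed
  have 4: "\<phi> (Dom C u) Y (f \<cdot> AMap F u) = \<phi> (Cod C u) Y f \<cdot> u"
    if u: "u \<in> Arr C" and f: "f \<in> Arr C" "Dom C f = OMap F (Cod C u)" "Cod C f = Y" for u Y f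
  proof -
    have Y: "Y \<in> Obj C" using cod_obj[OF f(1)] f(3) by simp
    have "\<phi> (Dom C u) Y (Idt C Y \<cdot> f \<cdot> AMap F u) = AMap K (Idt C Y) \<cdot> \<phi> (Cod C u) Y f \<cdot> u"
      by (rule nat0[OF cod_obj[OF u] Y h[OF u] Idt_in[OF Y]]) (use f in \<open>simp add: homs_def\<close>)
    moreover have "Idt C Y \<cdot> f \<cdot> AMap F u = f \<cdot> AMap F u" using f FD(2-4)[OF u] by simp
    moreover have "AMap K (Idt C Y) \<cdot> \<phi> (Cod C u) Y f \<cdot> u = \<phi> (Cod C u) Y f \<cdot> u"
      using 1[OF cod_obj[OF u] f] u KD(5)[OF Y] by simp
    ultimately show ?thesis by simp
  qed
  \<comment> \<open>The transposes of the zero and the identity endomorphism of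
    \<open>OMap F Z\<close> both start at the zero object \<open>Z\<close>, so they coincide, and
    injectivity applies.\<close>
  have F0: "is_zero C (OMap F Z)" if Z: "is_zero C Z" for Z
  proof -
    have Zo: "Z \<in> Obj C" "OMap F Z \<in> Obj C" using is_zero_obj[OF Z] FD(1) by blast+
    obtain z where z: "zero_arr C z" "Dom C z = OMap F Z" "Cod C z = OMap F Z" by (rule ex_zero_arr[OF Zo(2) Zo(2)])
    have "\<phi> Z (OMap F Z) z = \<phi> Z (OMap F Z) (Idt C (OMap F Z))"
      by (rule is_zero_from[OF Z])
        (use 1[OF Zo(1), of z "OMap F Z"] 1[OF Zo(1), of "Idt C (OMap F Z)" "OMap F Z"] z Zo in simp_all)
    then have "z = Idt C (OMap F Z)" by (rule 2[OF Zo(1), rotated 6]) (use z Zo in simp_all)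
    then show ?thesis using z Zo by (simp add: is_zero_iff)
  qed
  have 6: "zero_arr C (AMap F u)" if u: "zero_arr C u" for u
  proof -
    obtain Z a b where ab: "is_zero C Z" "a \<in> Arr C" "b \<in> Arr C" "Dom C a = Dom C u" "Cod C a = Z"
      "Dom C b = Z" "Cod C b = Cod C u" "b \<cdot> a = u" by (rule zero_arrE[OF u])
    have "zero_arr C (AMap F b \<cdot> AMap F a)"
      by (rule zero_arrI[OF F0[OF ab(1)]]) (use FD(2-4)[OF ab(2)] FD(2-4)[OF ab(3)] ab(5,6) in simp_all)
    moreover have "AMap F (b \<cdot> a) = AMap F b \<cdot> AMap F a" by (rule FD(6)[OF ab(2,3)]) (use ab(5,6) in simp)
    ultimately show ?thesis using ab(8) by simp
  qed
  \<comment> \<open>A zero arrow \<open>z\<close> is unchanged by precomposition with the image of a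
    zero arrow \<open>v\<close>; by naturality its transpose factors through
    \<open>v\<close>.\<close>
  have 5: "zero_arr C (\<phi> V Y f) \<longleftrightarrow> zero_arr C f"
    if V: "V \<in> Obj C" and f: "f \<in> Arr C" "Dom C f = OMap F V" "Cod C f = Y" for V Y f
  proof -
    have Y: "Y \<in> Obj C" using cod_obj[OF f(1)] f(3) by simp
    obtain z where z: "zero_arr C z" "Dom C z = OMap F V" "Cod C z = Y" by (rule ex_zero_arr[OF FD(1)[OF V] Y])
    obtain v where v: "zero_arr C v" "Dom C v = V" "Cod C v = V" by (rule ex_zero_arr[OF V V])
    have va: "v \<in> Arr C" and za: "z \<in> Arr C" using v z by simp_all
    have "z \<cdot> AMap F v = z"
      by (rule zero_arr_unique) (use z za v va FD(2-4)[OF va] 6[OF v(1)] in simp_all)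
    then have "\<phi> V Y z = \<phi> V Y z \<cdot> v" using 4[OF va za, of Y] z v by simp
    moreover have "zero_arr C (\<phi> V Y z \<cdot> v)"
      by (rule zero_arr_left[OF v(1)]) (use 1[OF V za z(2,3)] v in simp_all)
    ultimately have zz: "zero_arr C (\<phi> V Y z)" by simp
    show ?thesis
    proof
      assume "zero_arr C (\<phi> V Y f)"
      then have "\<phi> V Y f = \<phi> V Y z" using zz by (rule zero_arr_unique) (use 1[OF V f] 1[OF V za z(2,3)] in simp_all)
      then have "f = z" by (rule 2[OF V f za z(2,3)])
      then show "zero_arr C f" using z by simp
    next
      assume "zero_arr C f"
      then have "f = z" using z(1) by (rule zero_arr_unique) (use f z in simp_all)
      then show "zero_arr C (\<phi> V Y f)" using zz by simp
    qed
  qed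
  show thesis by (rule that[OF 1 2 3 4 5 6])
qed

text \<open>Here \<open>s'\<close> is the intersection of \<open>s\<close> with the kernel of
  \<open>\<gamma>\<close>. The quotient by \<open>s'\<close> is an extension of the quotient by
  \<open>s\<close>, and its kernel part, which is \<open>s\<close> modulo \<open>s'\<close>, embeds
  in the target of \<open>\<gamma>\<close>.\<close>

lemma quotient_by_intersection:
  assumes s: "short_exact C s c" and g: "\<gamma> \<in> Arr C" "Dom C \<gamma> = Cod C s"
    and s': "short_exact C s' c'" "Cod C s' = Cod C s" "sub_le C s' s" "zero_arr C (\<gamma> \<cdot> s')"
    and max: "\<And>w. \<lbrakk>w \<in> Arr C; Cod C w = Cod C s; sub_le C w s; zero_arr C (\<gamma> \<cdot> w)\<rbrakk> \<Longrightarrow> sub_le C w s'"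
  obtains l h where "short_exact C l h" "Cod C l = Cod C c'" "Cod C h = Cod C c" "subobject C (Dom C l) (Cod C \<gamma>)"
proof -
  note D = short_exactD[OF s] and D' = short_exactD[OF s'(1)]
  have dims: "Dom C c = Cod C s" "Dom C c' = Cod C s" using D(5) D'(5) s'(2) by simp_all
  have cs': "zero_arr C (c \<cdot> s')" using kernel_factor_iff[OF D(1) D'(6)] s'(2,3) dims by simp
  obtain h where h: "h \<in> Arr C" "Dom C h = Cod C c'" "Cod C h = Cod C c" "h \<cdot> c' = c"
    by (rule cokernel_factor[OF D'(2) D(7) _ cs']) (use dims s'(2) in simp)
  have e: "epi_arr C (h \<cdot> c')" using h D by simp
  have eh: "epi_arr C h" by (rule epi_of_comp[OF e]) (use h D' in simp_all)
  obtain l where l: "short_exact C l h" by (rule epi_short_exact[OF eh])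
  note lD = short_exactD[OF l]
  have lc: "Cod C l = Cod C c'" using lD(5) h by simp
  obtain \<gamma>' where g': "\<gamma>' \<in> Arr C" "Dom C \<gamma>' = Cod C c'" "Cod C \<gamma>' = Cod C \<gamma>" "\<gamma>' \<cdot> c' = \<gamma>"
    by (rule cokernel_factor[OF D'(2) g(1) _ s'(4)]) (use g s'(2) in simp)
  have gl: "\<gamma>' \<cdot> l \<in> Arr C" using g' lD lc by simp
  obtain k where k: "is_kernel C (\<gamma>' \<cdot> l) k" using ex_kernel[OF gl] ..
  note kD = kernelD[OF k]
  have kl: "Cod C k = Dom C l" using kD(3) g' lD lc by simp
  have mlk: "mono_arr C (l \<cdot> k)" by (rule mono_comp[OF lD(3) kD(5) kl])
  have lkc: "Cod C (l \<cdot> k) = Cod C c'" using lD kD kl lc by simp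
  \<comment> \<open>\<open>p\<close> is the inverse image of the kernel of
    \<open>\<gamma>' \<cdot> l\<close>. It is killed by \<open>\<gamma>\<close> and by
    \<open>c\<close>, so it lies in \<open>s'\<close> by maximality, and that kernel
    vanishes.\<close>
  obtain p r where p: "mono_arr C p" "Cod C p = Dom C c'" "r \<in> Arr C" "Dom C r = Dom C p" "Cod C r = Dom C (l \<cdot> k)"
    "(l \<cdot> k) \<cdot> r = c' \<cdot> p" "epi_arr C r"
    using ex_pullback_mono[OF mlk D'(7) lkc[symmetric]] D'(4) by metis
  have rk: "Cod C r = Dom C k" using p(5) lD kD kl by simp
  have cp: "c' \<cdot> p = l \<cdot> k \<cdot> r" using p(3,6) lD kD kl rk by simp
  have "\<gamma> \<cdot> p = \<gamma>' \<cdot> c' \<cdot> p"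
    by (rule comp_eq_extend[OF g'(4), symmetric]) (use g' D'(7) p(1,2) in simp_all)
  also have "\<dots> = ((\<gamma>' \<cdot> l) \<cdot> k) \<cdot> r" unfolding cp using g' lD lc kD kl p(3) rk by simp
  finally have gp: "\<gamma> \<cdot> p = ((\<gamma>' \<cdot> l) \<cdot> k) \<cdot> r" .
  have gp0: "zero_arr C (\<gamma> \<cdot> p)" unfolding gp
    by (rule zero_arr_right[OF kD(4)]) (use g' lD lc kD(2) kl p(3) rk in simp_all)
  have "c \<cdot> p = h \<cdot> c' \<cdot> p"
    by (rule comp_eq_extend[OF h(4), symmetric]) (use h D'(7) p(1,2) in simp_all)
  also have "\<dots> = (h \<cdot> l) \<cdot> k \<cdot> r" unfolding cp using h lD lc kD kl p(3) rk by simp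
  finally have cpe: "c \<cdot> p = (h \<cdot> l) \<cdot> k \<cdot> r" .
  have "zero_arr C (c \<cdot> p)" unfolding cpe
    by (rule zero_arr_right[OF kernelD(4)[OF lD(1)]]) (use h lD lc kD(2) kl p(3) rk in simp_all)
  then have "sub_le C p s" using kernel_factor[OF D(1), of p] p(1,2) dims by simp
  then have "sub_le C p s'" using max[of p] gp0 p(1,2) dims by simp
  then have "zero_arr C (c' \<cdot> p)" using kernel_factor_iff[OF D'(1), of p] p(1,2) by simp
  then have "zero_arr C ((l \<cdot> k) \<cdot> r)" using p(6) by simp
  then have "zero_arr C r" using mono_zero_iff[OF mlk p(3,5)] by simp
  then have "is_zero C (Dom C k)" using epi_zero_cod[OF p(7)] rk by simp
  then have "mono_arr C (\<gamma>' \<cdot> l)" by (rule kernel_zero_mono[OF k])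
  then have "subobject C (Dom C l) (Cod C \<gamma>)" by (rule subobjectI) (use g' lD lc in simp_all)
  then show thesis by (rule that[OF l lc h(3)])
qed

end

context grothendieck_cosmos
begin

lemma tens_arr [simp]:
  assumes "f \<in> Arr C" "g \<in> Arr C"
  shows "f \<star> g \<in> Arr C" "Dom C (f \<star> g) = Dom C f \<odot> Dom C g" "Cod C (f \<star> g) = Cod C f \<odot> Cod C g"
  using TensA_in[of f "Dom C f" "Cod C f" g "Dom C g" "Cod C g"] assms by (simp_all add: homs_def)

declare Tens_in [simp] Unt_in [simp]

lemma interchange:
  assumes "f \<in> Arr C" "f' \<in> Arr C" "g \<in> Arr C" "g' \<in> Arr C" "Cod C f = Dom C f'" "Cod C g = Dom C g'"
  shows "(f' \<star> g') \<cdot> (f \<star> g) = (f' \<cdot> f) \<star> (g' \<cdot> g)"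
  by (rule TensA_Comp[symmetric]) (use assms in \<open>auto simp: homs_def\<close>)

lemma lunit_arr [simp]:
  assumes "X \<in> Obj C"
  shows "LUnit C X \<in> Arr C" "Dom C (LUnit C X) = Unt C \<odot> X" "Cod C (LUnit C X) = X"
  using LUnit_iso[OF assms] by (simp_all add: homs_def)

lemma lunit_iso: "X \<in> Obj C \<Longrightarrow> iso_arr C (LUnit C X)"
  using LUnit_iso by blast

lemma braid_arr [simp]:
  assumes "X \<in> Obj C" "Y \<in> Obj C"
  shows "Braid C X Y \<in> Arr C" "Dom C (Braid C X Y) = X \<odot> Y" "Cod C (Braid C X Y) = Y \<odot> X"
  using Braid_iso[OF assms] by (simp_all add: homs_def)

lemma braid_iso: "\<lbrakk>X \<in> Obj C; Y \<in> Obj C\<rbrakk> \<Longrightarrow> iso_arr C (Braid C X Y)"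
  using Braid_iso by blast

lemma braid_nat:
  assumes "f \<in> Arr C" "g \<in> Arr C"
  shows "Braid C (Cod C f) (Cod C g) \<cdot> (f \<star> g) = (g \<star> f) \<cdot> Braid C (Dom C f) (Dom C g)"
  by (rule Braid_nat) (use assms in \<open>simp_all add: homs_def\<close>)

lemma lunit_nat: "f \<in> Arr C \<Longrightarrow> LUnit C (Cod C f) \<cdot> (Idt C (Unt C) \<star> f) = f \<cdot> LUnit C (Dom C f)"
  by (rule LUnit_nat) (simp add: homs_def)

text \<open>\<open>- \<odot> M\<close> has a right adjoint, so it preserves epimorphisms, zero arrows and cokernels.\<close>

lemma closed_hom:
  assumes "M \<in> Obj C"
  obtains \<phi> where
    "\<And>V Y f. \<lbrakk>V \<in> Obj C; f \<in> Arr C; Dom C f = V \<odot> M; Cod C f = Y\<rbrakk> \<Longrightarrow>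
       \<phi> V Y f \<in> Arr C \<and> Dom C (\<phi> V Y f) = V \<and> Cod C (\<phi> V Y f) = IHom C M Y"
    "\<And>V Y f g. \<lbrakk>V \<in> Obj C; f \<in> Arr C; Dom C f = V \<odot> M; Cod C f = Y; g \<in> Arr C; Dom C g = V \<odot> M; Cod C g = Y;
       \<phi> V Y f = \<phi> V Y g\<rbrakk> \<Longrightarrow> f = g"
    "\<And>V Y g. \<lbrakk>Y \<in> Obj C; g \<in> Arr C; Dom C g = V; Cod C g = IHom C M Y\<rbrakk> \<Longrightarrow>
       \<exists>f \<in> Arr C. Dom C f = V \<odot> M \<and> Cod C f = Y \<and> \<phi> V Y f = g"
    "\<And>u Y f. \<lbrakk>u \<in> Arr C; f \<in> Arr C; Dom C f = Cod C u \<odot> M; Cod C f = Y\<rbrakk> \<Longrightarrow>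
       \<phi> (Dom C u) Y (f \<cdot> (u \<star> Idt C M)) = \<phi> (Cod C u) Y f \<cdot> u"
    "\<And>V Y f. \<lbrakk>V \<in> Obj C; f \<in> Arr C; Dom C f = V \<odot> M; Cod C f = Y\<rbrakk> \<Longrightarrow>
       zero_arr C (\<phi> V Y f) \<longleftrightarrow> zero_arr C f"
    "\<And>u. zero_arr C u \<Longrightarrow> zero_arr C (u \<star> Idt C M)"
proof -
  obtain h where h: "right_adjoint C \<lparr>OMap = (\<lambda>Y. IHom C M Y), AMap = h\<rparr> (tensor_right C M)"
    using closed[OF assms] ..
  show thesis by (rule right_adjoint_hom[OF h, unfolded tensor_right_def endofunctor.simps]) (rule that; assumption)
qed

lemma tens_epi_right:
  assumes e: "epi_arr C e" and M: "M \<in> Obj C"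
  shows "epi_arr C (e \<star> Idt C M)"
proof (rule epi_arr_zeroI)
  fix w assume w: "w \<in> Arr C" "Dom C w = Cod C (e \<star> Idt C M)" "zero_arr C (w \<cdot> (e \<star> Idt C M))"
  obtain \<phi> where phi: "\<And>V Y f. \<lbrakk>V \<in> Obj C; f \<in> Arr C; Dom C f = V \<odot> M; Cod C f = Y\<rbrakk> \<Longrightarrow>
       \<phi> V Y f \<in> Arr C \<and> Dom C (\<phi> V Y f) = V \<and> Cod C (\<phi> V Y f) = IHom C M Y"
    "\<And>u Y f. \<lbrakk>u \<in> Arr C; f \<in> Arr C; Dom C f = Cod C u \<odot> M; Cod C f = Y\<rbrakk> \<Longrightarrow>
       \<phi> (Dom C u) Y (f \<cdot> (u \<star> Idt C M)) = \<phi> (Cod C u) Y f \<cdot> u"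
    "\<And>V Y f. \<lbrakk>V \<in> Obj C; f \<in> Arr C; Dom C f = V \<odot> M; Cod C f = Y\<rbrakk> \<Longrightarrow>
       zero_arr C (\<phi> V Y f) \<longleftrightarrow> zero_arr C f"
    by (rule closed_hom[OF M]) (rule that; assumption)
  have ea: "e \<in> Arr C" using e by simp
  have dw: "Dom C w = Cod C e \<odot> M" using w ea M by simp
  have "zero_arr C (\<phi> (Dom C e) (Cod C w) (w \<cdot> (e \<star> Idt C M)))"
    using phi(3)[of "Dom C e" "w \<cdot> (e \<star> Idt C M)" "Cod C w"] w ea M dw by simp
  then have "zero_arr C (\<phi> (Cod C e) (Cod C w) w \<cdot> e)" using phi(2)[OF ea w(1) dw refl] by simp
  then have "zero_arr C (\<phi> (Cod C e) (Cod C w) w)"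
    using epi_zero_iff[OF e] phi(1)[OF cod_obj[OF ea] w(1) dw refl] by simp
  then show "zero_arr C w" using phi(3)[OF cod_obj[OF ea] w(1) dw refl] by simp
qed (use assms in simp)

lemma tens_zero_right: "\<lbrakk>zero_arr C u; M \<in> Obj C\<rbrakk> \<Longrightarrow> zero_arr C (u \<star> Idt C M)"
  by (rule closed_hom) blast+

text \<open>The closed structure concerns tensoring on the right; conjugating with the symmetry
  moves its consequences to the left.\<close>

lemma tens_left_eq:
  assumes "f \<in> Arr C" "V \<in> Obj C"
  shows "Idt C V \<star> f = Braid C (Cod C f) V \<cdot> (f \<star> Idt C V) \<cdot> Braid C V (Dom C f)"
proof -
  have "Braid C (Cod C f) V \<cdot> Braid C V (Cod C f) \<cdot> (Idt C V \<star> f) = Idt C (V \<odot> Cod C f) \<cdot> (Idt C V \<star> f)"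
    by (rule comp_eq_extend[OF symmetry]) (use assms in simp_all)
  then show ?thesis using braid_nat[of "Idt C V" f] assms by simp
qed

lemma tens_epi_left:
  assumes e: "epi_arr C e" and V: "V \<in> Obj C"
  shows "epi_arr C (Idt C V \<star> e)"
proof -
  have ea: "e \<in> Arr C" using e by simp
  show ?thesis unfolding tens_left_eq[OF ea V]
    by (rule epi_comp[OF iso_epi[OF braid_iso] epi_comp[OF tens_epi_right[OF e V] iso_epi[OF braid_iso]]])
      (use ea V in simp_all)
qed

lemma tens_cokernel:
  assumes c: "is_cokernel C s c" and M: "M \<in> Obj C"
  shows "is_cokernel C (s \<star> Idt C M) (c \<star> Idt C M)"
proof -
  note D = cokernelD[OF c]
  obtain \<phi> where phi: "\<And>V Y f. \<lbrakk>V \<in> Obj C; f \<in> Arr C; Dom C f = V \<odot> M; Cod C f = Y\<rbrakk> \<Longrightarrow>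
       \<phi> V Y f \<in> Arr C \<and> Dom C (\<phi> V Y f) = V \<and> Cod C (\<phi> V Y f) = IHom C M Y"
    "\<And>V Y f g. \<lbrakk>V \<in> Obj C; f \<in> Arr C; Dom C f = V \<odot> M; Cod C f = Y; g \<in> Arr C; Dom C g = V \<odot> M; Cod C g = Y;
       \<phi> V Y f = \<phi> V Y g\<rbrakk> \<Longrightarrow> f = g"
    "\<And>V Y g. \<lbrakk>Y \<in> Obj C; g \<in> Arr C; Dom C g = V; Cod C g = IHom C M Y\<rbrakk> \<Longrightarrow>
       \<exists>f \<in> Arr C. Dom C f = V \<odot> M \<and> Cod C f = Y \<and> \<phi> V Y f = g"
    "\<And>u Y f. \<lbrakk>u \<in> Arr C; f \<in> Arr C; Dom C f = Cod C u \<odot> M; Cod C f = Y\<rbrakk> \<Longrightarrow>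
       \<phi> (Dom C u) Y (f \<cdot> (u \<star> Idt C M)) = \<phi> (Cod C u) Y f \<cdot> u"
    "\<And>V Y f. \<lbrakk>V \<in> Obj C; f \<in> Arr C; Dom C f = V \<odot> M; Cod C f = Y\<rbrakk> \<Longrightarrow>
       zero_arr C (\<phi> V Y f) \<longleftrightarrow> zero_arr C f"
    by (rule closed_hom[OF M]) (rule that; assumption)
  show ?thesis
  proof (rule cokernelI)
    show "epi_arr C (c \<star> Idt C M)" by (rule tens_epi_right[OF D(5) M])
    have "(c \<star> Idt C M) \<cdot> (s \<star> Idt C M) = (c \<cdot> s) \<star> Idt C M" using interchange[of s c "Idt C M" "Idt C M"] D M by simp
    then show "zero_arr C ((c \<star> Idt C M) \<cdot> (s \<star> Idt C M))" using tens_zero_right[OF D(4) M] by simp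
    fix u assume u: "u \<in> Arr C" "Dom C u = Cod C (s \<star> Idt C M)" "zero_arr C (u \<cdot> (s \<star> Idt C M))"
    let ?Y = "Cod C u"
    have du: "Dom C u = Cod C s \<odot> M" using u D M by simp
    have Y: "?Y \<in> Obj C" using u by simp
    note pu = phi(1)[OF cod_obj[OF D(1)] u(1) du refl]
    have "zero_arr C (\<phi> (Dom C s) ?Y (u \<cdot> (s \<star> Idt C M)))"
      using phi(5)[of "Dom C s" "u \<cdot> (s \<star> Idt C M)" ?Y] u D M by simp
    then have "zero_arr C (\<phi> (Cod C s) ?Y u \<cdot> s)" using phi(4)[OF D(1) u(1) du refl] by simp
    then obtain v where v: "v \<in> Arr C" "Dom C v = Cod C c" "Cod C v = Cod C (\<phi> (Cod C s) ?Y u)" "v \<cdot> c = \<phi> (Cod C s) ?Y u"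
      using cokernel_factor[OF c, of "\<phi> (Cod C s) ?Y u"] pu by metis
    have vc: "Cod C v = IHom C M ?Y" using v(3) pu by simp
    obtain w where w: "w \<in> Arr C" "Dom C w = Cod C c \<odot> M" "Cod C w = ?Y" "\<phi> (Cod C c) ?Y w = v"
      using phi(3)[OF Y v(1,2) vc] by blast
    have "\<phi> (Cod C s) ?Y (w \<cdot> (c \<star> Idt C M)) = \<phi> (Cod C s) ?Y u"
      using phi(4)[OF D(2) w(1,2,3)] D(3) w(4) v(4) by simp
    then have "w \<cdot> (c \<star> Idt C M) = u"
      by (rule phi(2)[OF cod_obj[OF D(1)] _ _ _ u(1) du refl, rotated 3]) (use w D M in simp_all)
    then show "\<exists>v\<in>Arr C. Dom C v = Cod C (c \<star> Idt C M) \<and> Cod C v = Cod C u \<and> v \<cdot> (c \<star> Idt C M) = u"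
      using w D M by (intro bexI[of _ w]) simp_all
  qed (use D M in simp_all)
qed

section \<open>Annihilators\<close>

text \<open>\<open>scal u N\<close> is multiplication by \<open>u : V \<rightarrow> I\<close> on \<open>N\<close>; the \<open>u\<close> for which it vanishes form the annihilator of \<open>N\<close>.\<close>

definition scal where "scal u N = LUnit C N \<cdot> (u \<star> Idt C N)"

lemma scal_arr [simp]:
  assumes "u \<in> Arr C" "Cod C u = Unt C" "N \<in> Obj C"
  shows "scal u N \<in> Arr C" "Dom C (scal u N) = Dom C u \<odot> N" "Cod C (scal u N) = N"
  using assms by (simp_all add: scal_def)

text \<open>Multiplication commutes with arrows. The common value
  \<open>LUnit C (Cod C n) \<cdot> (u \<star> n)\<close> is the product of the ideal
  \<open>u\<close> with the arrow \<open>n\<close>, and it serves below as the normal form of such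
  products.\<close>

lemma scal_nat:
  assumes "u \<in> Arr C" "Cod C u = Unt C" "n \<in> Arr C"
  shows "n \<cdot> scal u (Dom C n) = LUnit C (Cod C n) \<cdot> (u \<star> n)"
    "scal u (Cod C n) \<cdot> (Idt C (Dom C u) \<star> n) = LUnit C (Cod C n) \<cdot> (u \<star> n)"
proof -
  have "LUnit C (Cod C n) \<cdot> (Idt C (Unt C) \<star> n) \<cdot> (u \<star> Idt C (Dom C n)) = n \<cdot> LUnit C (Dom C n) \<cdot> (u \<star> Idt C (Dom C n))"
    by (rule comp_eq_extend2[OF lunit_nat]) (use assms in simp_all)
  then show "n \<cdot> scal u (Dom C n) = LUnit C (Cod C n) \<cdot> (u \<star> n)"
    using interchange[of u "Idt C (Unt C)" "Idt C (Dom C n)" n] assms by (simp add: scal_def)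
  show "scal u (Cod C n) \<cdot> (Idt C (Dom C u) \<star> n) = LUnit C (Cod C n) \<cdot> (u \<star> n)"
    using interchange[of "Idt C (Dom C u)" u n "Idt C (Cod C n)"] assms by (simp add: scal_def)
qed

text \<open>Annihilators can only grow on passing to a subobject: the inclusion is cancelled after
  multiplying. For quotients, in the next lemma, an epimorphism is cancelled before
  multiplying.\<close>

lemma scal_zero_sub:
  assumes u: "u \<in> Arr C" "Cod C u = Unt C" and z: "zero_arr C (scal u N)" and L: "subobject C L N"
  shows "zero_arr C (scal u L)"
proof -
  obtain n where n: "mono_arr C n" "Dom C n = L" "Cod C n = N" using L by (rule subobjectE)
  have na: "n \<in> Arr C" using n by simp
  have "zero_arr C (scal u N \<cdot> (Idt C (Dom C u) \<star> n))"
    by (rule zero_arr_right[OF z]) (use u n na cod_obj[OF na] in simp_all)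
  then have "zero_arr C (n \<cdot> scal u L)" using scal_nat[OF u na] n by simp
  then show ?thesis using mono_zero_iff[OF n(1), of "scal u L"] u n dom_obj[OF na] by simp
qed

lemma scal_zero_quotient:
  assumes u: "u \<in> Arr C" "Cod C u = Unt C" and z: "zero_arr C (scal u N)" and Q: "quotient_object C Q N"
  shows "zero_arr C (scal u Q)"
proof -
  obtain q where q: "epi_arr C q" "Dom C q = N" "Cod C q = Q" using Q by (rule quotient_objectE)
  have qa: "q \<in> Arr C" using q by simp
  have "zero_arr C (q \<cdot> scal u N)" by (rule zero_arr_left[OF z]) (use u q qa dom_obj[OF qa] in simp_all)
  then have "zero_arr C (scal u Q \<cdot> (Idt C (Dom C u) \<star> q))" using scal_nat[OF u qa] q by simp
  then show ?thesis
    using epi_zero_iff[OF tens_epi_left[OF q(1) dom_obj[OF u(1)]], of "scal u Q"] u q qa cod_obj[OF qa] by simp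
qed

text \<open>The image \<open>B\<close> of \<open>I \<rightarrow> [N, N]\<close> is the quotient of \<open>I\<close> by the annihilator of \<open>N\<close>, and it acts on \<open>N\<close>.\<close>

lemma ex_unit_image:
  assumes N: "N \<in> Obj C"
  obtains e b a where "epi_arr C e" "Dom C e = Unt C" "Cod C e = Dom C b" "mono_arr C b" "Cod C b = IHom C N N"
    "a \<in> Arr C" "Dom C a = Dom C b \<odot> N" "Cod C a = N" "a \<cdot> (e \<star> Idt C N) = LUnit C N"
    "\<And>u. \<lbrakk>u \<in> Arr C; Cod C u = Unt C\<rbrakk> \<Longrightarrow> zero_arr C (e \<cdot> u) \<longleftrightarrow> zero_arr C (scal u N)"
proof -
  obtain \<phi> where phi: "\<And>V Y f. \<lbrakk>V \<in> Obj C; f \<in> Arr C; Dom C f = V \<odot> N; Cod C f = Y\<rbrakk> \<Longrightarrow>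
       \<phi> V Y f \<in> Arr C \<and> Dom C (\<phi> V Y f) = V \<and> Cod C (\<phi> V Y f) = IHom C N Y"
    "\<And>V Y f g. \<lbrakk>V \<in> Obj C; f \<in> Arr C; Dom C f = V \<odot> N; Cod C f = Y; g \<in> Arr C; Dom C g = V \<odot> N; Cod C g = Y;
       \<phi> V Y f = \<phi> V Y g\<rbrakk> \<Longrightarrow> f = g"
    "\<And>V Y g. \<lbrakk>Y \<in> Obj C; g \<in> Arr C; Dom C g = V; Cod C g = IHom C N Y\<rbrakk> \<Longrightarrow>
       \<exists>f \<in> Arr C. Dom C f = V \<odot> N \<and> Cod C f = Y \<and> \<phi> V Y f = g"
    "\<And>u Y f. \<lbrakk>u \<in> Arr C; f \<in> Arr C; Dom C f = Cod C u \<odot> N; Cod C f = Y\<rbrakk> \<Longrightarrow>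
       \<phi> (Dom C u) Y (f \<cdot> (u \<star> Idt C N)) = \<phi> (Cod C u) Y f \<cdot> u"
    "\<And>V Y f. \<lbrakk>V \<in> Obj C; f \<in> Arr C; Dom C f = V \<odot> N; Cod C f = Y\<rbrakk> \<Longrightarrow>
       zero_arr C (\<phi> V Y f) \<longleftrightarrow> zero_arr C f"
    by (rule closed_hom[OF N]) (rule that; assumption)
  define \<alpha> where "\<alpha> = \<phi> (Unt C) N (LUnit C N)"
  have al: "\<alpha> \<in> Arr C" "Dom C \<alpha> = Unt C" "Cod C \<alpha> = IHom C N N"
    using phi(1)[of "Unt C" "LUnit C N" N] N by (simp_all add: \<alpha>_def)
  obtain e b where eb: "epi_arr C e" "mono_arr C b" "Dom C e = Dom C \<alpha>" "Cod C e = Dom C b"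
    "Cod C b = Cod C \<alpha>" "b \<cdot> e = \<alpha>" by (rule ex_epi_mono_factor[OF al(1)])
  have ea: "e \<in> Arr C" and ba: "b \<in> Arr C" using eb by simp_all
  have bc: "Cod C b = IHom C N N" and de: "Dom C e = Unt C" using eb al by simp_all
  obtain a where a: "a \<in> Arr C" "Dom C a = Dom C b \<odot> N" "Cod C a = N" "\<phi> (Dom C b) N a = b"
    using phi(3)[OF N ba refl bc] by blast
  have "\<phi> (Unt C) N (a \<cdot> (e \<star> Idt C N)) = \<phi> (Unt C) N (LUnit C N)"
    using phi(4)[OF ea a(1), of N] a eb(4,6) de by (simp add: \<alpha>_def)
  then have ae: "a \<cdot> (e \<star> Idt C N) = LUnit C N"
    by (rule phi(2)[OF Unt_in, rotated 6]) (use a ea eb(4) de N in simp_all)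
  \<comment> \<open>The transpose of \<open>scal u N\<close> is \<open>\<alpha> \<cdot> u\<close>,
    and \<open>\<alpha>\<close> is \<open>e\<close> followed by a monomorphism.\<close>
  have zero: "zero_arr C (e \<cdot> u) \<longleftrightarrow> zero_arr C (scal u N)" if u: "u \<in> Arr C" "Cod C u = Unt C" for u
  proof -
    have "\<phi> (Dom C u) N (scal u N) = \<alpha> \<cdot> u"
      using phi(4)[OF u(1), of "LUnit C N" N] u N by (simp add: scal_def \<alpha>_def)
    moreover have "zero_arr C (\<phi> (Dom C u) N (scal u N)) \<longleftrightarrow> zero_arr C (scal u N)"
      by (rule phi(5)) (use u N in simp_all)
    moreover have "b \<cdot> e \<cdot> u = \<alpha> \<cdot> u" by (rule comp_eq_extend[OF eb(6)]) (use u ea ba eb(4) de in simp_all)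
    moreover have "zero_arr C (b \<cdot> e \<cdot> u) \<longleftrightarrow> zero_arr C (e \<cdot> u)"
      by (rule mono_zero_iff[OF eb(2)]) (use u ea eb(4) de in simp_all)
    ultimately show ?thesis by simp
  qed
  show thesis by (rule that[OF eb(1) de eb(4) eb(2) bc a(1-3) ae zero])
qed

text \<open>\<open>k\<close> is the kernel of the transpose \<open>Q \<rightarrow> [S, Q]\<close> of multiplication by \<open>s : S \<rightarrow> I\<close>.\<close>

lemma ex_killed_part:
  assumes s: "s \<in> Arr C" "Cod C s = Unt C" and Q: "Q \<in> Obj C"
  obtains k where "mono_arr C k" "Cod C k = Q"
    "\<And>v. \<lbrakk>v \<in> Arr C; Cod C v = Q\<rbrakk> \<Longrightarrow> sub_le C v k \<longleftrightarrow> zero_arr C (LUnit C Q \<cdot> (s \<star> v))"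
proof -
  let ?S = "Dom C s"
  have S: "?S \<in> Obj C" using s by simp
  obtain \<phi> where phi: "\<And>V Y f. \<lbrakk>V \<in> Obj C; f \<in> Arr C; Dom C f = V \<odot> ?S; Cod C f = Y\<rbrakk> \<Longrightarrow>
       \<phi> V Y f \<in> Arr C \<and> Dom C (\<phi> V Y f) = V \<and> Cod C (\<phi> V Y f) = IHom C ?S Y"
    "\<And>u Y f. \<lbrakk>u \<in> Arr C; f \<in> Arr C; Dom C f = Cod C u \<odot> ?S; Cod C f = Y\<rbrakk> \<Longrightarrow>
       \<phi> (Dom C u) Y (f \<cdot> (u \<star> Idt C ?S)) = \<phi> (Cod C u) Y f \<cdot> u"
    "\<And>V Y f. \<lbrakk>V \<in> Obj C; f \<in> Arr C; Dom C f = V \<odot> ?S; Cod C f = Y\<rbrakk> \<Longrightarrow>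
       zero_arr C (\<phi> V Y f) \<longleftrightarrow> zero_arr C f"
    by (rule closed_hom[OF S]) (rule that; assumption)
  \<comment> \<open>The braiding puts \<open>S\<close> on the right, where the adjunction for
    \<open>[S, Q]\<close> expects it.\<close>
  define m where "m = scal s Q \<cdot> Braid C Q ?S"
  have m: "m \<in> Arr C" "Dom C m = Q \<odot> ?S" "Cod C m = Q" using s Q by (simp_all add: m_def)
  define \<psi> where "\<psi> = \<phi> Q Q m"
  have psi: "\<psi> \<in> Arr C" "Dom C \<psi> = Q" using phi(1)[OF Q m] by (simp_all add: \<psi>_def)
  obtain k where k: "is_kernel C \<psi> k" using ex_kernel[OF psi(1)] ..
  have "sub_le C v k \<longleftrightarrow> zero_arr C (LUnit C Q \<cdot> (s \<star> v))" if v: "v \<in> Arr C" "Cod C v = Q" for v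
  proof -
    have "sub_le C v k \<longleftrightarrow> zero_arr C (\<psi> \<cdot> v)" using kernel_factor_iff[OF k v(1)] v psi by simp
    also have "\<psi> \<cdot> v = \<phi> (Dom C v) Q (m \<cdot> (v \<star> Idt C ?S))" using phi(2)[OF v(1) m(1)] m v by (simp add: \<psi>_def)
    also have "zero_arr C \<dots> \<longleftrightarrow> zero_arr C (m \<cdot> (v \<star> Idt C ?S))" by (rule phi(3)) (use m v S in simp_all)
    also have "m \<cdot> (v \<star> Idt C ?S) = (scal s Q \<cdot> (Idt C ?S \<star> v)) \<cdot> Braid C (Dom C v) ?S"
      using braid_nat[of v "Idt C ?S"] v s Q S by (simp add: m_def)
    also have "scal s Q \<cdot> (Idt C ?S \<star> v) = LUnit C Q \<cdot> (s \<star> v)" using scal_nat(2)[OF s v(1)] v by simp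
    also have "zero_arr C ((LUnit C Q \<cdot> (s \<star> v)) \<cdot> Braid C (Dom C v) ?S) \<longleftrightarrow> zero_arr C (LUnit C Q \<cdot> (s \<star> v))"
      by (rule epi_zero_iff[OF iso_epi[OF braid_iso]]) (use v s Q S in simp_all)
    finally show ?thesis .
  qed
  then show thesis using that[OF kernelD(5)[OF k]] kernelD(3)[OF k] psi by simp
qed

end

section \<open>Classification of torsion-free classes\<close>

locale acted_cosmos = grothendieck_cosmos C \<kappa> + acted_category C G \<rho>
  for C :: "('o, 'a, 'm) mon_cat_scheme" (structure) and \<kappa> :: "'k rel"
    and G :: "('g, 'n) monoid_scheme" and \<rho> :: "'g \<Rightarrow> ('o, 'a) endofunctor set" +
  assumes loc_noeth: "locally_noetherian \<kappa> C"
    and dualizable_generators: "\<exists>S. (\<forall>D\<in>S. dualizable C D) \<and> generating C S"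
    and localizing_tensor_ideal:
      "localizing_subcategory \<kappa> C \<X> \<Longrightarrow> G_closed G \<rho> \<X> \<Longrightarrow> tensor_ideal C \<X>"
    and torsion_free_hom_ideal:
      "torsion_free_class (noeth_cat C) \<X> \<Longrightarrow> G_closed G \<rho> \<X> \<Longrightarrow> hom_ideal (noeth_cat C) \<X>"
    and Ass_in_closure:
      "\<lbrakk>M \<in> Obj C; x \<in> SuppG G C \<rho> M\<rbrakk> \<Longrightarrow> \<exists>y \<in> AssG G C \<rho> M. y \<in> SpecG_top G C \<rho> closure_of {x}"
begin

text \<open>Closure under coproducts is the part that rests on exactness of direct limits, through
  \<open>Supp_coproduct\<close>.\<close>

lemma SuppG_inv_localizing: "localizing_subcategory \<kappa> C (SuppG_inv U)"
  unfolding localizing_subcategory_def closed_coproducts_def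
proof (intro conjI allI impI)
  show "serre_subcategory C (SuppG_inv U)" by (rule SuppG_inv_serre)
  fix I :: "'k set" and X P \<iota>
  assume I: "small \<kappa> I" and X: "\<forall>i\<in>I. X i \<in> SuppG_inv U" and P: "is_coproduct C I X P \<iota>"
  have "SuppG G C \<rho> P \<subseteq> (\<Union>i\<in>I. SuppG G C \<rho> (X i))"
    using Supp_coproduct[OF I P] unfolding SuppG_def by blast
  then show "P \<in> SuppG_inv U" using X coproductD(1)[OF P] unfolding SuppG_inv_def by blast
qed

lemma SuppG_inv_tensor: "\<lbrakk>X \<in> SuppG_inv U; M \<in> Obj C\<rbrakk> \<Longrightarrow> X \<odot> M \<in> SuppG_inv U"
  using localizing_tensor_ideal[OF SuppG_inv_localizing SuppG_inv_closed] unfolding tensor_ideal_def by blast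

lemma SuppG_inv_sub: "\<lbrakk>X \<in> SuppG_inv U; subobject C L X\<rbrakk> \<Longrightarrow> L \<in> SuppG_inv U"
  using SuppG_inv_serre unfolding serre_subcategory_def closed_subobjects_def by blast

lemma IHom_NC: "IHom NC = IHom C"
  by (simp add: noeth_cat_def full_sub_def)

lemma hom_ideal_D:
  assumes "torsion_free_class NC \<X>" "G_closed G \<rho> \<X>" "L \<in> \<X>" "noetherian C S"
  shows "IHom C S L \<in> \<X>"
  using torsion_free_hom_ideal[OF assms(1,2)] assms(3,4) unfolding hom_ideal_def IHom_NC NC_simps by blast

lemma AssG_inv_IHom: "\<lbrakk>L \<in> AssG_inv G C \<rho> \<Phi>; noetherian C S\<rbrakk> \<Longrightarrow> IHom C S L \<in> AssG_inv G C \<rho> \<Phi>"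
  by (rule hom_ideal_D[OF AssG_inv_torsion_free AssG_inv_closed])

text \<open>The noetherian objects whose associated orbits are among those of \<open>N\<close> form
  a \<open>G\<close>-closed torsion-free class, hence a Hom ideal. It contains \<open>N\<close>, so
  it contains \<open>[N, N]\<close>.\<close>

lemma AssG_IHom:
  assumes "noetherian C N"
  shows "noetherian C (IHom C N N)" "AssG G C \<rho> (IHom C N N) \<subseteq> AssG G C \<rho> N"
  using AssG_inv_IHom[of N "AssG G C \<rho> N" N] assms by (simp_all add: AssG_inv_iff)

text \<open>
  Among the noetherian objects with one associated
  orbit, which is \<open>x\<close> or \<open>y\<close>, choose \<open>N\<close> with maximal annihilator.  By assumption \<open>N\<close> has a subquotient \<open>Y\<close>
  of the other kind; its annihilator is not larger, so \<open>I / ann N = I / ann Y\<close> embeds both in \<open>[N, N]\<close>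
  and in \<open>[Y, Y]\<close>.
\<close>

lemma orbit_separation:
  assumes K: "noetherian C K" "AssG G C \<rho> K = {x}"
    and xy: "\<And>M. M \<in> Obj C \<Longrightarrow> x \<in> SuppG G C \<rho> M \<longleftrightarrow> y \<in> SuppG G C \<rho> M"
  shows "x = y"
proof -
  define \<Y> where "\<Y> = {N. noetherian C N \<and> (AssG G C \<rho> N = {x} \<or> AssG G C \<rho> N = {y})}"
  have KY: "K \<in> \<Y>" using K by (simp add: \<Y>_def)
  note Ko = noeth_obj[OF K(1)]
  obtain e b a where e: "epi_arr C e" "Dom C e = Unt C" "Cod C e = Dom C b" "mono_arr C b" "Cod C b = IHom C K K"
    "a \<in> Arr C" "Dom C a = Dom C b \<odot> K" "Cod C a = K" "a \<cdot> (e \<star> Idt C K) = LUnit C K"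
    "\<And>u. \<lbrakk>u \<in> Arr C; Cod C u = Unt C\<rbrakk> \<Longrightarrow> zero_arr C (e \<cdot> u) \<longleftrightarrow> zero_arr C (scal u K)"
    by (rule ex_unit_image[OF Ko]) (rule that; assumption)
  have ea: "e \<in> Arr C" using e by simp
  have Bn: "noetherian C (Dom C b)" by (rule noetherian_sub[OF AssG_IHom(1)[OF K(1)] subobjectI[OF e(4) refl e(5)]])
  \<comment> \<open>\<open>m\<close> stands for \<open>ann N / ann K\<close> inside
    \<open>B = I / ann K\<close>. Annihilators are measured there because \<open>B\<close>, a
    subobject of \<open>[K, K]\<close>, is noetherian. Such an \<open>m\<close> exists only if
    \<open>ann K\<close> is contained in \<open>ann N\<close>.\<close>
  define ann where "ann m N \<longleftrightarrow> mono_arr C m \<and> Cod C m = Dom C b \<and>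
    (\<forall>w. w \<in> Arr C \<and> Cod C w = Unt C \<longrightarrow> (sub_le C (e \<cdot> w) m \<longleftrightarrow> zero_arr C (scal w N)))" for m N
  have ex_ann: "\<exists>m. ann m N"
    if N: "N \<in> Obj C" and le: "\<And>w. \<lbrakk>w \<in> Arr C; Cod C w = Unt C; zero_arr C (scal w K)\<rbrakk> \<Longrightarrow> zero_arr C (scal w N)" for N
  proof -
    obtain e' b' a' where e': "epi_arr C e'" "Dom C e' = Unt C"
      "\<And>u. \<lbrakk>u \<in> Arr C; Cod C u = Unt C\<rbrakk> \<Longrightarrow> zero_arr C (e' \<cdot> u) \<longleftrightarrow> zero_arr C (scal u N)"
      by (rule ex_unit_image[OF N]) (rule that; assumption)
    obtain k where k: "short_exact C k e" by (rule epi_short_exact[OF e(1)])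
    note kD = short_exactD[OF k]
    have kc: "Cod C k = Unt C" using kD e by simp
    have "zero_arr C (e \<cdot> k)" by (rule kernelD(4)[OF kD(1)])
    then have e'k: "zero_arr C (e' \<cdot> k)" using e(10)[OF kD(6) kc] e'(3)[OF kD(6) kc] le[OF kD(6) kc] by blast
    obtain q where q: "q \<in> Arr C" "Dom C q = Cod C e" "Cod C q = Cod C e'" "q \<cdot> e = e'"
      by (rule cokernel_factor[OF kD(2) epi_arrD[OF e'(1)] _ e'k]) (use e' kc in simp)
    obtain m where m: "is_kernel C q m" using ex_kernel[OF q(1)] ..
    note mD = kernelD[OF m]
    have "sub_le C (e \<cdot> w) m \<longleftrightarrow> zero_arr C (scal w N)" if w: "w \<in> Arr C" "Cod C w = Unt C" for w
    proof -
      have "q \<cdot> e \<cdot> w = e' \<cdot> w" by (rule comp_eq_extend[OF q(4)]) (use q ea e(2) w in simp_all)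
      then show ?thesis using kernel_factor_iff[OF m, of "e \<cdot> w"] e'(3)[OF w] ea e(2) w q by simp
    qed
    then have "ann m N" unfolding ann_def using mD q e(3) by simp
    then show ?thesis ..
  qed
  define S where "S = {m. \<exists>N\<in>\<Y>. ann m N}"
  obtain m0 where "ann m0 K" using ex_ann[OF Ko] by blast
  then have "m0 \<in> S" using KY unfolding S_def by blast
  then obtain m where m: "m \<in> S" "\<And>n. \<lbrakk>n \<in> S; sub_le C m n\<rbrakk> \<Longrightarrow> sub_le C n m"
    by (rule noetherian_maximal[OF Bn]) (auto simp: S_def ann_def)
  then obtain N where N: "N \<in> \<Y>" "ann m N" unfolding S_def by blast
  have Nn: "noetherian C N" using N(1) by (simp add: \<Y>_def)
  note No = noeth_obj[OF Nn]
  \<comment> \<open>Since \<open>x\<close> and \<open>y\<close> lie in the same supports, the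
    support of \<open>N\<close> contains both; \<open>z\<close> is the associated one and
    \<open>z'\<close> the other.\<close>
  obtain z z' where z: "AssG G C \<rho> N = {z}" "z' \<in> SuppG G C \<rho> N" "(z = x \<and> z' = y) \<or> (z = y \<and> z' = x)"
  proof -
    have "x \<in> SuppG G C \<rho> N \<and> y \<in> SuppG G C \<rho> N"
      using N(1) AssG_subset_SuppG[of N] xy[OF No] unfolding \<Y>_def by auto
    then show thesis using N(1) that[of x y] that[of y x] unfolding \<Y>_def by blast
  qed
  obtain Y L where Y: "monoform C Y" "subobject C L N" "quotient_object C Y L" "z' = orbit Y"
    using z(2) by (rule SuppGE)
  have Yn: "noetherian C Y" by (rule noetherian_quotient[OF noetherian_sub[OF Nn Y(2)] Y(3)])
  note Yo = noeth_obj[OF Yn]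
  have AY: "AssG G C \<rho> Y = {z'}" using AssG_monoform[OF Y(1)] Y(4) by simp
  have YY: "Y \<in> \<Y>" using Yn AY z(3) unfolding \<Y>_def by auto
  have NY: "zero_arr C (scal w Y)" if "w \<in> Arr C" "Cod C w = Unt C" "zero_arr C (scal w N)" for w
    by (rule scal_zero_quotient[OF that(1,2) scal_zero_sub[OF that Y(2)] Y(3)])
  have mm: "mono_arr C m" "Cod C m = Dom C b"
    and mN: "\<And>w. \<lbrakk>w \<in> Arr C; Cod C w = Unt C\<rbrakk> \<Longrightarrow> sub_le C (e \<cdot> w) m \<longleftrightarrow> zero_arr C (scal w N)"
    using N(2) unfolding ann_def by blast+
  have KN: "zero_arr C (scal w N)" if w: "w \<in> Arr C" "Cod C w = Unt C" "zero_arr C (scal w K)" for w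
  proof -
    have "zero_arr C (e \<cdot> w)" using e(10) w by simp
    then have "sub_le C (e \<cdot> w) m" by (rule zero_sub_le) (use mm ea e(2,3) w in simp_all)
    then show ?thesis using mN w by simp
  qed
  obtain n where n: "ann n Y" using ex_ann[OF Yo] KN NY by blast
  have mn': "mono_arr C n" "Cod C n = Dom C b"
    and nY: "\<And>w. \<lbrakk>w \<in> Arr C; Cod C w = Unt C\<rbrakk> \<Longrightarrow> sub_le C (e \<cdot> w) n \<longleftrightarrow> zero_arr C (scal w Y)"
    using n unfolding ann_def by blast+
  have "sub_le C m n"
  proof -
    \<comment> \<open>The predicate \<open>ann\<close> tests only images of arrows into the unit. So
      \<open>m\<close> is represented by its inverse image \<open>p\<close> in the unit, which kills
      \<open>N\<close> and therefore \<open>Y\<close>.\<close>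
    obtain p r where p: "mono_arr C p" "Cod C p = Dom C e" "r \<in> Arr C" "Dom C r = Dom C p" "Cod C r = Dom C m"
      "m \<cdot> r = e \<cdot> p" "epi_arr C r"
      using ex_pullback_mono[OF mm(1) ea] e(1,3) mm(2) by metis
    have pa: "p \<in> Arr C" "Cod C p = Unt C" using p e(2) by simp_all
    have "sub_le C (m \<cdot> r) m" by (rule sub_le_comp) (use p mm in simp_all)
    then have "sub_le C (e \<cdot> p) m" using p(6) by simp
    then have "sub_le C (e \<cdot> p) n" using mN[OF pa] nY[OF pa] NY[OF pa] by simp
    then have "sub_le C (m \<cdot> r) n" using p(6) by simp
    then show ?thesis by - (rule sub_le_epi_cancel[OF p(7) mn'(1)], insert p mm mn', simp_all)
  qed
  then have nm: "sub_le C n m" using m(2) YY n unfolding S_def by blast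
  have same: "zero_arr C (scal w N) \<longleftrightarrow> zero_arr C (scal w Y)" if w: "w \<in> Arr C" "Cod C w = Unt C" for w
    using mN[OF w] nY[OF w] NY[OF w] sub_le_trans[OF _ nm mono_arrD[OF mm(1)], of "e \<cdot> w"] by blast
  obtain e1 b1 a1 where e1: "epi_arr C e1" "Dom C e1 = Unt C" "Cod C e1 = Dom C b1" "mono_arr C b1" "Cod C b1 = IHom C N N"
    "a1 \<in> Arr C" "Dom C a1 = Dom C b1 \<odot> N" "Cod C a1 = N" "a1 \<cdot> (e1 \<star> Idt C N) = LUnit C N"
    "\<And>u. \<lbrakk>u \<in> Arr C; Cod C u = Unt C\<rbrakk> \<Longrightarrow> zero_arr C (e1 \<cdot> u) \<longleftrightarrow> zero_arr C (scal u N)"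
    by (rule ex_unit_image[OF No]) (rule that; assumption)
  obtain e2 b2 a2 where e2: "epi_arr C e2" "Dom C e2 = Unt C" "Cod C e2 = Dom C b2" "mono_arr C b2" "Cod C b2 = IHom C Y Y"
    "a2 \<in> Arr C" "Dom C a2 = Dom C b2 \<odot> Y" "Cod C a2 = Y" "a2 \<cdot> (e2 \<star> Idt C Y) = LUnit C Y"
    "\<And>u. \<lbrakk>u \<in> Arr C; Cod C u = Unt C\<rbrakk> \<Longrightarrow> zero_arr C (e2 \<cdot> u) \<longleftrightarrow> zero_arr C (scal u Y)"
    by (rule ex_unit_image[OF Yo]) (rule that; assumption)
  have e1a: "e1 \<in> Arr C" and e2a: "e2 \<in> Arr C" using e1 e2 by simp_all
  have same_ker: "zero_arr C (e1 \<cdot> u) \<longleftrightarrow> zero_arr C (e2 \<cdot> u)" if "u \<in> Arr C" "Cod C u = Dom C e1" for u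
    using that same e1(2,10) e2(10) by simp
  have d21: "Dom C e2 = Dom C e1" using e1 e2 by simp
  \<comment> \<open>Equal annihilators identify the images of the unit in \<open>[N, N]\<close> and
    \<open>[Y, Y]\<close>. The associated orbits of \<open>Dom C b1\<close> then lie in both
    \<open>{z}\<close> and \<open>{z'}\<close>.\<close>
  obtain j where j: "mono_arr C j" "Dom C j = Cod C e1" "Cod C j = Cod C e2"
    by (rule ex_mono_of_same_kernel[OF e1(1) e2a d21 same_ker]) blast
  have s1: "subobject C (Dom C b1) (IHom C N N)" by (rule subobjectI[OF e1(4) refl e1(5)])
  have "subobject C (Dom C b1) (Dom C b2)" by (rule subobjectI[OF j(1)]) (use j e1 e2 in simp_all)
  then have s2: "subobject C (Dom C b1) (IHom C Y Y)"
    using subobject_trans subobjectI[OF e2(4) refl e2(5)] by blast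
  \<comment> \<open>If it were zero, the unit isomorphism of \<open>N\<close>, which factors through
    \<open>e1 \<star> Idt C N\<close>, would vanish.\<close>
  have "\<not> is_zero C (Dom C b1)"
  proof
    assume "is_zero C (Dom C b1)"
    then have "zero_arr C e1" using is_zero_zero_arr e1a e1(3) by simp
    then have "zero_arr C (e1 \<star> Idt C N)" using tens_zero_right No by simp
    then have "zero_arr C (LUnit C N)"
      by (rule zero_left_eq[OF _ e1(9)]) (use e1 e1a No in simp_all)
    then have "is_zero C N" using epi_zero_cod[OF iso_epi[OF lunit_iso[OF No]]] No by simp
    then show False using AssG_zero z(1) by simp
  qed
  then have "AssG G C \<rho> (Dom C b1) \<noteq> {}"
    using AssG_nonempty noetherian_sub[OF AssG_IHom(1)[OF Nn] s1] by blast
  moreover have "AssG G C \<rho> (Dom C b1) \<subseteq> {z}" using AssG_sub[OF s1] AssG_IHom(2)[OF Nn] z(1) by simp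
  moreover have "AssG G C \<rho> (Dom C b1) \<subseteq> {z'}" using AssG_sub[OF s2] AssG_IHom(2)[OF Yn] AY by simp
  ultimately have "z = z'" by blast
  then show "x = y" using z(3) by auto
qed

text \<open>
  \<open>Q\<close> is killed by a subobject \<open>S\<close> of \<open>I\<close> such that \<open>I / S\<close> is supported in the support of \<open>Q\<close>:
  take the part \<open>k\<close> of \<open>Q\<close> killed by such an \<open>S\<close> to be maximal.  If \<open>d : D \<rightarrow> Q\<close> with \<open>D\<close> dualizable does
  not factor through \<open>k\<close>, intersect \<open>S\<close> with the kernel of \<open>I \<rightarrow> Q \<odot> E\<close>, where \<open>E\<close> is dual to \<open>D\<close>;
  this kernel kills \<open>d\<close>.
\<close>

lemma ex_killing_ideal:
  assumes Q: "noetherian C Q"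
  obtains s c where "short_exact C s c" "Cod C s = Unt C" "Cod C c \<in> SuppG_inv (SuppG G C \<rho> Q)"
    "zero_arr C (scal s Q)"
proof -
  note Qo = noeth_obj[OF Q]
  define \<L> where "\<L> = SuppG_inv (SuppG G C \<rho> Q)"
  have QL: "Q \<in> \<L>" using Qo by (simp add: \<L>_def SuppG_inv_def)
  define ideal where "ideal s c \<longleftrightarrow> short_exact C s c \<and> Cod C s = Unt C \<and> Cod C c \<in> \<L>" for s c
  define killed where "killed s k \<longleftrightarrow> mono_arr C k \<and> Cod C k = Q \<and>
    (\<forall>v. v \<in> Arr C \<and> Cod C v = Q \<longrightarrow> (sub_le C v k \<longleftrightarrow> zero_arr C (LUnit C Q \<cdot> (s \<star> v))))" for s k
  have ex_killed: "\<exists>k. killed s k" if "s \<in> Arr C" "Cod C s = Unt C" for s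
    unfolding killed_def by (rule ex_killed_part[OF that Qo]) blast
  \<comment> \<open>The maximum is taken over the killed parts of the noetherian \<open>Q\<close>,
    not over ideals of the unit, for which no chain condition is available.\<close>
  define T where "T = {k. \<exists>s c. ideal s c \<and> killed s k}"
  obtain c0 where c0: "short_exact C (Idt C (Unt C)) c0" using mono_short_exact[OF idt_mono[OF Unt_in]] .
  note c0D = short_exactD[OF c0]
  have "zero_arr C c0" using kernelD(4)[OF c0D(1)] c0D(5,7) by simp
  then have "is_zero C (Cod C c0)" by (rule epi_zero_cod[OF c0D(4)])
  then have "Cod C c0 \<in> \<L>" using is_zero_obj by (simp add: \<L>_def SuppG_inv_def SuppG_def Supp_zero)
  then have i0: "ideal (Idt C (Unt C)) c0" unfolding ideal_def using c0 by simp
  obtain k0 where "killed (Idt C (Unt C)) k0" using ex_killed[of "Idt C (Unt C)"] by auto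
  then have "k0 \<in> T" unfolding T_def using i0 by blast
  then obtain k where k: "k \<in> T" "\<And>n. \<lbrakk>n \<in> T; sub_le C k n\<rbrakk> \<Longrightarrow> sub_le C n k"
    by (rule noetherian_maximal[OF Q]) (auto simp: T_def killed_def)
  then obtain s c where sc: "ideal s c" and sk: "killed s k" unfolding T_def by blast
  have se: "short_exact C s c" "Cod C s = Unt C" "Cod C c \<in> \<L>" using sc unfolding ideal_def by blast+
  note seD = short_exactD[OF se(1)]
  have km: "mono_arr C k" "Cod C k = Q"
    and kle: "\<And>v. \<lbrakk>v \<in> Arr C; Cod C v = Q\<rbrakk> \<Longrightarrow> sub_le C v k \<longleftrightarrow> zero_arr C (LUnit C Q \<cdot> (s \<star> v))"
    using sk unfolding killed_def by blast+
  have dk: "sub_le C d k" if D: "dualizable C D" and d: "d \<in> Arr C" "Dom C d = D" "Cod C d = Q" for D d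
  proof -
    obtain E where Do: "D \<in> Obj C" and E: "E \<in> Obj C" "right_adjoint C (tensor_right C E) (tensor_right C D)"
      using D unfolding dualizable_def by blast
    obtain \<phi> where phi: "\<And>V Y f. \<lbrakk>V \<in> Obj C; f \<in> Arr C; Dom C f = V \<odot> D; Cod C f = Y\<rbrakk> \<Longrightarrow>
         \<phi> V Y f \<in> Arr C \<and> Dom C (\<phi> V Y f) = V \<and> Cod C (\<phi> V Y f) = Y \<odot> E"
      "\<And>u Y f. \<lbrakk>u \<in> Arr C; f \<in> Arr C; Dom C f = Cod C u \<odot> D; Cod C f = Y\<rbrakk> \<Longrightarrow>
         \<phi> (Dom C u) Y (f \<cdot> (u \<star> Idt C D)) = \<phi> (Cod C u) Y f \<cdot> u"
      "\<And>V Y f. \<lbrakk>V \<in> Obj C; f \<in> Arr C; Dom C f = V \<odot> D; Cod C f = Y\<rbrakk> \<Longrightarrow>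
         zero_arr C (\<phi> V Y f) \<longleftrightarrow> zero_arr C f"
      by (rule right_adjoint_hom[OF E(2), unfolded tensor_right_def endofunctor.simps]) (rule that; assumption)
    define f where "f = d \<cdot> LUnit C D"
    have f: "f \<in> Arr C" "Dom C f = Unt C \<odot> D" "Cod C f = Q" using d Do by (simp_all add: f_def)
    \<comment> \<open>The transpose of \<open>I \<odot> D -> D -> Q\<close>. An arrow into the unit
      is killed by \<open>\<gamma>\<close> exactly if its product with \<open>d\<close>
      vanishes.\<close>
    define \<gamma> where "\<gamma> = \<phi> (Unt C) Q f"
    have g: "\<gamma> \<in> Arr C" "Dom C \<gamma> = Unt C" "Cod C \<gamma> = Q \<odot> E"
      using phi(1)[OF Unt_in f] by (simp_all add: \<gamma>_def)
    have gzero: "zero_arr C (\<gamma> \<cdot> u) \<longleftrightarrow> zero_arr C (d \<cdot> scal u D)" if u: "u \<in> Arr C" "Cod C u = Unt C" for u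
    proof -
      have "\<gamma> \<cdot> u = \<phi> (Dom C u) Q (f \<cdot> (u \<star> Idt C D))" using phi(2)[OF u(1) f(1)] f u by (simp add: \<gamma>_def)
      moreover have "zero_arr C (\<phi> (Dom C u) Q (f \<cdot> (u \<star> Idt C D))) \<longleftrightarrow> zero_arr C (f \<cdot> (u \<star> Idt C D))"
        by (rule phi(3)) (use f u Do in simp_all)
      moreover have "f \<cdot> (u \<star> Idt C D) = d \<cdot> scal u D" using d u Do by (simp add: f_def scal_def)
      ultimately show ?thesis by simp
    qed
    obtain t where t: "is_kernel C \<gamma> t" using ex_kernel[OF g(1)] ..
    note tD = kernelD[OF t]
    have ts: "Cod C s = Cod C t" using tD g se by simp
    \<comment> \<open>\<open>s \<cdot> p\<close> is the intersection of \<open>s\<close> with the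
      kernel of \<open>\<gamma>\<close>.\<close>
    obtain p r where p: "mono_arr C p" "Cod C p = Dom C s" "r \<in> Arr C" "Dom C r = Dom C p" "Cod C r = Dom C t"
      "t \<cdot> r = s \<cdot> p" "\<And>u. \<lbrakk>u \<in> Arr C; Cod C u = Dom C s\<rbrakk> \<Longrightarrow> sub_le C u p \<longleftrightarrow> sub_le C (s \<cdot> u) t"
      using ex_pullback_mono[OF tD(5) seD(6) ts] by metis
    define s' where "s' = s \<cdot> p"
    have s': "mono_arr C s'" "Cod C s' = Unt C" "Dom C s' = Dom C p"
      using mono_comp[OF seD(3) p(1,2)] p seD se by (simp_all add: s'_def)
    have s'a: "s' \<in> Arr C" using s' by simp
    obtain c' where c': "short_exact C s' c'" by (rule mono_short_exact[OF s'(1)])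
    have le: "sub_le C s' s" unfolding s'_def by (rule sub_le_comp) (use seD p in simp_all)
    have "sub_le C s' t" unfolding s'_def p(6)[symmetric] by (rule sub_le_comp) (use tD p in simp_all)
    then have gs': "zero_arr C (\<gamma> \<cdot> s')" using kernel_factor_iff[OF t s'a] s' g by simp
    have max: "sub_le C w s'" if w: "w \<in> Arr C" "Cod C w = Cod C s" "sub_le C w s" "zero_arr C (\<gamma> \<cdot> w)" for w
    proof -
      obtain h where h: "h \<in> Arr C" "Dom C h = Dom C w" "Cod C h = Dom C s" "s \<cdot> h = w" using w(3) by (rule sub_leE)
      have "sub_le C w t" using kernel_factor[OF t w(1)] w(2,4) se g by simp
      then have "sub_le C h p" using p(7)[OF h(1,3)] h(4) by simp
      then have "sub_le C (s \<cdot> h) (s \<cdot> p)" by (rule sub_le_comp_left) (use p seD in simp_all)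
      then show ?thesis using h(4) by (simp add: s'_def)
    qed
    \<comment> \<open>The new quotient of the unit is an extension of the old one by a subobject of
      \<open>Q \<odot> E\<close>. Both lie in \<open>\<L>\<close>, the second because
      \<open>\<L>\<close> is a tensor ideal.\<close>
    obtain l h where lh: "short_exact C l h" "Cod C l = Cod C c'" "Cod C h = Cod C c" "subobject C (Dom C l) (Cod C \<gamma>)"
      by (rule quotient_by_intersection[OF se(1) g(1) _ c' _ le gs' max]) (use g s' se in simp_all)
    have "Dom C l \<in> \<L>"
      using SuppG_inv_sub lh(4) SuppG_inv_tensor[OF QL[unfolded \<L>_def] E(1)] unfolding \<L>_def g(3) by blast
    then have "Cod C l \<in> \<L>"
      using SuppG_inv_serre lh(1,3) se(3) unfolding \<L>_def serre_subcategory_def closed_extensions_def by metis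
    then have id': "ideal s' c'" unfolding ideal_def using c' s' lh(2) by simp
    obtain k' where k': "killed s' k'" using ex_killed[OF s'a s'(2)] ..
    have k'm: "mono_arr C k'" "Cod C k' = Q"
      and k'le: "\<And>v. \<lbrakk>v \<in> Arr C; Cod C v = Q\<rbrakk> \<Longrightarrow> sub_le C v k' \<longleftrightarrow> zero_arr C (LUnit C Q \<cdot> (s' \<star> v))"
      using k' unfolding killed_def by blast+
    have "sub_le C k k'"
    proof -
      have ka: "k \<in> Arr C" using km by simp
      have "zero_arr C (LUnit C Q \<cdot> (s \<star> k))" using kle[OF ka km(2)] sub_le_refl[OF ka] by simp
      then have "zero_arr C ((LUnit C Q \<cdot> (s \<star> k)) \<cdot> (p \<star> Idt C (Dom C k)))"
        by (rule zero_arr_right) (use seD se p ka km Qo in simp_all)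
      moreover have "(LUnit C Q \<cdot> (s \<star> k)) \<cdot> (p \<star> Idt C (Dom C k)) = LUnit C Q \<cdot> (s' \<star> k)"
        using interchange[of p s "Idt C (Dom C k)" k] seD se p ka km Qo by (simp add: s'_def)
      ultimately show ?thesis using k'le[OF ka km(2)] by simp
    qed
    \<comment> \<open>The smaller ideal kills at least as much, so maximality of \<open>k\<close>
      makes the two killed parts equal. The new one contains \<open>d\<close> by
      construction.\<close>
    then have k'k: "sub_le C k' k" using k(2) id' k' unfolding T_def by blast
    have "zero_arr C (d \<cdot> scal s' D)" using gzero[OF s'a s'(2)] gs' by simp
    then have "zero_arr C (LUnit C Q \<cdot> (s' \<star> d))" using scal_nat(1)[OF s'a s'(2) d(1)] d by simp
    then have "sub_le C d k'" using k'le[OF d(1,3)] by simp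
    then show ?thesis using sub_le_trans[OF _ k'k] km by simp
  qed
  \<comment> \<open>Every arrow from a dualizable generator factors through \<open>k\<close>, so the
    cokernel of \<open>k\<close> is zero.\<close>
  have "sub_le C (Idt C Q) k"
  proof -
    obtain q where q: "short_exact C k q" by (rule mono_short_exact[OF km(1)])
    note qD = short_exactD[OF q]
    have dq: "Dom C q = Q" using qD(5) km by simp
    have "zero_arr C q"
    proof (rule ccontr)
      assume q0: "\<not> zero_arr C q"
      obtain z where z: "zero_arr C z" "Dom C z = Q" "Cod C z = Cod C q" using ex_zero_arr[OF Qo cod_obj[OF qD(7)]] .
      obtain S where S: "\<forall>D\<in>S. dualizable C D" "generating C S" using dualizable_generators by blast
      have "q \<in> homs C Q (Cod C q)" "z \<in> homs C Q (Cod C q)" "q \<noteq> z" using z q0 dq qD(7) by (auto simp: homs_def)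
      then obtain D d where D: "D \<in> S" "d \<in> homs C D Q" "q \<cdot> d \<noteq> z \<cdot> d" using S(2) unfolding generating_def by blast
      have d: "d \<in> Arr C" "Dom C d = D" "Cod C d = Q" using D(2) by (simp_all add: homs_def)
      have "sub_le C d k" by (rule dk[OF _ d]) (use S D in blast)
      then have "zero_arr C (q \<cdot> d)" using kernel_factor_iff[OF qD(1) d(1)] d dq by simp
      then have "q \<cdot> d = z \<cdot> d" by (rule zero_arr_unique) (use z d dq qD(7) in simp_all)
      then show False using D(3) by simp
    qed
    then show ?thesis using kernel_factor_iff[OF qD(1), of "Idt C Q"] Qo dq qD(7) by simp
  qed
  then have "zero_arr C (scal s Q)" using kle[of "Idt C Q"] Qo by (simp add: scal_def)
  then show thesis using that[OF se(1,2)] se(3) unfolding \<L>_def by blast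
qed

text \<open>As \<open>s\<close> kills \<open>K\<close>, the unit isomorphism
  \<open>I \<odot> K -> K\<close> factors through \<open>Cod C c \<odot> K\<close>. So
  \<open>K\<close> is a quotient of an object of the tensor ideal.\<close>

lemma SuppG_of_killed:
  assumes s: "short_exact C s c" "Cod C s = Unt C" "Cod C c \<in> SuppG_inv U" and K: "K \<in> Obj C" "zero_arr C (scal s K)"
  shows "SuppG G C \<rho> K \<subseteq> U"
proof -
  note D = short_exactD[OF s(1)]
  have dc: "Dom C c = Unt C" using D s by simp
  have ck: "is_cokernel C (s \<star> Idt C K) (c \<star> Idt C K)" by (rule tens_cokernel[OF D(2) K(1)])
  obtain t where t: "t \<in> Arr C" "Dom C t = Cod C c \<odot> K" "Cod C t = K" "t \<cdot> (c \<star> Idt C K) = LUnit C K"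
    by (rule cokernel_factor[OF ck, of "LUnit C K"]) (use K D s dc in \<open>simp_all add: scal_def\<close>)
  have "epi_arr C (t \<cdot> (c \<star> Idt C K))" using iso_epi[OF lunit_iso[OF K(1)]] t by simp
  then have "epi_arr C t" by (rule epi_of_comp) (use t D K in simp_all)
  then have "quotient_object C K (Cod C c \<odot> K)" using t by (intro quotient_objectI[of t]) simp_all
  then have "SuppG G C \<rho> K \<subseteq> SuppG G C \<rho> (Cod C c \<odot> K)" by (rule SuppG_quotient)
  also have "\<dots> \<subseteq> U" using SuppG_inv_tensor[OF s(3) K(1)] by (simp add: SuppG_inv_def)
  finally show ?thesis .
qed

end

section \<open>A fixed \<open>G\<close>-closed torsion-free class\<close>

context acted_cosmos
begin

context
  fixes \<X>
  assumes \<X>: "\<X> \<in> G_torsion_free_classes G C \<rho>"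
begin

lemma X_torsion_free: "torsion_free_class NC \<X>" and X_closed: "G_closed G \<rho> \<X>"
  using \<X> unfolding G_torsion_free_classes_def by blast+

lemmas X_D = torsion_free_NC_D[OF X_torsion_free]

lemma X_isomorphic: "\<lbrakk>X \<in> \<X>; isomorphic C Y X\<rbrakk> \<Longrightarrow> Y \<in> \<X>"
  using X_D(3) isomorphic_sub by blast

text \<open>The class knows the orbit \<open>x\<close> only through some monoform \<open>H'\<close>.
  A translate of \<open>H'\<close> lies in the class as well and has the same atom as a monoform
  subobject of \<open>N\<close>, so the two share a nonzero subobject.\<close>

lemma ex_sub_in_X:
  assumes x: "x \<in> AssG G C \<rho> N" "x \<in> AssG_class G C \<rho> \<X>"
  obtains L where "L \<in> \<X>" "\<not> is_zero C L" "subobject C L N"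
proof -
  obtain H where H: "monoform C H" "subobject C H N" "x = orbit H" using x(1) by (rule AssGE)
  obtain X where X: "X \<in> \<X>" "x \<in> AssG G C \<rho> X" using x(2) unfolding AssG_class_def by blast
  obtain H' where H': "monoform C H'" "subobject C H' X" "x = orbit H'" using X(2) by (rule AssGE)
  have H'X: "H' \<in> \<X>" using X_D(3)[OF X(1) H'(2)] .
  obtain g where g: "g \<in> carrier G" "atom C H = atom C (act \<rho> g H')"
    by (rule orbit_eqE[OF H'(1) H(1)]) (use H(3) H'(3) in simp)
  have gX: "act \<rho> g H' \<in> \<X>" using X_closed g(1) H'X unfolding G_closed_def by blast
  obtain L where L: "\<not> is_zero C L" "subobject C L H" "subobject C L (act \<rho> g H')"
    using g(2) unfolding atom_eq_iff[OF H(1) act_monoform[OF g(1) H'(1)]] by (rule common_nonzero_subobjectE)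
  show thesis using that[OF X_D(3)[OF gX L(3)] L(1)] subobject_trans[OF L(2) H(2)] by blast
qed

text \<open>Choose \<open>n\<close> maximal among the subobjects in the class. A forbidden orbit of
  the quotient would give a nonzero subobject of the quotient in the class; its inverse image, an
  extension, would be in the class and strictly larger.\<close>

lemma ex_maximal_in_X:
  assumes M: "noetherian C M"
  obtains n q where "short_exact C n q" "Cod C n = M" "Dom C n \<in> \<X>"
    "AssG G C \<rho> (Cod C q) \<inter> AssG_class G C \<rho> \<X> = {}"
proof -
  define S where "S = {n. mono_arr C n \<and> Cod C n = M \<and> Dom C n \<in> \<X>}"
  obtain z where z: "mono_arr C z" "Cod C z = M" "is_zero C (Dom C z)" using ex_zero_sub[OF noeth_obj[OF M]] .
  then have "z \<in> S" using X_D(2) unfolding S_def by blast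
  then obtain n where n: "n \<in> S" "\<And>n'. \<lbrakk>n' \<in> S; sub_le C n n'\<rbrakk> \<Longrightarrow> sub_le C n' n"
    by (rule noetherian_maximal[OF M]) (auto simp: S_def)
  then have nS: "mono_arr C n" "Cod C n = M" "Dom C n \<in> \<X>" unfolding S_def by blast+
  obtain q where q: "short_exact C n q" by (rule mono_short_exact[OF nS(1)])
  note qD = short_exactD[OF q]
  have "x \<notin> AssG_class G C \<rho> \<X>" if x: "x \<in> AssG G C \<rho> (Cod C q)" for x
  proof
    assume "x \<in> AssG_class G C \<rho> \<X>"
    then obtain L where L: "L \<in> \<X>" "\<not> is_zero C L" "subobject C L (Cod C q)" using ex_sub_in_X[OF x] by blast
    obtain h where h: "mono_arr C h" "Dom C h = L" "Cod C h = Cod C q" using L(3) by (rule subobjectE)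
    obtain p n' r where p: "mono_arr C p" "Cod C p = Cod C n" "short_exact C n' r" "Dom C n' = Dom C n"
      "Cod C n' = Dom C p" "Cod C r = Dom C h" "p \<cdot> n' = n" "h \<cdot> r = q \<cdot> p" "sub_le C n p"
      by (rule pullback_extension[OF q h(1,3)])
    note rD = short_exactD[OF p(3)]
    have pn: "noetherian C (Cod C n')"
      unfolding p(5) by (rule noetherian_sub[OF M subobjectI[OF p(1) refl]]) (use p nS in simp)
    have "Cod C n' \<in> \<X>" by (rule X_D(4)[OF p(3) pn]) (use p nS h L in simp_all)
    then have "p \<in> S" unfolding S_def using p nS by simp
    then have "sub_le C p n" using n(2) p(9) by blast
    then have "zero_arr C (h \<cdot> r)" using kernel_factor_iff[OF qD(1), of p] p(1,2,8) qD by simp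
    then have "zero_arr C r" using mono_zero_iff[OF h(1), of r] rD p by simp
    then have "is_zero C (Cod C r)" by (rule epi_zero_cod[OF rD(4)])
    then show False using L(2) p(6) h(2) by simp
  qed
  then show thesis using that[OF q nS(2,3)] by blast
qed

text \<open>
  With \<open>L \<subseteq> M\<close> maximal in \<open>\<X>\<close>, \<open>Q = M / L\<close> and \<open>S \<subseteq> I\<close> killing \<open>Q\<close>, multiplication gives
  \<open>M \<rightarrow> [S, L]\<close>, and \<open>[S, L] \<in> \<X>\<close>; since \<open>S\<close> need not be noetherian, it is replaced by its image in
  \<open>I / ann M \<subseteq> [M, M]\<close>.  The kernel is killed by \<open>S\<close>, hence supported in the support of \<open>Q\<close>; if it is
  nonzero, the hypothesis on closures makes \<open>x\<close> indistinguishable from an associated orbit of \<open>Q\<close>.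
\<close>

lemma one_orbit_in_X:
  assumes M: "noetherian C M" and x: "AssG G C \<rho> M = {x}" "x \<in> AssG_class G C \<rho> \<X>"
  shows "M \<in> \<X>"
proof -
  note Mo = noeth_obj[OF M]
  obtain n q where nq: "short_exact C n q" "Cod C n = M" "Dom C n \<in> \<X>"
    "AssG G C \<rho> (Cod C q) \<inter> AssG_class G C \<rho> \<X> = {}" by (rule ex_maximal_in_X[OF M])
  note qD = short_exactD[OF nq(1)]
  have dq: "Dom C q = M" using qD nq by simp
  have Qn: "noetherian C (Cod C q)" by (rule noetherian_quotient[OF M quotient_objectI[OF qD(4) dq refl]])
  note Qo = noeth_obj[OF Qn] and Ln = X_D(1)[OF nq(3)]
  note Lo = noeth_obj[OF Ln]
  obtain s c where s: "short_exact C s c" "Cod C s = Unt C" "Cod C c \<in> SuppG_inv (SuppG G C \<rho> (Cod C q))"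
    "zero_arr C (scal s (Cod C q))" by (rule ex_killing_ideal[OF Qn])
  note sD = short_exactD[OF s(1)]
  have So: "Dom C s \<in> Obj C" using sD by simp
  obtain e b a where e: "epi_arr C e" "Dom C e = Unt C" "Cod C e = Dom C b" "mono_arr C b" "Cod C b = IHom C M M"
    "a \<in> Arr C" "Dom C a = Dom C b \<odot> M" "Cod C a = M" "a \<cdot> (e \<star> Idt C M) = LUnit C M"
    by (rule ex_unit_image[OF Mo]) (rule that; assumption)
  have ea: "e \<in> Arr C" using e by simp
  have Bn: "noetherian C (Dom C b)" by (rule noetherian_sub[OF AssG_IHom(1)[OF M] subobjectI[OF e(4) refl e(5)]])
  have es: "e \<cdot> s \<in> Arr C" "Dom C (e \<cdot> s) = Dom C s" "Cod C (e \<cdot> s) = Dom C b" using ea e sD s by simp_all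
  \<comment> \<open>\<open>j\<close> is the image of the ideal \<open>s\<close> in
    \<open>I / ann M\<close>; as a subobject of a noetherian object, its domain is admissible in the
    Hom ideal property.\<close>
  obtain t j where tj: "epi_arr C t" "mono_arr C j" "Dom C t = Dom C (e \<cdot> s)" "Cod C t = Dom C j"
    "Cod C j = Cod C (e \<cdot> s)" "j \<cdot> t = e \<cdot> s" by (rule ex_epi_mono_factor[OF es(1)])
  let ?S = "Dom C j"
  have ta: "t \<in> Arr C" "Dom C t = Dom C s" "Cod C t = ?S" and ja: "j \<in> Arr C" "Cod C j = Dom C b"
    using tj es by simp_all
  have Sn: "noetherian C ?S" by (rule noetherian_sub[OF Bn subobjectI[OF tj(2) refl ja(2)]])
  note S'o = noeth_obj[OF Sn]
  \<comment> \<open>Multiplication by \<open>s\<close> on \<open>M\<close> factors through its image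
    \<open>j\<close> acting by \<open>a\<close>, so vanishing and factorization statements pass
    between the two.\<close>
  have act_eq: "a \<cdot> (j \<star> v) \<cdot> (t \<star> Idt C (Dom C v)) = LUnit C M \<cdot> (s \<star> v)" if v: "v \<in> Arr C" "Cod C v = M" for v
  proof -
    have "(j \<star> v) \<cdot> (t \<star> Idt C (Dom C v)) = (e \<cdot> s) \<star> v"
      using interchange[of t j "Idt C (Dom C v)" v] ta ja v tj(6) by simp
    also have "\<dots> = (e \<star> Idt C M) \<cdot> (s \<star> v)"
      using interchange[of s e v "Idt C M"] ea e sD s v Mo by simp
    finally have 1: "(j \<star> v) \<cdot> (t \<star> Idt C (Dom C v)) = (e \<star> Idt C M) \<cdot> (s \<star> v)" .
    have "a \<cdot> (e \<star> Idt C M) \<cdot> (s \<star> v) = LUnit C M \<cdot> (s \<star> v)"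
      by (rule comp_eq_extend[OF e(9)]) (use e(2,3,6,7) ea sD s v Mo in simp_all)
    then show ?thesis unfolding 1 .
  qed
  have qscal: "zero_arr C (q \<cdot> LUnit C M \<cdot> (s \<star> Idt C M))"
  proof -
    have "zero_arr C (scal s (Cod C q) \<cdot> (Idt C (Dom C s) \<star> q))"
      by (rule zero_arr_right[OF s(4)]) (use sD(6) s(2) qD(7) dq So Qo in simp_all)
    then have "zero_arr C (q \<cdot> scal s (Dom C q))" unfolding scal_nat[OF sD(6) s(2) qD(7)] .
    then show ?thesis using dq by (simp add: scal_def)
  qed
  have am: "a \<cdot> (j \<star> Idt C M) \<in> Arr C" "Dom C (a \<cdot> (j \<star> Idt C M)) = ?S \<odot> M" "Cod C (a \<cdot> (j \<star> Idt C M)) = M"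
    using e ja Mo by simp_all
  have "zero_arr C ((q \<cdot> a \<cdot> (j \<star> Idt C M)) \<cdot> (t \<star> Idt C M))"
    using qscal act_eq[of "Idt C M"] am qD(7) dq e(6,7,8) ja ta Mo by simp
  then have "zero_arr C (q \<cdot> a \<cdot> (j \<star> Idt C M))"
    using epi_zero_iff[OF tens_epi_right[OF tj(1) Mo], of "q \<cdot> a \<cdot> (j \<star> Idt C M)"] am qD(7) dq ta Mo by simp
  then have "sub_le C (a \<cdot> (j \<star> Idt C M)) n" using kernel_factor[OF qD(1) am(1)] am(3) dq by simp
  then obtain \<psi> where psi: "\<psi> \<in> Arr C" "Dom C \<psi> = ?S \<odot> M" "Cod C \<psi> = Dom C n" "n \<cdot> \<psi> = a \<cdot> (j \<star> Idt C M)"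
    by (rule sub_leE) (rule that, unfold am(2), assumption+)
  obtain \<phi> where phi: "\<And>V Y f. \<lbrakk>V \<in> Obj C; f \<in> Arr C; Dom C f = V \<odot> ?S; Cod C f = Y\<rbrakk> \<Longrightarrow>
       \<phi> V Y f \<in> Arr C \<and> Dom C (\<phi> V Y f) = V \<and> Cod C (\<phi> V Y f) = IHom C ?S Y"
    "\<And>u Y f. \<lbrakk>u \<in> Arr C; f \<in> Arr C; Dom C f = Cod C u \<odot> ?S; Cod C f = Y\<rbrakk> \<Longrightarrow>
       \<phi> (Dom C u) Y (f \<cdot> (u \<star> Idt C ?S)) = \<phi> (Cod C u) Y f \<cdot> u"
    "\<And>V Y f. \<lbrakk>V \<in> Obj C; f \<in> Arr C; Dom C f = V \<odot> ?S; Cod C f = Y\<rbrakk> \<Longrightarrow>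
       zero_arr C (\<phi> V Y f) \<longleftrightarrow> zero_arr C f"
    by (rule closed_hom[OF S'o]) (rule that; assumption)
  define f where "f = \<psi> \<cdot> Braid C M ?S"
  have f: "f \<in> Arr C" "Dom C f = M \<odot> ?S" "Cod C f = Dom C n" using psi Mo S'o by (simp_all add: f_def)
  define \<chi> where "\<chi> = \<phi> M (Dom C n) f"
  have chi: "\<chi> \<in> Arr C" "Dom C \<chi> = M" "Cod C \<chi> = IHom C ?S (Dom C n)"
    using phi(1)[OF Mo f] by (simp_all add: \<chi>_def)
  obtain k where k: "is_kernel C \<chi> k" using ex_kernel[OF chi(1)] ..
  note kD = kernelD[OF k]
  have kM: "Cod C k = M" using kD chi by simp
  let ?K = "Dom C k"
  have Ko: "?K \<in> Obj C" using kD by simp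
  have Kn: "noetherian C ?K" by (rule noetherian_sub[OF M subobjectI[OF kD(5) refl kM]])
  \<comment> \<open>Undoes the construction of \<open>\<chi>\<close>: transposition, braiding and
    the inclusion \<open>n\<close> are removed in turn. Precomposing with \<open>t\<close> then
    returns from the image \<open>j\<close> to \<open>s\<close> itself.\<close>
  have "zero_arr C (scal s ?K)"
  proof -
    have "zero_arr C (\<phi> ?K (Dom C n) (f \<cdot> (k \<star> Idt C ?S)))"
      using kD(4) phi(2)[OF kD(2) f(1)] f kM by (simp add: \<chi>_def)
    then have "zero_arr C (f \<cdot> (k \<star> Idt C ?S))"
      using phi(3)[of ?K "f \<cdot> (k \<star> Idt C ?S)" "Dom C n"] f kD(2) kM Ko S'o by simp
    moreover have "f \<cdot> (k \<star> Idt C ?S) = (\<psi> \<cdot> (Idt C ?S \<star> k)) \<cdot> Braid C ?K ?S"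
      using braid_nat[of k "Idt C ?S"] psi kD(2) kM Mo Ko S'o by (simp add: f_def)
    ultimately have "zero_arr C ((\<psi> \<cdot> (Idt C ?S \<star> k)) \<cdot> Braid C ?K ?S)" by simp
    then have "zero_arr C (\<psi> \<cdot> (Idt C ?S \<star> k))"
      using epi_zero_iff[OF iso_epi[OF braid_iso[OF Ko S'o]], of "\<psi> \<cdot> (Idt C ?S \<star> k)"] psi kD(2) kM Ko S'o by simp
    then have "zero_arr C (n \<cdot> \<psi> \<cdot> (Idt C ?S \<star> k))"
      by (rule zero_arr_left) (use psi kD(2) kM Ko S'o qD in simp_all)
    moreover have "n \<cdot> \<psi> \<cdot> (Idt C ?S \<star> k) = (a \<cdot> (j \<star> Idt C M)) \<cdot> (Idt C ?S \<star> k)"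
      by (rule comp_eq_extend[OF psi(4)]) (use psi kD(2) kM Ko S'o qD in simp_all)
    moreover have "(a \<cdot> (j \<star> Idt C M)) \<cdot> (Idt C ?S \<star> k) = a \<cdot> (j \<star> k)"
      using interchange[of "Idt C ?S" j k "Idt C M"] e(6,7) ja kD(2) kM Mo S'o by simp
    ultimately have "zero_arr C (a \<cdot> (j \<star> k))" by simp
    then have "zero_arr C ((a \<cdot> (j \<star> k)) \<cdot> (t \<star> Idt C ?K))"
      by (rule zero_arr_right) (use e(6,7) ja ta kD(2) kM Ko in simp_all)
    then have "zero_arr C (LUnit C M \<cdot> (s \<star> k))"
      using act_eq[OF kD(2) kM] e(6,7) ja ta kD(2) kM Ko by simp
    then have "zero_arr C (k \<cdot> scal s ?K)" using scal_nat(1)[OF sD(6) s(2) kD(2)] kM by simp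
    then show ?thesis using mono_zero_iff[OF kD(5), of "scal s ?K"] sD(6) s(2) Ko by simp
  qed
  then have supp: "SuppG G C \<rho> ?K \<subseteq> SuppG G C \<rho> (Cod C q)" by (rule SuppG_of_killed[OF s(1-3) Ko])
  show ?thesis
  proof (cases "is_zero C ?K")
    case True
    have "subobject C M (IHom C ?S (Dom C n))"
      using subobjectI[OF kernel_zero_mono[OF k True] chi(2,3)] .
    then show ?thesis using X_D(3) hom_ideal_D[OF X_torsion_free X_closed nq(3) Sn] by blast
  next
    case False
    have "AssG G C \<rho> ?K \<subseteq> {x}"
      using AssG_sub[OF subobjectI[OF kD(5) refl kM]] unfolding x(1) .
    then have "x \<in> AssG G C \<rho> ?K" using AssG_nonempty[OF Kn False] by (simp add: subset_singleton_iff)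
    then have xQ: "x \<in> SuppG G C \<rho> (Cod C q)" using subsetD[OF subset_trans[OF AssG_subset_SuppG supp]] by simp
    obtain y where y: "y \<in> AssG G C \<rho> (Cod C q)" "y \<in> SpecG_top G C \<rho> closure_of {x}"
      using Ass_in_closure[OF Qo xQ] by (elim bexE) (rule that)
    have "y \<in> SuppG G C \<rho> (Cod C q)" using subsetD[OF AssG_subset_SuppG y(1)] .
    \<comment> \<open>The closure hypothesis is now applied to \<open>M\<close>, whose only
      associated orbit is \<open>x\<close>. So \<open>x\<close> lies in the closure of
      \<open>y\<close>, in addition to \<open>y\<close> lying in the closure of
      \<open>x\<close>.\<close>
    then have "y \<in> SuppG G C \<rho> M"
      using subsetD[OF SuppG_quotient[OF quotient_objectI[OF qD(4) dq refl]]] by simp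
    then have "\<exists>z\<in>AssG G C \<rho> M. z \<in> SpecG_top G C \<rho> closure_of {y}" by (rule Ass_in_closure[OF Mo])
    then have xy: "x \<in> SpecG_top G C \<rho> closure_of {y}" unfolding x(1) by simp
    have "x = y"
    proof (rule orbit_separation[OF M x(1)])
      fix N assume "N \<in> Obj C"
      then show "x \<in> SuppG G C \<rho> N \<longleftrightarrow> y \<in> SuppG G C \<rho> N"
        using closure_SuppG[OF xy, of N] closure_SuppG[OF y(2), of N] by iprover
    qed
    then show ?thesis using y(1) nq(4) x(2) by blast
  qed
qed

text \<open>Among the quotients of \<open>M\<close> violating the claim, a minimal one has a single associated orbit.\<close>

lemma AssG_inv_AssG_class: "AssG_inv G C \<rho> (AssG_class G C \<rho> \<X>) = \<X>"
proof
  let ?\<Phi> = "AssG_class G C \<rho> \<X>"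
  show "\<X> \<subseteq> AssG_inv G C \<rho> ?\<Phi>"
    using X_D(1) unfolding AssG_inv_def AssG_class_def NC_simps by blast
  show "AssG_inv G C \<rho> ?\<Phi> \<subseteq> \<X>"
  proof
    fix M assume "M \<in> AssG_inv G C \<rho> ?\<Phi>"
    then have M: "noetherian C M" "AssG G C \<rho> M \<subseteq> ?\<Phi>" by (simp_all add: AssG_inv_iff)
    show "M \<in> \<X>"
    proof (rule ccontr)
      assume MX: "M \<notin> \<X>"
      \<comment> \<open>The quotients are indexed by their kernels \<open>n\<close>, so a maximal
        \<open>n\<close> gives a minimal counterexample.\<close>
      define S where "S = {n. \<exists>q. short_exact C n q \<and> Cod C n = M \<and> AssG G C \<rho> (Cod C q) \<subseteq> ?\<Phi> \<and> Cod C q \<notin> \<X>}"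
      obtain z where z: "mono_arr C z" "Cod C z = M" "is_zero C (Dom C z)" using ex_zero_sub[OF noeth_obj[OF M(1)]] .
      obtain q0 where q0: "short_exact C z q0" by (rule mono_short_exact[OF z(1)])
      note q0D = short_exactD[OF q0]
      have "iso_arr C q0" by (rule cokernel_of_zero_dom[OF q0D(2)]) (rule is_zero_zero_arr[OF z(3)], use z in simp_all)
      then have iso: "isomorphic C M (Cod C q0)" by (rule isomorphicI) (use q0D z in simp_all)
      have "z \<in> S" unfolding S_def
        using q0 z M(2) AssG_isomorphic[OF iso] X_isomorphic[OF _ iso] MX by blast
      then obtain n where n: "n \<in> S" "\<And>n'. \<lbrakk>n' \<in> S; sub_le C n n'\<rbrakk> \<Longrightarrow> sub_le C n' n"
        by (rule noetherian_maximal[OF M(1)]) (auto simp: S_def dest: short_exactD(3))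
      obtain q where q: "short_exact C n q" "Cod C n = M" "AssG G C \<rho> (Cod C q) \<subseteq> ?\<Phi>" "Cod C q \<notin> \<X>"
        using n(1) unfolding S_def by blast
      note qD = short_exactD[OF q(1)]
      have dq: "Dom C q = M" using qD q by simp
      let ?T = "Cod C q"
      have Tn: "noetherian C ?T" by (rule noetherian_quotient[OF M(1) quotient_objectI[OF qD(4) dq refl]])
      \<comment> \<open>A proper quotient of \<open>?T\<close> is a smaller quotient of
        \<open>M\<close>. If its orbits are still allowed, it must lie in the class, by
        minimality.\<close>
      have quotient_in_X: "Cod C r \<in> \<X>"
        if r: "short_exact C m r" "Cod C m = ?T" "AssG G C \<rho> (Cod C r) \<subseteq> ?\<Phi>" "\<not> is_zero C (Dom C m)" for m r
      proof (rule ccontr)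
        assume rX: "Cod C r \<notin> \<X>"
        note rD = short_exactD[OF r(1)]
        have dr: "Dom C r = ?T" using rD r by simp
        have "epi_arr C (r \<cdot> q)" by (rule epi_comp[OF rD(4) qD(4)]) (use dr in simp)
        then obtain m' where m': "short_exact C m' (r \<cdot> q)" by (rule epi_short_exact)
        note m'D = short_exactD[OF m']
        have m'M: "Cod C m' = M" using m'D(5) dr qD(7) rD(7) dq by simp
        have crq: "Cod C (r \<cdot> q) = Cod C r" using dr qD(7) rD(7) by simp
        have "m' \<in> S" unfolding S_def mem_Collect_eq
          by (rule exI[of _ "r \<cdot> q"]) (unfold crq, intro conjI m' m'M r(3) rX)
        moreover have "sub_le C n m'"
        proof (rule kernel_factor[OF m'D(1) qD(6)])
          have "zero_arr C (r \<cdot> q \<cdot> n)" by (rule zero_arr_left[OF kernelD(4)[OF qD(1)]]) (use rD(7) dr qD in simp_all)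
          then show "zero_arr C ((r \<cdot> q) \<cdot> n)" using rD(7) dr qD by simp
        qed (use q(2) dr qD(7) rD(7) dq in simp)
        ultimately have m'n: "sub_le C m' n" using n(2) by blast
        obtain p u where p: "mono_arr C p" "Cod C p = Dom C q" "u \<in> Arr C" "Dom C u = Dom C p" "Cod C u = Dom C m"
          "m \<cdot> u = q \<cdot> p" "epi_arr C u"
          using ex_pullback_mono[OF rD(3) qD(7)] qD(4) r(2) by metis
        have "zero_arr C ((r \<cdot> m) \<cdot> u)" by (rule zero_arr_right[OF kernelD(4)[OF rD(1)]]) (use rD dr r(2) p in simp_all)
        then have "zero_arr C ((r \<cdot> q) \<cdot> p)" using p rD dr r(2) qD(7) by simp
        then have "sub_le C p m'" using kernel_factor[OF m'D(1), of p] p(1,2) dr qD(7) rD(7) by simp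
        then have "sub_le C p n" by (rule sub_le_trans[OF _ m'n qD(6)])
        then have "zero_arr C (m \<cdot> u)" using kernel_factor_iff[OF qD(1), of p] p(1,2,6) by simp
        then have "zero_arr C u" using mono_zero_iff[OF rD(3) p(3,5)] by simp
        then have "is_zero C (Cod C u)" by (rule epi_zero_cod[OF p(7)])
        then show False using r(4) p(5) by simp
      qed
      have nz: "\<not> is_zero C ?T" using q(4) X_D(2) by blast
      then obtain x1 where x1: "x1 \<in> AssG G C \<rho> ?T" using AssG_nonempty[OF Tn] by blast
      have "AssG G C \<rho> ?T \<noteq> {x1}" using one_orbit_in_X[OF Tn] q(3,4) x1 by blast
      then obtain x2 where x2: "x2 \<in> AssG G C \<rho> ?T" "x1 \<noteq> x2" using x1 by blast
      \<comment> \<open>The subobject collects the orbit \<open>x\<close> and the quotient loses it.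
        As \<open>x\<close> is associated to \<open>?T\<close>, the subobject is nonzero and the
        quotient proper.\<close>
      have split: "\<exists>m r. short_exact C m r \<and> Cod C m = ?T \<and> AssG G C \<rho> (Dom C m) \<subseteq> {x} \<and> Cod C r \<in> \<X>"
        if x: "x \<in> AssG G C \<rho> ?T" for x
      proof -
        obtain m r where mr: "short_exact C m r" "Cod C m = ?T" "Ass C (Dom C m) \<subseteq> {u. orbit_map G C \<rho> u = x}"
          "Ass C (Cod C r) \<subseteq> Ass C ?T - {u. orbit_map G C \<rho> u = x}" by (rule Ass_split[OF Tn])
        have A: "AssG G C \<rho> (Dom C m) \<subseteq> {x}" "AssG G C \<rho> (Cod C r) \<subseteq> AssG G C \<rho> ?T - {x}"
          using mr(3,4) unfolding AssG_def by blast+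
        have "\<not> is_zero C (Dom C m)" using AssG_extension[OF mr(1)] AssG_zero[of "Dom C m"] A(2) x mr(2) by auto
        then have "Cod C r \<in> \<X>" using quotient_in_X[OF mr(1,2)] A(2) q(3) by blast
        then show ?thesis using mr(1,2) A(1) by blast
      qed
      obtain m1 r1 where 1: "short_exact C m1 r1" "Cod C m1 = ?T" "AssG G C \<rho> (Dom C m1) \<subseteq> {x1}" "Cod C r1 \<in> \<X>"
        using split[OF x1] by blast
      obtain m2 r2 where 2: "short_exact C m2 r2" "Cod C m2 = ?T" "AssG G C \<rho> (Dom C m2) \<subseteq> {x2}" "Cod C r2 \<in> \<X>"
        using split[OF x2(1)] by blast
      note D1 = short_exactD[OF 1(1)] and D2 = short_exactD[OF 2(1)]
      have d2: "Dom C r2 = ?T" using D2 2 by simp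
      have rm: "r2 \<cdot> m1 \<in> Arr C" "Dom C (r2 \<cdot> m1) = Dom C m1" "Cod C (r2 \<cdot> m1) = Cod C r2" using D1 D2 1 d2 by simp_all
      \<comment> \<open>\<open>k\<close> is the intersection of \<open>m1\<close> and
        \<open>m2\<close>. Its associated orbits lie in \<open>{x1}\<close> and in
        \<open>{x2}\<close>, so it is zero, and \<open>m1\<close> embeds in the quotient by
        \<open>m2\<close>, which is in the class. Then \<open>?T\<close> is an extension of two
        members.\<close>
      obtain k where k: "is_kernel C (r2 \<cdot> m1) k" using ex_kernel[OF rm(1)] ..
      note kD = kernelD[OF k]
      have kc: "Cod C k = Dom C m1" using kD rm by simp
      have "zero_arr C (r2 \<cdot> m1 \<cdot> k)" using kD(4) D1 D2 1 d2 kc kD(2) by simp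
      then have "sub_le C (m1 \<cdot> k) m2" using kernel_factor[OF D2(1), of "m1 \<cdot> k"] D1(6) kD(2) kc 1(2) d2 by simp
      then obtain h where h: "h \<in> Arr C" "Dom C h = Dom C (m1 \<cdot> k)" "Cod C h = Dom C m2" "m2 \<cdot> h = m1 \<cdot> k"
        by (rule sub_leE)
      have "mono_arr C (m2 \<cdot> h)" unfolding h(4) by (rule mono_comp[OF D1(3) kD(5) kc])
      then have mh: "mono_arr C h" by (rule mono_of_comp) (use h D2 in simp_all)
      have "subobject C (Dom C k) (Dom C m2)" by (rule subobjectI[OF mh]) (use h D1 kD(2) kc in simp_all)
      moreover have sk: "subobject C (Dom C k) (Dom C m1)" by (rule subobjectI[OF kD(5) refl kc])
      ultimately have "AssG G C \<rho> (Dom C k) = {}" using AssG_sub 1(3) 2(3) x2(2) by blast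
      moreover have m1n: "noetherian C (Dom C m1)" by (rule noetherian_sub[OF Tn subobjectI[OF D1(3) refl 1(2)]])
      then have "noetherian C (Dom C k)" using noetherian_sub sk by blast
      ultimately have "is_zero C (Dom C k)" using AssG_nonempty by blast
      then have "mono_arr C (r2 \<cdot> m1)" by (rule kernel_zero_mono[OF k])
      then have "subobject C (Dom C m1) (Cod C r2)" by (rule subobjectI[OF _ rm(2,3)])
      then have "Dom C m1 \<in> \<X>" by (rule X_D(3)[OF 2(4)])
      then have "Cod C m1 \<in> \<X>" using X_D(4)[OF 1(1)] 1(2,4) Tn by simp
      then show False using 1(2) q(4) by simp
    qed
  qed
qed

end

section \<open>The two maps are mutually inverse\<close>

lemma AssG_inv_in_classes: "AssG_inv G C \<rho> \<Phi> \<in> G_torsion_free_classes G C \<rho>"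
  unfolding G_torsion_free_classes_def using AssG_inv_torsion_free AssG_inv_closed by blast

lemma AssG_class_AssG_inv:
  assumes \<Phi>: "\<Phi> \<subseteq> SpecG G C \<rho>"
  shows "AssG_class G C \<rho> (AssG_inv G C \<rho> \<Phi>) = \<Phi>"
proof
  show "AssG_class G C \<rho> (AssG_inv G C \<rho> \<Phi>) \<subseteq> \<Phi>" unfolding AssG_class_def AssG_inv_iff[abs_def] by (auto simp: AssG_inv_iff)
  show "\<Phi> \<subseteq> AssG_class G C \<rho> (AssG_inv G C \<rho> \<Phi>)"
  proof
    fix x assume x: "x \<in> \<Phi>"
    then obtain H where H: "monoform C H" "x = orbit H" using \<Phi> unfolding SpecG_def Spec_def by blast
    obtain N where N: "noetherian C N" "\<not> is_zero C N" "subobject C N H"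
      by (rule ex_noetherian_sub[OF loc_noeth monoformD[OF H(1)]])
    have "AssG G C \<rho> N = {x}"
      using AssG_monoform[OF monoform_sub[OF H(1) N(3,2)]] atom_sub[OF H(1) N(3,2)] H(2) by simp
    then show "x \<in> AssG_class G C \<rho> (AssG_inv G C \<rho> \<Phi>)"
      using N(1) x unfolding AssG_class_def by (intro UN_I[of N]) (simp_all add: AssG_inv_iff)
  qed
qed

lemma AssG_class_subset: "AssG_class G C \<rho> \<X> \<subseteq> SpecG G C \<rho>"
  unfolding AssG_class_def AssG_def Ass_def SpecG_def Spec_def by blast

end

theorem theorem5p5:
  fixes \<kappa> :: "'k rel"
    and A :: "('o, 'a, 'm) mon_cat_scheme"
    and G :: "('g, 'n) monoid_scheme"
    and \<rho> :: "'g \<Rightarrow> ('o, 'a) endofunctor set"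
  assumes "universe_cardinal \<kappa>"
    and "grothendieck_cosmos A \<kappa>"
    and "locally_noetherian \<kappa> A"
    and "is_action G A \<rho>"
    and a: "finitely_presented \<kappa> A (Unt A)"
    and b: "\<exists>S. small \<kappa> S \<and> (\<forall>D\<in>S. dualizable A D) \<and> generating A S"
    and c: "\<And>\<X>. localizing_subcategory \<kappa> A \<X> \<Longrightarrow> tensor_ideal A \<X> \<longleftrightarrow> G_closed G \<rho> \<X>"
    and d: "\<And>\<X>. torsion_free_class (noeth_cat A) \<X> \<Longrightarrow>
              hom_ideal (noeth_cat A) \<X> \<longleftrightarrow> G_closed G \<rho> \<X>"
    and e: "\<And>M x. \<lbrakk>M \<in> Obj A; x \<in> SuppG G A \<rho> M\<rbrakk> \<Longrightarrow>
              \<exists>y \<in> AssG G A \<rho> M. y \<in> SpecG_top G A \<rho> closure_of {x}"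
  shows "bij_betw (AssG_inv G A \<rho>) (Pow (SpecG G A \<rho>)) (G_torsion_free_classes G A \<rho>)
       \<and> bij_betw (AssG_class G A \<rho>) (G_torsion_free_classes G A \<rho>) (Pow (SpecG G A \<rho>))
       \<and> (\<forall>\<Phi> \<in> Pow (SpecG G A \<rho>). AssG_class G A \<rho> (AssG_inv G A \<rho> \<Phi>) = \<Phi>)
       \<and> (\<forall>\<X> \<in> G_torsion_free_classes G A \<rho>. AssG_inv G A \<rho> (AssG_class G A \<rho> \<X>) = \<X>)
       \<and> mono_on (Pow (SpecG G A \<rho>)) (AssG_inv G A \<rho>)
       \<and> mono_on (G_torsion_free_classes G A \<rho>) (AssG_class G A \<rho>)"
proof -
  interpret grothendieck_cosmos A \<kappa> by fact
  interpret acted_cosmos A \<kappa> G \<rho>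
  proof
    show "\<exists>S. (\<forall>D\<in>S. dualizable A D) \<and> generating A S" using b by blast
    show "localizing_subcategory \<kappa> A \<X> \<Longrightarrow> G_closed G \<rho> \<X> \<Longrightarrow> tensor_ideal A \<X>" for \<X> using c by blast
    show "torsion_free_class (noeth_cat A) \<X> \<Longrightarrow> G_closed G \<rho> \<X> \<Longrightarrow> hom_ideal (noeth_cat A) \<X>" for \<X> using d by blast
  qed (fact assms)+
  have 1: "\<forall>\<Phi> \<in> Pow (SpecG G A \<rho>). AssG_class G A \<rho> (AssG_inv G A \<rho> \<Phi>) = \<Phi>"
    using AssG_class_AssG_inv by blast
  have 2: "\<forall>\<X> \<in> G_torsion_free_classes G A \<rho>. AssG_inv G A \<rho> (AssG_class G A \<rho> \<X>) = \<X>"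
    using AssG_inv_AssG_class by blast
  have 3: "AssG_inv G A \<rho> ` Pow (SpecG G A \<rho>) \<subseteq> G_torsion_free_classes G A \<rho>" using AssG_inv_in_classes by blast
  have 4: "AssG_class G A \<rho> ` G_torsion_free_classes G A \<rho> \<subseteq> Pow (SpecG G A \<rho>)" using AssG_class_subset by blast
  have 5: "mono_on (Pow (SpecG G A \<rho>)) (AssG_inv G A \<rho>)" by (rule mono_onI) (auto simp: AssG_inv_def)
  have 6: "mono_on (G_torsion_free_classes G A \<rho>) (AssG_class G A \<rho>)" by (rule mono_onI) (auto simp: AssG_class_def)
  show ?thesis using bij_betw_byWitness[OF 1 2 3 4] bij_betw_byWitness[OF 2 1 4 3] 1 2 5 6 by blast
qed

end
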